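(* Let $\Lambda$ be a finite index set, and suppose that $\mathbf{a}=(a_i)_{i\in\Lambda}\in\mathbb{C}^\Lambda$ and $\lambda\in\mathbb{D}\setminus\mathbb{R}$ are such that the iterated function system $(z\mapsto\lambda z+a_i)_{i\in\Lambda}$ satisfies the open set condition. There is a set $E\subset\mathbb{C}$ of zero Hausdorff dimension such that the following holds: for every $p\in\mathbb{P}_\Lambda$ such that $s(\lambda,p)>1$ and every $u\in\mathbb{C}\setminus E$, $$\nu_{\lambda,\mathbf{a}}^p * S_u\nu_{\lambda,\mathbf{a}}^p\ll\mathcal{L},$$ and moreover the density is in $L^q$ for some $q=q(u)>1$. In particular, if $|\lambda|>1/\#\Lambda$, then $\mathcal{L}(A_{\lambda,\mathbf{a}}+uA_{\lambda,\mathbf{a}})>0$ for all $u\in\mathbb{C}\setminus E$.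
   Context: $\mathbb{D}$ is the open unit disk in $\mathbb{C}$; $\mathcal{L}$ is Lebesgue measure on $\mathbb{C}\cong\mathbb{R}^2$. $\mathbb{P}_\Lambda$ is the open simplex of probability vectors $p=(p_i)_{i\in\Lambda}$ with all $p_i>0$. $\nu_{\lambda,\mathbf{a}}^p$ is the unique Borel probability measure on $\mathbb{C}$ satisfying $\nu_{\lambda,\mathbf{a}}^p=\sum_{i\in\Lambda}p_i\,f_i\nu_{\lambda,\mathbf{a}}^p$, where $f_i(z)=\lambda z+a_i$ and $g\mu(A)=\mu(g^{-1}A)$ is the push-forward; $A_{\lambda,\mathbf{a}}$ is its topological support, i.e. the attractor of $(f_i)_{i\in\Lambda}$. The similarity dimension is $s(\lambda,p)=h(p)/(-\log|\lambda|)$, where $h(p)=-\sum_{i\in\Lambda}p_i\log p_i$. $S_u(z)=uz$. The convolution $\mu*\nu$ is the push-forward of $\mu\times\nu$ under $(x,y)\mapsto x+y$, and $A+B=\{x+y:x\in A,y\in B\}$. The system $(f_i)$ satisfies the open set condition if there is a nonempty bounded open set $V$ such that the sets $f_i(V)$, $i\in\Lambda$, are pairwise disjoint and contained in $V$. *)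

theory Defs
  imports "HOL-Probability.Probability"
begin

section \<open>Hausdorff dimension\<close>

text \<open>
  The convention is \<open>diam(U)^0 = 1\<close> for nonempty \<open>U\<close>, whereas \<open>0 powr 0 = 0\<close>; hence the case
  distinction. The covering sets are required to be bounded since \<^const>\<open>diameter\<close> is
  unspecified on unbounded sets.
\<close>

definition diam_pow :: "real \<Rightarrow> 'a::metric_space set \<Rightarrow> ennreal" where
  "diam_pow s U = (if U = {} then 0 else if s = 0 then 1 else ennreal (diameter U powr s))"

definition hausdorff_premeasure :: "real \<Rightarrow> real \<Rightarrow> 'a::metric_space set \<Rightarrow> ennreal" where
  "hausdorff_premeasure s \<delta> X =
     Inf {(\<Sum>n. diam_pow s (U n)) | U :: nat \<Rightarrow> 'a set.
            X \<subseteq> (\<Union>n. U n) \<and> (\<forall>n. bounded (U n) \<and> diameter (U n) \<le> \<delta>)}"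

definition hausdorff_measure :: "real \<Rightarrow> 'a::metric_space set \<Rightarrow> ennreal" where
  "hausdorff_measure s X = (SUP \<delta>\<in>{0<..}. hausdorff_premeasure s \<delta> X)"

definition hausdorff_dim :: "'a::metric_space set \<Rightarrow> ennreal" where
  "hausdorff_dim X = Inf {ennreal s | s. 0 \<le> s \<and> hausdorff_measure s X = 0}"

section \<open>Homogeneous self-similar sets and measures in the plane\<close>

definition sim :: "complex \<Rightarrow> complex \<Rightarrow> complex \<Rightarrow> complex" where
  "sim lam c z = lam * z + c"

definition open_set_condition :: "complex \<Rightarrow> ('i::finite \<Rightarrow> complex) \<Rightarrow> bool" where
  "open_set_condition lam a \<longleftrightarrow>
     (\<exists>V. V \<noteq> {} \<and> bounded V \<and> open V \<and>
          disjoint_family (\<lambda>i. sim lam (a i) ` V) \<and> (\<forall>i. sim lam (a i) ` V \<subseteq> V))"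

definition prob_simplex :: "('i::finite \<Rightarrow> real) set" where
  "prob_simplex = {p. (\<forall>i. 0 < p i) \<and> (\<Sum>i\<in>UNIV. p i) = 1}"

definition shannon_entropy :: "('i::finite \<Rightarrow> real) \<Rightarrow> real" where
  "shannon_entropy p = - (\<Sum>i\<in>UNIV. p i * ln (p i))"

definition similarity_dim :: "complex \<Rightarrow> ('i::finite \<Rightarrow> real) \<Rightarrow> real" where
  "similarity_dim lam p = shannon_entropy p / (- ln (cmod lam))"

text \<open>
  For \<open>0 < |lam| < 1\<close> and \<open>p\<close> in the simplex, both of the following are characterised uniquely:
  the attractor is the unique nonempty compact invariant set, which is also the topological
  support of every \<open>self_similar_measure lam a p\<close>.
\<close>

definition is_self_similar_measure ::
    "complex \<Rightarrow> ('i::finite \<Rightarrow> complex) \<Rightarrow> ('i \<Rightarrow> real) \<Rightarrow> complex measure \<Rightarrow> bool" where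
  "is_self_similar_measure lam a p \<nu> \<longleftrightarrow>
     prob_space \<nu> \<and> sets \<nu> = sets borel \<and>
     (\<forall>B\<in>sets borel. emeasure \<nu> B =
        (\<Sum>i\<in>UNIV. ennreal (p i) * emeasure (distr \<nu> borel (sim lam (a i))) B))"

definition self_similar_measure ::
    "complex \<Rightarrow> ('i::finite \<Rightarrow> complex) \<Rightarrow> ('i \<Rightarrow> real) \<Rightarrow> complex measure" where
  "self_similar_measure lam a p = (THE \<nu>. is_self_similar_measure lam a p \<nu>)"

definition attractor :: "complex \<Rightarrow> ('i::finite \<Rightarrow> complex) \<Rightarrow> complex set" where
  "attractor lam a =
     (THE K. K \<noteq> {} \<and> compact K \<and> K = (\<Union>i. sim lam (a i) ` K))"

section \<open>Convolutions and densities\<close>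

text \<open>
  The library constant for convolution requires an ordered Euclidean space, of which
  \<^typ>\<open>complex\<close> is not an instance.
\<close>

definition conv_measure :: "complex measure \<Rightarrow> complex measure \<Rightarrow> complex measure" where
  "conv_measure \<mu> \<nu> = distr (\<mu> \<Otimes>\<^sub>M \<nu>) borel (\<lambda>(x, y). x + y)"

definition scale_measure_by :: "complex \<Rightarrow> complex measure \<Rightarrow> complex measure" where
  "scale_measure_by u \<mu> = distr \<mu> borel (\<lambda>z. u * z)"

definition has_density_in_Lq :: "real \<Rightarrow> complex measure \<Rightarrow> bool" where
  "has_density_in_Lq q \<mu> \<longleftrightarrow>
     (\<exists>f :: complex \<Rightarrow> real. f \<in> borel_measurable borel \<and> (\<forall>z. 0 \<le> f z) \<and>
        \<mu> = density lborel (\<lambda>z. ennreal (f z)) \<and>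
        integrable lborel (\<lambda>z. f z powr q))"

end

theory Submission
  imports Defs
begin

text \<open>
  Let \<open>\<nu>\<^sub>u\<close> be the convolution, the law of \<open>\<Sum> lam^t \<xi>\<^sub>t\<close> with i.i.d. digits \<open>\<xi>\<^sub>t = a\<^sub>i + u a\<^sub>j\<close>. Choose \<open>k\<close>
  with \<open>\<theta> = lam^k\<close> non-real and \<open>(k - 1) h(p) > - k ln |lam|\<close>, and split the digits into the positions not
  divisible by \<open>k\<close>, which form the self-similar sequence \<open>\<eta>\<^sub>n\<close>, and the positions divisible by \<open>k\<close>.
  The former still have similarity dimension greater than 2. If their words are exponentially separated, the
  entropy of \<open>\<eta>\<^sub>n\<close> at scale \<open>|\<theta>|^n\<close> is full. Otherwise every scale has an entropy deficit, so convolving \<open>\<eta>\<^sub>n\<close>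
  with a piece of itself that is not concentrated gains entropy, because \<open>\<theta>\<close> is non-real and many rescaled
  copies of the piece fill the plane in all directions. The total gain is limited, hence most small cells
  are concentrated near a point, and \<open>\<eta>\<^sub>n\<close> would admit
  a code that is too short. Full entropy bounds a moment of order \<open>1 + s\<close> of the mollified density of \<open>\<eta>\<^sub>n\<close> by
  \<open>exp (\<epsilon> n)\<close>, and a power decay of the Fourier transform of the remaining digits upgrades this, by
  Plancherel, to \<open>\<nu>\<^sub>u(B) \<le> K |B|^\<gamma>\<close>, hence to a density in \<open>L\<^sup>q\<close>. The separation fails only for \<open>u\<close> in
  small discs, one for each quadruple of words, whose radii are bounded by the open set condition; the decay fails only for
  \<open>u\<close> in an Erdos--Kahane set, covered by codes of few non-zero digits. Both sets have dimension zero.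
\<close>

section \<open>Lebesgue measure and Gaussian densities on the complex plane\<close>

text \<open>Entropy is taken after Gaussian smoothing because Gaussians form a convolution
  semigroup: coarsening the scale and adding an independent summand are then both instances of data
  processing, the source of every monotonicity below. For a self-similar sequence this lets a scale
  and a length that almost attain the infimum of the entropy drops be shifted to all finer scales; a
  positive infimum is what \<open>full_dimension\<close> refutes. Moments use uniform discs instead,
  because compact support leaves only boundedly many cells that influence a point. Full entropy by
  itself still loses \<open>exp (\<epsilon> * n)\<close>. This is why a positive fraction of the
  digits is reserved: their transform decays with a fixed exponent, and \<epsilon> is chosen
  afterwards, below that exponent. The reserved positions are filled by one constant pair of digits,
  so atoms remain values of words over the same alphabet and a single separation condition serves
  every \<open>k\<close>. The period \<open>k\<close> depends on \<open>p\<close>, but the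
  exceptional set is a union over all periods and therefore does not.\<close>

lemma lborel_complex_eq:
  "(lborel :: complex measure) = distr (lborel \<Otimes>\<^sub>M lborel) borel (\<lambda>(x, y). Complex x y)"
proof (rule lborel_eqI)
  have m[measurable]: "(\<lambda>(x, y). Complex x y) \<in> borel_measurable (lborel \<Otimes>\<^sub>M lborel)"
    unfolding split_beta complex_eq_iff Complex_eq by measurable
  fix l u :: complex assume le: "\<And>b. b \<in> Basis \<Longrightarrow> l \<bullet> b \<le> u \<bullet> b"
  have "1 \<in> (Basis::complex set)" "\<i> \<in> (Basis::complex set)" by (auto simp: Basis_complex_def)
  from le[OF this(1)] le[OF this(2)] have *: "Re l \<le> Re u" "Im l \<le> Im u" by auto
  have "(\<lambda>(x, y). Complex x y) -` box l u \<inter> space (lborel \<Otimes>\<^sub>M lborel)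
     = {Re l<..<Re u} \<times> {Im l<..<Im u}"
    by (auto simp: box_def Basis_complex_def space_pair_measure)
  then have "emeasure (distr (lborel \<Otimes>\<^sub>M lborel) borel (\<lambda>(x, y). Complex x y)) (box l u)
     = emeasure (lborel \<Otimes>\<^sub>M lborel) ({Re l<..<Re u} \<times> {Im l<..<Im u})"
    by (subst emeasure_distr) auto
  also have "\<dots> = ennreal (Re u - Re l) * ennreal (Im u - Im l)"
    using * by (subst lborel.emeasure_pair_measure_Times) auto
  finally show "emeasure (distr (lborel \<Otimes>\<^sub>M lborel) borel (\<lambda>(x, y). Complex x y)) (box l u)
      = (\<Prod>b\<in>Basis. (u - l) \<bullet> b)"
    using * by (simp add: Basis_complex_def ennreal_mult)
qed simp

lemma measurable_Complex[measurable]: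
  assumes [measurable]: "f \<in> borel_measurable M" "g \<in> borel_measurable M"
  shows "(\<lambda>x. Complex (f x) (g x)) \<in> borel_measurable M"
  unfolding Complex_eq by measurable

lemma nn_integral_complex:
  assumes [measurable]: "f \<in> borel_measurable borel"
  shows "(\<integral>\<^sup>+z. f z \<partial>lborel) = (\<integral>\<^sup>+x. \<integral>\<^sup>+y. f (Complex x y) \<partial>lborel \<partial>lborel)"
proof -
  have [measurable]: "(\<lambda>(x, y). Complex x y) \<in> borel_measurable (lborel \<Otimes>\<^sub>M lborel)"
    unfolding split_beta by measurable
  have "(\<integral>\<^sup>+z. f z \<partial>lborel) = (\<integral>\<^sup>+p. f (case p of (x, y) \<Rightarrow> Complex x y) \<partial>(lborel \<Otimes>\<^sub>M lborel))"
    by (subst lborel_complex_eq, subst nn_integral_distr) auto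
  also have "\<dots> = (\<integral>\<^sup>+x. \<integral>\<^sup>+y. f (Complex x y) \<partial>lborel \<partial>lborel)"
    by (subst lborel.nn_integral_fst[symmetric]) (auto simp: split_beta)
  finally show ?thesis .
qed

lemma nn_integral_complex_mult:
  fixes c :: complex
  assumes c: "c \<noteq> 0" and [measurable]: "f \<in> borel_measurable borel"
  shows "(\<integral>\<^sup>+z. f z \<partial>lborel) = ennreal ((cmod c)\<^sup>2) * (\<integral>\<^sup>+z. f (c * z) \<partial>lborel)"
proof (cases "Im c = 0")
  case True
  define a where "a = Re c"
  have a: "a \<noteq> 0" "c = of_real a" using True c by (auto simp: a_def complex_eq_iff)
  have "(\<integral>\<^sup>+z. f (c * z) \<partial>lborel) = (\<integral>\<^sup>+x. \<integral>\<^sup>+y. f (Complex (a * x) (a * y)) \<partial>lborel \<partial>lborel)"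
    by (subst nn_integral_complex) (auto simp: a(2) complex_eq_iff intro!: nn_integral_cong arg_cong[where f=f])
  also have "ennreal ((cmod c)\<^sup>2) * \<dots> = ennreal \<bar>a\<bar> * (\<integral>\<^sup>+x. ennreal \<bar>a\<bar> * \<integral>\<^sup>+y. f (Complex (a * x) (a * y)) \<partial>lborel \<partial>lborel)"
  proof -
    have "ennreal ((cmod c)\<^sup>2) = ennreal \<bar>a\<bar> * ennreal \<bar>a\<bar>"
      by (simp add: a(2) power2_eq_square flip: ennreal_mult)
    then show ?thesis by (simp add: nn_integral_cmult mult.assoc)
  qed
  also have "\<dots> = ennreal \<bar>a\<bar> * (\<integral>\<^sup>+x. \<integral>\<^sup>+y. f (Complex (a * x) y) \<partial>lborel \<partial>lborel)"
    by (subst nn_integral_real_affine[of "\<lambda>y. f (Complex _ y)" a 0]) (use a in auto)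
  also have "\<dots> = (\<integral>\<^sup>+x. \<integral>\<^sup>+y. f (Complex x y) \<partial>lborel \<partial>lborel)"
    by (subst nn_integral_real_affine[of "\<lambda>x. \<integral>\<^sup>+y. f (Complex x y) \<partial>lborel" a 0]) (use a in auto)
  finally show ?thesis by (simp add: nn_integral_complex)
next
  case False
  define a b where "a = Re c" and "b = Im c"
  have b: "b \<noteq> 0" using False by (simp add: b_def)
  define n where "n = (cmod c)\<^sup>2"
  have n: "n = a\<^sup>2 + b\<^sup>2" by (simp add: n_def a_def b_def cmod_power2)
  have n': "n > 0" using c by (simp add: n_def)
  have n0: "n \<noteq> 0" using n' by simp
  have "(\<integral>\<^sup>+z. f (c * z) \<partial>lborel) = (\<integral>\<^sup>+x. \<integral>\<^sup>+y. f (Complex (a * x - b * y) (b * x + a * y)) \<partial>lborel \<partial>lborel)"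
    by (subst nn_integral_complex)
       (auto simp: a_def b_def complex_eq_iff algebra_simps intro!: nn_integral_cong arg_cong[where f=f])
  also have "\<dots> = (\<integral>\<^sup>+y. \<integral>\<^sup>+x. f (Complex (a * x - b * y) (b * x + a * y)) \<partial>lborel \<partial>lborel)"
    by (rule lborel_pair.Fubini') measurable
  \<comment> \<open>For fixed \<open>y\<close> the inner variable becomes
    \<open>v = b * x + a * y\<close>; then \<open>a * x - b * y = a / b * v - n / b * y\<close>. The
    division by \<open>b\<close> is the reason for treating real \<open>c\<close>
    separately.\<close>
  also have "\<dots> = (\<integral>\<^sup>+y. ennreal (1 / \<bar>b\<bar>) * (\<integral>\<^sup>+v. f (Complex (a / b * v + (- n / b) * y) v) \<partial>lborel) \<partial>lborel)"
  proof (intro nn_integral_cong)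
    fix y
    have "(\<integral>\<^sup>+x. f (Complex (a * x - b * y) (b * x + a * y)) \<partial>lborel)
       = ennreal \<bar>1 / b\<bar> * (\<integral>\<^sup>+v. f (Complex (a * (- a * y / b + 1 / b * v) - b * y) (b * (- a * y / b + 1 / b * v) + a * y)) \<partial>lborel)"
      by (rule nn_integral_real_affine) (use b in auto)
    also have "\<dots> = ennreal (1 / \<bar>b\<bar>) * (\<integral>\<^sup>+v. f (Complex (a / b * v + (- n / b) * y) v) \<partial>lborel)"
      using b by (intro arg_cong2[where f="(*)"] nn_integral_cong arg_cong[where f=f])
         (auto simp: n field_simps power2_eq_square)
    finally show "(\<integral>\<^sup>+x. f (Complex (a * x - b * y) (b * x + a * y)) \<partial>lborel)
       = ennreal (1 / \<bar>b\<bar>) * (\<integral>\<^sup>+v. f (Complex (a / b * v + (- n / b) * y) v) \<partial>lborel)" .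
  qed
  also have "\<dots> = ennreal (1 / \<bar>b\<bar>) * (\<integral>\<^sup>+y. \<integral>\<^sup>+v. f (Complex (a / b * v + (- n / b) * y) v) \<partial>lborel \<partial>lborel)"
    by (rule nn_integral_cmult) measurable
  also have "(\<integral>\<^sup>+y. \<integral>\<^sup>+v. f (Complex (a / b * v + (- n / b) * y) v) \<partial>lborel \<partial>lborel)
     = (\<integral>\<^sup>+v. \<integral>\<^sup>+y. f (Complex (a / b * v + (- n / b) * y) v) \<partial>lborel \<partial>lborel)"
    by (rule lborel_pair.Fubini') measurable
  finally have "ennreal n * (\<integral>\<^sup>+z. f (c * z) \<partial>lborel) =
     ennreal (n / \<bar>b\<bar>) * (\<integral>\<^sup>+v. \<integral>\<^sup>+y. f (Complex (a / b * v + (- n / b) * y) v) \<partial>lborel \<partial>lborel)"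
    using n' b by (simp add: mult.assoc[symmetric] flip: ennreal_mult)
  also have "\<dots> = (\<integral>\<^sup>+v. ennreal \<bar>- n / b\<bar> * \<integral>\<^sup>+y. f (Complex (a / b * v + (- n / b) * y) v) \<partial>lborel \<partial>lborel)"
    using n' by (subst nn_integral_cmult) auto
  also have "\<dots> = (\<integral>\<^sup>+v. \<integral>\<^sup>+w. f (Complex w v) \<partial>lborel \<partial>lborel)"
    by (intro nn_integral_cong, subst nn_integral_real_affine[of _ "- n / b" "a / b * _"])
       (use n0 b in auto)
  also have "\<dots> = (\<integral>\<^sup>+w. \<integral>\<^sup>+v. f (Complex w v) \<partial>lborel \<partial>lborel)"
    by (rule lborel_pair.Fubini') measurable
  finally show ?thesis by (simp add: nn_integral_complex n_def)
qed

lemma lborel_complex_mult: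
  fixes c :: complex
  assumes c: "c \<noteq> 0"
  shows "lborel = density (distr lborel borel ((*) c)) (\<lambda>_. ennreal ((cmod c)\<^sup>2))"
proof (rule measure_eqI)
  fix A :: "complex set" assume "A \<in> sets lborel"
  then have [measurable]: "A \<in> sets borel" by simp
  have "emeasure lborel A = (\<integral>\<^sup>+z. indicator A z \<partial>lborel)" by simp
  also have "\<dots> = ennreal ((cmod c)\<^sup>2) * (\<integral>\<^sup>+z. indicator A (c * z) \<partial>lborel)"
    by (rule nn_integral_complex_mult[OF c]) measurable
  also have "(\<integral>\<^sup>+z. indicator A (c * z) \<partial>lborel) = emeasure (distr lborel borel ((*) c)) A"
    by (subst nn_integral_distr[symmetric, where f="indicator A" and M'=borel]) auto
  also have "ennreal ((cmod c)\<^sup>2) * \<dots> = emeasure (density (distr lborel borel ((*) c)) (\<lambda>_. ennreal ((cmod c)\<^sup>2))) A"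
    by (simp add: emeasure_density nn_integral_cmult)
  finally show "emeasure lborel A = emeasure (density (distr lborel borel ((*) c)) (\<lambda>_. ennreal ((cmod c)\<^sup>2))) A" .
qed simp

lemma integral_complex_mult:
  fixes c :: complex and f :: "complex \<Rightarrow> real"
  assumes c: "c \<noteq> 0" and [measurable]: "f \<in> borel_measurable borel"
  shows "(LINT z|lborel. f (c * z)) = (LINT z|lborel. f z) / (cmod c)\<^sup>2"
proof -
  have "(LINT z|lborel. f z) = (cmod c)\<^sup>2 * (LINT z|lborel. f (c * z))"
    by (subst lborel_complex_mult[OF c], subst integral_density) (auto simp: integral_distr)
  then show ?thesis using c by simp
qed

lemma integrable_complex_mult:
  fixes c :: complex and f :: "complex \<Rightarrow> real"
  assumes c: "c \<noteq> 0" and f: "integrable lborel f"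
  shows "integrable lborel (\<lambda>z. f (c * z))"
proof -
  have [measurable]: "f \<in> borel_measurable borel" using f by auto
  have "integrable (density (distr lborel borel ((*) c)) (\<lambda>_. ennreal ((cmod c)\<^sup>2))) f"
    using f lborel_complex_mult[OF c] by simp
  then have "integrable lborel (\<lambda>z. (cmod c)\<^sup>2 * f (c * z))"
    by (subst (asm) integrable_density) (auto simp: integrable_distr_eq)
  then show ?thesis using c by simp
qed

lemma lborel_complex_translate: "distr lborel borel (\<lambda>z. z + t) = (lborel :: complex measure)"
proof -
  have "distr lborel borel (\<lambda>z. z + t) = distr lborel borel ((+) t)"
    by (rule distr_cong) (auto simp: add.commute)
  then show ?thesis by (simp add: lborel_distr_plus)
qed

lemma integral_complex_translate:
  fixes f :: "complex \<Rightarrow> 'b::{banach, second_countable_topology}"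
  assumes [measurable]: "f \<in> borel_measurable borel"
  shows "(LINT z|lborel. f (z - t)) = (LINT z|lborel. f z)"
proof -
  have "(LINT z|lborel. f z) = (LINT z|distr lborel borel (\<lambda>z. z + (-t)). f z)"
    by (simp only: lborel_complex_translate)
  also have "\<dots> = (LINT z|lborel. f (z - t))"
    by (subst integral_distr) auto
  finally show ?thesis by simp
qed

lemma nn_integral_complex_translate:
  fixes f :: "complex \<Rightarrow> ennreal"
  assumes [measurable]: "f \<in> borel_measurable borel"
  shows "(\<integral>\<^sup>+z. f (z - t) \<partial>lborel) = (\<integral>\<^sup>+z. f z \<partial>lborel)"
proof -
  have "(\<integral>\<^sup>+z. f z \<partial>lborel) = (\<integral>\<^sup>+z. f z \<partial>distr lborel borel (\<lambda>z. z + (-t)))"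
    by (simp only: lborel_complex_translate)
  also have "\<dots> = (\<integral>\<^sup>+z. f (z - t) \<partial>lborel)"
    by (subst nn_integral_distr) auto
  finally show ?thesis by simp
qed

lemma integrable_complex_translate:
  fixes f :: "complex \<Rightarrow> 'b::{banach, second_countable_topology}"
  assumes f: "integrable lborel f"
  shows "integrable lborel (\<lambda>z. f (z - t))"
proof -
  have [measurable]: "f \<in> borel_measurable borel" using f by auto
  have "integrable (distr lborel borel (\<lambda>z. z + (-t))) f"
    using f by (simp only: lborel_complex_translate)
  then show ?thesis by (subst (asm) integrable_distr_eq) auto
qed

text \<open>Standard deviation \<open>r\<close> in each coordinate; the product form carries
  one-dimensional facts on normal densities over by Fubini.\<close>

definition gauss :: "real \<Rightarrow> complex \<Rightarrow> real" where
  "gauss r z = normal_density 0 r (Re z) * normal_density 0 r (Im z)"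

lemma gauss_eq:
  assumes "r > 0"
  shows "gauss r z = exp (- (cmod z)\<^sup>2 / (2 * r\<^sup>2)) / (2 * pi * r\<^sup>2)"
proof -
  have "sqrt (2 * pi * r\<^sup>2) * sqrt (2 * pi * r\<^sup>2) = 2 * pi * r\<^sup>2"
    by (subst real_sqrt_mult_self) auto
  moreover have "exp (- (Re z)\<^sup>2 / (2 * r\<^sup>2)) * exp (- (Im z)\<^sup>2 / (2 * r\<^sup>2)) = exp (- (cmod z)\<^sup>2 / (2 * r\<^sup>2))"
    by (simp add: mult_exp_exp cmod_power2 add_divide_distrib diff_divide_distrib)
  ultimately show ?thesis by (simp add: gauss_def normal_density_def)
qed

lemma gauss_pos: "r > 0 \<Longrightarrow> gauss r z > 0"
  by (simp add: gauss_def normal_density_pos)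

lemma gauss_nonneg: "gauss r z \<ge> 0"
  by (simp add: gauss_def normal_density_nonneg)

lemma gauss_le: "r > 0 \<Longrightarrow> gauss r z \<le> 1 / (2 * pi * r\<^sup>2)"
  by (simp add: gauss_eq divide_right_mono)

lemma gauss_minus[simp]: "gauss r (- z) = gauss r z"
  by (simp add: gauss_def normal_density_def)

lemma gauss_minus_commute: "gauss r (x - y) = gauss r (y - x)"
  using gauss_minus[of r "x - y"] by simp

lemma gauss_mult:
  assumes "r > 0" "c \<noteq> 0"
  shows "gauss (cmod c * r) (c * z) = gauss r z / (cmod c)\<^sup>2"
  using assms by (simp add: gauss_eq norm_mult power_mult_distrib field_simps)

lemma measurable_gauss[measurable]: "gauss r \<in> borel_measurable borel"
  unfolding gauss_def by measurable

lemma nn_integral_complex_prod: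
  assumes [measurable]: "f \<in> borel_measurable borel" "g \<in> borel_measurable borel"
  shows "(\<integral>\<^sup>+z. f (Re z) * g (Im z) \<partial>lborel) = (\<integral>\<^sup>+x. f x \<partial>lborel) * (\<integral>\<^sup>+y. g y \<partial>lborel)"
  by (subst nn_integral_complex) (auto simp: nn_integral_cmult nn_integral_multc)

lemma nn_integral_gauss: "r > 0 \<Longrightarrow> (\<integral>\<^sup>+z. ennreal (gauss r z) \<partial>lborel) = 1"
  unfolding gauss_def
  using nn_integral_complex_prod[of "\<lambda>t. ennreal (normal_density 0 r t)" "\<lambda>t. ennreal (normal_density 0 r t)"]
  by (simp add: ennreal_mult' normal_density_nonneg nn_integral_eq_integral)

lemma integrable_gauss: "r > 0 \<Longrightarrow> integrable lborel (gauss r)"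
  by (rule integrableI_nonneg) (auto simp: gauss_nonneg nn_integral_gauss)

lemma integral_gauss: "r > 0 \<Longrightarrow> (LINT z|lborel. gauss r z) = 1"
  by (rule integral_eq_nn_integral[THEN trans]) (auto simp: gauss_nonneg nn_integral_gauss)

lemma gauss_conv_nn:
  assumes "r > 0" "s > 0"
  shows "(\<integral>\<^sup>+y. ennreal (gauss r (x - y) * gauss s y) \<partial>lborel) = ennreal (gauss (sqrt (r\<^sup>2 + s\<^sup>2)) x)"
proof -
  have "(\<integral>\<^sup>+y. ennreal (gauss r (x - y) * gauss s y) \<partial>lborel)
     = (\<integral>\<^sup>+y. (\<lambda>t. ennreal (normal_density 0 r (Re x - t) * normal_density 0 s t)) (Re y)
            * (\<lambda>t. ennreal (normal_density 0 r (Im x - t) * normal_density 0 s t)) (Im y) \<partial>lborel)"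
    by (intro nn_integral_cong) (simp add: gauss_def ennreal_mult[symmetric] normal_density_nonneg mult_ac)
  also have "\<dots> = ennreal (normal_density 0 (sqrt (r\<^sup>2 + s\<^sup>2)) (Re x)) * ennreal (normal_density 0 (sqrt (r\<^sup>2 + s\<^sup>2)) (Im x))"
    by (subst nn_integral_complex_prod)
       (auto intro!: arg_cong2[where f="(*)"] fun_cong[OF conv_normal_density_zero_mean[OF assms]])
  finally show ?thesis by (simp add: gauss_def ennreal_mult normal_density_nonneg)
qed

lemma gauss_conv:
  assumes "r > 0" "s > 0"
  shows "integrable lborel (\<lambda>y. gauss r (x - y) * gauss s y)"
    and "(LINT y|lborel. gauss r (x - y) * gauss s y) = gauss (sqrt (r\<^sup>2 + s\<^sup>2)) x"
proof -
  show "integrable lborel (\<lambda>y. gauss r (x - y) * gauss s y)"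
    by (rule integrableI_nonneg) (auto simp: gauss_nonneg gauss_conv_nn[OF assms])
  show "(LINT y|lborel. gauss r (x - y) * gauss s y) = gauss (sqrt (r\<^sup>2 + s\<^sup>2)) x"
    by (rule integral_eq_nn_integral[THEN trans]) (auto simp: gauss_nonneg gauss_conv_nn[OF assms])
qed


lemma integral_complex_prod:
  fixes f g :: "real \<Rightarrow> real"
  assumes f: "integrable lborel f" and g: "integrable lborel g"
  shows "integrable lborel (\<lambda>z. f (Re z) * g (Im z))"
    and "(LINT z|lborel. f (Re z) * g (Im z)) = (LINT x|lborel. f x) * (LINT y|lborel. g y)"
proof -
  have [measurable]: "f \<in> borel_measurable borel" "g \<in> borel_measurable borel" using f g by auto
  have [measurable]: "(\<lambda>(x, y). Complex x y) \<in> borel_measurable (lborel \<Otimes>\<^sub>M lborel)"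
    unfolding split_beta by measurable
  have i: "integrable (lborel \<Otimes>\<^sub>M lborel) (\<lambda>(x, y). f x * g y)"
    by (rule lborel_pair.Fubini_integrable) (use f g in \<open>auto simp: abs_mult\<close>)
  show "integrable lborel (\<lambda>z. f (Re z) * g (Im z))"
    by (subst lborel_complex_eq, subst integrable_distr_eq) (use i in \<open>auto simp: split_beta'\<close>)
  have "(LINT z|lborel. f (Re z) * g (Im z)) = (LINT p|(lborel \<Otimes>\<^sub>M lborel). (case p of (x, y) \<Rightarrow> f x * g y))"
    by (subst lborel_complex_eq, subst integral_distr) (auto simp: split_beta')
  also have "\<dots> = (LINT x|lborel. LINT y|lborel. f x * g y)"
    using lborel_pair.integral_fst'[OF i] by simp
  finally show "(LINT z|lborel. f (Re z) * g (Im z)) = (LINT x|lborel. f x) * (LINT y|lborel. g y)"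
    by simp
qed

lemma std_normal_cos_sin:
  shows "(LINT x|lborel. std_normal_density x * cos (t * x)) = exp (- t\<^sup>2 / 2)"
    and "(LINT x|lborel. std_normal_density x * sin (t * x)) = 0"
proof -
  have i: "complex_integrable std_normal_distribution (\<lambda>x. iexp (t * x))"
    by (rule prob_space.integrable_iexp) (auto intro: prob_space_normal_density)
  have c: "(CLINT x|std_normal_distribution. iexp (t * x)) = exp (- (t\<^sup>2) / 2)"
    using fun_cong[OF char_std_normal_distribution, of t] by (simp add: char_def)
  have "(LINT x|std_normal_distribution. cos (t * x)) = Re (CLINT x|std_normal_distribution. iexp (t * x))"
    using i by (subst integral_Re[symmetric]) (auto simp: Re_exp)
  also have "\<dots> = exp (- t\<^sup>2 / 2)" by (simp only: c Re_complex_of_real)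
  finally show "(LINT x|lborel. std_normal_density x * cos (t * x)) = exp (- t\<^sup>2 / 2)"
    by (subst (asm) integral_density) (auto simp: normal_density_nonneg)
  have "(LINT x|std_normal_distribution. sin (t * x)) = Im (CLINT x|std_normal_distribution. iexp (t * x))"
    using i by (subst integral_Im[symmetric]) (auto simp: Im_exp)
  also have "\<dots> = 0" by (simp only: c Im_complex_of_real)
  finally show "(LINT x|lborel. std_normal_density x * sin (t * x)) = 0"
    by (subst (asm) integral_density) (auto simp: normal_density_nonneg)
qed

lemma gauss_fourier:
  assumes s: "s > 0"
  shows "(LINT \<xi>|lborel. gauss s \<xi> * cos (\<xi> \<bullet> z)) = exp (- s\<^sup>2 * (cmod z)\<^sup>2 / 2)"
proof -
  define a b where "a = s * Re z" and "b = s * Im z"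
  let ?n = "std_normal_density"
  have int: "integrable lborel (\<lambda>x. ?n x * cos (t * x))" "integrable lborel (\<lambda>x. ?n x * sin (t * x))" for t :: real
    by (rule Bochner_Integration.integrable_bound[where f="\<lambda>x. std_normal_density x"];
        auto simp: abs_mult normal_density_nonneg mult_left_le intro!: AE_I2)+
  have "(LINT \<xi>|lborel. gauss s \<xi> * cos (\<xi> \<bullet> z)) = s\<^sup>2 * (LINT \<xi>|lborel. gauss s (of_real s * \<xi>) * cos ((of_real s * \<xi>) \<bullet> z))"
    using integral_complex_mult[of "of_real s" "\<lambda>\<xi>. gauss s \<xi> * cos (\<xi> \<bullet> z)"] s by simp
  also have "\<dots> = (LINT \<xi>|lborel. gauss 1 \<xi> * cos (a * Re \<xi> + b * Im \<xi>))"
  proof -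
    have "gauss s (of_real s * \<xi>) = gauss 1 \<xi> / s\<^sup>2" for \<xi>
      using gauss_mult[of 1 "of_real s" \<xi>] s by simp
    then show ?thesis using s by (simp add: inner_complex_def a_def b_def mult_ac)
  qed
  also have "\<dots> = (LINT \<xi>|lborel. (?n (Re \<xi>) * cos (a * Re \<xi>)) * (?n (Im \<xi>) * cos (b * Im \<xi>))
        - (?n (Re \<xi>) * sin (a * Re \<xi>)) * (?n (Im \<xi>) * sin (b * Im \<xi>)))"
    by (intro Bochner_Integration.integral_cong) (auto simp: gauss_def cos_add algebra_simps)
  also have "\<dots> = exp (- a\<^sup>2 / 2) * exp (- b\<^sup>2 / 2)"
    by (subst Bochner_Integration.integral_diff)
       (auto intro!: integral_complex_prod(1)[of "\<lambda>x. ?n x * cos (a * x)" "\<lambda>x. ?n x * cos (b * x)"]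
          integral_complex_prod(1)[of "\<lambda>x. ?n x * sin (a * x)" "\<lambda>x. ?n x * sin (b * x)"] int
         simp: integral_complex_prod(2)[of "\<lambda>x. ?n x * cos (a * x)" "\<lambda>x. ?n x * cos (b * x)", OF int(1) int(1)]
          integral_complex_prod(2)[of "\<lambda>x. ?n x * sin (a * x)" "\<lambda>x. ?n x * sin (b * x)", OF int(2) int(2)] std_normal_cos_sin)
  also have "\<dots> = exp (- s\<^sup>2 * (cmod z)\<^sup>2 / 2)"
        by (simp add: a_def b_def mult_exp_exp cmod_power2 power_mult_distrib distrib_left add_divide_distrib)
  finally show ?thesis .
qed

text \<open>A Gaussian is its own Fourier transform up to scaling, so inversion is
  \<open>gauss_fourier\<close> at the width \<open>s = 1 / (sqrt 2 * k)\<close>. The width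
  \<open>sqrt 2 * k\<close> is that of the convolution of two Gaussians of width
  \<open>k\<close>.\<close>

lemma gauss_fourier_inversion:
  assumes k: "k > 0"
  shows "integrable lborel (\<lambda>\<xi>::complex. exp (- k\<^sup>2 * (cmod \<xi>)\<^sup>2))"
    and "(LINT \<xi>|lborel. exp (- k\<^sup>2 * (cmod \<xi>)\<^sup>2)) = pi / k\<^sup>2"
    and "gauss (sqrt 2 * k) z = (LINT \<xi>|lborel. exp (- k\<^sup>2 * (cmod \<xi>)\<^sup>2) * cos (\<xi> \<bullet> z)) / (4 * pi\<^sup>2)"
proof -
  define s where "s = 1 / (sqrt 2 * k)"
  have s: "s > 0" "s\<^sup>2 = 1 / (2 * k\<^sup>2)" using k by (auto simp: s_def power_mult_distrib power_divide)
  have e: "exp (- k\<^sup>2 * (cmod \<xi>)\<^sup>2) = pi / k\<^sup>2 * gauss s \<xi>" for \<xi>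
    using s k by (simp add: gauss_eq field_simps)
  show "integrable lborel (\<lambda>\<xi>::complex. exp (- k\<^sup>2 * (cmod \<xi>)\<^sup>2))"
    unfolding e using integrable_gauss[OF s(1)] by simp
  show "(LINT \<xi>|lborel. exp (- k\<^sup>2 * (cmod \<xi>)\<^sup>2)) = pi / k\<^sup>2"
    unfolding e using integral_gauss[OF s(1)] by simp
  have "(LINT \<xi>|lborel. exp (- k\<^sup>2 * (cmod \<xi>)\<^sup>2) * cos (\<xi> \<bullet> z)) = pi / k\<^sup>2 * exp (- s\<^sup>2 * (cmod z)\<^sup>2 / 2)"
    unfolding e by (simp add: mult.assoc gauss_fourier[OF s(1)])
  also have "\<dots> = (4 * pi\<^sup>2) * gauss (sqrt 2 * k) z"
    using k unfolding s(2) by (simp add: gauss_eq power_mult_distrib power2_eq_square)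
  finally show "gauss (sqrt 2 * k) z = (LINT \<xi>|lborel. exp (- k\<^sup>2 * (cmod \<xi>)\<^sup>2) * cos (\<xi> \<bullet> z)) / (4 * pi\<^sup>2)"
    by simp
qed

section \<open>Parseval's identity for measures smoothed by a Gaussian\<close>

definition gsm :: "real \<Rightarrow> complex measure \<Rightarrow> complex \<Rightarrow> real" where
  "gsm r N z = (LINT x|N. gauss r (z - x))"

definition cf :: "complex measure \<Rightarrow> complex \<Rightarrow> complex" where
  "cf N \<xi> = (CLINT x|N. cis (\<xi> \<bullet> x))"

text \<open>Only measurability of the identity is demanded, not the Borel sigma-algebra, so that
  \<open>measure_pmf\<close>, where every set is measurable, is covered together with Borel
  measures.\<close>

locale complex_finite_measure = finite_measure N for N :: "complex measure" +
  assumes id_measurable[measurable]: "(\<lambda>x. x) \<in> borel_measurable N"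
begin

lemma integrable_bounded:
  fixes f :: "complex \<Rightarrow> 'b::{banach, second_countable_topology}"
  assumes [measurable]: "f \<in> borel_measurable borel" and "\<And>x. norm (f x) \<le> B"
  shows "integrable N f"
proof (rule integrable_const_bound)
  show "AE x in N. norm (f x) \<le> B" using assms by auto
  have "f \<circ> (\<lambda>x. x) \<in> borel_measurable N" by (rule measurable_comp[OF id_measurable assms(1)])
  then show "f \<in> borel_measurable N" by (simp add: comp_def)
qed

lemma integrable_gauss_shift: "r > 0 \<Longrightarrow> integrable N (\<lambda>x. gauss r (z - x))"
  by (rule integrable_bounded[where B="1 / (2 * pi * r\<^sup>2)"]) (auto simp: gauss_nonneg gauss_le)

lemma gsm_nonneg: "gsm r N z \<ge> 0"
  by (simp add: gsm_def gauss_nonneg)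

lemma measurable_gsm[measurable]: "gsm r N \<in> borel_measurable borel"
proof -
  have "(\<lambda>(z, x). gauss r (z - x)) \<in> borel_measurable (borel \<Otimes>\<^sub>M N)"
    unfolding split_beta by measurable
  then show ?thesis unfolding gsm_def[abs_def] by (rule borel_measurable_lebesgue_integral)
qed

end


lemma pair_integral_product:
  fixes f g :: "'a \<Rightarrow> 'b::{real_normed_field, banach, second_countable_topology}"
  assumes "finite_measure M" "finite_measure N"
    and f: "integrable M f" and g: "integrable N g"
  shows "integrable (M \<Otimes>\<^sub>M N) (\<lambda>p. f (fst p) * g (snd p))"
    and "(LINT p|(M \<Otimes>\<^sub>M N). f (fst p) * g (snd p)) = (LINT x|M. f x) * (LINT y|N. g y)"
proof -
  interpret M: finite_measure M by fact
  interpret N: finite_measure N by fact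
  interpret P: pair_sigma_finite M N ..
  have [measurable]: "f \<in> borel_measurable M" "g \<in> borel_measurable N" using f g by auto
  show i: "integrable (M \<Otimes>\<^sub>M N) (\<lambda>p. f (fst p) * g (snd p))"
    by (rule P.Fubini_integrable) (use f g in \<open>auto simp: norm_mult\<close>)
  show "(LINT p|(M \<Otimes>\<^sub>M N). f (fst p) * g (snd p)) = (LINT x|M. f x) * (LINT y|N. g y)"
    using P.integral_fst'[OF i] by simp
qed

lemma finite_pair_measure:
  assumes "finite_measure M" "finite_measure N"
  shows "finite_measure (M \<Otimes>\<^sub>M N)"
proof -
  interpret M: finite_measure M by fact
  interpret N: finite_measure N by fact
  show ?thesis
    by (rule finite_measureI)
       (simp add: space_pair_measure N.emeasure_pair_measure_Times ennreal_mult_eq_top_iff)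
qed

context
  fixes N1 N2 :: "complex measure"
  assumes N1: "complex_finite_measure N1" and N2: "complex_finite_measure N2"
begin

interpretation N1: complex_finite_measure N1 by (rule N1)
interpretation N2: complex_finite_measure N2 by (rule N2)
interpretation P: finite_measure "N1 \<Otimes>\<^sub>M N2"
  by (rule finite_pair_measure) unfold_locales
interpretation PL: pair_sigma_finite "N1 \<Otimes>\<^sub>M N2" "lborel :: complex measure" ..

text \<open>Both sides integrate the kernel \<open>gauss (sqrt 2 * k) (x - y)\<close> over the
  product of \<open>N1\<close> and \<open>N2\<close>: on the left it arises from the semigroup
  property, on the right from Fourier inversion.\<close>

lemma gauss_parseval:
  assumes k: "k > 0"
  shows "integrable lborel (\<lambda>z. gsm k N1 z * gsm k N2 z)"
    and "integrable lborel (\<lambda>\<xi>. exp (- k\<^sup>2 * (cmod \<xi>)\<^sup>2) * Re (cf N1 \<xi> * cnj (cf N2 \<xi>)))"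
    and "(LINT z|lborel. gsm k N1 z * gsm k N2 z)
       = (LINT \<xi>|lborel. exp (- k\<^sup>2 * (cmod \<xi>)\<^sup>2) * Re (cf N1 \<xi> * cnj (cf N2 \<xi>))) / (4 * pi\<^sup>2)"
proof -
  let ?P = "N1 \<Otimes>\<^sub>M N2"
  define F where "F = (\<lambda>p z. gauss k (z - fst p) * gauss k (z - snd p))"
  define H where "H = (\<lambda>p \<xi>. exp (- k\<^sup>2 * (cmod \<xi>)\<^sup>2) * cos (\<xi> \<bullet> (fst p - snd p)))"
  have k2: "sqrt (k\<^sup>2 + k\<^sup>2) = sqrt 2 * k" using k by (simp add: real_sqrt_mult flip: mult_2)
  have k2': "sqrt (2 * k\<^sup>2) = sqrt 2 * k" using k by (simp add: real_sqrt_mult)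
  have Fz: "integrable lborel (F p)" "(LINT z|lborel. F p z) = gauss (sqrt 2 * k) (fst p - snd p)" for p
  proof -
    have *: "(\<lambda>z. gauss k ((fst p - snd p) - (z - snd p)) * gauss k (z - snd p)) = F p"
      by (auto simp: F_def gauss_minus_commute[of k "fst p"])
    show "integrable lborel (F p)"
      using integrable_complex_translate[OF gauss_conv(1)[OF k k, of "fst p - snd p"], of "snd p"] * by simp
    show "(LINT z|lborel. F p z) = gauss (sqrt 2 * k) (fst p - snd p)"
      using integral_complex_translate[of "\<lambda>z. gauss k ((fst p - snd p) - z) * gauss k z" "snd p"]
        gauss_conv(2)[OF k k, of "fst p - snd p"] * by (simp add: k2 k2')
  qed
  have gP: "integrable ?P (\<lambda>p. gauss (sqrt 2 * k) (fst p - snd p))"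
    using k by (intro P.integrable_const_bound[where B="1 / (2 * pi * (sqrt 2 * k)\<^sup>2)"])
       (auto simp: gauss_nonneg gauss_le)
  have iF: "integrable (?P \<Otimes>\<^sub>M lborel) (case_prod F)"
  proof (rule PL.Fubini_integrable)
    show "case_prod F \<in> borel_measurable (?P \<Otimes>\<^sub>M lborel)" unfolding F_def split_beta by measurable
    show "integrable ?P (\<lambda>p. LINT z|lborel. norm (case_prod F (p, z)))"
      using gP Fz(2) by (simp add: F_def gauss_nonneg)
  qed (use Fz(1) in auto)
  have iH: "integrable (?P \<Otimes>\<^sub>M lborel) (case_prod H)"
  proof -
    have "integrable (?P \<Otimes>\<^sub>M lborel) (\<lambda>(p, \<xi>). exp (- k\<^sup>2 * (cmod \<xi>)\<^sup>2))"
      by (rule PL.Fubini_integrable) (use gauss_fourier_inversion(1)[OF k] in \<open>auto simp: split_beta\<close>)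
    then show ?thesis
    proof (rule Bochner_Integration.integrable_bound)
      show "case_prod H \<in> borel_measurable (?P \<Otimes>\<^sub>M lborel)" unfolding H_def split_beta by measurable
    qed (auto simp: H_def abs_mult mult_left_le)
  qed
  have gs: "(LINT p|?P. F p z) = gsm k N1 z * gsm k N2 z" for z
    unfolding F_def gsm_def
    by (rule pair_integral_product(2)) (auto intro!: N1.integrable_gauss_shift N2.integrable_gauss_shift k N1.finite_measure_axioms N2.finite_measure_axioms)
  have ch: "(LINT p|?P. H p \<xi>) = exp (- k\<^sup>2 * (cmod \<xi>)\<^sup>2) * Re (cf N1 \<xi> * cnj (cf N2 \<xi>))" for \<xi>
  proof -
    have i1: "complex_integrable N1 (\<lambda>x. cis (\<xi> \<bullet> x))" by (rule N1.integrable_bounded[where B=1]) (auto simp: cis_conv_exp)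
    have i2: "complex_integrable N2 (\<lambda>x. cis (- (\<xi> \<bullet> x)))" by (rule N2.integrable_bounded[where B=1]) (auto simp: cis_conv_exp)
    have c2: "cnj (cf N2 \<xi>) = (CLINT x|N2. cis (- (\<xi> \<bullet> x)))"
      unfolding cf_def by (subst Bochner_Integration.integral_cnj[symmetric]) (simp add: cis_cnj)
    have ii: "complex_integrable ?P (\<lambda>p. cis (\<xi> \<bullet> fst p) * cis (- (\<xi> \<bullet> snd p)))"
      by (rule pair_integral_product(1)[OF _ _ i1 i2]) unfold_locales
    have "cf N1 \<xi> * cnj (cf N2 \<xi>) = (CLINT p|?P. cis (\<xi> \<bullet> fst p) * cis (- (\<xi> \<bullet> snd p)))"
      unfolding c2 unfolding cf_def
      by (rule pair_integral_product(2)[OF _ _ i1 i2, symmetric]) unfold_locales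
    then have "Re (cf N1 \<xi> * cnj (cf N2 \<xi>)) = (LINT p|?P. Re (cis (\<xi> \<bullet> fst p) * cis (- (\<xi> \<bullet> snd p))))"
      using integral_Re[OF ii] by simp
    also have "\<dots> = (LINT p|?P. cos (\<xi> \<bullet> (fst p - snd p)))"
      by (simp add: inner_diff_right cos_diff)
    finally show ?thesis by (simp add: H_def)
  qed
  show "integrable lborel (\<lambda>z. gsm k N1 z * gsm k N2 z)"
    using PL.integrable_snd[OF iF] by (simp add: gs)
  show "integrable lborel (\<lambda>\<xi>. exp (- k\<^sup>2 * (cmod \<xi>)\<^sup>2) * Re (cf N1 \<xi> * cnj (cf N2 \<xi>)))"
    using PL.integrable_snd[OF iH] by (simp add: ch)
  have "(LINT z|lborel. gsm k N1 z * gsm k N2 z) = (LINT p|?P. LINT z|lborel. F p z)"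
    using PL.Fubini_integral[OF iF] by (simp add: gs)
  also have "\<dots> = (LINT p|?P. (LINT \<xi>|lborel. H p \<xi>) / (4 * pi\<^sup>2))"
    unfolding Fz(2) H_def using gauss_fourier_inversion(3)[OF k] by simp
  also have "\<dots> = (LINT p|?P. LINT \<xi>|lborel. H p \<xi>) / (4 * pi\<^sup>2)"
    by simp
  also have "(LINT p|?P. LINT \<xi>|lborel. H p \<xi>) = (LINT \<xi>|lborel. LINT p|?P. H p \<xi>)"
    using PL.Fubini_integral[OF iH] by simp
  finally show "(LINT z|lborel. gsm k N1 z * gsm k N2 z)
       = (LINT \<xi>|lborel. exp (- k\<^sup>2 * (cmod \<xi>)\<^sup>2) * Re (cf N1 \<xi> * cnj (cf N2 \<xi>))) / (4 * pi\<^sup>2)"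
    by (simp only: ch)
qed

end

section \<open>Entropy of finitely supported measures smoothed by a Gaussian\<close>

lemma measure_pmf_complex_finite: "complex_finite_measure (measure_pmf A)"
  by unfold_locales auto

interpretation pmf: complex_finite_measure "measure_pmf A" for A :: "complex pmf"
  by (rule measure_pmf_complex_finite)

abbreviation fin_pmf :: "'a pmf \<Rightarrow> bool" where "fin_pmf A \<equiv> finite (set_pmf A)"

lemma integrable_fin_pmf: "fin_pmf A \<Longrightarrow> integrable (measure_pmf A) (f :: _ \<Rightarrow> 'b::{banach, second_countable_topology})"
  by (rule integrable_measure_pmf_finite)

lemma expectation_fin: "fin_pmf A \<Longrightarrow> measure_pmf.expectation A (f :: _ \<Rightarrow> 'b::{banach, second_countable_topology}) = (\<Sum>x\<in>set_pmf A. pmf A x *\<^sub>R f x)"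
  by (rule integral_measure_pmf) auto

lemma expectation_mono_pmf:
  fixes f g :: "'a \<Rightarrow> real"
  assumes "fin_pmf A" "\<And>x. x \<in> set_pmf A \<Longrightarrow> f x \<le> g x"
  shows "measure_pmf.expectation A f \<le> measure_pmf.expectation A g"
  using assms by (auto intro!: integral_mono_AE integrable_fin_pmf simp: AE_measure_pmf_iff)

lemma expectation_bind_fin:
  fixes f :: "'b \<Rightarrow> real"
  assumes "fin_pmf Z" "\<And>z. z \<in> set_pmf Z \<Longrightarrow> fin_pmf (Y z)"
  shows "measure_pmf.expectation (bind_pmf Z Y) f = measure_pmf.expectation Z (\<lambda>z. measure_pmf.expectation (Y z) f)"
  using pmf_expectation_bind[OF assms(1) _ order_refl, of Y f] assms by (simp add: expectation_fin)

section \<open>Convolution and smoothing of finitely supported laws\<close>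

definition pconv :: "complex pmf \<Rightarrow> complex pmf \<Rightarrow> complex pmf" (infixl "\<oplus>" 70) where
  "pconv A B = bind_pmf B (\<lambda>b. map_pmf (\<lambda>a. a + b) A)"

lemma pconv_alt: "A \<oplus> B = bind_pmf A (\<lambda>a. map_pmf (\<lambda>b. a + b) B)"
  unfolding pconv_def map_pmf_def by (subst bind_commute_pmf) simp

lemma pconv_commute: "A \<oplus> B = B \<oplus> A"
  unfolding pconv_def[of A B] pconv_alt[of B A] by (simp add: add.commute)

lemma pconv_assoc: "(A \<oplus> B) \<oplus> C = A \<oplus> (B \<oplus> C)"
  by (simp add: pconv_def map_bind_pmf bind_map_pmf bind_assoc_pmf pmf.map_comp comp_def add.assoc)

lemma set_pconv: "set_pmf (A \<oplus> B) = (\<lambda>(a, b). a + b) ` (set_pmf A \<times> set_pmf B)"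
  by (auto simp: pconv_def)

lemma fin_pconv[intro, simp]: "fin_pmf A \<Longrightarrow> fin_pmf B \<Longrightarrow> fin_pmf (A \<oplus> B)"
  by (simp add: set_pconv)

lemma pconv_return[simp]: "A \<oplus> return_pmf 0 = A" "return_pmf 0 \<oplus> A = A"
  by (simp_all add: pconv_def bind_return_pmf bind_return_pmf' pmf.map_ident)

lemma pconv_return_right: "A \<oplus> return_pmf b = map_pmf (\<lambda>a. a + b) A"
  by (simp add: pconv_def bind_return_pmf)

lemma expectation_pconv:
  fixes f :: "complex \<Rightarrow> real"
  assumes "fin_pmf A" "fin_pmf B"
  shows "measure_pmf.expectation (A \<oplus> B) f = measure_pmf.expectation B (\<lambda>b. measure_pmf.expectation A (\<lambda>a. f (a + b)))"
  unfolding pconv_def using assms by (subst expectation_bind_fin) auto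

lemma gsm_pmf_le: "r > 0 \<Longrightarrow> gsm r (measure_pmf A) z \<le> 1 / (2 * pi * r\<^sup>2)"
  unfolding gsm_def by (rule measure_pmf.integral_le_const) (auto intro: pmf.integrable_gauss_shift gauss_le)

lemma gsm_ge: "fin_pmf A \<Longrightarrow> x \<in> set_pmf A \<Longrightarrow> pmf A x * gauss r (z - x) \<le> gsm r (measure_pmf A) z"
  unfolding gsm_def
  by (subst expectation_fin) (auto intro!: member_le_sum[of x _ "\<lambda>x. pmf A x * gauss r (z - x)"] simp: gauss_nonneg)

lemma gsm_pos:
  assumes "fin_pmf A" "r > 0" shows "gsm r (measure_pmf A) z > 0"
proof -
  obtain x where x: "x \<in> set_pmf A" using set_pmf_not_empty by fast
  then have "0 < pmf A x * gauss r (z - x)" using assms(2) by (simp add: gauss_pos pmf_positive)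
  also have "\<dots> \<le> gsm r (measure_pmf A) z" using gsm_ge[OF assms(1) x] .
  finally show ?thesis .
qed

text \<open>Logarithms of Gaussian mixtures belong to this class, and its members are integrable
  against every smoothed law; all entropy integrals below converge for this reason.\<close>

definition quad_growth :: "(complex \<Rightarrow> real) \<Rightarrow> bool" where
  "quad_growth F \<longleftrightarrow> F \<in> borel_measurable borel \<and> (\<exists>C. \<forall>z. \<bar>F z\<bar> \<le> C * (1 + (cmod z)\<^sup>2))"

lemma quad_growth_diff: "quad_growth F \<Longrightarrow> quad_growth G \<Longrightarrow> quad_growth (\<lambda>z. F z - G z)"
proof -
  assume *: "quad_growth F" "quad_growth G"
  then obtain C D where "\<And>z. \<bar>F z\<bar> \<le> C * (1 + (cmod z)\<^sup>2)" "\<And>z. \<bar>G z\<bar> \<le> D * (1 + (cmod z)\<^sup>2)"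
    unfolding quad_growth_def by blast
  then have "\<bar>F z - G z\<bar> \<le> (C + D) * (1 + (cmod z)\<^sup>2)" for z
    unfolding distrib_right by (meson abs_triangle_ineq4 add_mono order_trans)
  then show ?thesis using * unfolding quad_growth_def by auto
qed

text \<open>Half of the exponent absorbs the quadratic factor through
  \<open>t * exp (- t) \<le> 1\<close>; the other half is the Gaussian of width
  \<open>sqrt 2 * r\<close>.\<close>

lemma gauss_quad_le:
  assumes r: "r > 0"
  shows "gauss r (z - x) * (1 + (cmod z)\<^sup>2) \<le> 2 * (1 + 8 * r\<^sup>2 + 2 * (cmod x)\<^sup>2) * gauss (sqrt 2 * r) (z - x)"
proof -
  define w where "w = z - x"
  define t where "t = (cmod w)\<^sup>2 / (4 * r\<^sup>2)"
  have t: "t \<ge> 0" "(cmod w)\<^sup>2 = 4 * r\<^sup>2 * t" using r by (auto simp: t_def)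
  have g: "gauss r w = exp (- t) * exp (- t) / (2 * pi * r\<^sup>2)" using r by (simp add: gauss_eq t mult_exp_exp)
  have g2: "gauss (sqrt 2 * r) w = exp (- t) / (4 * pi * r\<^sup>2)" using r by (simp add: gauss_eq t power_mult_distrib)
  have "cmod z \<le> cmod w + cmod x" using norm_triangle_ineq[of w x] by (simp add: w_def)
  then have "(cmod z)\<^sup>2 \<le> (cmod w + cmod x)\<^sup>2" by (rule power_mono) simp
  also have "\<dots> \<le> 2 * (cmod w)\<^sup>2 + 2 * (cmod x)\<^sup>2"
    using sum_squares_bound[of "cmod w" "cmod x"] by (simp add: power2_sum)
  finally have z: "1 + (cmod z)\<^sup>2 \<le> 1 + 8 * r\<^sup>2 * t + 2 * (cmod x)\<^sup>2" by (simp add: t)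
  have te: "t * exp (- t) \<le> 1" using order_trans[OF _ exp_ge_add_one_self[of t], of t] t(1) by (simp add: exp_minus field_simps)
  have e1: "exp (- t) \<le> 1" using t by simp
  have "exp (- t) * (1 + (cmod z)\<^sup>2) \<le> exp (- t) * (1 + 8 * r\<^sup>2 * t + 2 * (cmod x)\<^sup>2)"
    using z by simp
  also have "\<dots> = exp (- t) * 1 + 8 * r\<^sup>2 * (t * exp (- t)) + 2 * (cmod x)\<^sup>2 * exp (- t)" by (simp add: algebra_simps)
  also have "\<dots> \<le> 1 + 8 * r\<^sup>2 * 1 + 2 * (cmod x)\<^sup>2 * 1"
    using te e1 by (intro add_mono mult_left_mono) auto
  finally have "exp (- t) * (1 + (cmod z)\<^sup>2) \<le> 1 + 8 * r\<^sup>2 + 2 * (cmod x)\<^sup>2" by simp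
  from mult_left_mono[OF this, of "exp (- t) / (2 * pi * r\<^sup>2)"] show ?thesis
    using r unfolding w_def[symmetric] g g2 by (simp add: field_simps)
qed

lemma gsm_quad_growth:
  assumes A: "fin_pmf A" and r: "r > 0" and F: "quad_growth F"
  shows "integrable lborel (\<lambda>z. gsm r (measure_pmf A) z * F z)"
    and "\<exists>B. \<forall>z. \<bar>gsm r (measure_pmf A) z * F z\<bar> \<le> B"
proof -
  obtain C where C: "\<And>z. \<bar>F z\<bar> \<le> C * (1 + (cmod z)\<^sup>2)" and [measurable]: "F \<in> borel_measurable borel"
    using F unfolding quad_growth_def by blast
  have C0: "C \<ge> 0" using C[of 0] by simp
  define D where "D x = C * (2 * (1 + 8 * r\<^sup>2 + 2 * (cmod x)\<^sup>2))" for x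
  have D0: "D x \<ge> 0" for x using C0 by (simp add: D_def)
  have b: "\<bar>gauss r (z - x) * F z\<bar> \<le> D x * gauss (sqrt 2 * r) (z - x)" for x z
  proof -
    have "\<bar>gauss r (z - x) * F z\<bar> \<le> gauss r (z - x) * (C * (1 + (cmod z)\<^sup>2))"
      unfolding abs_mult using C by (simp add: gauss_nonneg mult_left_mono)
    also have "\<dots> \<le> D x * gauss (sqrt 2 * r) (z - x)"
      using mult_left_mono[OF gauss_quad_le[OF r, of z x] C0] by (simp add: D_def mult_ac)
    finally show ?thesis .
  qed
  have i: "integrable lborel (\<lambda>z. gauss r (z - x) * F z)" for x
  proof (rule Bochner_Integration.integrable_bound)
    show "integrable lborel (\<lambda>z. D x * gauss (sqrt 2 * r) (z - x))"
      using integrable_complex_translate[OF integrable_gauss, of "sqrt 2 * r" x] r by simp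
    show "AE z in lborel. norm (gauss r (z - x) * F z) \<le> norm (D x * gauss (sqrt 2 * r) (z - x))"
      using b D0 by (intro AE_I2) (simp add: abs_mult gauss_nonneg)
  qed simp
  have e: "gsm r (measure_pmf A) z * F z = (\<Sum>x\<in>set_pmf A. pmf A x * (gauss r (z - x) * F z))" for z
    unfolding gsm_def using A by (simp add: expectation_fin sum_distrib_right mult.assoc)
  show "integrable lborel (\<lambda>z. gsm r (measure_pmf A) z * F z)"
    unfolding e using i by auto
  have "\<bar>gauss r (z - x) * F z\<bar> \<le> D x * (1 / (2 * pi * (sqrt 2 * r)\<^sup>2))" for z x
    using b[of z x] mult_left_mono[OF gauss_le[of "sqrt 2 * r" "z - x"] D0[of x]] r by simp
  then have "\<bar>gsm r (measure_pmf A) z * F z\<bar> \<le> (\<Sum>x\<in>set_pmf A. pmf A x * (D x * (1 / (2 * pi * (sqrt 2 * r)\<^sup>2))))" for z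
    unfolding e by (intro order_trans[OF sum_abs] sum_mono) (simp only: abs_mult[of "pmf A _"] abs_of_nonneg[OF pmf_nonneg] mult_left_mono[OF _ pmf_nonneg])
  then show "\<exists>B. \<forall>z. \<bar>gsm r (measure_pmf A) z * F z\<bar> \<le> B" by blast
qed

text \<open>The smoothed density lies below the peak of the Gaussian and above the contribution of a
  single atom.\<close>

lemma quad_growth_ln_gsm:
  assumes A: "fin_pmf A" and r: "r > 0"
  shows "quad_growth (\<lambda>z. ln (gsm r (measure_pmf A) z))"
proof -
  obtain x where x: "x \<in> set_pmf A" using set_pmf_not_empty by fast
  define c where "c = \<bar>ln (pmf A x)\<bar> + \<bar>ln (2 * pi * r\<^sup>2)\<bar>"
  have p: "pmf A x > 0" using x by (simp add: pmf_positive)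
  have "\<bar>ln (gsm r (measure_pmf A) z)\<bar> \<le> (c + (1 + (cmod x)\<^sup>2) / r\<^sup>2) * (1 + (cmod z)\<^sup>2)" for z
  proof -
    have "ln (gsm r (measure_pmf A) z) \<le> ln (1 / (2 * pi * r\<^sup>2))"
      using gsm_pmf_le[OF r, of A z] gsm_pos[OF A r, of z] r by (subst ln_le_cancel_iff) auto
    also have "\<dots> = - ln (2 * pi * r\<^sup>2)" using r by (simp add: ln_div)
    also have "\<dots> \<le> c" by (simp add: c_def)
    finally have 1: "ln (gsm r (measure_pmf A) z) \<le> c" .
    have "ln (pmf A x * gauss r (z - x)) \<le> ln (gsm r (measure_pmf A) z)"
      using gsm_ge[OF A x, of r z] gsm_pos[OF A r, of z] p r by (subst ln_le_cancel_iff) (auto simp: gauss_pos)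
    moreover have "ln (pmf A x * gauss r (z - x)) = ln (pmf A x) - (cmod (z - x))\<^sup>2 / (2 * r\<^sup>2) - ln (2 * pi * r\<^sup>2)"
      using p r by (simp add: gauss_eq ln_mult ln_div)
    moreover have "(cmod (z - x))\<^sup>2 / (2 * r\<^sup>2) \<le> ((cmod z)\<^sup>2 + (cmod x)\<^sup>2) / r\<^sup>2"
    proof -
      have "(cmod (z - x))\<^sup>2 \<le> (cmod z + cmod x)\<^sup>2" by (rule power_mono[OF norm_triangle_ineq4]) simp
      also have "\<dots> \<le> 2 * ((cmod z)\<^sup>2 + (cmod x)\<^sup>2)"
        using sum_squares_bound[of "cmod z" "cmod x"] by (simp add: power2_sum)
      finally show ?thesis using r by (simp add: field_simps)
    qed
    ultimately have 2: "ln (gsm r (measure_pmf A) z) \<ge> - c - ((cmod z)\<^sup>2 + (cmod x)\<^sup>2) / r\<^sup>2" unfolding c_def by linarith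
    have "((cmod z)\<^sup>2 + (cmod x)\<^sup>2) \<le> (1 + (cmod x)\<^sup>2) * (1 + (cmod z)\<^sup>2)" by (simp add: algebra_simps)
    then have "((cmod z)\<^sup>2 + (cmod x)\<^sup>2) / r\<^sup>2 \<le> (1 + (cmod x)\<^sup>2) / r\<^sup>2 * (1 + (cmod z)\<^sup>2)"
      using r by (simp add: divide_right_mono)
    moreover have "c * 1 \<le> c * (1 + (cmod z)\<^sup>2)" by (rule mult_left_mono) (auto simp: c_def)
    moreover have "0 \<le> ((cmod z)\<^sup>2 + (cmod x)\<^sup>2) / r\<^sup>2" by simp
    ultimately show ?thesis using 1 2 unfolding distrib_right by linarith
  qed
  then show ?thesis unfolding quad_growth_def by auto
qed

lemma quad_growth_1: "quad_growth (\<lambda>_. 1)"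
  unfolding quad_growth_def by (auto intro!: exI[of _ 1])

lemma integrable_gsm: "fin_pmf A \<Longrightarrow> r > 0 \<Longrightarrow> integrable lborel (gsm r (measure_pmf A))"
  using gsm_quad_growth(1)[OF _ _ quad_growth_1] by simp

lemma integral_gsm:
  assumes "fin_pmf A" "r > 0" shows "(LINT z|lborel. gsm r (measure_pmf A) z) = 1"
proof -
  have "(LINT z|lborel. gauss r (z - x)) = 1" for x
    using assms by (subst integral_complex_translate) (auto simp: integral_gauss)
  moreover have "integrable lborel (\<lambda>z. gauss r (z - x))" for x
    using assms by (intro integrable_complex_translate integrable_gauss)
  ultimately show ?thesis
    using assms sum_pmf_eq_1[OF assms(1) order_refl] unfolding gsm_def by (simp add: expectation_fin)
qed

section \<open>Differential entropy, relative entropy and data processing at a given scale\<close>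

definition ent :: "real \<Rightarrow> complex pmf \<Rightarrow> real" where
  "ent r A = - (LINT z|lborel. gsm r (measure_pmf A) z * ln (gsm r (measure_pmf A) z))"

definition relent :: "real \<Rightarrow> complex pmf \<Rightarrow> complex pmf \<Rightarrow> real" where
  "relent r A B = (LINT z|lborel. gsm r (measure_pmf A) z * (ln (gsm r (measure_pmf A) z) - ln (gsm r (measure_pmf B) z)))"

lemma integral_conv:
  fixes k :: "complex \<Rightarrow> real"
  assumes "prob_space M" and [measurable]: "c \<in> borel_measurable M" and k: "integrable lborel k"
  shows "integrable lborel (\<lambda>x. LINT m|M. k (x - c m))"
    and "(LINT x|lborel. LINT m|M. k (x - c m)) = (LINT x|lborel. k x)"
proof -
  interpret M: prob_space M by fact
  interpret P: pair_sigma_finite M "lborel :: complex measure" ..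
  have [measurable]: "k \<in> borel_measurable borel" using k by auto
  have "(LINT x|lborel. norm (k (x - c m))) = (LINT x|lborel. norm (k x))" for m
    by (rule integral_complex_translate) measurable
  then have i: "integrable (M \<Otimes>\<^sub>M lborel) (\<lambda>(m, x). k (x - c m))"
    by (intro P.Fubini_integrable) (auto simp: split_beta intro: integrable_complex_translate[OF k])
  show "integrable lborel (\<lambda>x. LINT m|M. k (x - c m))" by (rule P.integrable_snd[OF i])
  have "(LINT x|lborel. k (x - c m)) = (LINT x|lborel. k x)" for m
    by (rule integral_complex_translate) measurable
  then show "(LINT x|lborel. LINT m|M. k (x - c m)) = (LINT x|lborel. k x)"
    using P.Fubini_integral[OF i] by (simp add: M.prob_space)
qed

text \<open>Pointwise this is the log-sum inequality, i.e. the tangent line bound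
  \<open>f ln (f / g) \<ge> f ln t + f - t g\<close> averaged over the shifts with \<open>t = f' / g'\<close>.\<close>

lemma relative_entropy_conv_le:
  fixes f g :: "complex \<Rightarrow> real"
  assumes M: "prob_space M" and c[measurable]: "c \<in> borel_measurable M"
    and [measurable]: "f \<in> borel_measurable borel" "g \<in> borel_measurable borel"
    and pos: "\<And>x. f x > 0" "\<And>x. g x > 0" and bdd: "\<And>x. f x \<le> B" "\<And>x. g x \<le> B"
    and k: "integrable lborel (\<lambda>x. f x * (ln (f x) - ln (g x)))" "\<And>x. \<bar>f x * (ln (f x) - ln (g x))\<bar> \<le> B"
    and f': "\<And>x. f' x = (LINT m|M. f (x - c m))" and g': "\<And>x. g' x = (LINT m|M. g (x - c m))"
    and pos': "\<And>x. f' x > 0" "\<And>x. g' x > 0"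
    and k': "integrable lborel (\<lambda>x. f' x * (ln (f' x) - ln (g' x)))"
  shows "(LINT x|lborel. f' x * (ln (f' x) - ln (g' x))) \<le> (LINT x|lborel. f x * (ln (f x) - ln (g x)))"
proof -
  interpret M: prob_space M by fact
  define k where "k = (\<lambda>x. f x * (ln (f x) - ln (g x)))"
  have [measurable]: "k \<in> borel_measurable borel" unfolding k_def by measurable
  have int: "integrable M (\<lambda>m. f (x - c m))" "integrable M (\<lambda>m. g (x - c m))" "integrable M (\<lambda>m. k (x - c m))" for x
    using bdd k pos by (auto intro!: M.integrable_const_bound[where B=B] simp: less_imp_le k_def)
  have pw: "f' x * (ln (f' x) - ln (g' x)) \<le> (LINT m|M. k (x - c m))" for x
  proof -
    define t where "t = f' x / g' x"
    have t: "t > 0" "t * g' x = f' x" using pos'[of x] by (auto simp: t_def)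
    have lt: "ln t = ln (f' x) - ln (g' x)" using pos'[of x] by (simp add: t_def ln_div)
    have tan: "f y * ln t + f y - t * g y \<le> k y" for y
    proof -
      have "ln (t * g y / f y) \<le> t * g y / f y - 1" using t(1) pos[of y] by (intro ln_le_minus_one) simp
      moreover have "ln (t * g y / f y) = ln t + ln (g y) - ln (f y)" using t(1) pos[of y] by (simp add: ln_mult ln_div)
      ultimately have "f y * (ln t + ln (g y) - ln (f y)) \<le> f y * (t * g y / f y - 1)"
        using pos[of y] by (simp add: mult_left_mono)
      also have "\<dots> = t * g y - f y" using pos(1)[of y] by (simp add: field_simps)
      finally show ?thesis unfolding k_def by (simp add: algebra_simps)
    qed
    have "f' x * ln t = (LINT m|M. f (x - c m) * ln t + f (x - c m) - t * g (x - c m))"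
      using int t(2) by (simp add: f' g')
    also have "\<dots> \<le> (LINT m|M. k (x - c m))"
      using int tan by (intro integral_mono) auto
    finally show ?thesis by (simp add: lt)
  qed
  have ki: "integrable lborel k" using k(1) by (simp add: k_def)
  have "(LINT x|lborel. f' x * (ln (f' x) - ln (g' x))) \<le> (LINT x|lborel. LINT m|M. k (x - c m))"
    by (rule integral_mono[OF k' integral_conv(1)[OF M c ki]]) (rule pw)
  also have "\<dots> = (LINT x|lborel. k x)" by (rule integral_conv(2)[OF M c ki])
  finally show ?thesis by (simp add: k_def)
qed

lemma relent_integrable:
  assumes "fin_pmf A" "fin_pmf B" "r > 0" "s > 0" "t > 0"
  shows "integrable lborel (\<lambda>z. gsm r (measure_pmf A) z * (ln (gsm s (measure_pmf A) z) - ln (gsm t (measure_pmf B) z)))"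
  by (intro gsm_quad_growth(1) quad_growth_diff quad_growth_ln_gsm assms)

lemma gsm_conv_pmf:
  assumes "fin_pmf A" "fin_pmf C" 
  shows "gsm r (measure_pmf (A \<oplus> C)) x = measure_pmf.expectation C (\<lambda>c. gsm r (measure_pmf A) (x - c))"
  unfolding gsm_def using assms by (simp add: expectation_pconv algebra_simps)

lemma gauss_prob_space: "t > 0 \<Longrightarrow> prob_space (density lborel (gauss t))"
  by (rule prob_spaceI) (simp add: emeasure_density nn_integral_gauss)

lemma gsm_conv_gauss:
  assumes A: "fin_pmf A" and r: "r > 0" "t > 0" and s: "s = sqrt (r\<^sup>2 + t\<^sup>2)"
  shows "gsm s (measure_pmf A) x = (LINT c|density lborel (gauss t). gsm r (measure_pmf A) (x - c))"
proof -
  have "(LINT c|density lborel (gauss t). gsm r (measure_pmf A) (x - c))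
     = (LINT c|lborel. gauss t c * gsm r (measure_pmf A) (x - c))"
    by (subst integral_density) (auto simp: gauss_nonneg)
  also have "\<dots> = (LINT c|lborel. (\<Sum>a\<in>set_pmf A. pmf A a * (gauss r ((x - a) - c) * gauss t c)))"
    unfolding gsm_def using A by (simp add: expectation_fin sum_distrib_left mult_ac algebra_simps)
  also have "\<dots> = (\<Sum>a\<in>set_pmf A. pmf A a * gauss s (x - a))"
    unfolding s using gauss_conv[OF r] by (subst Bochner_Integration.integral_sum) auto
  finally show ?thesis unfolding gsm_def using A by (simp add: expectation_fin)
qed

lemma relent_conv_le:
  assumes "fin_pmf A" "fin_pmf B" "fin_pmf C" "r > 0"
  shows "relent r (A \<oplus> C) (B \<oplus> C) \<le> relent r A B"
proof -
  obtain b where b: "\<And>z. \<bar>gsm r (measure_pmf A) z * (ln (gsm r (measure_pmf A) z) - ln (gsm r (measure_pmf B) z))\<bar> \<le> b"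
    using gsm_quad_growth(2)[OF assms(1,4) quad_growth_diff[OF quad_growth_ln_gsm quad_growth_ln_gsm]] assms by blast
  show ?thesis unfolding relent_def
    by (rule relative_entropy_conv_le[where c="\<lambda>x. x" and M="measure_pmf C" and B="max b (1 / (2 * pi * r\<^sup>2))"])
       (use assms in \<open>auto intro!: gsm_pos gsm_conv_pmf relent_integrable prob_space_measure_pmf le_max_iff_disj[THEN iffD2] b gsm_pmf_le\<close>)
qed

text \<open>The Gaussian of width \<open>s\<close> is the one of width \<open>r\<close> convolved
  with one of width \<open>t\<close>, so coarsening the scale is a convolution and
  \<open>relative_entropy_conv_le\<close> applies with a Gaussian shift.\<close>

lemma relent_scale_le:
  assumes "fin_pmf A" "fin_pmf B" "0 < r" "r \<le> s"
  shows "relent s A B \<le> relent r A B"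
proof (cases "r = s")
  case False
  define t where "t = sqrt (s\<^sup>2 - r\<^sup>2)"
  have "r\<^sup>2 < s\<^sup>2" using False assms by (intro power_strict_mono) auto
  then have t: "t > 0" "s = sqrt (r\<^sup>2 + t\<^sup>2)" using assms by (auto simp: t_def)
  obtain b where b: "\<And>z. \<bar>gsm r (measure_pmf A) z * (ln (gsm r (measure_pmf A) z) - ln (gsm r (measure_pmf B) z))\<bar> \<le> b"
    using gsm_quad_growth(2)[OF assms(1,3) quad_growth_diff[OF quad_growth_ln_gsm quad_growth_ln_gsm]] assms by blast
  have s: "s > 0" using assms by simp
  show ?thesis unfolding relent_def
    by (rule relative_entropy_conv_le[where c="\<lambda>x. x" and M="density lborel (gauss t)" and B="max b (1 / (2 * pi * r\<^sup>2))"])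
       (use assms t s in \<open>auto intro!: gsm_pos gsm_conv_gauss relent_integrable gauss_prob_space le_max_iff_disj[THEN iffD2] b gsm_pmf_le\<close>)
qed simp

lemma relent_nonneg:
  assumes "fin_pmf A" "fin_pmf B" "r > 0"
  shows "relent r A B \<ge> 0"
proof -
  have "(LINT z|lborel. gsm r (measure_pmf A) z - gsm r (measure_pmf B) z) \<le> relent r A B"
    unfolding relent_def
  proof (rule integral_mono)
    show "gsm r (measure_pmf A) z - gsm r (measure_pmf B) z
      \<le> gsm r (measure_pmf A) z * (ln (gsm r (measure_pmf A) z) - ln (gsm r (measure_pmf B) z))" for z
    proof -
      define f g where "f = gsm r (measure_pmf A) z" and "g = gsm r (measure_pmf B) z"
      have "f > 0" "g > 0" using assms by (auto simp: f_def g_def intro: gsm_pos)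
      then have "f * ln (g / f) \<le> f * (g / f - 1)" by (intro mult_left_mono ln_le_minus_one) auto
      then have "f - g \<le> f * (ln f - ln g)" using \<open>f > 0\<close> \<open>g > 0\<close> by (simp add: ln_div algebra_simps)
      then show ?thesis by (simp add: f_def g_def)
    qed
  qed (use assms in \<open>auto intro!: integrable_gsm relent_integrable\<close>)
  then show ?thesis using assms by (simp add: integrable_gsm integral_gsm)
qed

lemma gsm_bind:
  assumes "fin_pmf Z" "\<And>z. z \<in> set_pmf Z \<Longrightarrow> fin_pmf (Y z)"
  shows "gsm r (measure_pmf (bind_pmf Z Y)) x = measure_pmf.expectation Z (\<lambda>z. gsm r (measure_pmf (Y z)) x)"
  unfolding gsm_def using assms by (simp add: expectation_bind_fin)

lemma fin_bind_pmf[intro]: "fin_pmf Z \<Longrightarrow> (\<And>z. z \<in> set_pmf Z \<Longrightarrow> fin_pmf (Y z)) \<Longrightarrow> fin_pmf (bind_pmf Z Y)"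
  by simp

lemma cross_entropy_mix:
  assumes Z: "fin_pmf Z" and Y: "\<And>z. z \<in> set_pmf Z \<Longrightarrow> fin_pmf (Y z)" and B: "fin_pmf B" and r: "r > 0" "s > 0"
  shows "(LINT x|lborel. gsm r (measure_pmf (bind_pmf Z Y)) x * ln (gsm s (measure_pmf B) x))
    = measure_pmf.expectation Z (\<lambda>z. LINT x|lborel. gsm r (measure_pmf (Y z)) x * ln (gsm s (measure_pmf B) x))"
  using Z Y gsm_quad_growth(1)[OF _ r(1) quad_growth_ln_gsm[OF B r(2)]]
  by (simp add: gsm_bind expectation_fin sum_distrib_right mult.assoc)

lemma relent_eq:
  assumes "fin_pmf A" "fin_pmf B" "r > 0"
  shows "relent r A B = - ent r A - (LINT x|lborel. gsm r (measure_pmf A) x * ln (gsm r (measure_pmf B) x))"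
  unfolding relent_def ent_def using assms by (simp add: right_diff_distrib gsm_quad_growth quad_growth_ln_gsm)

lemma expectation_diff_fin:
  fixes f g :: "'a \<Rightarrow> real"
  shows "fin_pmf Z \<Longrightarrow> measure_pmf.expectation Z (\<lambda>z. f z - g z) = measure_pmf.expectation Z f - measure_pmf.expectation Z g"
  by (rule Bochner_Integration.integral_diff) (auto intro: integrable_fin_pmf)

lemma expectation_cong_pmf: "(\<And>z. z \<in> set_pmf Z \<Longrightarrow> f z = g z) \<Longrightarrow> measure_pmf.expectation Z f = measure_pmf.expectation Z g"
  by (rule integral_cong_AE) (auto simp: AE_measure_pmf_iff)

lemma expectation_relent:
  assumes Z: "fin_pmf Z" and Y: "\<And>z. z \<in> set_pmf Z \<Longrightarrow> fin_pmf (Y z)" and B: "fin_pmf B" and r: "r > 0"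
  shows "measure_pmf.expectation Z (\<lambda>z. relent r (Y z) B)
     = - measure_pmf.expectation Z (\<lambda>z. ent r (Y z)) - (LINT x|lborel. gsm r (measure_pmf (bind_pmf Z Y)) x * ln (gsm r (measure_pmf B) x))"
proof -
  have "measure_pmf.expectation Z (\<lambda>z. relent r (Y z) B) = measure_pmf.expectation Z (\<lambda>z. - ent r (Y z) - (LINT x|lborel. gsm r (measure_pmf (Y z)) x * ln (gsm r (measure_pmf B) x)))"
    by (rule expectation_cong_pmf) (rule relent_eq[OF Y B r])
  then show ?thesis using Z by (simp add: expectation_diff_fin cross_entropy_mix[OF Z Y B r r])
qed

text \<open>Chain rule: the second summand is the mutual information between \<open>Z\<close> and
  the smoothed observation.\<close>

lemma ent_bind:
  assumes Z: "fin_pmf Z" and Y: "\<And>z. z \<in> set_pmf Z \<Longrightarrow> fin_pmf (Y z)" and r: "r > 0"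
  shows "ent r (bind_pmf Z Y) = measure_pmf.expectation Z (\<lambda>z. ent r (Y z))
           + measure_pmf.expectation Z (\<lambda>z. relent r (Y z) (bind_pmf Z Y))"
  by (subst expectation_relent[OF Z Y fin_bind_pmf[OF Z Y] r]) (auto simp: ent_def)

text \<open>For an arbitrary reference \<open>B\<close> the right-hand side exceeds the left-hand
  side by exactly \<open>relent r (bind_pmf Z Y) B\<close>.\<close>

lemma ent_bind_le:
  assumes Z: "fin_pmf Z" and Y: "\<And>z. z \<in> set_pmf Z \<Longrightarrow> fin_pmf (Y z)" and B: "fin_pmf B" and r: "r > 0"
  shows "ent r (bind_pmf Z Y) \<le> measure_pmf.expectation Z (\<lambda>z. ent r (Y z))
           + measure_pmf.expectation Z (\<lambda>z. relent r (Y z) B)"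
proof -
  have f: "fin_pmf (bind_pmf Z Y)" using Z Y by (rule fin_bind_pmf)
  show ?thesis
    using relent_nonneg[OF f B r] relent_eq[OF f B r] expectation_relent[OF Z Y B r] by simp
qed

text \<open>Data processing: the information about \<open>Z\<close> carried by a noisy observation of \<open>Y\<close>
  decreases with the noise level.\<close>

lemma ent_bind_scale:
  assumes Z: "fin_pmf Z" and Y: "\<And>z. z \<in> set_pmf Z \<Longrightarrow> fin_pmf (Y z)" and r: "0 < r" "r \<le> s"
  shows "ent s (bind_pmf Z Y) - measure_pmf.expectation Z (\<lambda>z. ent s (Y z))
       \<le> ent r (bind_pmf Z Y) - measure_pmf.expectation Z (\<lambda>z. ent r (Y z))"
proof -
  have "measure_pmf.expectation Z (\<lambda>z. relent s (Y z) (bind_pmf Z Y)) \<le> measure_pmf.expectation Z (\<lambda>z. relent r (Y z) (bind_pmf Z Y))"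
    using Z Y r by (intro expectation_mono_pmf relent_scale_le fin_bind_pmf) auto
  then show ?thesis using ent_bind[of Z Y r, OF Z Y] ent_bind[of Z Y s, OF Z Y] r by simp
qed

lemma ent_translate:
  assumes "fin_pmf A" shows "ent r (map_pmf (\<lambda>a. a + b) A) = ent r A"
proof -
  have "gsm r (measure_pmf (map_pmf (\<lambda>a. a + b) A)) z = gsm r (measure_pmf A) (z - b)" for z
    by (simp add: gsm_def algebra_simps)
  then show ?thesis unfolding ent_def
    by (simp add: integral_complex_translate[of "\<lambda>z. gsm r (measure_pmf A) z * ln (gsm r (measure_pmf A) z)" b])
qed

definition pscale :: "complex \<Rightarrow> complex pmf \<Rightarrow> complex pmf" where
  "pscale c A = map_pmf ((*) c) A"

lemma fin_pscale[intro, simp]: "fin_pmf A \<Longrightarrow> fin_pmf (pscale c A)"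
  by (simp add: pscale_def)

lemma pscale_pconv: "pscale c (A \<oplus> B) = pscale c A \<oplus> pscale c B"
  by (simp add: pscale_def pconv_def map_bind_pmf bind_map_pmf pmf.map_comp comp_def distrib_left)

lemma pscale_pscale: "pscale c (pscale d A) = pscale (c * d) A"
  by (simp add: pscale_def pmf.map_comp comp_def mult.assoc cong: map_pmf_cong)

lemma pscale_1[simp]: "pscale 1 A = A"
proof -
  have "(*) (1::complex) = id" by auto
  then show ?thesis by (simp add: pscale_def pmf.map_id)
qed

lemma pscale_return[simp]: "pscale c (return_pmf x) = return_pmf (c * x)"
  by (simp add: pscale_def)

lemma gsm_pscale:
  assumes "r > 0" "c \<noteq> 0"
  shows "gsm (cmod c * r) (measure_pmf (pscale c A)) (c * z) = gsm r (measure_pmf A) z / (cmod c)\<^sup>2"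
  unfolding gsm_def pscale_def using gauss_mult[OF assms]
  by (simp add: right_diff_distrib[symmetric])

lemma ent_pscale:
  assumes A: "fin_pmf A" and r: "r > 0" and c: "c \<noteq> 0"
  shows "ent (cmod c * r) (pscale c A) = ent r A + 2 * ln (cmod c)"
proof -
  let ?f = "gsm (cmod c * r) (measure_pmf (pscale c A))"
  let ?g = "gsm r (measure_pmf A)"
  have "(LINT z|lborel. ?f z * ln (?f z)) = (cmod c)\<^sup>2 * (LINT z|lborel. ?f (c * z) * ln (?f (c * z)))"
    using integral_complex_mult[OF c, of "\<lambda>z. ?f z * ln (?f z)"] c by simp
  also have "\<dots> = (LINT z|lborel. ?g z * ln (?g z) - 2 * ln (cmod c) * ?g z)"
  proof -
    have "?f (c * z) * ln (?f (c * z)) = (?g z * ln (?g z) - 2 * ln (cmod c) * ?g z) / (cmod c)\<^sup>2" for z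
      using gsm_pos[OF A r, of z] c unfolding gsm_pscale[OF r c] by (simp add: ln_div ln_realpow field_simps)
    then show ?thesis using c by simp
  qed
  also have "\<dots> = (LINT z|lborel. ?g z * ln (?g z)) - 2 * ln (cmod c)"
    using A r by (simp add: gsm_quad_growth quad_growth_ln_gsm integrable_gsm integral_gsm)
  finally show ?thesis unfolding ent_def by simp
qed

text \<open>By \<open>gain_eq\<close> this is the mutual information between \<open>B\<close> and
  the smoothed sum, hence nonnegative and subject to data processing.\<close>

definition gain :: "real \<Rightarrow> complex pmf \<Rightarrow> complex pmf \<Rightarrow> real" where
  "gain r A B = ent r (A \<oplus> B) - ent r A"

lemma gain_eq:
  assumes "fin_pmf A" "fin_pmf B" "r > 0"
  shows "gain r A B = measure_pmf.expectation B (\<lambda>b. relent r (map_pmf (\<lambda>a. a + b) A) (A \<oplus> B))"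
  unfolding gain_def pconv_def using assms by (subst ent_bind) (auto simp: ent_translate)

lemma gain_nonneg: "fin_pmf A \<Longrightarrow> fin_pmf B \<Longrightarrow> r > 0 \<Longrightarrow> gain r A B \<ge> 0"
proof -
  assume *: "fin_pmf A" "fin_pmf B" "r > 0"
  then have "measure_pmf.expectation B (\<lambda>_. 0) \<le> gain r A B"
    unfolding gain_eq[OF *] by (intro expectation_mono_pmf relent_nonneg) auto
  then show ?thesis by simp
qed

text \<open>Submodularity of entropy: a further independent summand \<open>C\<close> can only hide
  information about \<open>B\<close>.\<close>

lemma gain_conv_le:
  assumes "fin_pmf A" "fin_pmf B" "fin_pmf C" "r > 0"
  shows "gain r (A \<oplus> C) B \<le> gain r A B"
proof -
  have "map_pmf (\<lambda>a. a + b) (A \<oplus> C) = map_pmf (\<lambda>a. a + b) A \<oplus> C" for b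
    unfolding pconv_return_right[symmetric] by (metis pconv_assoc pconv_commute)
  moreover have "(A \<oplus> C) \<oplus> B = (A \<oplus> B) \<oplus> C" by (metis pconv_assoc pconv_commute)
  ultimately show ?thesis
    using assms by (subst (1 2) gain_eq) (auto intro!: expectation_mono_pmf relent_conv_le)
qed

lemma gain_scale_le:
  assumes "fin_pmf A" "fin_pmf B" "0 < r" "r \<le> s"
  shows "gain s A B \<le> gain r A B"
  using assms by (subst (1 2) gain_eq) (auto intro!: expectation_mono_pmf relent_scale_le)

lemma gain_pscale:
  assumes "fin_pmf A" "fin_pmf B" "r > 0" "c \<noteq> 0"
  shows "gain (cmod c * r) (pscale c A) (pscale c B) = gain r A B"
  unfolding gain_def pscale_pconv[symmetric] using assms by (simp add: ent_pscale)

lemma gain_add: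
  assumes "fin_pmf A" "fin_pmf B" "fin_pmf C" "r > 0"
  shows "gain r A (B \<oplus> C) \<le> gain r A B + gain r A C"
  using gain_conv_le[of A C B r] assms by (simp add: gain_def pconv_assoc)

lemma gauss_odd_moment: "r > 0 \<Longrightarrow> (LINT z|lborel. gauss r z * (z \<bullet> w)) = 0"
proof -
  have "(LINT z|lborel. gauss r z * (z \<bullet> w)) = (LINT z|lborel. gauss r ((-1) * z) * (((-1) * z) \<bullet> w))"
    by (subst integral_complex_mult) auto
  also have "\<dots> = - (LINT z|lborel. gauss r z * (z \<bullet> w))" by simp
  finally show ?thesis by simp
qed

lemma relent_return:
  assumes r: "r > 0"
  shows "relent r (return_pmf b) (return_pmf c) = (cmod (b - c))\<^sup>2 / (2 * r\<^sup>2)"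
proof -
  define w where "w = b - c"
  have g: "gsm r (measure_pmf (return_pmf x)) z = gauss r (z - x)" for x z by (simp add: gsm_def)
  have "ln (gauss r (z - b)) - ln (gauss r (z - c)) = ((cmod (z - c))\<^sup>2 - (cmod (z - b))\<^sup>2) / (2 * r\<^sup>2)" for z
    using r by (simp add: gauss_eq ln_div diff_divide_distrib)
  moreover have "(cmod (z - c))\<^sup>2 - (cmod (z - b))\<^sup>2 = (cmod w)\<^sup>2 + 2 * ((z - b) \<bullet> w)" for z
    unfolding w_def power2_norm_eq_inner by (simp add: inner_diff inner_commute algebra_simps)
  ultimately have "relent r (return_pmf b) (return_pmf c)
      = (LINT z|lborel. gauss r (z - b) * (((cmod w)\<^sup>2 + 2 * ((z - b) \<bullet> w)) / (2 * r\<^sup>2)))"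
    unfolding relent_def g by simp
  also have "\<dots> = (LINT z|lborel. gauss r z * (((cmod w)\<^sup>2 + 2 * (z \<bullet> w)) / (2 * r\<^sup>2)))"
    by (rule integral_complex_translate[of "\<lambda>z. gauss r z * (((cmod w)\<^sup>2 + 2 * (z \<bullet> w)) / (2 * r\<^sup>2))"]) measurable
  also have "\<dots> = (LINT z|lborel. (cmod w)\<^sup>2 / (2 * r\<^sup>2) * gauss r z + 1 / r\<^sup>2 * (gauss r z * (z \<bullet> w)))"
    using r by (intro Bochner_Integration.integral_cong) (auto simp: field_simps)
  also have "\<dots> = (cmod w)\<^sup>2 / (2 * r\<^sup>2)"
  proof -
    have "quad_growth (\<lambda>z. z \<bullet> w)" unfolding quad_growth_def
    proof (intro conjI exI allI)
      show "\<bar>z \<bullet> w\<bar> \<le> cmod w * (1 + (cmod z)\<^sup>2)" for z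
      proof -
        have "cmod z \<le> 1 + (cmod z)\<^sup>2" using sum_squares_bound[of 1 "cmod z"] norm_ge_zero[of z] unfolding one_power2 by linarith
        then have "cmod z * cmod w \<le> cmod w * (1 + (cmod z)\<^sup>2)" by (subst mult.commute) (rule mult_left_mono, auto)
        then show ?thesis using Cauchy_Schwarz_ineq2[of z w] by linarith
      qed
    qed measurable
    from gsm_quad_growth(1)[OF _ r this, of "return_pmf 0"]
    have "integrable lborel (\<lambda>z. gauss r z * (z \<bullet> w))" by (simp add: gsm_def)
    then show ?thesis using r by (simp add: integrable_gauss integral_gauss gauss_odd_moment)
  qed
  finally show ?thesis by (simp add: w_def)
qed

text \<open>Submodularity replaces \<open>A\<close> by a point mass. Taking a Gaussian centred at
  \<open>c\<close> as reference in \<open>ent_bind_le\<close>, the divergence of two Gaussians of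
  equal width is quadratic in the distance of their centres.\<close>

lemma gain_le_variance:
  assumes A: "fin_pmf A" and B: "fin_pmf B" and r: "r > 0"
  shows "gain r A B \<le> measure_pmf.expectation B (\<lambda>b. (cmod (b - c))\<^sup>2) / (2 * r\<^sup>2)"
proof -
  have "gain r A B \<le> gain r (return_pmf 0) B"
    using gain_conv_le[of "return_pmf 0" B A r] assms by simp
  also have "\<dots> = ent r (bind_pmf B return_pmf) - ent r (return_pmf 0)" by (simp add: gain_def bind_return_pmf')
  also have "\<dots> \<le> measure_pmf.expectation B (\<lambda>b. relent r (return_pmf b) (return_pmf c))"
  proof -
    have "ent r (return_pmf b) = ent r (return_pmf 0)" for b using ent_translate[of "return_pmf 0" r b] by simp
    then have "measure_pmf.expectation B (\<lambda>b. ent r (return_pmf b)) = measure_pmf.expectation B (\<lambda>b. ent r (return_pmf 0))"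
      by (intro expectation_cong_pmf)
    then show ?thesis using ent_bind_le[OF B, of return_pmf "return_pmf c" r] r by simp
  qed
  also have "\<dots> = measure_pmf.expectation B (\<lambda>b. (cmod (b - c))\<^sup>2) / (2 * r\<^sup>2)"
    using r by (simp add: relent_return)
  finally show ?thesis .
qed

text \<open>Entropy dominates collision entropy; pointwise this is \<open>ln x \<le> x - 1\<close>
  for \<open>x\<close> the smoothed density divided by \<open>K\<close>. It reduces lower bounds on
  entropy to Plancherel.\<close>

lemma ent_ge_collision:
  assumes A: "fin_pmf A" and r: "r > 0" and K: "(LINT z|lborel. (gsm r (measure_pmf A) z)\<^sup>2) \<le> K" "K > 0"
  shows "ent r A \<ge> - ln K"
proof -
  let ?f = "gsm r (measure_pmf A)"
  have i: "integrable lborel (\<lambda>z. (?f z)\<^sup>2)"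
    using gauss_parseval(1)[OF pmf.complex_finite_measure_axioms pmf.complex_finite_measure_axioms r] by (simp add: power2_eq_square)
  have "(LINT z|lborel. ?f z * ln (?f z)) \<le> (LINT z|lborel. (?f z)\<^sup>2 / K + (ln K - 1) * ?f z)"
  proof (rule integral_mono)
    fix z
    have f: "?f z > 0" using gsm_pos[OF A r] .
    have "?f z * ln (?f z / K) \<le> ?f z * (?f z / K - 1)" using f K by (intro mult_left_mono ln_le_minus_one) auto
    then show "?f z * ln (?f z) \<le> (?f z)\<^sup>2 / K + (ln K - 1) * ?f z"
      using f K by (simp add: ln_div power2_eq_square algebra_simps)
  qed (use A r i in \<open>auto intro!: gsm_quad_growth quad_growth_ln_gsm integrable_gsm\<close>)
  also have "\<dots> = (LINT z|lborel. (?f z)\<^sup>2) / K + (ln K - 1)"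
    using A r i by (simp add: integrable_gsm integral_gsm)
  also have "\<dots> \<le> ln K" using K by (simp add: divide_le_eq)
  finally show ?thesis by (simp add: ent_def)
qed

section \<open>Growth of entropy under convolution\<close>

lemma cf_pmf: "fin_pmf A \<Longrightarrow> cf (measure_pmf A) \<xi> = (\<Sum>x\<in>set_pmf A. of_real (pmf A x) * cis (\<xi> \<bullet> x))"
  unfolding cf_def by (subst expectation_fin) (auto simp: scaleR_conv_of_real)

lemma cf_return[simp]: "cf (measure_pmf (return_pmf 0)) \<xi> = 1"
  by (simp add: cf_def)

lemma cf_pconv:
  assumes "fin_pmf A" "fin_pmf B"
  shows "cf (measure_pmf (A \<oplus> B)) \<xi> = cf (measure_pmf A) \<xi> * cf (measure_pmf B) \<xi>"
proof -
  have "cf (measure_pmf (A \<oplus> B)) \<xi> = (\<Sum>b\<in>set_pmf B. pmf B b *\<^sub>R measure_pmf.expectation (map_pmf (\<lambda>a. a + b) A) (\<lambda>x. cis (\<xi> \<bullet> x)))"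
    unfolding cf_def pconv_def using assms by (subst pmf_expectation_bind[OF assms(2)]) auto
  also have "\<dots> = (\<Sum>b\<in>set_pmf B. of_real (pmf B b) * (cis (\<xi> \<bullet> b) * cf (measure_pmf A) \<xi>))"
    using assms unfolding cf_def by (simp add: inner_add_right cis_mult[symmetric] scaleR_conv_of_real mult.commute)
  also have "\<dots> = cf (measure_pmf A) \<xi> * cf (measure_pmf B) \<xi>"
    by (simp add: cf_pmf[OF assms(2)] sum_distrib_left mult_ac)
  finally show ?thesis .
qed

lemma inner_complex_mult: "\<xi> \<bullet> (c * x) = (cnj c * \<xi>) \<bullet> (x::complex)"
  by (simp add: inner_complex_def algebra_simps)

lemma cf_pscale: "cf (measure_pmf (pscale c A)) \<xi> = cf (measure_pmf A) (cnj c * \<xi>)"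
  by (simp add: cf_def pscale_def inner_complex_mult)

lemma cf_pmf_norm_le: "cmod (cf (measure_pmf A) \<xi>) \<le> 1"
  unfolding cf_def by (rule order_trans[OF integral_norm_bound])
    (auto intro!: measure_pmf.integral_le_const pmf.integrable_bounded[where B=1])

text \<open>Twice the variance. The form with two independent samples names no centre and matches
  the cosine formula \<open>cf_norm_square\<close>.\<close>

definition spread :: "complex pmf \<Rightarrow> real" where
  "spread A = measure_pmf.expectation A (\<lambda>x. measure_pmf.expectation A (\<lambda>y. (cmod (x - y))\<^sup>2))"

lemma spread_nonneg: "spread A \<ge> 0"
  by (simp add: spread_def)

lemma spread_pscale: "spread (pscale c A) = (cmod c)\<^sup>2 * spread A"
  by (simp add: spread_def pscale_def norm_mult power_mult_distrib flip: right_diff_distrib)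

lemma spread_le:
  assumes "fin_pmf A" "\<And>x y. x \<in> set_pmf A \<Longrightarrow> y \<in> set_pmf A \<Longrightarrow> cmod (x - y) \<le> r" 
  shows "spread A \<le> r\<^sup>2"
proof -
  have "spread A \<le> measure_pmf.expectation A (\<lambda>x. measure_pmf.expectation A (\<lambda>y. r\<^sup>2))"
    unfolding spread_def using assms by (intro expectation_mono_pmf power_mono) auto
  then show ?thesis by simp
qed

lemma spread_center:
  assumes A: "fin_pmf A"
  obtains c where "c \<in> set_pmf A" "measure_pmf.expectation A (\<lambda>x. (cmod (x - c))\<^sup>2) \<le> spread A"
proof -
  define g where "g x = measure_pmf.expectation A (\<lambda>y. (cmod (x - y))\<^sup>2)" for x
  have "\<exists>c\<in>set_pmf A. g c \<le> spread A"
  proof (rule ccontr)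
    assume "\<not> ?thesis"
    then have "g c > spread A" if "c \<in> set_pmf A" for c using that by auto
    then have "(\<Sum>x\<in>set_pmf A. pmf A x * spread A) < (\<Sum>x\<in>set_pmf A. pmf A x * g x)"
      using A set_pmf_not_empty by (intro sum_strict_mono) (auto simp: pmf_positive)
    also have "\<dots> = spread A" unfolding spread_def g_def[symmetric] using A by (simp add: expectation_fin)
    finally show False using sum_pmf_eq_1[OF A order_refl] by (simp flip: sum_distrib_right)
  qed
  then show ?thesis using that by (auto simp: g_def norm_minus_commute)
qed

lemma cos_le_quadratic:
  assumes "\<bar>t\<bar> \<le> (1::real)" shows "cos t \<le> 1 - t\<^sup>2 / 3"
proof -
  obtain u where u: "cos t = (\<Sum>m<4. cos_coeff m * t ^ m) + cos (u + 1 / 2 * real 4 * pi) / fact 4 * t ^ 4"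
    using Maclaurin_cos_expansion[of t 4] by blast
  have "cos (u + 1 / 2 * real 4 * pi) / fact 4 * t ^ 4 \<le> 1 / fact 4 * t ^ 4"
    by (intro mult_right_mono divide_right_mono) auto
  also have "t ^ 4 \<le> t ^ 2 * 1"
    using assms mult_left_mono[of "t\<^sup>2" 1 "t\<^sup>2"] by (simp add: abs_square_le_1 flip: power_add)
  finally have "cos (u + 1 / 2 * real 4 * pi) / fact 4 * t ^ 4 \<le> t\<^sup>2 / 24"
    by (simp add: fact_numeral)
  moreover have "(\<Sum>m<4. cos_coeff m * t ^ m) = 1 - t\<^sup>2 / 2"
    by (simp add: lessThan_nat_numeral cos_coeff_def fact_numeral)
  ultimately show ?thesis using u zero_le_power2[of t] by linarith
qed

text \<open>For non-real \<open>c\<close> the two directions \<open>\<zeta>\<close> and \<open>cnj c * \<zeta>\<close> span the plane, so together they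
  detect every displacement.\<close>

lemma two_directions:
  assumes c: "cmod c \<le> 1"
  shows "(\<zeta> \<bullet> w)\<^sup>2 + ((cnj c * \<zeta>) \<bullet> w)\<^sup>2 \<ge> (Im c)\<^sup>2 / 4 * (cmod \<zeta>)\<^sup>2 * (cmod w)\<^sup>2"
proof -
  \<comment> \<open>Multiplying by \<open>cnj \<zeta>\<close> turns the two inner products into
    \<open>Re v\<close> and \<open>Re (c * v)\<close>, which together determine \<open>v\<close>
    when \<open>Im c\<close> is non-zero.\<close>
  define v where "v = cnj \<zeta> * w"
  have 1: "\<zeta> \<bullet> w = Re v" by (simp add: v_def inner_complex_def)
  have 2: "(cnj c * \<zeta>) \<bullet> w = Re c * Re v - Im c * Im v" by (simp add: v_def inner_complex_def algebra_simps)
  define p q where "p = Re v" and "q = Re c * Re v - Im c * Im v"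
  have cc: "(Re c)\<^sup>2 \<le> 1" "(Im c)\<^sup>2 \<le> 1" 
    using c abs_Re_le_cmod[of c] abs_Im_le_cmod[of c] by (simp_all add: abs_square_le_1)
  have "(Im c * Im v)\<^sup>2 = (Re c * p - q)\<^sup>2" by (simp add: p_def q_def)
  also have "\<dots> \<le> 2 * (Re c * p)\<^sup>2 + 2 * q\<^sup>2"
    using sum_squares_bound[of "Re c * p" "- q"] by (simp add: power2_diff)
  also have "(Re c * p)\<^sup>2 \<le> p\<^sup>2" using cc(1) mult_right_mono[of "(Re c)\<^sup>2" 1 "p\<^sup>2"] by (simp add: power_mult_distrib)
  finally have "(Im c)\<^sup>2 * (Im v)\<^sup>2 \<le> 2 * p\<^sup>2 + 2 * q\<^sup>2" by (simp add: power_mult_distrib)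
  moreover have "(Im c)\<^sup>2 * (Re v)\<^sup>2 \<le> p\<^sup>2" using cc(2) mult_right_mono[of "(Im c)\<^sup>2" 1 "p\<^sup>2"] by (simp add: p_def)
  moreover have "(cmod \<zeta>)\<^sup>2 * (cmod w)\<^sup>2 = (Re v)\<^sup>2 + (Im v)\<^sup>2"
  proof -
    have "(cmod \<zeta>)\<^sup>2 * (cmod w)\<^sup>2 = (cmod v)\<^sup>2" by (simp add: v_def norm_mult power_mult_distrib)
    then show ?thesis by (simp only: cmod_power2[of v])
  qed
  moreover from this have "(Im c)\<^sup>2 * ((cmod \<zeta>)\<^sup>2 * (cmod w)\<^sup>2) = (Im c)\<^sup>2 * (Re v)\<^sup>2 + (Im c)\<^sup>2 * (Im v)\<^sup>2"
    by (simp add: distrib_left)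
  ultimately have "(Im c)\<^sup>2 * ((cmod \<zeta>)\<^sup>2 * (cmod w)\<^sup>2) \<le> 4 * (p\<^sup>2 + q\<^sup>2)"
    using zero_le_power2[of p] zero_le_power2[of q] unfolding distrib_left by linarith
  then show ?thesis unfolding 1 2 by (simp add: p_def q_def mult.assoc)
qed

lemma cf_norm_square:
  assumes A: "fin_pmf A"
  shows "(cmod (cf (measure_pmf A) \<xi>))\<^sup>2 = measure_pmf.expectation A (\<lambda>x. measure_pmf.expectation A (\<lambda>y. cos (\<xi> \<bullet> (x - y))))"
proof -
  let ?c = "\<lambda>x. cos (\<xi> \<bullet> x)" and ?s = "\<lambda>x. sin (\<xi> \<bullet> x)"
  let ?E = "measure_pmf.expectation A"
  have re: "Re (cf (measure_pmf A) \<xi>) = ?E ?c" "Im (cf (measure_pmf A) \<xi>) = ?E ?s"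
    using A by (simp_all add: cf_pmf expectation_fin)
  have "?E (\<lambda>x. ?E (\<lambda>y. cos (\<xi> \<bullet> (x - y)))) = ?E (\<lambda>x. ?c x * ?E ?c + ?s x * ?E ?s)"
    using A by (simp add: inner_diff_right cos_diff expectation_fin sum.distrib sum_distrib_left distrib_left mult_ac)
  also have "\<dots> = (?E ?c)\<^sup>2 + (?E ?s)\<^sup>2"
    using A by (simp add: integrable_fin_pmf power2_eq_square)
  finally show ?thesis by (simp add: cmod_power2 re)
qed

text \<open>A single frequency misses a law supported on a line orthogonal to it; the pair of
  frequencies does not, by \<open>two_directions\<close>. The bounds on diameter and frequency keep
  all phases in \<open>[-1, 1]\<close>, where the cosine is at most
  \<open>1 - t ^ 2 / 3\<close>.\<close>

lemma cf_two_directions: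
  assumes A: "fin_pmf A" and diam: "\<And>x y. x \<in> set_pmf A \<Longrightarrow> y \<in> set_pmf A \<Longrightarrow> cmod (x - y) \<le> 1"
    and c: "cmod c \<le> 1" and z: "cmod \<zeta> \<le> 1"
  shows "(cmod (cf (measure_pmf A) \<zeta>))\<^sup>2 * (cmod (cf (measure_pmf A) (cnj c * \<zeta>)))\<^sup>2
     \<le> exp (- ((Im c)\<^sup>2 / 12 * (cmod \<zeta>)\<^sup>2 * spread A))"
proof -
  let ?E = "measure_pmf.expectation A"
  define q where "q \<xi> = ?E (\<lambda>x. ?E (\<lambda>y. (\<xi> \<bullet> (x - y))\<^sup>2))" for \<xi>
  have b: "(cmod (cf (measure_pmf A) \<xi>))\<^sup>2 \<le> exp (- (q \<xi> / 3))" if "cmod \<xi> \<le> 1" for \<xi>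
  proof -
    have "(cmod (cf (measure_pmf A) \<xi>))\<^sup>2 \<le> ?E (\<lambda>x. ?E (\<lambda>y. 1 - (\<xi> \<bullet> (x - y))\<^sup>2 / 3))"
      unfolding cf_norm_square[OF A]
    proof (intro expectation_mono_pmf A cos_le_quadratic)
      fix x y assume "x \<in> set_pmf A" "y \<in> set_pmf A"
      then have "\<bar>\<xi> \<bullet> (x - y)\<bar> \<le> cmod \<xi> * cmod (x - y)" by (intro Cauchy_Schwarz_ineq2)
      also have "\<dots> \<le> 1 * 1" using that diam \<open>x \<in> set_pmf A\<close> \<open>y \<in> set_pmf A\<close> by (intro mult_mono) auto
      finally show "\<bar>\<xi> \<bullet> (x - y)\<bar> \<le> 1" by simp
    qed
    also have "\<dots> = 1 - q \<xi> / 3" unfolding q_def using A by (simp add: integrable_fin_pmf)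
    also have "\<dots> \<le> exp (- (q \<xi> / 3))" using exp_ge_add_one_self[of "- (q \<xi> / 3)"] by simp
    finally show ?thesis .
  qed
  have cz: "cmod (cnj c * \<zeta>) \<le> 1" using mult_mono[OF c z] by (simp add: norm_mult)
  have "(Im c)\<^sup>2 / 4 * (cmod \<zeta>)\<^sup>2 * spread A = ?E (\<lambda>x. ?E (\<lambda>y. (Im c)\<^sup>2 / 4 * (cmod \<zeta>)\<^sup>2 * (cmod (x - y))\<^sup>2))"
    unfolding spread_def by simp
  also have "\<dots> \<le> ?E (\<lambda>x. ?E (\<lambda>y. (\<zeta> \<bullet> (x - y))\<^sup>2 + ((cnj c * \<zeta>) \<bullet> (x - y))\<^sup>2))"
    using A two_directions[OF c] by (intro expectation_mono_pmf) auto
  also have "\<dots> = q \<zeta> + q (cnj c * \<zeta>)" unfolding q_def using A by (simp add: integrable_fin_pmf)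
  finally have "exp (- (q \<zeta> / 3) + - (q (cnj c * \<zeta>) / 3)) \<le> exp (- ((Im c)\<^sup>2 / 12 * (cmod \<zeta>)\<^sup>2 * spread A))"
    by simp
  moreover have "(cmod (cf (measure_pmf A) \<zeta>))\<^sup>2 * (cmod (cf (measure_pmf A) (cnj c * \<zeta>)))\<^sup>2
     \<le> exp (- (q \<zeta> / 3)) * exp (- (q (cnj c * \<zeta>) / 3))"
    using b[OF z] b[OF cz] by (intro mult_mono) auto
  ultimately show ?thesis unfolding exp_add by linarith
qed

section \<open>Towers: sums of many rotated and rescaled copies of one law\<close>

primrec rep :: "nat \<Rightarrow> complex pmf \<Rightarrow> complex pmf" where
  "rep 0 A = return_pmf 0"
| "rep (Suc n) A = rep n A \<oplus> A"

lemma fin_rep[simp, intro]: "fin_pmf A \<Longrightarrow> fin_pmf (rep n A)"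
  by (induction n) auto

lemma cf_rep: "fin_pmf A \<Longrightarrow> cf (measure_pmf (rep n A)) \<xi> = cf (measure_pmf A) \<xi> ^ n"
  by (induction n) (auto simp: cf_pconv)

lemma gain_return[simp]: "gain r A (return_pmf 0) = 0"
  by (simp add: gain_def)

lemma gain_rep_le: "fin_pmf A \<Longrightarrow> fin_pmf B \<Longrightarrow> r > 0 \<Longrightarrow> gain r A (rep n B) \<le> real n * gain r A B"
proof (induction n)
  case (Suc n)
  then show ?case using gain_add[of A "rep n B" B r] by (simp add: distrib_right)
qed simp

primrec tower :: "complex \<Rightarrow> nat \<Rightarrow> nat \<Rightarrow> complex pmf \<Rightarrow> complex pmf" where
  "tower c 0 n A = return_pmf 0"
| "tower c (Suc J) n A = tower c J n A \<oplus> rep n (pscale (c ^ J) A)"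

lemma fin_tower[simp, intro]: "fin_pmf A \<Longrightarrow> fin_pmf (tower c J n A)"
  by (induction J) auto

lemma cf_tower:
  "fin_pmf A \<Longrightarrow> cf (measure_pmf (tower c J n A)) \<xi> = (\<Prod>j<J. cf (measure_pmf A) (cnj c ^ j * \<xi>)) ^ n"
  by (induction J) (auto simp: cf_pconv cf_rep cf_pscale power_mult_distrib)

lemma gain_tower_le:
  assumes "fin_pmf A" "fin_pmf B" "r > 0"
  shows "gain r A (tower c J n B) \<le> (\<Sum>j<J. real n * gain r A (pscale (c ^ j) B))"
proof (induction J)
  case (Suc J)
  have "gain r A (tower c (Suc J) n B) \<le> gain r A (tower c J n B) + gain r A (rep n (pscale (c ^ J) B))"
    using assms by (auto intro!: gain_add)
  also have "gain r A (rep n (pscale (c ^ J) B)) \<le> real n * gain r A (pscale (c ^ J) B)"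
    using assms by (intro gain_rep_le) auto
  finally show ?case using Suc.IH by simp
qed simp

lemma pscale_rep: "pscale d (rep n A) = rep n (pscale d A)"
  by (induction n) (auto simp: pscale_pconv)

lemma pscale_tower: "pscale d (tower c J n A) = tower c J n (pscale d A)"
  by (induction J) (auto simp: pscale_pconv pscale_rep pscale_pscale mult.commute)

lemma exp_neg_mult_le: "x \<ge> (0::real) \<Longrightarrow> x * exp (- x / 2) \<le> 1"
proof -
  assume "x \<ge> 0"
  then have "1 + x / 2 + (x / 2)\<^sup>2 / 2 \<le> exp (x / 2)" using exp_lower_Taylor_quadratic[of "x / 2"] by simp
  moreover have "x \<le> 1 + x / 2 + (x / 2)\<^sup>2 / 2"
    using zero_le_power2[of "x / 2 - 1"] by (simp add: power2_diff)
  ultimately have "x \<le> exp (x / 2)" by linarith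
  then show ?thesis by (simp add: exp_minus field_simps)
qed

text \<open>The collision integral is estimated on the Fourier side. Low frequencies contribute a
  constant, very high ones are damped by the smoothing, and in between the \<open>n\<close> copies
  at two consecutive levels push the squared transform below \<open>k ^ 2\<close>. The tower thus
  looks like a law of bounded density down to the scale \<open>k\<close>.\<close>

lemma ent_tower_nonneg:
  assumes A: "fin_pmf A" and diam: "\<And>x y. x \<in> set_pmf A \<Longrightarrow> y \<in> set_pmf A \<Longrightarrow> cmod (x - y) \<le> 1"
    and c: "0 < cmod c" "cmod c < 1"
    and n: "real n * ((Im c)\<^sup>2 * (cmod c)\<^sup>2 / 12 * spread A) \<ge> 2 * real K * - ln (cmod c)"
  shows "ent (cmod c ^ K) (tower c (2 * K + 2) n A) \<ge> 0"
proof -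
  define k where "k = cmod c ^ K"
  have k: "k > 0" "k \<le> 1" using c by (auto simp: k_def power_le_one)
  define T where "T = tower c (2 * K + 2) n A"
  have T: "fin_pmf T" using A by (simp add: T_def)
  let ?\<phi> = "\<lambda>\<xi>. (cmod (cf (measure_pmf T) \<xi>))\<^sup>2"
  let ?e = "\<lambda>a \<xi>. exp (- a\<^sup>2 * (cmod \<xi>)\<^sup>2)"
  have phi1: "?\<phi> \<xi> \<le> 1" for \<xi> using cf_pmf_norm_le[of T \<xi>] by (simp add: power_le_one)
  have mid: "?\<phi> \<xi> \<le> k\<^sup>2" if x: "1 \<le> cmod \<xi>" "cmod c ^ (2 * K) * cmod \<xi> \<le> 1" for \<xi>
  proof -
    \<comment> \<open>The first such \<open>j\<close> brings the frequency into the range from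
      \<open>|c|\<close> to 1. It is at most \<open>2 * K\<close>, so the levels \<open>j\<close>
      and \<open>j + 1\<close>, the only ones kept, are present among the \<open>2 * K + 2\<close>
      levels.\<close>
    define j where "j = (LEAST j. cmod c ^ j * cmod \<xi> \<le> 1)"
    have j: "cmod c ^ j * cmod \<xi> \<le> 1" "j \<le> 2 * K" unfolding j_def using x(2) by (rule LeastI, rule Least_le)
    have j2: "cmod c \<le> cmod c ^ j * cmod \<xi>"
    proof (cases j)
      case 0 then show ?thesis using x c by simp
    next
      case (Suc i)
      then have "\<not> (cmod c ^ i * cmod \<xi> \<le> 1)" using not_less_Least[of i "\<lambda>j. cmod c ^ j * cmod \<xi> \<le> 1"] by (simp add: j_def)
      then have "cmod c * 1 \<le> cmod c * (cmod c ^ i * cmod \<xi>)" using c by (intro mult_left_mono) auto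
      then show ?thesis by (simp add: Suc)
    qed
    define \<zeta> where "\<zeta> = cnj c ^ j * \<xi>"
    have z: "cmod \<zeta> \<le> 1" "cmod c \<le> cmod \<zeta>" using j j2 by (auto simp: \<zeta>_def norm_mult norm_power)
    let ?f = "\<lambda>j. (cmod (cf (measure_pmf A) (cnj c ^ j * \<xi>)))\<^sup>2"
    have f1: "?f i \<le> 1" for i using cf_pmf_norm_le[of A] by (simp add: power_le_one)
    have "(\<Prod>i<2 * K + 2. ?f i) = (\<Prod>i\<in>{j, Suc j}. ?f i) * (\<Prod>i\<in>{..<2 * K + 2} - {j, Suc j}. ?f i)"
      using j(2) by (intro prod.subset_diff[THEN trans, OF _ _ mult.commute]) auto
    also have "\<dots> \<le> (\<Prod>i\<in>{j, Suc j}. ?f i) * 1"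
      using f1 by (intro mult_left_mono prod_le_1 prod_nonneg) auto
    also have "\<dots> = (cmod (cf (measure_pmf A) \<zeta>))\<^sup>2 * (cmod (cf (measure_pmf A) (cnj c * \<zeta>)))\<^sup>2"
      by (simp add: \<zeta>_def mult_ac)
    also have "\<dots> \<le> exp (- ((Im c)\<^sup>2 / 12 * (cmod \<zeta>)\<^sup>2 * spread A))"
      using cf_two_directions[OF A diam _ z(1)] c by simp
    also have "\<dots> \<le> exp (- ((Im c)\<^sup>2 * (cmod c)\<^sup>2 / 12 * spread A))"
    proof -
      have "(cmod c)\<^sup>2 \<le> (cmod \<zeta>)\<^sup>2" using z by (intro power_mono) auto
      then have "(Im c)\<^sup>2 * (cmod c)\<^sup>2 \<le> (Im c)\<^sup>2 * (cmod \<zeta>)\<^sup>2" by (intro mult_left_mono) auto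
      from mult_right_mono[OF this spread_nonneg[of A]] show ?thesis by simp
    qed
    finally have *: "(\<Prod>i<2 * K + 2. ?f i) \<le> exp (- ((Im c)\<^sup>2 * (cmod c)\<^sup>2 / 12 * spread A))" .
    have "cmod (cf (measure_pmf T) \<xi>) = (\<Prod>i<2 * K + 2. cmod (cf (measure_pmf A) (cnj c ^ i * \<xi>))) ^ n"
      unfolding T_def cf_tower[OF A] norm_power by (simp only: prod_norm)
    then have "?\<phi> \<xi> = ((\<Prod>i<2 * K + 2. cmod (cf (measure_pmf A) (cnj c ^ i * \<xi>))) ^ 2) ^ n"
      by (simp only: power_mult[symmetric] mult.commute)
    then have "?\<phi> \<xi> = (\<Prod>i<2 * K + 2. ?f i) ^ n"
      by (simp only: prod_power_distrib)
    also have "\<dots> \<le> exp (- ((Im c)\<^sup>2 * (cmod c)\<^sup>2 / 12 * spread A)) ^ n"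
      by (intro power_mono * prod_nonneg) auto
    also have "\<dots> = exp (- (real n * ((Im c)\<^sup>2 * (cmod c)\<^sup>2 / 12 * spread A)))"
      by (simp add: exp_of_nat_mult[symmetric])
    also have "\<dots> \<le> exp (2 * real K * ln (cmod c))" using n by simp
    also have "exp (2 * real K * ln (cmod c)) = exp (real (2 * K) * ln (cmod c))" by simp
    also have "\<dots> = exp (ln (cmod c)) ^ (2 * K)" by (rule exp_of_nat_mult)
    also have "\<dots> = k\<^sup>2" using c by (simp add: k_def power_mult[symmetric] mult.commute)
    finally show ?thesis .
  qed
  \<comment> \<open>The first Gaussian covers \<open>|\<xi>| \<le> 1\<close>, the second the middle
    range, the third the tail, where half of the exponent is traded for the factor
    \<open>k ^ 2\<close>. Their integrals add up to \<open>6 * pi\<close>.\<close>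
  have pw: "?e k \<xi> * ?\<phi> \<xi> \<le> 3 * ?e 1 \<xi> + k\<^sup>2 * ?e k \<xi> + k\<^sup>2 * ?e (k / sqrt 2) \<xi>" for \<xi>
  proof -
    have nn: "0 \<le> 3 * ?e 1 \<xi>" "0 \<le> k\<^sup>2 * ?e k \<xi>" "0 \<le> k\<^sup>2 * ?e (k / sqrt 2) \<xi>" by simp_all
    consider "cmod \<xi> \<le> 1" | "1 \<le> cmod \<xi>" "cmod c ^ (2 * K) * cmod \<xi> \<le> 1" | "cmod c ^ (2 * K) * cmod \<xi> > 1" by linarith
    then show ?thesis
    proof cases
      case 1
      have "?e k \<xi> * ?\<phi> \<xi> \<le> 1 * 1" using phi1 by (intro mult_mono) auto
      moreover have "1 \<le> 3 * exp (- 1 :: real)" using exp_le by (simp add: exp_minus field_simps)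
      moreover have "3 * exp (- 1) \<le> 3 * ?e 1 \<xi>" using 1 by (simp add: power_le_one)
      ultimately show ?thesis using nn by linarith
    next
      case 2
      then have "?\<phi> \<xi> \<le> k\<^sup>2" by (rule mid)
      then have "?\<phi> \<xi> * ?e k \<xi> \<le> k\<^sup>2 * ?e k \<xi>" by (rule mult_right_mono) simp
      moreover have "?e k \<xi> * ?\<phi> \<xi> = ?\<phi> \<xi> * ?e k \<xi>" by (rule mult.commute)
      ultimately show ?thesis using nn by linarith
    next
      case 3
      have "k\<^sup>2 * cmod \<xi> > 1" using 3 by (simp add: k_def power_mult[symmetric] mult.commute)
      then have "1 \<le> (k\<^sup>2 * cmod \<xi>)\<^sup>2" by (simp add: one_le_power)
      then have kk: "1 / k\<^sup>2 \<le> k\<^sup>2 * (cmod \<xi>)\<^sup>2" using k by (simp add: divide_le_eq power_mult_distrib power2_eq_square mult_ac)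
      have 1: "?e k \<xi> * ?\<phi> \<xi> \<le> ?e k \<xi> * 1" using phi1 by (intro mult_left_mono) auto
      have 2: "?e k \<xi> = exp (- (k\<^sup>2 * (cmod \<xi>)\<^sup>2) / 2) * ?e (k / sqrt 2) \<xi>"
        by (simp add: mult_exp_exp power_divide)
      have "exp (- (k\<^sup>2 * (cmod \<xi>)\<^sup>2) / 2) \<le> exp (- (1 / k\<^sup>2) / 2)" using kk by simp
      also have "exp (- (1 / k\<^sup>2) / 2) \<le> k\<^sup>2"
        using exp_neg_mult_le[of "1 / k\<^sup>2"] k by (simp add: divide_le_eq)
      finally have "exp (- (k\<^sup>2 * (cmod \<xi>)\<^sup>2) / 2) * ?e (k / sqrt 2) \<xi> \<le> k\<^sup>2 * ?e (k / sqrt 2) \<xi>"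
        by (rule mult_right_mono) simp
      then have "?e k \<xi> * ?\<phi> \<xi> \<le> k\<^sup>2 * ?e (k / sqrt 2) \<xi>" using 1 2 by linarith
      then show ?thesis using nn by linarith
    qed
  qed
  have k2: "k / sqrt 2 > 0" using k by simp
  have col: "(LINT z|lborel. (gsm k (measure_pmf T) z)\<^sup>2) = (LINT \<xi>|lborel. ?e k \<xi> * ?\<phi> \<xi>) / (4 * pi\<^sup>2)"
    using gauss_parseval(3)[OF pmf.complex_finite_measure_axioms pmf.complex_finite_measure_axioms k(1), of T T]
    by (simp only: power2_eq_square[of "gsm _ _ _"] complex_norm_square[symmetric] Re_complex_of_real)
  have "(LINT \<xi>|lborel. ?e k \<xi> * ?\<phi> \<xi>) \<le> (LINT \<xi>|lborel. 3 * ?e 1 \<xi> + k\<^sup>2 * ?e k \<xi> + k\<^sup>2 * ?e (k / sqrt 2) \<xi>)"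
  proof (rule integral_mono)
    show "integrable lborel (\<lambda>\<xi>. ?e k \<xi> * ?\<phi> \<xi>)"
      using gauss_parseval(2)[OF pmf.complex_finite_measure_axioms pmf.complex_finite_measure_axioms k(1), of T T]
      by (simp only: complex_norm_square[symmetric] Re_complex_of_real)
    show "integrable lborel (\<lambda>\<xi>. 3 * ?e 1 \<xi> + k\<^sup>2 * ?e k \<xi> + k\<^sup>2 * ?e (k / sqrt 2) \<xi>)"
      using gauss_fourier_inversion(1)[of 1] gauss_fourier_inversion(1)[OF k(1)] gauss_fourier_inversion(1)[OF k2] by simp
  qed (rule pw)
  also have "\<dots> = 6 * pi"
  proof -
    have lin: "(LINT \<xi>|lborel. 3 * f \<xi> + a * g \<xi> + a * h \<xi>) = 3 * (LINT \<xi>|lborel. f \<xi>) + a * (LINT \<xi>|lborel. g \<xi>) + a * (LINT \<xi>|lborel. h \<xi>)"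
      if "integrable lborel f" "integrable lborel g" "integrable lborel h" for a and f g h :: "complex \<Rightarrow> real"
      using that by simp
    note g1 = gauss_fourier_inversion(1,2)[OF zero_less_one]
    note g2 = gauss_fourier_inversion(1,2)[OF k(1)]
    note g3 = gauss_fourier_inversion(1,2)[OF k2]
    have "(LINT \<xi>|lborel. 3 * ?e 1 \<xi> + k\<^sup>2 * ?e k \<xi> + k\<^sup>2 * ?e (k / sqrt 2) \<xi>)
       = 3 * (pi / 1\<^sup>2) + k\<^sup>2 * (pi / k\<^sup>2) + k\<^sup>2 * (pi / (k / sqrt 2)\<^sup>2)"
      unfolding lin[OF g1(1) g2(1) g3(1)] g1(2) g2(2) g3(2) ..
    also have "\<dots> = 6 * pi" using k by (simp add: power_divide)
    finally show ?thesis .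
  qed
  finally have "(LINT z|lborel. (gsm k (measure_pmf T) z)\<^sup>2) \<le> 6 * pi / (4 * pi\<^sup>2)"
    unfolding col by (rule divide_right_mono) simp
  also have "\<dots> \<le> 1" using pi_ge_two by (simp add: power2_eq_square divide_le_eq)
  finally have "- ln 1 \<le> ent k T" by (rule ent_ge_collision[OF T k(1)]) simp
  then show ?thesis by (simp add: k_def T_def)
qed


text \<open>A point mass has the value \<open>- 2 * ln q\<close>; values near 0 mean full dimension
  between the scales \<open>q * t\<close> and \<open>t\<close>. The deficit of the overview is a
  positive lower bound for this quantity.\<close>

definition edrop :: "real \<Rightarrow> real \<Rightarrow> complex pmf \<Rightarrow> real" where
  "edrop q t A = ent t A - ent (q * t) A"

lemma edrop_conv_le:
  assumes "fin_pmf A" "fin_pmf B" "0 < q" "q < 1" "t > 0"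
  shows "edrop q t (A \<oplus> B) \<le> edrop q t A"
  using gain_scale_le[OF assms(1,2), of "q * t" t] assms by (simp add: gain_def edrop_def)

lemma edrop_pscale:
  assumes "fin_pmf A" "c \<noteq> 0" "q > 0" "t > 0"
  shows "edrop q (cmod c * t) (pscale c A) = edrop q t A"
  using ent_pscale[OF assms(1) assms(4,2)] ent_pscale[OF assms(1) _ assms(2), of "q * t"] assms
  by (simp add: edrop_def mult_ac)

lemma ent_telescope:
  "ent t A - ent (q ^ m * t) A = (\<Sum>i<m. edrop q (q ^ i * t) A)"
  by (induction m) (auto simp: edrop_def mult_ac)

text \<open>The laws of the partial sums of a random series of independent blocks: the blocks after
  the first \<open>n\<close> form a copy of the sequence shrunk by \<open>lam ^ n\<close>.\<close>

locale selfsim_seq =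
  fixes lam :: complex and X :: "nat \<Rightarrow> complex pmf"
  assumes lam: "0 < cmod lam" "cmod lam < 1" "Im lam \<noteq> 0"
    and fin_X[simp, intro]: "fin_pmf (X n)"
    and X_0: "X 0 = return_pmf 0"
    and X_add: "X (n + m) = X n \<oplus> pscale (lam ^ n) (X m)"
begin

abbreviation "q \<equiv> cmod lam"

lemma lam0[simp]: "lam \<noteq> 0" using lam by auto

lemma edrop_mono: "t > 0 \<Longrightarrow> edrop q t (X (n + m)) \<le> edrop q t (X n)"
  unfolding X_add using lam by (intro edrop_conv_le) auto

text \<open>\<open>n\<close> more digits buy \<open>n\<close> finer scales without increasing the
  drop: the last \<open>m\<close> blocks are a rescaled \<open>X m\<close>, and the first
  \<open>n\<close> blocks are only an additional summand.\<close>

lemma edrop_shift: "t > 0 \<Longrightarrow> edrop q (q ^ n * t) (X (n + m)) \<le> edrop q t (X m)"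
proof -
  assume t: "t > 0"
  have "X (n + m) = pscale (lam ^ n) (X m) \<oplus> X n" by (simp add: X_add pconv_commute)
  then have "edrop q (q ^ n * t) (X (n + m)) \<le> edrop q (q ^ n * t) (pscale (lam ^ n) (X m))"
    using lam t by (auto intro!: edrop_conv_le)
  also have "\<dots> = edrop q t (X m)"
    using edrop_pscale[of "X m" "lam ^ n" q t] lam t by (simp add: norm_power)
  finally show ?thesis .
qed

text \<open>Passing to the scale \<open>q ^ j * r\<close>, discarding the first \<open>j\<close>
  blocks and discarding the blocks after the next \<open>N\<close> each can only raise the gain.
  What remains is the pair \<open>X N\<close>, \<open>Y\<close>, both shrunk by
  \<open>lam ^ j\<close>, and rescaling is exact.\<close>

lemma gain_X_pscale:
  assumes Y: "fin_pmf Y" and r: "r > 0" and j: "j \<le> J"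
  shows "gain r (X (N + J)) (pscale (lam ^ j) Y) \<le> gain r (X N) Y"
proof -
  have e: "X (N + J) = pscale (lam ^ j) (X N \<oplus> pscale (lam ^ N) (X (J - j))) \<oplus> X j"
    using X_add[of j "N + (J - j)"] X_add[of N "J - j"] j by (simp add: pconv_commute)
  have "gain r (X (N + J)) (pscale (lam ^ j) Y) \<le> gain (q ^ j * r) (X (N + J)) (pscale (lam ^ j) Y)"
    using Y r lam by (intro gain_scale_le) (auto simp: mult_le_cancel_right1 power_le_one)
  also have "\<dots> \<le> gain (q ^ j * r) (pscale (lam ^ j) (X N \<oplus> pscale (lam ^ N) (X (J - j)))) (pscale (lam ^ j) Y)"
    unfolding e using Y r lam by (intro gain_conv_le) auto
  also have "\<dots> = gain r (X N \<oplus> pscale (lam ^ N) (X (J - j))) Y"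
    using gain_pscale[of "X N \<oplus> pscale (lam ^ N) (X (J - j))" Y r "lam ^ j"] Y r by (simp add: norm_power)
  also have "\<dots> \<le> gain r (X N) Y" using Y r by (intro gain_conv_le) auto
  finally show ?thesis .
qed

lemma gain_X_tower:
  assumes Y: "fin_pmf Y" and r: "r > 0"
  shows "gain r (X (N + J)) (tower lam J n Y) \<le> real (J * n) * gain r (X N) Y"
proof -
  have "gain r (X (N + J)) (tower lam J n Y) \<le> (\<Sum>j<J. real n * gain r (X (N + J)) (pscale (lam ^ j) Y))"
    using Y r by (intro gain_tower_le) auto
  also have "\<dots> \<le> (\<Sum>j<J. real n * gain r (X N) Y)"
    by (intro sum_mono mult_left_mono gain_X_pscale Y r) auto
  finally show ?thesis by simp
qed

lemma ent_return_scale: "r > 0 \<Longrightarrow> ent r (return_pmf 0) = ent 1 (return_pmf 0) + 2 * ln r"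
  using ent_pscale[of "return_pmf 0" 1 "of_real r"] by simp

text \<open>Relative to a point mass each copy gains at most its variance over
  \<open>2 * S ^ 2\<close>, and the variances of the rescaled copies form a geometric
  series.\<close>

lemma ent_tower_le:
  assumes Y: "fin_pmf Y" and S: "S > 0"
  shows "ent S (tower lam J n Y) \<le> ent 1 (return_pmf 0) + 2 * ln S + real n * spread Y / (2 * S\<^sup>2 * (1 - q\<^sup>2))"
proof -
  obtain c where c: "c \<in> set_pmf Y" "measure_pmf.expectation Y (\<lambda>x. (cmod (x - c))\<^sup>2) \<le> spread Y"
    using spread_center[OF Y] .
  have "gain S (return_pmf 0) (tower lam J n Y) \<le> (\<Sum>j<J. real n * gain S (return_pmf 0) (pscale (lam ^ j) Y))"
    using Y S by (intro gain_tower_le) auto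
  also have "\<dots> \<le> (\<Sum>j<J. real n * ((q\<^sup>2) ^ j * spread Y / (2 * S\<^sup>2)))"
  proof (intro sum_mono mult_left_mono)
    fix j
    have "gain S (return_pmf 0) (pscale (lam ^ j) Y) \<le> measure_pmf.expectation (pscale (lam ^ j) Y) (\<lambda>b. (cmod (b - lam ^ j * c))\<^sup>2) / (2 * S\<^sup>2)"
      using Y S by (intro gain_le_variance) auto
    also have "measure_pmf.expectation (pscale (lam ^ j) Y) (\<lambda>b. (cmod (b - lam ^ j * c))\<^sup>2)
        = (q\<^sup>2) ^ j * measure_pmf.expectation Y (\<lambda>b. (cmod (b - c))\<^sup>2)"
    proof -
      have "(cmod (lam ^ j * b - lam ^ j * c))\<^sup>2 = (q\<^sup>2) ^ j * (cmod (b - c))\<^sup>2" for b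
        by (simp add: norm_mult norm_power power_mult_distrib flip: right_diff_distrib power_mult) (simp add: mult.commute)
      then show ?thesis by (simp add: pscale_def)
    qed
    also have "\<dots> / (2 * S\<^sup>2) \<le> (q\<^sup>2) ^ j * spread Y / (2 * S\<^sup>2)"
      using c by (intro divide_right_mono mult_left_mono) auto
    finally show "gain S (return_pmf 0) (pscale (lam ^ j) Y) \<le> (q\<^sup>2) ^ j * spread Y / (2 * S\<^sup>2)" .
  qed auto
  also have "\<dots> = real n * spread Y / (2 * S\<^sup>2) * (\<Sum>j<J. (q\<^sup>2) ^ j)"
    by (simp add: sum_distrib_left sum_divide_distrib algebra_simps)
  also have "\<dots> \<le> real n * spread Y / (2 * S\<^sup>2) * (1 / (1 - q\<^sup>2))"
  proof (rule mult_left_mono)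
    have "q\<^sup>2 < 1" using lam by (simp add: power_less_one_iff)
    then show "(\<Sum>j<J. (q\<^sup>2) ^ j) \<le> 1 / (1 - q\<^sup>2)"
      using sum_le_suminf[OF summable_geometric[of "q\<^sup>2"], of "{..<J}"] suminf_geometric[of "q\<^sup>2"] by simp
  qed (simp add: spread_nonneg)
  finally show ?thesis using ent_return_scale[OF S] unfolding gain_def by simp
qed

text \<open>Adding many rescaled independent copies of \<open>Y\<close> produces a measure of nearly full entropy on a
  window of scales, whereas \<open>X\<close> has a deficit there. By submodularity each copy gains at most as
  much as a single \<open>Y\<close>.\<close>

lemma gain_ge_spread:
  assumes D0: "D > 0" and Dle: "\<forall>t>0. \<forall>N. edrop q t (X N) \<ge> D"
  shows "\<exists>K c. c > 0 \<and> (\<forall>\<rho> N Y. \<rho> > 0 \<longrightarrow> fin_pmf Y \<longrightarrow> (\<forall>x\<in>set_pmf Y. \<forall>y\<in>set_pmf Y. cmod (x - y) \<le> \<rho>)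
        \<longrightarrow> gain (q ^ K * \<rho>) (X N) Y \<ge> c * spread Y / \<rho>\<^sup>2)"
proof -
  have D: "D > 0" "\<And>t N. t > 0 \<Longrightarrow> edrop q t (X N) \<ge> D" using D0 Dle by auto
  define L where "L = - ln q"
  have L: "L > 0" using lam by (simp add: L_def)
  define c0 where "c0 = (Im lam)\<^sup>2 * q\<^sup>2 / 12"
  have c0: "c0 > 0" using lam by (simp add: c0_def)
  define C0 where "C0 = ent 1 (return_pmf 0)"
  have q2: "q\<^sup>2 < 1" using lam by (simp add: power_less_one_iff)
  \<comment> \<open>A lower bound for the gain of the tower between the scales
    \<open>q ^ (s ^ 2) * \<rho>\<close> and \<open>\<rho> / q ^ s\<close>. The deficit of
    \<open>X\<close> contributes \<open>(s ^ 2 + s) * D\<close>, quadratic in \<open>s\<close>,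
    whereas the entropy of the tower at the coarse end costs only \<open>2 * s * L\<close> plus
    bounded terms.\<close>
  define F where "F s = (s\<^sup>2 + s) * D - C0 - 2 * s * L - (2 * L * s\<^sup>2 / c0 + 1) * exp (- L * s) ^ 2 / (2 * (1 - q\<^sup>2))" for s :: real
  have "filterlim F at_top at_top"
    unfolding F_def using D(1) L c0 q2 by real_asymp
  then have "\<forall>\<^sub>F s in at_top. F s \<ge> 1" by (simp add: filterlim_at_top)
  then have "\<forall>\<^sub>F s in sequentially. F (real s) \<ge> 1" 
    using filterlim_real_sequentially by (rule eventually_compose_filterlim)
  then obtain s where s: "F (real s) \<ge> 1" unfolding eventually_sequentially by blast
  define K where "K = s\<^sup>2"
  define J where "J = 2 * K + 2"
  define W where "W = 2 * L * real K / c0 + 1"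
  have W: "W > 0" using L c0 by (simp add: W_def add_nonneg_pos)
  have main: "gain (q ^ K * \<rho>) (X N) Y \<ge> 1 / (real J * W) * spread Y / \<rho>\<^sup>2"
    if \<rho>: "\<rho> > 0" and Y: "fin_pmf Y" and diam: "\<And>x y. x \<in> set_pmf Y \<Longrightarrow> y \<in> set_pmf Y \<Longrightarrow> cmod (x - y) \<le> \<rho>" for \<rho> N Y
  proof (cases "spread Y = 0")
    case True
    then show ?thesis using gain_nonneg[of "X N" Y "q ^ K * \<rho>"] Y \<rho> by simp
  next
    case False
    define Y' where "Y' = pscale (of_real (1 / \<rho>)) Y"
    have Y': "fin_pmf Y'" using Y by (simp add: Y'_def)
    have diam': "cmod (x - y) \<le> 1" if "x \<in> set_pmf Y'" "y \<in> set_pmf Y'" for x y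
    proof -
      from that obtain x' y' where "x' \<in> set_pmf Y" "y' \<in> set_pmf Y" "x = of_real (1 / \<rho>) * x'" "y = of_real (1 / \<rho>) * y'"
        by (auto simp: Y'_def pscale_def)
      then show ?thesis using diam[of x' y'] \<rho> 
        by (simp add: norm_mult norm_divide divide_le_eq flip: right_diff_distrib diff_divide_distrib)
    qed
    define V where "V = spread Y'"
    have V: "V = spread Y / \<rho>\<^sup>2" using \<rho> by (simp add: V_def Y'_def spread_pscale power_divide norm_divide)
    have V0: "V > 0" using False spread_nonneg[of Y] \<rho> by (simp add: V)
    have V1: "V \<le> 1" using spread_le[OF Y' diam'] by (simp add: V_def)
    \<comment> \<open>Of the order of \<open>1 / V\<close> copies: enough for
      \<open>ent_tower_nonneg\<close>, while the total spread \<open>n * V\<close> stays below the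
      constant \<open>W\<close>.\<close>
    define n where "n = nat \<lceil>2 * L * real K / (c0 * V)\<rceil>"
    have n0: "0 \<le> 2 * L * real K / (c0 * V)" using L c0 V0 by simp
    have n1: "real n \<ge> 2 * L * real K / (c0 * V)" using n0 unfolding n_def by linarith
    have n2: "real n \<le> 2 * L * real K / (c0 * V) + 1" using n0 unfolding n_def by linarith
    have nV: "real n * V \<le> W"
      using mult_right_mono[OF n2, of V] V0 V1 by (simp add: W_def field_simps)
    have nV': "real n * ((Im lam)\<^sup>2 * (cmod lam)\<^sup>2 / 12 * spread Y') \<ge> 2 * real K * - ln (cmod lam)"
    proof -
      have "2 * L * real K \<le> real n * (c0 * V)" using n1 V0 c0 by (simp add: divide_le_eq)
      then show ?thesis by (simp add: L_def c0_def V_def mult_ac)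
    qed
    define T' where "T' = tower lam J n Y'"
    define T where "T = tower lam J n Y"
    have fT: "fin_pmf T" "fin_pmf T'" using Y Y' by (auto simp: T_def T'_def)
    have TT: "T = pscale (of_real \<rho>) T'"
      using \<rho> by (simp add: T_def T'_def pscale_tower Y'_def pscale_pscale)
    define S where "S = 1 / q ^ s"
    have S: "S > 0" "ln S = real s * L" using lam by (auto simp: S_def L_def ln_div ln_realpow)
    have e1: "ent (q ^ K) T' \<ge> 0"
      unfolding T'_def J_def using lam by (intro ent_tower_nonneg Y' diam' nV') auto
    have e2: "ent S T' \<le> C0 + 2 * real s * L + W * exp (- L * real s) ^ 2 / (2 * (1 - q\<^sup>2))"
    proof -
      have E: "exp (- L * real s) = 1 / S" using S lam by (simp add: L_def S_def exp_of_nat2_mult)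
      moreover have "real n * V / (2 * S\<^sup>2 * (1 - q\<^sup>2)) \<le> W / (2 * S\<^sup>2 * (1 - q\<^sup>2))"
        using nV q2 by (intro divide_right_mono) auto
      moreover have "W / (2 * S\<^sup>2 * (1 - q\<^sup>2)) = W * exp (- L * real s) ^ 2 / (2 * (1 - q\<^sup>2))"
        unfolding E by (simp add: power_divide)
      ultimately show ?thesis using ent_tower_le[OF Y' S(1), of J n] unfolding T'_def S(2) C0_def V_def by linarith
    qed
    have e3: "ent (q ^ K * \<rho>) T - ent (S * \<rho>) T = ent (q ^ K) T' - ent S T'"
      using ent_pscale[OF fT(2), of "q ^ K" "of_real \<rho>"] ent_pscale[OF fT(2) S(1), of "of_real \<rho>"] \<rho> lam
      by (simp add: TT mult.commute)
    have KS: "q ^ K * \<rho> \<le> S * \<rho>"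
    proof -
      have "q ^ K \<le> 1" "q ^ s \<le> 1" using lam by (auto simp: power_le_one)
      then have "q ^ K \<le> S" using lam by (simp add: S_def le_divide_eq mult_le_one)
      then show ?thesis using \<rho> by simp
    qed
    \<comment> \<open>The additional \<open>J\<close> blocks pay for the \<open>J\<close> levels of
      the tower in \<open>gain_X_tower\<close>.\<close>
    let ?N = "N + J"
    have r: "q ^ K * \<rho> > 0" "S * \<rho> > 0" using \<rho> lam S by auto
    have w1: "ent (S * \<rho>) (X ?N) - ent (q ^ K * \<rho>) (X ?N) \<ge> real (K + s) * D"
    proof -
      have E: "q ^ (K + s) * (S * \<rho>) = q ^ K * \<rho>" using lam by (simp add: S_def power_add)
      have "ent (S * \<rho>) (X ?N) - ent (q ^ K * \<rho>) (X ?N) = (\<Sum>i<K + s. edrop q (q ^ i * (S * \<rho>)) (X ?N))"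
        using ent_telescope[of "S * \<rho>" "X ?N" q "K + s"] unfolding E .
      also have "\<dots> \<ge> (\<Sum>i<K + s. D)" using lam r by (intro sum_mono D) auto
      finally show ?thesis by simp
    qed
    have w2: "ent (q ^ K * \<rho>) (X ?N \<oplus> T) - ent (S * \<rho>) (X ?N \<oplus> T) \<ge> ent (q ^ K * \<rho>) T - ent (S * \<rho>) T"
      using gain_scale_le[OF fT(1) fin_X[of ?N] r(1) KS] by (simp add: gain_def pconv_commute)
    have "1 \<le> F (real s)" by fact
    also have "F (real s) = real (K + s) * D - (C0 + 2 * real s * L + W * exp (- L * real s) ^ 2 / (2 * (1 - q\<^sup>2)))"
      by (simp add: F_def K_def W_def)
    also have "\<dots> \<le> gain (q ^ K * \<rho>) (X ?N) T - gain (S * \<rho>) (X ?N) T"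
      using w1 w2 e1 e2 e3 by (simp add: gain_def)
    also have "\<dots> \<le> gain (q ^ K * \<rho>) (X ?N) T" using gain_nonneg[OF fin_X fT(1) r(2)] by simp
    also have "\<dots> \<le> real (J * n) * gain (q ^ K * \<rho>) (X N) Y"
      unfolding T_def by (rule gain_X_tower[OF Y r(1)])
    finally have g: "1 \<le> real J * real n * gain (q ^ K * \<rho>) (X N) Y" by simp
    then have n: "real n > 0" by (cases "n = 0") auto
    have J: "real J > 0" by (simp add: J_def)
    \<comment> \<open>The total gain of at least 1 is shared by \<open>J * n\<close> copies, and
      \<open>n \<le> W / V\<close> turns each share into a bound linear in the spread.\<close>
    have "1 / (real J * W) * V \<le> 1 / (real J * real n)"
      using nV n J W by (simp add: field_simps)
    also have "\<dots> \<le> gain (q ^ K * \<rho>) (X N) Y"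
      using g n J by (simp add: divide_le_eq mult_ac)
    finally show ?thesis by (simp add: V)
  qed
  have "real J * W > 0" using W by (simp add: J_def)
  then show ?thesis using main by (intro exI[of _ K] exI[of _ "1 / (real J * W)"]) simp
qed

end

section \<open>Cells, codes and full entropy dimension\<close>

text \<open>The conditional law given the label. Labels of probability zero carry no information
  here, hence the membership hypotheses in the lemmas below.\<close>

definition cell :: "'a pmf \<Rightarrow> ('a \<Rightarrow> 'b) \<Rightarrow> 'b \<Rightarrow> 'a pmf" where
  "cell P z w = cond_pmf P (z -` {w})"

lemma cell_nonempty: "w \<in> z ` set_pmf P \<Longrightarrow> set_pmf P \<inter> z -` {w} \<noteq> {}"
  by auto

lemma set_cell: "w \<in> z ` set_pmf P \<Longrightarrow> set_pmf (cell P z w) = {x \<in> set_pmf P. z x = w}"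
  unfolding cell_def by (subst set_cond_pmf[OF cell_nonempty]) auto

lemma fin_cell: "fin_pmf P \<Longrightarrow> w \<in> z ` set_pmf P \<Longrightarrow> fin_pmf (cell P z w)"
  by (simp add: set_cell)

lemma bind_cell: "bind_pmf (map_pmf z P) (cell P z) = P"
proof -
  have "bind_pmf (map_pmf z P) (\<lambda>w. cond_pmf P {x. z x = w}) = P"
  proof (rule bind_cond_pmf_cancel)
    show "measure_pmf.prob P {x. z x = w} = measure_pmf.prob (map_pmf z P) {w. z x = w}"
      if "z x = w" for x w
      using that by (simp add: vimage_def)
  qed auto
  then show ?thesis by (simp add: cell_def[abs_def] vimage_def)
qed

lemma expectation_cell:
  fixes f :: "'a \<Rightarrow> real"
  assumes "fin_pmf P"
  shows "measure_pmf.expectation P f = measure_pmf.expectation (map_pmf z P) (\<lambda>w. measure_pmf.expectation (cell P z w) f)"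
  by (subst bind_cell[of z P, symmetric], subst expectation_bind_fin) (use assms in \<open>auto simp: fin_cell\<close>)

definition shannon :: "'a pmf \<Rightarrow> real" where
  "shannon P = - (\<Sum>x\<in>set_pmf P. pmf P x * ln (pmf P x))"

text \<open>Gibbs' inequality: a sub-probability \<open>Q\<close> acts as a code with word lengths
  \<open>- ln (Q w)\<close>.\<close>

lemma shannon_le_code:
  assumes P: "fin_pmf P" and inj: "inj_on z (set_pmf P)" and Q: "\<And>w. Q w > 0" "(\<Sum>w\<in>z ` set_pmf P. Q w) \<le> 1"
  shows "shannon P \<le> measure_pmf.expectation P (\<lambda>x. - ln (Q (z x)))"
proof -
  have "(\<Sum>x\<in>set_pmf P. pmf P x * (ln (Q (z x)) - ln (pmf P x))) \<le> (\<Sum>x\<in>set_pmf P. Q (z x) - pmf P x)"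
  proof (rule sum_mono)
    fix x assume "x \<in> set_pmf P"
    then have p: "pmf P x > 0" by (simp add: pmf_positive)
    have "pmf P x * ln (Q (z x) / pmf P x) \<le> pmf P x * (Q (z x) / pmf P x - 1)"
      using p Q(1) by (intro mult_left_mono ln_le_minus_one) auto
    then show "pmf P x * (ln (Q (z x)) - ln (pmf P x)) \<le> Q (z x) - pmf P x"
      using p Q(1)[of "z x"] by (simp add: ln_div right_diff_distrib)
  qed
  also have "\<dots> = (\<Sum>w\<in>z ` set_pmf P. Q w) - 1"
    using sum_pmf_eq_1[OF P order_refl] by (simp add: sum_subtractf sum.reindex[OF inj])
  also have "\<dots> \<le> 0" using Q by simp
  finally show ?thesis using P
    by (simp add: shannon_def expectation_fin right_diff_distrib sum_subtractf sum_negf)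
qed

text \<open>The refinement history of a point, latest entry first: \<open>None\<close> for the part
  near the centre of the previous cell, \<open>Some\<close> with a grid position otherwise.\<close>

type_synonym label = "(int \<times> int) option list"

definition is_code :: "complex pmf \<Rightarrow> real \<Rightarrow> (complex \<Rightarrow> label) \<Rightarrow> (label \<Rightarrow> real) \<Rightarrow> real \<Rightarrow> bool" where
  "is_code P \<rho> z Q B \<longleftrightarrow> (\<forall>w. Q w > 0) \<and> (\<Sum>w\<in>z ` set_pmf P. Q w) \<le> 1 \<and>
    (\<forall>x\<in>set_pmf P. \<forall>y\<in>set_pmf P. z x = z y \<longrightarrow> cmod (x - y) \<le> \<rho>) \<and>
    measure_pmf.expectation P (\<lambda>x. - ln (Q (z x))) \<le> B"

text \<open>A cell of small spread is refined into the part near its centre, which receives almost all of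
  the code mass, and a bounded number of grid pieces.\<close>

lemma code_refine:
  fixes P :: "complex pmf" and z :: "complex \<Rightarrow> label"
  assumes P: "fin_pmf P" and q: "0 < q" "q < (1::real)" and \<rho>: "\<rho> > 0" and \<delta>: "0 < \<delta>" "\<delta> < 1"
    and code: "is_code P \<rho> z Q B"
    and spr: "measure_pmf.expectation (map_pmf z P) (\<lambda>w. spread (cell P z w)) \<le> \<epsilon> * \<rho>\<^sup>2"
    and m: "m = nat \<lceil>2 / q\<rceil> + 2"
  shows "\<exists>z' Q'. is_code P (q * \<rho>) z' Q' (B - ln (1 - \<delta>) + 4 * \<epsilon> / q\<^sup>2 * ln (real (m * m) / \<delta>))"
proof -
  have diam: "cmod (x - y) \<le> \<rho>" if "x \<in> set_pmf P" "y \<in> set_pmf P" "z x = z y" for x y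
    using code that by (simp add: is_code_def)
  have Q: "Q w > 0" "(\<Sum>w\<in>z ` set_pmf P. Q w) \<le> 1" for w using code by (auto simp: is_code_def)
  have B: "measure_pmf.expectation P (\<lambda>x. - ln (Q (z x))) \<le> B" using code by (simp add: is_code_def)
  \<comment> \<open>Two points within \<open>g\<close> of a common centre, or in a common square of
    side \<open>g\<close>, are at distance at most \<open>q * \<rho>\<close>.\<close>
  define g where "g = q * \<rho> / 2"
  have g: "g > 0" using q \<rho> by (simp add: g_def)
  have "\<exists>c. \<forall>w\<in>z ` set_pmf P. measure_pmf.expectation (cell P z w) (\<lambda>x. (cmod (x - c w))\<^sup>2) \<le> spread (cell P z w)"
  proof (rule bchoice, rule ballI)
    fix w assume w: "w \<in> z ` set_pmf P"
    obtain c where "measure_pmf.expectation (cell P z w) (\<lambda>x. (cmod (x - c))\<^sup>2) \<le> spread (cell P z w)"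
      by (rule spread_center[OF fin_cell[OF P w]])
    then show "\<exists>c. measure_pmf.expectation (cell P z w) (\<lambda>x. (cmod (x - c))\<^sup>2) \<le> spread (cell P z w)" ..
  qed
  then obtain c where c: "\<And>w. w \<in> z ` set_pmf P \<Longrightarrow> measure_pmf.expectation (cell P z w) (\<lambda>x. (cmod (x - c w))\<^sup>2) \<le> spread (cell P z w)"
    by blast
  \<comment> \<open>Residues suffice: points of one cell are at distance at most
    \<open>\<rho> = 2 / q * g\<close>, so their grid indices differ by less than \<open>m\<close>.
    This keeps the number of labels per step bounded.\<close>
  define fl where "fl u = \<lfloor>u / g\<rfloor> mod int m" for u
  define near where "near x \<longleftrightarrow> cmod (x - c (z x)) \<le> g" for x
  define t where "t x = (if near x then None else Some (fl (Re x), fl (Im x)))" for x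
  define z' where "z' x = t x # z x" for x
  \<comment> \<open>Staying near the centre costs only \<open>- ln (1 - \<delta>)\<close>; the
    \<open>m * m\<close> grid pieces share the remaining mass \<delta>.\<close>
  define p where "p o' = (if o' = None then 1 - \<delta> else \<delta> / real (m * m))" for o' :: "(int \<times> int) option"
  define Q' where "Q' w = p (hd w) * Q (tl w)" for w
  define T where "T = insert None (Some ` ({0..<int m} \<times> {0..<int m}))"
  have m0: "m > 0" "real m \<ge> 2" by (auto simp: m)
  have p0: "p o' > 0" for o' using \<delta> m0 by (auto simp: p_def)
  have pT: "(\<Sum>o'\<in>T. p o') = 1"
  proof -
    have "(\<Sum>o'\<in>T. p o') = p None + (\<Sum>o'\<in>Some ` ({0..<int m} \<times> {0..<int m}). p o')"
      unfolding T_def by (subst sum.insert) auto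
    also have "(\<Sum>o'\<in>Some ` ({0..<int m} \<times> {0..<int m}). p o') = (\<Sum>i\<in>{0..<int m} \<times> {0..<int m}. \<delta> / real (m * m))"
      by (subst sum.reindex) (auto simp: p_def)
    also have "\<dots> = \<delta>" using m0 by simp
    finally show ?thesis by (simp add: p_def)
  qed
  have Q'0: "Q' w > 0" for w using p0 Q(1) by (simp add: Q'_def)
  have sumQ': "(\<Sum>w\<in>z' ` set_pmf P. Q' w) \<le> 1"
  proof -
    have "z' ` set_pmf P \<subseteq> (\<lambda>(o', w). o' # w) ` (T \<times> z ` set_pmf P)"
      using m0 by (auto simp: z'_def t_def T_def fl_def image_iff)
    then have "(\<Sum>w\<in>z' ` set_pmf P. Q' w) \<le> (\<Sum>w\<in>(\<lambda>(o', w). o' # w) ` (T \<times> z ` set_pmf P). Q' w)"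
      using P Q'0 by (intro sum_mono2) (auto simp: T_def less_imp_le)
    also have "\<dots> = (\<Sum>(o', w)\<in>T \<times> z ` set_pmf P. p o' * Q w)"
      by (subst sum.reindex) (auto simp: inj_on_def Q'_def intro!: sum.cong)
    also have "\<dots> = (\<Sum>o'\<in>T. p o') * (\<Sum>w\<in>z ` set_pmf P. Q w)"
      by (simp add: sum_product sum.cartesian_product)
    finally show ?thesis using Q(2) by (simp add: pT)
  qed
  have diam': "cmod (x - y) \<le> q * \<rho>" if x: "x \<in> set_pmf P" "y \<in> set_pmf P" and e: "z' x = z' y" for x y
  proof -
    have zz: "z x = z y" "t x = t y" using e by (auto simp: z'_def)
    have d: "cmod (x - y) \<le> \<rho>" using diam x zz by auto
    show ?thesis
    proof (cases "near x")
      case True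
      then have "near y" using zz(2) by (auto simp: t_def split: if_splits)
      then have "cmod (x - c (z x)) \<le> g" "cmod (y - c (z x)) \<le> g" using True zz by (auto simp: near_def)
      then show ?thesis using norm_triangle_ineq4[of "x - c (z x)" "y - c (z x)"] by (simp add: g_def)
    next
      case False
      then have fl: "fl (Re x) = fl (Re y)" "fl (Im x) = fl (Im y)" using zz(2) by (auto simp: t_def split: if_splits)
      have key: "\<bar>u - v\<bar> \<le> g" if "fl u = fl v" "\<bar>u - v\<bar> \<le> \<rho>" for u v
      proof -
        have "\<rho> / g = 2 / q" using \<rho> q by (simp add: g_def)
        moreover have "\<bar>u / g - v / g\<bar> = \<bar>u - v\<bar> / g" using g by (simp flip: diff_divide_distrib)
        ultimately have "\<bar>u / g - v / g\<bar> \<le> 2 / q" using divide_right_mono[OF that(2), of g] g by simp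
        moreover have "2 / q \<le> real m - 2" by (simp add: m) linarith
        ultimately have "\<bar>\<lfloor>u / g\<rfloor> - \<lfloor>v / g\<rfloor>\<bar> < int m" by linarith
        moreover have "int m dvd \<lfloor>u / g\<rfloor> - \<lfloor>v / g\<rfloor>" using that(1) unfolding fl_def by (simp add: mod_eq_dvd_iff)
        ultimately have "\<lfloor>u / g\<rfloor> - \<lfloor>v / g\<rfloor> = 0"
          using dvd_imp_le_int[of "\<lfloor>u / g\<rfloor> - \<lfloor>v / g\<rfloor>" "int m"] by linarith
        then have "\<bar>u / g - v / g\<bar> \<le> 1" by linarith
        then show ?thesis using g by (simp add: divide_le_eq abs_divide flip: diff_divide_distrib)
      qed
      have "\<bar>Re (x - y)\<bar> \<le> g" "\<bar>Im (x - y)\<bar> \<le> g"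
        using key fl d abs_Re_le_cmod[of "x - y"] abs_Im_le_cmod[of "x - y"] by (force intro: order_trans)+
      then show ?thesis using cmod_le[of "x - y"] by (simp add: g_def)
    qed
  qed
  define far where "far = measure_pmf.expectation P (\<lambda>x. if near x then 0 else 1 :: real)"
  \<comment> \<open>Chebyshev's inequality around the centre \<open>c w\<close> of each cell; the
    factor 4 comes from \<open>g = q * \<rho> / 2\<close>.\<close>
  have far: "far \<le> 4 * \<epsilon> / q\<^sup>2"
  proof -
    have "far \<le> measure_pmf.expectation P (\<lambda>x. (cmod (x - c (z x)))\<^sup>2 / g\<^sup>2)"
      unfolding far_def
    proof (rule expectation_mono_pmf[OF P])
      fix x show "(if near x then 0 else 1) \<le> (cmod (x - c (z x)))\<^sup>2 / g\<^sup>2"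
        using g by (auto simp: near_def le_divide_eq intro!: power_mono)
    qed
    also have "\<dots> = measure_pmf.expectation P (\<lambda>x. (cmod (x - c (z x)))\<^sup>2) / g\<^sup>2" by simp
    also have "measure_pmf.expectation P (\<lambda>x. (cmod (x - c (z x)))\<^sup>2)
      = measure_pmf.expectation (map_pmf z P) (\<lambda>w. measure_pmf.expectation (cell P z w) (\<lambda>x. (cmod (x - c (z x)))\<^sup>2))"
      by (rule expectation_cell[OF P])
    also have "\<dots> \<le> measure_pmf.expectation (map_pmf z P) (\<lambda>w. spread (cell P z w))"
    proof (rule expectation_mono_pmf)
      fix w assume "w \<in> set_pmf (map_pmf z P)"
      then have w: "w \<in> z ` set_pmf P" by simp
      have "measure_pmf.expectation (cell P z w) (\<lambda>x. (cmod (x - c (z x)))\<^sup>2) = measure_pmf.expectation (cell P z w) (\<lambda>x. (cmod (x - c w))\<^sup>2)"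
        by (rule expectation_cong_pmf) (auto simp: set_cell[OF w])
      then show "measure_pmf.expectation (cell P z w) (\<lambda>x. (cmod (x - c (z x)))\<^sup>2) \<le> spread (cell P z w)" using c[OF w] by simp
    qed (use P in auto)
    also have "\<dots> \<le> \<epsilon> * \<rho>\<^sup>2" by (rule spr)
    finally have "far \<le> \<epsilon> * \<rho>\<^sup>2 / g\<^sup>2" by (simp add: divide_right_mono)
    also have "\<dots> = 4 * \<epsilon> / q\<^sup>2" using \<rho> q by (simp add: g_def power_divide power_mult_distrib)
    finally show ?thesis .
  qed
  have "real (m * m) \<ge> 2 * 2" unfolding of_nat_mult using m0 by (intro mult_mono) auto
  then have ln0: "ln (real (m * m) / \<delta>) \<ge> 0" using \<delta> by (intro ln_ge_zero) (simp add: le_divide_eq)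
  have "measure_pmf.expectation P (\<lambda>x. - ln (Q' (z' x))) \<le> measure_pmf.expectation P (\<lambda>x. - ln (Q (z x)) + (- ln (1 - \<delta>) + ln (real (m * m) / \<delta>) * (if near x then 0 else 1)))"
  proof (rule expectation_mono_pmf[OF P])
    fix x
    have "- ln (Q' (z' x)) = - ln (p (t x)) - ln (Q (z x))"
      using p0[of "t x"] Q(1)[of "z x"] by (simp add: Q'_def z'_def ln_mult)
    moreover have "- ln (p (t x)) \<le> - ln (1 - \<delta>) + ln (real (m * m) / \<delta>) * (if near x then 0 else 1)"
    proof (cases "near x")
      case False
      have "- ln (p (t x)) = ln (real (m * m) / \<delta>)" using False \<delta> m0 by (simp add: p_def t_def ln_div ln_mult)
      moreover have "ln (1 - \<delta>) \<le> 0" using \<delta> by simp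
      ultimately show ?thesis using False by simp
    qed (simp add: p_def t_def)
    ultimately show "- ln (Q' (z' x)) \<le> - ln (Q (z x)) + (- ln (1 - \<delta>) + ln (real (m * m) / \<delta>) * (if near x then 0 else 1))" by simp
  qed
  also have "\<dots> = measure_pmf.expectation P (\<lambda>x. - ln (Q (z x))) - ln (1 - \<delta>) + ln (real (m * m) / \<delta>) * far"
  proof -
    have lin: "measure_pmf.expectation P (\<lambda>x. f x + (a + b * h x)) = measure_pmf.expectation P f + a + b * measure_pmf.expectation P h" for a b and f h :: "complex \<Rightarrow> real"
      using P by (simp add: integrable_fin_pmf)
    show ?thesis unfolding lin far_def by simp
  qed
  also have "\<dots> \<le> B - ln (1 - \<delta>) + ln (real (m * m) / \<delta>) * (4 * \<epsilon> / q\<^sup>2)"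
    using B far ln0 by (intro add_mono mult_left_mono diff_right_mono) auto
  finally have "measure_pmf.expectation P (\<lambda>x. - ln (Q' (z' x))) \<le> B - ln (1 - \<delta>) + 4 * \<epsilon> / q\<^sup>2 * ln (real (m * m) / \<delta>)"
    by (simp add: mult.commute)
  then have "is_code P (q * \<rho>) z' Q' (B - ln (1 - \<delta>) + 4 * \<epsilon> / q\<^sup>2 * ln (real (m * m) / \<delta>))"
    unfolding is_code_def using Q'0 sumQ' diam' by blast
  then show ?thesis by blast
qed

text \<open>A grid of mesh \<open>\<rho> / 2\<close> costs the logarithmic term, and each of
  \<open>J\<close> applications of \<open>code_refine\<close> adds a fixed price. Afterwards cells
  are smaller than the gaps between atoms, so the label determines the atom and the expected code
  length bounds the entropy.\<close>

lemma shannon_le_cells: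
  fixes P :: "complex pmf"
  assumes P: "fin_pmf P" and R: "\<And>x. x \<in> set_pmf P \<Longrightarrow> cmod x \<le> R" "R \<ge> 0"
    and q: "0 < q" "q < (1::real)" and \<rho>: "\<rho> > 0" and \<delta>: "0 < \<delta>" "\<delta> < 1"
    and spr: "\<And>j (z :: complex \<Rightarrow> label). (\<And>x y. x \<in> set_pmf P \<Longrightarrow> y \<in> set_pmf P \<Longrightarrow> z x = z y \<Longrightarrow> cmod (x - y) \<le> q ^ j * \<rho>)
        \<Longrightarrow> measure_pmf.expectation (map_pmf z P) (\<lambda>w. spread (cell P z w)) \<le> \<epsilon> * (q ^ j * \<rho>)\<^sup>2"
    and m: "m = nat \<lceil>2 / q\<rceil> + 2"
    and sep: "\<And>x y. x \<in> set_pmf P \<Longrightarrow> y \<in> set_pmf P \<Longrightarrow> x \<noteq> y \<Longrightarrow> cmod (x - y) > q ^ J * \<rho>"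
  shows "shannon P \<le> 2 * ln (4 * R / \<rho> + 3) + real J * (- ln (1 - \<delta>) + 4 * \<epsilon> / q\<^sup>2 * ln (real (m * m) / \<delta>))"
proof -
  let ?\<eta> = "- ln (1 - \<delta>) + 4 * \<epsilon> / q\<^sup>2 * ln (real (m * m) / \<delta>)"
  let ?G = "\<lambda>j z Q. is_code P (q ^ j * \<rho>) z Q (2 * ln (4 * R / \<rho> + 3) + real j * ?\<eta>)"
  have "\<exists>z Q. ?G j z Q" for j
  proof (induction j)
    case 0
    define g where "g = \<rho> / 2"
    have g: "g > 0" using \<rho> by (simp add: g_def)
    define z0 :: "complex \<Rightarrow> label" where "z0 x = [Some (\<lfloor>Re x / g\<rfloor>, \<lfloor>Im x / g\<rfloor>)]" for x
    define N where "N = card (z0 ` set_pmf P)"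
    have N0: "N > 0" using P set_pmf_not_empty by (auto simp: N_def card_gt_0_iff)
    define k where "k = \<lfloor>R / g\<rfloor> + 1"
    have k0: "k \<ge> 1" using R(2) g by (simp add: k_def)
    have fl: "\<lfloor>u / g\<rfloor> \<in> {-k..<k}" if "\<bar>u\<bar> \<le> R" for u
    proof -
      have "u / g \<le> R / g" "- (R / g) \<le> u / g" 
        using that g divide_right_mono[of u R g] divide_right_mono[of "- R" u g] by auto
      then have "\<lfloor>u / g\<rfloor> \<le> \<lfloor>R / g\<rfloor>" "- (R / g) \<le> u / g" by (auto intro: floor_mono)
      moreover have "- k \<le> \<lfloor>u / g\<rfloor>"
      proof -
        have "- real_of_int \<lfloor>R / g\<rfloor> - 1 \<le> u / g" using calculation(2) floor_correct[of "R / g"] by linarith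
        then show ?thesis unfolding k_def le_floor_iff by simp
      qed
      ultimately have "\<lfloor>u / g\<rfloor> \<le> \<lfloor>R / g\<rfloor>" "- k \<le> \<lfloor>u / g\<rfloor>" by auto
      then show ?thesis unfolding k_def by simp
    qed
    have "z0 ` set_pmf P \<subseteq> (\<lambda>i. [Some i]) ` ({-k..<k} \<times> {-k..<k})"
    proof safe
      fix x assume "x \<in> set_pmf P"
      then have "\<bar>Re x\<bar> \<le> R" "\<bar>Im x\<bar> \<le> R" using R(1)[of x] abs_Re_le_cmod[of x] abs_Im_le_cmod[of x] by auto
      then show "z0 x \<in> (\<lambda>i. [Some i]) ` ({-k..<k} \<times> {-k..<k})" using fl unfolding z0_def by blast
    qed
    then have "N \<le> card ((\<lambda>i. [Some i]) ` ({-k..<k} \<times> {-k..<k}))" unfolding N_def by (rule card_mono[rotated]) auto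
    also have "\<dots> \<le> card ({-k..<k} \<times> {-k..<k})" by (rule card_image_le) auto
    also have "\<dots> = nat (2 * k) * nat (2 * k)" by simp
    finally have "real N \<le> real (nat (2 * k) * nat (2 * k))" by (simp only: of_nat_le_iff)
    also have "\<dots> = (2 * of_int k) ^ 2" using k0 by (simp add: power2_eq_square)
    also have "\<dots> \<le> (4 * R / \<rho> + 3) ^ 2"
    proof (rule power_mono)
      have "R / g = 2 * R / \<rho>" by (simp add: g_def)
      then have "of_int k \<le> 2 * R / \<rho> + 1" unfolding k_def by (simp add: of_int_floor_le)
      then show "2 * of_int k \<le> 4 * R / \<rho> + 3" by simp
    qed (use k0 in auto)
    finally have "real N \<le> (4 * R / \<rho> + 3) ^ 2" .
    then have "ln (real N) \<le> ln ((4 * R / \<rho> + 3) ^ 2)" using N0 R(2) \<rho> by (subst ln_le_cancel_iff) (auto intro!: zero_less_power add_nonneg_pos)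
    also have "\<dots> = 2 * ln (4 * R / \<rho> + 3)" using R(2) \<rho> by (subst ln_realpow) (auto intro!: add_nonneg_pos)
    finally have lnN: "ln (real N) \<le> 2 * ln (4 * R / \<rho> + 3)" .
    have "?G 0 z0 (\<lambda>_. 1 / real N)"
      unfolding is_code_def
    proof (intro conjI allI ballI impI)
      show "(\<Sum>w\<in>z0 ` set_pmf P. 1 / real N) \<le> 1" using N0 by (simp add: N_def)
      show "measure_pmf.expectation P (\<lambda>x. - ln (1 / real N)) \<le> 2 * ln (4 * R / \<rho> + 3) + real 0 * ?\<eta>"
        using lnN N0 by (simp add: ln_div)
      fix x y assume "z0 x = z0 y"
      then have "\<lfloor>Re x / g\<rfloor> = \<lfloor>Re y / g\<rfloor>" "\<lfloor>Im x / g\<rfloor> = \<lfloor>Im y / g\<rfloor>" by (auto simp: z0_def)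
      then have "\<bar>Re x / g - Re y / g\<bar> \<le> 1" "\<bar>Im x / g - Im y / g\<bar> \<le> 1" by linarith+
      then have "\<bar>Re (x - y)\<bar> \<le> g" "\<bar>Im (x - y)\<bar> \<le> g" using g by (simp_all add: divide_le_eq abs_divide flip: diff_divide_distrib)
      then show "cmod (x - y) \<le> q ^ 0 * \<rho>" using cmod_le[of "x - y"] by (simp add: g_def)
    qed (use N0 in auto)
    then show ?case by blast
  next
    case (Suc j)
    then obtain z Q where G: "?G j z Q" by blast
    have "q ^ j * \<rho> > 0" using q \<rho> by simp
    note qj = this
    have d: "cmod (x - y) \<le> q ^ j * \<rho>" if "x \<in> set_pmf P" "y \<in> set_pmf P" "z x = z y" for x y
      using G that by (simp add: is_code_def)
    have "measure_pmf.expectation (map_pmf z P) (\<lambda>w. spread (cell P z w)) \<le> \<epsilon> * (q ^ j * \<rho>)\<^sup>2"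
      by (rule spr) (rule d)
    from code_refine[OF P q qj \<delta> G this m]
    have "\<exists>z' Q'. is_code P (q * (q ^ j * \<rho>)) z' Q' (2 * ln (4 * R / \<rho> + 3) + real j * ?\<eta> - ln (1 - \<delta>) + 4 * \<epsilon> / q\<^sup>2 * ln (real (m * m) / \<delta>))" .
    moreover have "2 * ln (4 * R / \<rho> + 3) + real j * ?\<eta> - ln (1 - \<delta>) + 4 * \<epsilon> / q\<^sup>2 * ln (real (m * m) / \<delta>) = 2 * ln (4 * R / \<rho> + 3) + real (Suc j) * ?\<eta>"
      by (simp only: of_nat_Suc distrib_right mult_1)
    moreover have "q * (q ^ j * \<rho>) = q ^ Suc j * \<rho>" by simp
    ultimately show ?case by (simp only:)
  qed
  from this[of J] obtain z Q where G: "?G J z Q" by blast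
  have "inj_on z (set_pmf P)"
  proof (rule inj_onI, rule ccontr)
    fix x y assume xy: "x \<in> set_pmf P" "y \<in> set_pmf P" "z x = z y" "x \<noteq> y"
    then have "cmod (x - y) \<le> q ^ J * \<rho>" using G by (simp add: is_code_def)
    then show False using sep[OF xy(1,2,4)] by simp
  qed
  then have "shannon P \<le> measure_pmf.expectation P (\<lambda>x. - ln (Q (z x)))"
    using G by (intro shannon_le_code P) (auto simp: is_code_def)
  then show ?thesis using G by (simp add: is_code_def)
qed

context selfsim_seq
begin

lemma bounded_X: "\<exists>R\<ge>0. \<forall>n. \<forall>x\<in>set_pmf (X n). cmod x \<le> R"
proof -
  define R1 where "R1 = Max (insert 0 (cmod ` set_pmf (X 1)))"
  have R1: "R1 \<ge> 0" "\<And>x. x \<in> set_pmf (X 1) \<Longrightarrow> cmod x \<le> R1" by (auto simp: R1_def intro!: Max_ge)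
  define R where "R = R1 / (1 - q)"
  have R: "R \<ge> 0" "R1 + q * R = R" using R1 lam by (auto simp: R_def field_simps)
  have "cmod x \<le> R" if "x \<in> set_pmf (X n)" for n x using that
  proof (induction n arbitrary: x)
    case 0 then show ?case using R by (simp add: X_0)
  next
    case (Suc n)
    have "X (Suc n) = X 1 \<oplus> pscale lam (X n)" using X_add[of 1 n] by simp
    then obtain d y where "d \<in> set_pmf (X 1)" "y \<in> set_pmf (X n)" "x = d + lam * y"
      using Suc.prems by (auto simp: set_pconv pscale_def)
    then have "cmod x \<le> R1 + q * R" using R1(2)[of d] Suc.IH[of y] lam
      by (auto intro!: order_trans[OF norm_triangle_ineq] add_mono mult_left_mono simp: norm_mult)
    then show ?case using R by simp
  qed
  then show ?thesis using R by blast
qed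

text \<open>\<open>X (n + M)\<close> is a mixture, over the cells of \<open>X n\<close>, of the cell
  convolved with the rescaled continuation \<open>A\<close>. Its drop is at least \<open>D\<close>
  per scale, and data processing passes this on to the mean over cells; the drop of \<open>A\<close>
  alone is at most \<open>D + e1\<close>. The cells thus gain little on average, which by
  \<open>gain_ge_spread\<close> means little spread.\<close>

lemma cell_spread_small:
  assumes D0: "D > 0" and Dle: "\<forall>t>0. \<forall>N. edrop q t (X N) \<ge> D"
    and inf: "\<forall>\<epsilon>>0. \<exists>t>0. \<exists>N. edrop q t (X N) \<le> D + \<epsilon>"
    and \<epsilon>: "\<epsilon> > 0"
  shows "\<exists>r>0. \<forall>n j (z :: complex \<Rightarrow> label).
      (\<forall>x\<in>set_pmf (X n). \<forall>y\<in>set_pmf (X n). z x = z y \<longrightarrow> cmod (x - y) \<le> q ^ j * (q ^ n * r)) \<longrightarrow>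
      measure_pmf.expectation (map_pmf z (X n)) (\<lambda>w. spread (cell (X n) z w)) \<le> \<epsilon> * (q ^ j * (q ^ n * r))\<^sup>2"
proof -
  have D: "D > 0" "\<And>t N. t > 0 \<Longrightarrow> edrop q t (X N) \<ge> D" using D0 Dle by auto
  from gain_ge_spread[OF D0 Dle] obtain K c where Kc: "c > 0 \<and> (\<forall>\<rho> N Y. \<rho> > 0 \<longrightarrow> fin_pmf Y \<longrightarrow> (\<forall>x\<in>set_pmf Y. \<forall>y\<in>set_pmf Y. cmod (x - y) \<le> \<rho>)
        \<longrightarrow> gain (q ^ K * \<rho>) (X N) Y \<ge> c * spread Y / \<rho>\<^sup>2)"
    by (elim exE) (rule that)
  have c: "c > 0" using Kc ..
  have g: "gain (q ^ K * \<rho>) (X N) Y \<ge> c * spread Y / \<rho>\<^sup>2"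
    if "\<rho> > 0" "fin_pmf Y" "\<And>x y. x \<in> set_pmf Y \<Longrightarrow> y \<in> set_pmf Y \<Longrightarrow> cmod (x - y) \<le> \<rho>" for \<rho> N Y
    using Kc that by simp
  have "q\<^sup>2 < 1" using lam by (simp add: power_less_one_iff)
  \<comment> \<open>The coarse scale lies \<open>s\<close> steps above \<rho>. There the variance
    bound on the gain is multiplied by \<open>q ^ (2 * s) < c\<close>, which makes it at most half
    of the lower bound valid at the fine scale.\<close>
  then obtain s where s: "(q\<^sup>2) ^ s < c" using real_arch_pow_inv[OF c] by blast
  define e1 where "e1 = c * \<epsilon> / (2 * (real (K + s) + 1))"
  have e1: "e1 > 0" using c \<epsilon> by (simp add: e1_def)
  obtain t N0 where t: "t > 0" "edrop q t (X N0) \<le> D + e1" using inf e1 by blast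
  \<comment> \<open>With this value the coarse scale \<open>\<rho> / q ^ s\<close> equals
    \<open>q ^ n * (q ^ j * t)\<close>, so that after undoing the factor \<open>lam ^ n\<close> the
    almost minimal drop at \<open>t\<close> can be shifted to the whole window.\<close>
  define r where "r = t * q ^ s"
  have r: "r > 0" using t lam by (simp add: r_def)
  show ?thesis
  proof (intro exI[of _ r] conjI allI impI r)
    fix n j and z :: "complex \<Rightarrow> label"
    define \<rho> where "\<rho> = q ^ j * (q ^ n * r)"
    assume "\<forall>x\<in>set_pmf (X n). \<forall>y\<in>set_pmf (X n). z x = z y \<longrightarrow> cmod (x - y) \<le> q ^ j * (q ^ n * r)"
    then have diam: "\<And>x y. x \<in> set_pmf (X n) \<Longrightarrow> y \<in> set_pmf (X n) \<Longrightarrow> z x = z y \<Longrightarrow> cmod (x - y) \<le> \<rho>"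
      by (auto simp: \<rho>_def)
    have \<rho>: "\<rho> > 0" using lam r by (simp add: \<rho>_def)
    \<comment> \<open>Enough blocks for \<open>edrop_shift\<close> to lead from \<open>N0\<close> to
      each scale \<open>q ^ (i + j) * t\<close> with \<open>i < K + s\<close>; the surplus only
      lowers the drop by \<open>edrop_mono\<close>.\<close>
    define M where "M = (K + s + j) + N0"
    define A where "A = pscale (lam ^ n) (X M)"
    have A: "fin_pmf A" by (simp add: A_def)
    define S where "S = 1 / q ^ s"
    have S: "S > 0" using lam by (simp add: S_def)
    define Z where "Z = map_pmf z (X n)"
    define Y where "Y = cell (X n) z"
    have Z: "fin_pmf Z" by (simp add: Z_def)
    have Y: "fin_pmf (Y w)" if "w \<in> set_pmf Z" for w using that by (auto simp: Z_def Y_def intro: fin_cell)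
    have mix: "X (n + M) = bind_pmf Z (\<lambda>w. A \<oplus> Y w)"
    proof -
      have "X (n + M) = A \<oplus> bind_pmf Z Y" by (simp add: X_add A_def Z_def Y_def bind_cell pconv_commute)
      then show ?thesis by (simp add: pconv_def bind_assoc_pmf)
    qed
    let ?k = "q ^ K * \<rho>" and ?S = "S * \<rho>"
    have kS: "0 < ?k" "?k \<le> ?S" "0 < ?S"
    proof -
      have "q ^ K \<le> 1" "q ^ s \<le> 1" using lam by (auto simp: power_le_one)
      then have "q ^ K \<le> S" using lam by (simp add: S_def le_divide_eq mult_le_one)
      then show "?k \<le> ?S" using \<rho> by simp
    qed (use \<rho> lam S in auto)
    have E: "q ^ (K + s) * ?S = ?k" using lam by (simp add: S_def power_add)
    let ?E = "measure_pmf.expectation Z"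
    have 1: "real (K + s) * D \<le> ent ?S (X (n + M)) - ent ?k (X (n + M))"
    proof -
      have "(\<Sum>i<K + s. D) \<le> (\<Sum>i<K + s. edrop q (q ^ i * ?S) (X (n + M)))"
        using lam kS by (intro sum_mono D) auto
      also have "\<dots> = ent ?S (X (n + M)) - ent ?k (X (n + M))"
        using ent_telescope[of ?S "X (n + M)" q "K + s"] unfolding E by simp
      finally show ?thesis by simp
    qed
    have 2: "ent ?S (X (n + M)) - ent ?k (X (n + M)) \<le> ?E (\<lambda>w. ent ?S (A \<oplus> Y w)) - ?E (\<lambda>w. ent ?k (A \<oplus> Y w))"
      using ent_bind_scale[of Z "\<lambda>w. A \<oplus> Y w" ?k ?S] Z Y A kS unfolding mix by auto
    have 3: "ent ?S A - ent ?k A \<le> real (K + s) * (D + e1)"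
    proof -
      have "ent ?S A - ent ?k A = (\<Sum>i<K + s. edrop q (q ^ i * ?S) A)"
        using ent_telescope[of ?S A q "K + s"] unfolding E by simp
      also have "\<dots> \<le> (\<Sum>i<K + s. D + e1)"
      proof (rule sum_mono)
        fix i assume i: "i \<in> {..<K + s}"
        have sc: "q ^ i * ?S = cmod (lam ^ n) * (q ^ (i + j) * t)"
          using lam by (simp add: S_def \<rho>_def r_def norm_power power_add mult_ac)
        have "edrop q (q ^ i * ?S) A = edrop q (q ^ (i + j) * t) (X M)"
          unfolding sc A_def using lam t by (intro edrop_pscale) auto
        also have "\<dots> \<le> edrop q (q ^ (i + j) * t) (X ((i + j) + N0))"
          using edrop_mono[of "q ^ (i + j) * t" "(i + j) + N0" "K + s - i"] i lam t by (simp add: M_def add_ac)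
        also have "\<dots> \<le> edrop q t (X N0)" using t by (intro edrop_shift)
        also have "\<dots> \<le> D + e1" by (rule t)
        finally show "edrop q (q ^ i * ?S) A \<le> D + e1" .
      qed
      finally show ?thesis by simp
    qed
    have 4: "c / 2 * spread (Y w) / \<rho>\<^sup>2 \<le> gain ?k A (Y w) - gain ?S A (Y w)" if w: "w \<in> set_pmf Z" for w
    proof -
      have dY: "cmod (x - y) \<le> \<rho>" if "x \<in> set_pmf (Y w)" "y \<in> set_pmf (Y w)" for x y
        using that w diam by (auto simp: Y_def Z_def set_cell)
      define Y' where "Y' = pscale (1 / lam ^ n) (Y w)"
      have Y': "fin_pmf Y'" "Y w = pscale (lam ^ n) Y'" using Y[OF w] by (auto simp: Y'_def pscale_pscale)
      have "c * spread Y' / (\<rho> / q ^ n)\<^sup>2 \<le> gain (q ^ K * (\<rho> / q ^ n)) (X M) Y'"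
      proof (rule g)
        fix x y assume "x \<in> set_pmf Y'" "y \<in> set_pmf Y'"
        then obtain x' y' where "x' \<in> set_pmf (Y w)" "y' \<in> set_pmf (Y w)" "x = x' / lam ^ n" "y = y' / lam ^ n"
          by (auto simp: Y'_def pscale_def)
        then show "cmod (x - y) \<le> \<rho> / q ^ n" using dY[of x' y'] lam
          by (simp add: norm_divide norm_power divide_right_mono flip: diff_divide_distrib)
      qed (use \<rho> lam Y' in auto)
      also have "\<dots> = gain ?k A (Y w)"
        using gain_pscale[of "X M" Y' "q ^ K * (\<rho> / q ^ n)" "lam ^ n"] Y' lam \<rho> by (simp add: A_def norm_power)
      also have "c * spread Y' / (\<rho> / q ^ n)\<^sup>2 = c * spread (Y w) / \<rho>\<^sup>2"
        using lam \<rho> by (simp add: Y'_def spread_pscale norm_divide norm_power power_divide)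
      finally have gk: "c * spread (Y w) / \<rho>\<^sup>2 \<le> gain ?k A (Y w)" .
      obtain y0 where y0: "measure_pmf.expectation (Y w) (\<lambda>x. (cmod (x - y0))\<^sup>2) \<le> spread (Y w)"
        by (rule spread_center[OF Y[OF w]])
      have "gain ?S A (Y w) \<le> measure_pmf.expectation (Y w) (\<lambda>x. (cmod (x - y0))\<^sup>2) / (2 * ?S\<^sup>2)"
        by (rule gain_le_variance[OF A Y[OF w] kS(3)])
      also have "\<dots> \<le> spread (Y w) / (2 * ?S\<^sup>2)" using y0 by (simp add: divide_right_mono)
      also have "\<dots> = (q\<^sup>2) ^ s * (spread (Y w) / (2 * \<rho>\<^sup>2))"
        using lam \<rho> by (simp add: S_def power_mult_distrib power_divide power_mult[symmetric] mult_ac)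
      also have "\<dots> \<le> c * (spread (Y w) / (2 * \<rho>\<^sup>2))"
        using s by (intro mult_right_mono) (auto simp: spread_nonneg)
      finally have "gain ?S A (Y w) \<le> c * (spread (Y w) / (2 * \<rho>\<^sup>2))" .
      moreover have "c * spread (Y w) / \<rho>\<^sup>2 = c / 2 * spread (Y w) / \<rho>\<^sup>2 + c * (spread (Y w) / (2 * \<rho>\<^sup>2))"
        using \<rho> by (simp add: field_simps)
      ultimately show ?thesis using gk by linarith
    qed
    have "c / 2 / \<rho>\<^sup>2 * ?E (\<lambda>w. spread (Y w)) = ?E (\<lambda>w. c / 2 * spread (Y w) / \<rho>\<^sup>2)" by simp
    also have "\<dots> \<le> ?E (\<lambda>w. (ent ?k (A \<oplus> Y w) - ent ?S (A \<oplus> Y w)) + (ent ?S A - ent ?k A))"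
    proof (intro expectation_mono_pmf Z)
      fix w assume "w \<in> set_pmf Z"
      from 4[OF this] show "c / 2 * spread (Y w) / \<rho>\<^sup>2 \<le> (ent ?k (A \<oplus> Y w) - ent ?S (A \<oplus> Y w)) + (ent ?S A - ent ?k A)"
        unfolding gain_def by linarith
    qed
    also have "\<dots> = ?E (\<lambda>w. ent ?k (A \<oplus> Y w)) - ?E (\<lambda>w. ent ?S (A \<oplus> Y w)) + (ent ?S A - ent ?k A)"
      using Z by (simp add: integrable_fin_pmf)
    also have "\<dots> \<le> real (K + s) * e1" using 1 2 3 unfolding distrib_left by linarith
    also have "\<dots> \<le> c * \<epsilon> / 2" using c \<epsilon> by (simp add: e1_def divide_le_eq)
    finally have "c / 2 / \<rho>\<^sup>2 * ?E (\<lambda>w. spread (Y w)) \<le> c / 2 / \<rho>\<^sup>2 * (\<epsilon> * \<rho>\<^sup>2)" using \<rho> by simp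
    moreover have "c / 2 / \<rho>\<^sup>2 > 0" using c \<rho> by simp
    ultimately have "?E (\<lambda>w. spread (Y w)) \<le> \<epsilon> * \<rho>\<^sup>2" by (rule mult_left_le_imp_le)
    then show "measure_pmf.expectation (map_pmf z (X n)) (\<lambda>w. spread (cell (X n) z w)) \<le> \<epsilon> * (q ^ j * (q ^ n * r))\<^sup>2"
      by (simp add: Z_def Y_def \<rho>_def)
  qed
qed

text \<open>If the infimum \<open>D\<close> of the drops were positive, cells would be concentrated:
  labels would cost about \<open>2 * n * L\<close> for the initial grid and an arbitrarily small
  \<eta> for each of about \<open>C * n\<close> refinements down to the separation scale, less than
  the entropy \<open>n * H\<close>.\<close>

theorem full_dimension:
  assumes H: "H > - 2 * ln q" "\<And>n. shannon (X n) \<ge> real n * H"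
    and sep: "\<And>n x y. n \<ge> n0 \<Longrightarrow> x \<in> set_pmf (X n) \<Longrightarrow> y \<in> set_pmf (X n) \<Longrightarrow> x \<noteq> y \<Longrightarrow> cmod (x - y) \<ge> q ^ (C * n)"
    and e: "\<epsilon> > 0"
  shows "\<exists>t>0. \<exists>N. edrop q t (X N) < \<epsilon>"
proof (rule ccontr)
  assume neg: "\<not> ?thesis"
  define DS where "DS = {edrop q t (X N) |t N. t > 0}"
  define D where "D = Inf DS"
  have "edrop q 1 (X 0) \<in> DS" unfolding DS_def using zero_less_one by blast
  then have DS: "DS \<noteq> {}" by blast
  have lb: "\<epsilon> \<le> x" if "x \<in> DS" for x
  proof -
    from that obtain t N where "t > 0" "x = edrop q t (X N)" unfolding DS_def by blast
    then show ?thesis using neg by (meson not_le)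
  qed
  then have bdd: "bdd_below DS" by (auto simp: bdd_below_def)
  have "\<epsilon> \<le> D" unfolding D_def using DS lb by (intro cInf_greatest)
  then have D0: "D > 0" using e by simp
  have Dle: "edrop q t (X N) \<ge> D" if "t > 0" for t N
    unfolding D_def by (rule cInf_lower[OF _ bdd]) (use that in \<open>auto simp: DS_def\<close>)
  have inf: "\<exists>t>0. \<exists>N. edrop q t (X N) \<le> D + \<epsilon>'" if "\<epsilon>' > 0" for \<epsilon>'
  proof -
    have "\<exists>x\<in>DS. x < D + \<epsilon>'" unfolding D_def using cInf_lessD[OF DS, of "Inf DS + \<epsilon>'"] that by auto
    then obtain t N where "t > 0" "edrop q t (X N) < D + \<epsilon>'" unfolding DS_def by blast
    then show ?thesis by (meson less_imp_le)
  qed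
  define L where "L = - ln q"
  \<comment> \<open>All \<open>C * n\<close> refinements then cost at most half of the surplus
    \<open>n * (H - 2 * L)\<close>. The choices of \<delta> and \<open>\<epsilon>'\<close> below
    make each of the two parts of the price equal to \<open>\<eta> / 2\<close>.\<close>
  define \<eta> where "\<eta> = (H - 2 * L) / (2 * (real C + 1))"
  have \<eta>: "\<eta> > 0" using H(1) by (simp add: \<eta>_def L_def)
  define m where "m = nat \<lceil>2 / q\<rceil> + 2"
  define \<delta> where "\<delta> = 1 - exp (- \<eta> / 2)"
  have \<delta>: "0 < \<delta>" "\<delta> < 1" "- ln (1 - \<delta>) = \<eta> / 2" using \<eta> by (auto simp: \<delta>_def)
  have "real m \<ge> 2" unfolding m_def of_nat_add by linarith
  then have m1: "real (m * m) > 1" unfolding of_nat_mult by (intro less_1_mult) auto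
  have lm: "ln (real (m * m) / \<delta>) > 0" using \<delta> m1 by (intro ln_gt_zero) (simp add: less_divide_eq)
  define \<epsilon>' where "\<epsilon>' = \<eta> * q\<^sup>2 / (8 * ln (real (m * m) / \<delta>))"
  have \<epsilon>': "\<epsilon>' > 0" using \<eta> lm lam by (simp add: \<epsilon>'_def)
  have h2: "4 * \<epsilon>' / q\<^sup>2 * ln (real (m * m) / \<delta>) = \<eta> / 2"
    using lm lam unfolding \<epsilon>'_def by (simp add: field_simps)
  obtain r where r: "r > 0" and spr: "\<And>n j (z :: complex \<Rightarrow> label).
      (\<And>x y. x\<in>set_pmf (X n) \<Longrightarrow> y\<in>set_pmf (X n) \<Longrightarrow> z x = z y \<Longrightarrow> cmod (x - y) \<le> q ^ j * (q ^ n * r)) \<Longrightarrow>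
      measure_pmf.expectation (map_pmf z (X n)) (\<lambda>w. spread (cell (X n) z w)) \<le> \<epsilon>' * (q ^ j * (q ^ n * r))\<^sup>2"
  proof -
    have "\<forall>t>0. \<forall>N. edrop q t (X N) \<ge> D" "\<forall>\<epsilon>>0. \<exists>t>0. \<exists>N. edrop q t (X N) \<le> D + \<epsilon>"
      using Dle inf by auto
    from cell_spread_small[OF D0 this \<epsilon>'] obtain r where "r > 0" "\<forall>n j (z :: complex \<Rightarrow> label).
      (\<forall>x\<in>set_pmf (X n). \<forall>y\<in>set_pmf (X n). z x = z y \<longrightarrow> cmod (x - y) \<le> q ^ j * (q ^ n * r)) \<longrightarrow>
      measure_pmf.expectation (map_pmf z (X n)) (\<lambda>w. spread (cell (X n) z w)) \<le> \<epsilon>' * (q ^ j * (q ^ n * r))\<^sup>2"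
      by auto
    then show ?thesis by (intro that[of r]) simp_all
  qed
  obtain R where R: "R \<ge> 0" "\<And>n x. x \<in> set_pmf (X n) \<Longrightarrow> cmod x \<le> R" using bounded_X by blast
  \<comment> \<open>\<open>J0\<close> extra refinements compensate the factor \<open>r\<close> of
    the starting scale, which may exceed 1.\<close>
  obtain J0 where J0: "q ^ J0 < 1 / r" using real_arch_pow_inv[of "1 / r" q] r lam by auto
  define B where "B = 2 * ln (4 * R / r + 3) + real J0 * \<eta>"
  have bound: "real n * H \<le> 2 * real n * L + real (C * n) * \<eta> + B" if n: "n \<ge> n0" for n
  proof -
    have "shannon (X n) \<le> 2 * ln (4 * R / (q ^ n * r) + 3) + real (C * n + J0) * (- ln (1 - \<delta>) + 4 * \<epsilon>' / q\<^sup>2 * ln (real (m * m) / \<delta>))"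
    proof (rule shannon_le_cells[OF fin_X R(2) R(1) _ _ _ \<delta>(1,2) spr m_def])
      fix x y assume xy: "x \<in> set_pmf (X n)" "y \<in> set_pmf (X n)" "x \<noteq> y"
      have "q ^ (C * n + J0) * (q ^ n * r) = q ^ (C * n) * (q ^ n * (q ^ J0 * r))" by (simp add: power_add)
      also have "\<dots> < q ^ (C * n) * 1"
      proof (rule mult_strict_left_mono)
        have "q ^ n * (q ^ J0 * r) \<le> 1 * (q ^ J0 * r)" using lam r by (intro mult_right_mono) (auto simp: power_le_one)
        also have "\<dots> < 1" using J0 r by (simp add: less_divide_eq)
        finally show "q ^ n * (q ^ J0 * r) < 1" .
      qed (use lam in simp)
      also have "\<dots> \<le> cmod (x - y)" using sep[OF n xy] by simp
      finally show "cmod (x - y) > q ^ (C * n + J0) * (q ^ n * r)" .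
    qed (use lam r in auto)
    moreover have "ln (4 * R / (q ^ n * r) + 3) \<le> real n * L + ln (4 * R / r + 3)"
    proof -
      have qn: "0 < q ^ n" "q ^ n \<le> 1" using lam by (auto simp: power_le_one)
      have "4 * R / (q ^ n * r) + 3 \<le> (4 * R / r + 3) / q ^ n"
        using qn r R by (simp add: field_simps)
      then have "ln (4 * R / (q ^ n * r) + 3) \<le> ln ((4 * R / r + 3) / q ^ n)"
        using qn r R by (subst ln_le_cancel_iff) (auto intro!: add_nonneg_pos divide_pos_pos)
      also have "\<dots> = ln (4 * R / r + 3) - ln (q ^ n)" using qn r R by (intro ln_divide_pos) (auto intro!: add_nonneg_pos)
      finally show ?thesis using lam by (simp add: ln_realpow L_def)
    qed
    ultimately show ?thesis using H(2)[of n] unfolding \<delta>(3) h2 B_def by (simp add: algebra_simps)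
  qed
  have "real n * (\<eta> * (real C + 1)) \<le> B" if "n \<ge> n0" for n
  proof -
    have "2 * (real C + 1) > 0" by (intro mult_pos_pos add_nonneg_pos) auto
    then have "\<eta> * (2 * (real C + 1)) = H - 2 * L" unfolding \<eta>_def by (intro nonzero_eq_divide_eq[THEN iffD1]) auto
    then have "H - 2 * L = 2 * (\<eta> * (real C + 1))" by (simp add: mult_ac)
    then have "real n * (2 * (\<eta> * (real C + 1))) = real n * H - 2 * real n * L" by (metis mult.assoc mult.commute right_diff_distrib)
    moreover have "0 \<le> real n * \<eta>" using \<eta> by simp
    ultimately show ?thesis using bound[OF that] by (simp add: algebra_simps)
  qed
  moreover have pos: "\<eta> * (real C + 1) > 0" using \<eta> by (intro mult_pos_pos add_nonneg_pos) auto
  moreover obtain n1 where n1: "real n1 > B / (\<eta> * (real C + 1))" using reals_Archimedean2 by blast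
  ultimately have "real (max n0 n1) * (\<eta> * (real C + 1)) \<le> B" by simp
  moreover have "B < real n1 * (\<eta> * (real C + 1))" using n1 pos by (simp add: divide_less_eq)
  moreover have "real n1 * (\<eta> * (real C + 1)) \<le> real (max n0 n1) * (\<eta> * (real C + 1))" using pos by (intro mult_right_mono) auto
  ultimately show False by linarith
qed

end

section \<open>Moments of the mollified densities\<close>

text \<open>The mixture density is at least \<open>pmf Z z\<close> times that of the component, so
  each relative entropy in \<open>ent_bind\<close> is at most \<open>- ln (pmf Z z)\<close>.\<close>

lemma ent_bind_le_shannon:
  assumes Z: "fin_pmf Z" and Y: "\<And>z. z \<in> set_pmf Z \<Longrightarrow> fin_pmf (Y z)" and r: "r > 0"
  shows "ent r (bind_pmf Z Y) \<le> shannon Z + measure_pmf.expectation Z (\<lambda>z. ent r (Y z))"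
proof -
  let ?F = "bind_pmf Z Y"
  have F: "fin_pmf ?F" using Z Y by (rule fin_bind_pmf)
  have "relent r (Y z) ?F \<le> - ln (pmf Z z)" if z: "z \<in> set_pmf Z" for z
  proof -
    have p: "pmf Z z > 0" using z by (simp add: pmf_positive)
    have "relent r (Y z) ?F \<le> (LINT x|lborel. gsm r (measure_pmf (Y z)) x * (- ln (pmf Z z)))"
      unfolding relent_def
    proof (rule integral_mono)
      fix x
      have g: "gsm r (measure_pmf (Y z)) x > 0" "gsm r (measure_pmf ?F) x > 0" using gsm_pos Y[OF z] F r by auto
      have "pmf Z z * gsm r (measure_pmf (Y z)) x \<le> gsm r (measure_pmf ?F) x"
        using member_le_sum[of z "set_pmf Z" "\<lambda>z. pmf Z z *\<^sub>R gsm r (measure_pmf (Y z)) x"] Z z gsm_bind[of Z Y r x, OF Z Y]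
        by (simp add: pmf.gsm_nonneg expectation_fin)
      then have "ln (pmf Z z * gsm r (measure_pmf (Y z)) x) \<le> ln (gsm r (measure_pmf ?F) x)"
        using g p by (subst ln_le_cancel_iff) auto
      then have "ln (gsm r (measure_pmf (Y z)) x) - ln (gsm r (measure_pmf ?F) x) \<le> - ln (pmf Z z)"
        using g p by (simp add: ln_mult)
      then show "gsm r (measure_pmf (Y z)) x * (ln (gsm r (measure_pmf (Y z)) x) - ln (gsm r (measure_pmf ?F) x))
          \<le> gsm r (measure_pmf (Y z)) x * (- ln (pmf Z z))"
        using g by (intro mult_left_mono) auto
    qed (use Y[OF z] F r in \<open>auto intro!: relent_integrable integrable_gsm\<close>)
    also have "\<dots> = - ln (pmf Z z)" using integral_gsm[OF Y[OF z] r] by simp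
    finally show ?thesis .
  qed
  then have "measure_pmf.expectation Z (\<lambda>z. relent r (Y z) ?F) \<le> measure_pmf.expectation Z (\<lambda>z. - ln (pmf Z z))"
    by (intro expectation_mono_pmf Z)
  also have "\<dots> = shannon Z" using Z by (simp add: shannon_def expectation_fin sum_negf)
  finally show ?thesis using ent_bind[of Z Y r, OF Z Y r] by simp
qed

text \<open>Tangent of the power function at the value \<open>S\<close> of the sum. Missing mass is
  harmless: it contributes the nonnegative term
  \<open>(p - 1) * S powr p * (1 - sum w A)\<close>.\<close>

lemma powr_jensen_sub:
  fixes w t :: "'a \<Rightarrow> real"
  assumes A: "finite A" and w: "\<And>i. i \<in> A \<Longrightarrow> w i \<ge> 0" "sum w A \<le> 1" and t: "\<And>i. i \<in> A \<Longrightarrow> t i \<ge> 0" and p: "p \<ge> 1"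
  shows "(\<Sum>i\<in>A. w i * t i) powr p \<le> (\<Sum>i\<in>A. w i * t i powr p)"
proof -
  define S where "S = (\<Sum>i\<in>A. w i * t i)"
  have S0: "S \<ge> 0" unfolding S_def using w t by (intro sum_nonneg mult_nonneg_nonneg) auto
  show ?thesis
  proof (cases "S = 0")
    case True
    then show ?thesis using w unfolding S_def[symmetric] by (auto intro!: sum_nonneg mult_nonneg_nonneg)
  next
    case False
    then have S: "S > 0" using S0 by simp
    have tan: "S powr p + p * S powr (p - 1) * (x - S) \<le> x powr p" if "x \<ge> 0" for x
    proof (cases "x = 0")
      case True
      have "S powr (p - 1) * S = S powr p" using S powr_mult_base[of S "p - 1"] by (simp add: mult.commute)
      then have "S powr p + p * S powr (p - 1) * (x - S) = (1 - p) * S powr p" unfolding True by (simp add: algebra_simps)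
      also have "\<dots> \<le> 0" using p by (simp add: mult_nonpos_nonneg)
      finally show ?thesis using True by simp
    next
      case False
      then have x: "x > 0" using that by simp
      have "x powr p - S powr p \<ge> p * S powr (p - 1) * (x - S)"
      proof (rule convex_on_imp_above_tangent[OF powr_convex[OF p]])
        show "((\<lambda>x. x powr p) has_field_derivative p * S powr (p - 1)) (at S within {0<..})"
          using S by (auto intro!: derivative_eq_intros)
      qed (use x S in \<open>auto simp: interior_open\<close>)
      then show ?thesis by simp
    qed
    have "S powr p \<le> S powr p + (p - 1) * S powr p * (1 - sum w A)" using p w by simp
    also have "\<dots> = sum w A * S powr p + p * S powr (p - 1) * (S - sum w A * S)"
    proof -
      have "S powr (p - 1) * S = S powr p" using S powr_mult_base[of S "p - 1"] by (simp add: mult.commute)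
      then have "S powr (p - 1) * (S - sum w A * S) = S powr p - sum w A * S powr p"
        by (simp add: right_diff_distrib mult.assoc[symmetric] mult.commute)
      then have "p * S powr (p - 1) * (S - sum w A * S) = p * (S powr p - sum w A * S powr p)" by (simp only: mult.assoc)
      then show ?thesis by (simp add: algebra_simps)
    qed
    also have "\<dots> = (\<Sum>i\<in>A. w i * (S powr p + p * S powr (p - 1) * (t i - S)))"
    proof -
      have "(\<Sum>i\<in>A. w i * (a + b * (t i - c))) = sum w A * a + b * ((\<Sum>i\<in>A. w i * t i) - sum w A * c)" for a b c
        by (simp add: algebra_simps sum.distrib sum_subtractf sum_distrib_left sum_distrib_right)
      then show ?thesis by (simp only: S_def[symmetric])
    qed
    also have "\<dots> \<le> (\<Sum>i\<in>A. w i * t i powr p)"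
      using w t tan by (intro sum_mono mult_left_mono) auto
    finally show ?thesis by (simp add: S_def)
  qed
qed


text \<open>Moments are taken of disc averages and not of Gaussian ones: with compact support only
  the cells near a point enter the density there, as \<open>dens_moment_conv\<close>
  requires.\<close>

definition disc :: "real \<Rightarrow> complex \<Rightarrow> real" where
  "disc r z = indicator (ball 0 r) z / (pi * r\<^sup>2)"

lemma disc_nonneg: "disc r z \<ge> 0"
  by (simp add: disc_def)

lemma measurable_disc[measurable]: "disc r \<in> borel_measurable borel"
  unfolding disc_def[abs_def] by (intro borel_measurable_divide borel_measurable_indicator borel_measurable_const) auto

lemma disc_le: "r > 0 \<Longrightarrow> disc r z \<le> 1 / (pi * r\<^sup>2)"
  by (simp add: disc_def indicator_def)

lemma emeasure_ball_complex: "r \<ge> 0 \<Longrightarrow> emeasure lborel (ball (0::complex) r) = ennreal (pi * r\<^sup>2)"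
  by (simp add: emeasure_ball unit_ball_vol_2)

lemma integrable_disc: "r > 0 \<Longrightarrow> integrable lborel (disc r)"
  unfolding disc_def
  by (intro integrable_divide integrable_real_indicator) (auto simp: emeasure_ball_complex)

lemma integral_disc: "r > 0 \<Longrightarrow> (LINT z|lborel. disc r z) = 1"
  unfolding disc_def by (simp add: measure_def emeasure_ball_complex)

lemma disc_scale:
  assumes "c \<noteq> 0" "r > 0" shows "disc (cmod c * r) (c * z) = disc r z / (cmod c)\<^sup>2"
  using assms by (simp add: disc_def indicator_def norm_mult power_mult_distrib)

definition dens :: "real \<Rightarrow> complex pmf \<Rightarrow> complex \<Rightarrow> real" where
  "dens r A x = measure_pmf.expectation A (\<lambda>y. disc r (x - y))"

lemma dens_nonneg: "dens r A x \<ge> 0"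
  by (simp add: dens_def disc_nonneg)

lemma measurable_dens: "fin_pmf A \<Longrightarrow> dens r A \<in> borel_measurable borel"
proof -
  assume "fin_pmf A"
  then have "dens r A = (\<lambda>x. \<Sum>y\<in>set_pmf A. pmf A y * disc r (x - y))" by (simp add: dens_def fun_eq_iff expectation_fin)
  then show ?thesis by simp
qed

lemma dens_le: "fin_pmf A \<Longrightarrow> r > 0 \<Longrightarrow> dens r A x \<le> 1 / (pi * r\<^sup>2)"
  unfolding dens_def by (rule measure_pmf.integral_le_const) (auto intro: integrable_fin_pmf disc_le)

lemma dens_eq_0:
  assumes A: "fin_pmf A" "\<And>y. y \<in> set_pmf A \<Longrightarrow> cmod y \<le> R" and x: "cmod x \<ge> R + r"
  shows "dens r A x = 0"
proof -
  have "disc r (x - y) = 0" if "y \<in> set_pmf A" for y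
    using A(2)[OF that] x norm_triangle_ineq2[of x y] by (simp add: disc_def)
  then show ?thesis using A by (simp add: dens_def expectation_fin)
qed

lemma dens_conv:
  assumes A: "fin_pmf A" "fin_pmf B" and c: "c \<noteq> 0" "r > 0"
  shows "dens (cmod c * r) (A \<oplus> pscale c B) x = measure_pmf.expectation A (\<lambda>y. dens r B ((x - y) / c) / (cmod c)\<^sup>2)"
proof -
  have "dens (cmod c * r) (A \<oplus> pscale c B) x = measure_pmf.expectation (pscale c B \<oplus> A) (\<lambda>y. disc (cmod c * r) (x - y))"
    by (simp add: dens_def pconv_commute)
  also have "\<dots> = measure_pmf.expectation A (\<lambda>a. measure_pmf.expectation B (\<lambda>b. disc (cmod c * r) (x - (c * b + a))))"
    using A by (subst expectation_pconv) (auto simp: pscale_def)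
  also have "\<dots> = measure_pmf.expectation A (\<lambda>y. dens r B ((x - y) / c) / (cmod c)\<^sup>2)"
  proof -
    have "disc (cmod c * r) (x - (c * b + a)) = disc r ((x - a) / c - b) / (cmod c)\<^sup>2" for a b
    proof -
      have "x - (c * b + a) = c * ((x - a) / c - b)" using c by (simp add: field_simps)
      then show ?thesis by (simp only: disc_scale[OF c])
    qed
    then show ?thesis by (simp add: dens_def)
  qed
  finally show ?thesis .
qed

lemma dens_powr_integrable:
  assumes A: "fin_pmf A" and r: "r > 0" and p: "p \<ge> 1"
  shows "integrable lborel (\<lambda>x. dens r A x powr p)"
proof -
  define R where "R = Max (insert 0 (cmod ` set_pmf A))"
  have R: "R \<ge> 0" "\<And>x. x \<in> set_pmf A \<Longrightarrow> cmod x \<le> R" using A by (auto simp: R_def intro!: Max_ge)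
  define K where "K = (1 / (pi * r\<^sup>2)) powr p"
  show ?thesis
  proof (rule Bochner_Integration.integrable_bound[of _ "\<lambda>x. K * indicator (ball 0 (R + r)) x"])
    show "integrable lborel (\<lambda>x::complex. K * indicator (ball 0 (R + r)) x :: real)"
      using R r emeasure_ball_complex[of "R + r"] by (intro integrable_mult_right integrable_real_indicator) auto
    show "AE x in lborel. norm (dens r A x powr p) \<le> norm (K * indicator (ball 0 (R + r)) x :: real)"
    proof (intro AE_I2)
      fix x show "norm (dens r A x powr p) \<le> norm (K * indicator (ball 0 (R + r)) x :: real)"
      proof (cases "cmod x < R + r")
        case True
        then show ?thesis using dens_le[OF A r, of x] dens_nonneg[of r A x] p
          by (auto simp: K_def intro!: powr_mono2)
      next
        case False
        then show ?thesis using dens_eq_0[OF A R(2), of r x] by simp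
      qed
    qed
    show "(\<lambda>x. dens r A x powr p) \<in> borel_measurable lborel"
      using measurable_dens[OF A] by (intro powr_real_measurable) simp_all
  qed
qed

definition sq_cell :: "real \<Rightarrow> complex \<Rightarrow> int \<times> int" where
  "sq_cell r x = (\<lfloor>Re x / r\<rfloor>, \<lfloor>Im x / r\<rfloor>)"

lemma sq_cell_diam:
  assumes "r > 0" "sq_cell r x = sq_cell r y" shows "cmod (x - y) \<le> 2 * r"
proof -
  have "\<lfloor>Re x / r\<rfloor> = \<lfloor>Re y / r\<rfloor>" "\<lfloor>Im x / r\<rfloor> = \<lfloor>Im y / r\<rfloor>" using assms by (auto simp: sq_cell_def)
  then have "\<bar>Re x / r - Re y / r\<bar> \<le> 1" "\<bar>Im x / r - Im y / r\<bar> \<le> 1" by linarith+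
  then have "\<bar>Re (x - y)\<bar> \<le> r" "\<bar>Im (x - y)\<bar> \<le> r" using assms by (simp_all add: divide_le_eq abs_divide flip: diff_divide_distrib)
  then show ?thesis using cmod_le[of "x - y"] by simp
qed

lemma sq_cell_near:
  assumes r: "r > 0" and B: "B \<ge> 0"
  shows "finite {sq_cell r y |y. cmod (x - y) < B * r}" "real (card {sq_cell r y |y. cmod (x - y) < B * r}) \<le> (2 * B + 3)\<^sup>2"
proof -
  define k where "k = \<lceil>B\<rceil>"
  let ?I = "\<lambda>u. {\<lfloor>u / r\<rfloor> - k..\<lfloor>u / r\<rfloor> + k}"
  have k: "0 \<le> k" "B \<le> of_int k" "of_int k \<le> B + 1" using B unfolding k_def by linarith+
  have key: "\<lfloor>v / r\<rfloor> \<in> ?I u" if "\<bar>u - v\<bar> < B * r" for u v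
  proof -
    have "\<bar>u / r - v / r\<bar> = \<bar>u - v\<bar> / r" using r by (simp flip: diff_divide_distrib)
    also have "\<dots> < B" using that r by (simp add: divide_less_eq)
    finally have b: "\<bar>u / r - v / r\<bar> < of_int k" using k(2) by linarith
    then have "v / r \<le> u / r + of_int k" "u / r - of_int k \<le> v / r" by linarith+
    from this[THEN floor_mono] show ?thesis by simp
  qed
  have sub: "{sq_cell r y |y. cmod (x - y) < B * r} \<subseteq> ?I (Re x) \<times> ?I (Im x)"
  proof safe
    fix a b y assume "(a, b) = sq_cell r y" and y: "cmod (x - y) < B * r"
    then have ab: "a = \<lfloor>Re y / r\<rfloor>" "b = \<lfloor>Im y / r\<rfloor>" by (auto simp: sq_cell_def)
    have "\<bar>Re x - Re y\<bar> < B * r" "\<bar>Im x - Im y\<bar> < B * r"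
      using abs_Re_le_cmod[of "x - y"] abs_Im_le_cmod[of "x - y"] y by auto
    then show "a \<in> ?I (Re x)" "b \<in> ?I (Im x)" unfolding ab by (auto dest!: key)
  qed
  then show "finite {sq_cell r y |y. cmod (x - y) < B * r}" by (rule finite_subset) auto
  have "card {sq_cell r y |y. cmod (x - y) < B * r} \<le> card (?I (Re x) \<times> ?I (Im x))" by (rule card_mono[OF _ sub]) auto
  also have "\<dots> = nat (2 * k + 1) * nat (2 * k + 1)" by (simp add: card_cartesian_product algebra_simps)
  finally have "real (card {sq_cell r y |y. cmod (x - y) < B * r}) \<le> real (nat (2 * k + 1) * nat (2 * k + 1))" by (simp only: of_nat_le_iff)
  also have "\<dots> = (2 * of_int k + 1)\<^sup>2" using k by (simp add: power2_eq_square)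
  also have "\<dots> \<le> (2 * B + 3)\<^sup>2" using k by (intro power_mono) auto
  finally show "real (card {sq_cell r y |y. cmod (x - y) < B * r}) \<le> (2 * B + 3)\<^sup>2" .
qed

text \<open>Submultiplicativity of the moments: only the boundedly many cells near \<open>x\<close> contribute to the
  density at \<open>x\<close>, and Jensen's inequality is applied with the conditional weights of these cells.\<close>

lemma dens_moment_conv:
  assumes A: "fin_pmf A" and B: "fin_pmf B" "\<And>y. y \<in> set_pmf B \<Longrightarrow> cmod y \<le> R" and R: "R \<ge> 0"
    and c: "c \<noteq> 0" and r: "0 < r" "r \<le> 1" and s: "s > 0"
    and K: "K = (2 * (R + 1) + 3)\<^sup>2"
  shows "(LINT x|lborel. dens (cmod c * r) (A \<oplus> pscale c B) x powr (1 + s))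
    \<le> measure_pmf.expectation A (\<lambda>y. (K * pmf (map_pmf (sq_cell (cmod c)) A) (sq_cell (cmod c) y) / (cmod c)\<^sup>2) powr s)
       * (LINT x|lborel. dens r B x powr (1 + s))"
proof -
  let ?n = "cmod c"
  define \<pi> where "\<pi> y = pmf (map_pmf (sq_cell ?n) A) (sq_cell ?n y)" for y
  let ?f = "dens r B"
  have n: "?n > 0" using c by simp
  have K0: "K > 0" using R unfolding K by (intro zero_less_power add_nonneg_pos) auto
  have pi0: "\<pi> y > 0" if "y \<in> set_pmf A" for y
    unfolding \<pi>_def by (rule pmf_positive) (use that in auto)
  have pw: "dens (?n * r) (A \<oplus> pscale c B) x powr (1 + s)
      \<le> (\<Sum>y\<in>set_pmf A. pmf A y * ((K * \<pi> y / ?n\<^sup>2) powr s / ?n\<^sup>2) * ?f ((x - y) / c) powr (1 + s))" for x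
  proof -
    define N where "N = {y \<in> set_pmf A. cmod (x - y) < (R + 1) * ?n}"
    have fN: "finite N" using A by (simp add: N_def)
    have far: "?f ((x - y) / c) = 0" if "y \<in> set_pmf A - N" for y
    proof -
      have "(R + 1) * ?n \<le> cmod (x - y)" using that by (auto simp: N_def)
      then have "R + 1 \<le> cmod ((x - y) / c)" using n by (simp add: norm_divide le_divide_eq)
      then show ?thesis using r by (intro dens_eq_0[OF B]) auto
    qed
    \<comment> \<open>Within one cell \<open>pmf A y / \<pi> y\<close> sums to at most 1, and the
      points of \<open>N\<close> occupy at most \<open>K\<close> cells, so \<open>w\<close> has
      total mass at most 1. The values \<open>t\<close> carry the compensating factor.\<close>
    define w where "w y = pmf A y / (K * \<pi> y)" for y
    define t where "t y = K * \<pi> y / ?n\<^sup>2 * ?f ((x - y) / c)" for y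
    have wt: "w y * t y = pmf A y * (?f ((x - y) / c) / ?n\<^sup>2)" if "y \<in> set_pmf A" for y
      using pi0[OF that] K0 by (simp add: w_def t_def)
    have "dens (?n * r) (A \<oplus> pscale c B) x = (\<Sum>y\<in>set_pmf A. pmf A y * (?f ((x - y) / c) / ?n\<^sup>2))"
      using dens_conv[OF A B(1) c r(1), of x] A by (simp add: expectation_fin sum_divide_distrib)
    also have "\<dots> = (\<Sum>y\<in>N. w y * t y)"
      by (rule sum.mono_neutral_cong_right[OF A]) (use far wt in \<open>auto simp: N_def\<close>)
    finally have d: "dens (?n * r) (A \<oplus> pscale c B) x = (\<Sum>y\<in>N. w y * t y)" .
    have wN: "sum w N \<le> 1"
    proof -
      define C where "C = sq_cell ?n ` N"
      have fC: "finite C" using fN by (simp add: C_def)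
      have "sum w N = (\<Sum>v\<in>C. \<Sum>y\<in>{y\<in>N. sq_cell ?n y = v}. w y)"
        by (rule sum.group[symmetric]) (auto simp: fN C_def)
      also have "\<dots> \<le> (\<Sum>v\<in>C. 1 / K)"
      proof (rule sum_mono)
        fix v assume v: "v \<in> C"
        define P where "P = pmf (map_pmf (sq_cell ?n) A) v"
        obtain y0 where "y0 \<in> N" "v = sq_cell ?n y0" using v by (auto simp: C_def)
        then have P0: "P > 0" using pi0[of y0] by (simp add: P_def \<pi>_def N_def)
        have "(\<Sum>y\<in>{y\<in>N. sq_cell ?n y = v}. w y) = (\<Sum>y\<in>{y\<in>N. sq_cell ?n y = v}. pmf A y) / (K * P)"
          by (simp add: w_def \<pi>_def P_def sum_divide_distrib)
        also have "(\<Sum>y\<in>{y\<in>N. sq_cell ?n y = v}. pmf A y) \<le> P"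
        proof -
          have "(\<Sum>y\<in>{y\<in>N. sq_cell ?n y = v}. pmf A y) = measure_pmf.prob A {y\<in>N. sq_cell ?n y = v}"
            using fN by (simp add: measure_measure_pmf_finite)
          also have "\<dots> \<le> measure_pmf.prob A (sq_cell ?n -` {v})" by (rule measure_pmf.finite_measure_mono) auto
          finally show ?thesis by (simp add: P_def pmf_map)
        qed
        then show "(\<Sum>y\<in>{y\<in>N. sq_cell ?n y = v}. w y) \<le> 1 / K" using calculation P0 K0 by (simp add: divide_le_eq)
      qed
      also have "\<dots> = real (card C) / K" by simp
      also have "\<dots> \<le> 1"
      proof -
        have "C \<subseteq> {sq_cell ?n y |y. cmod (x - y) < (R + 1) * ?n}" by (auto simp: C_def N_def)
        then have "card C \<le> card {sq_cell ?n y |y. cmod (x - y) < (R + 1) * ?n}"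
          by (rule card_mono[OF sq_cell_near(1)[OF n], rotated]) (use R in auto)
        then have "real (card C) \<le> K" using sq_cell_near(2)[OF n, of "R + 1" x] R unfolding K by linarith
        then show ?thesis using K0 by simp
      qed
      finally show ?thesis .
    qed
    have "(\<Sum>y\<in>N. w y * t y) powr (1 + s) \<le> (\<Sum>y\<in>N. w y * t y powr (1 + s))"
      by (rule powr_jensen_sub[OF fN]) (use wN K0 s in \<open>auto simp: w_def t_def N_def \<pi>_def dens_nonneg\<close>)
    also have "\<dots> \<le> (\<Sum>y\<in>set_pmf A. w y * t y powr (1 + s))"
      using A K0 by (intro sum_mono2) (auto simp: N_def w_def \<pi>_def)
    also have "\<dots> = (\<Sum>y\<in>set_pmf A. pmf A y * ((K * \<pi> y / ?n\<^sup>2) powr s / ?n\<^sup>2) * ?f ((x - y) / c) powr (1 + s))"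
    proof (rule sum.cong[OF refl])
      fix y assume y: "y \<in> set_pmf A"
      let ?k = "K * \<pi> y / ?n\<^sup>2"
      have k: "?k > 0" using K0 pi0[OF y] n by simp
      have "t y powr (1 + s) = ?k powr (1 + s) * ?f ((x - y) / c) powr (1 + s)"
        unfolding t_def by (rule powr_mult)
      also have "?k powr (1 + s) = ?k powr 1 * ?k powr s" by (rule powr_add)
      also have "?k powr 1 = ?k" using k by (intro powr_one) simp
      finally show "w y * t y powr (1 + s) = pmf A y * (?k powr s / ?n\<^sup>2) * ?f ((x - y) / c) powr (1 + s)"
        using K0 pi0[OF y] by (simp add: w_def)
    qed
    finally show ?thesis by (simp add: d)
  qed
  have int: "integrable lborel (\<lambda>x. ?f ((x - y) / c) powr (1 + s))" 
    and val: "(LINT x|lborel. ?f ((x - y) / c) powr (1 + s)) = ?n\<^sup>2 * (LINT x|lborel. ?f x powr (1 + s))" for y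
  proof -
    have i: "integrable lborel (\<lambda>x. ?f x powr (1 + s))" using s by (intro dens_powr_integrable B r) auto
    have [measurable]: "?f \<in> borel_measurable borel" by (rule measurable_dens[OF B(1)])
    have "integrable lborel (\<lambda>x. ?f (1 / c * x) powr (1 + s))"
      using integrable_complex_mult[of "1 / c", OF _ i] c by simp
    from integrable_complex_translate[OF this, of y] show "integrable lborel (\<lambda>x. ?f ((x - y) / c) powr (1 + s))" by simp
    have "(LINT x|lborel. ?f ((x - y) / c) powr (1 + s)) = (LINT x|lborel. ?f (1 / c * x) powr (1 + s))"
      using integral_complex_translate[of "\<lambda>x. ?f (1 / c * x) powr (1 + s)" y] by simp
    also have "\<dots> = ?n\<^sup>2 * (LINT x|lborel. ?f x powr (1 + s))"
      using integral_complex_mult[of "1 / c" "\<lambda>x. ?f x powr (1 + s)"] c by (simp add: norm_divide power_divide)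
    finally show "(LINT x|lborel. ?f ((x - y) / c) powr (1 + s)) = ?n\<^sup>2 * (LINT x|lborel. ?f x powr (1 + s))" .
  qed
  have "(LINT x|lborel. dens (?n * r) (A \<oplus> pscale c B) x powr (1 + s))
     \<le> (LINT x|lborel. (\<Sum>y\<in>set_pmf A. pmf A y * ((K * \<pi> y / ?n\<^sup>2) powr s / ?n\<^sup>2) * ?f ((x - y) / c) powr (1 + s)))"
    using A B c r n s int by (intro integral_mono pw dens_powr_integrable Bochner_Integration.integrable_sum integrable_mult_right) auto
  also have "\<dots> = (\<Sum>y\<in>set_pmf A. pmf A y * ((K * \<pi> y / ?n\<^sup>2) powr s / ?n\<^sup>2) * (?n\<^sup>2 * (LINT x|lborel. ?f x powr (1 + s))))"
    by (subst Bochner_Integration.integral_sum) (use int val in auto)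
  also have "\<dots> = (\<Sum>y\<in>set_pmf A. pmf A y * (K * \<pi> y / ?n\<^sup>2) powr s) * (LINT x|lborel. ?f x powr (1 + s))"
    using n by (simp add: sum_distrib_right sum_distrib_left mult_ac)
  finally show ?thesis using A by (simp add: expectation_fin \<pi>_def)
qed


context selfsim_seq
begin

text \<open>A small drop persists at all finer scales by \<open>edrop_shift\<close>, so the entropy
  at scale \<open>q ^ n * t\<close> is at most \<open>n * \<epsilon>\<close> below that at
  \<open>t\<close>. The later digits and the position inside a cell of side \<open>q ^ n\<close>
  account for bounded amounts; the term \<open>- 2 * ln q\<close> comes from the entropy of the
  Gaussian noise itself.\<close>

lemma shannon_cells_ge:
  assumes FD: "\<forall>\<epsilon>>0. \<exists>t>0. \<exists>N. edrop q t (X N) < \<epsilon>" and \<epsilon>: "\<epsilon> > 0"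
  shows "\<exists>C. \<forall>n. shannon (map_pmf (sq_cell (q ^ n)) (X n)) \<ge> real n * (- 2 * ln q - \<epsilon>) - C"
proof -
  obtain t N0 where t: "t > 0" "edrop q t (X N0) < \<epsilon>" using FD \<epsilon> by meson
  obtain R where R: "R \<ge> 0" "\<And>n x. x \<in> set_pmf (X n) \<Longrightarrow> cmod x \<le> R" using bounded_X by meson
  define C where "C = R\<^sup>2 / (2 * t\<^sup>2) + 2 / t\<^sup>2"
  have "shannon (map_pmf (sq_cell (q ^ n)) (X n)) \<ge> real n * (- 2 * ln q - \<epsilon>) - C" for n
  proof -
    define s where "s = q ^ n * t"
    have s: "s > 0" using t lam by (simp add: s_def)
    have 1: "ent t (X (n + N0)) - ent s (X (n + N0)) \<le> real n * \<epsilon>"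
    proof -
      have "ent t (X (n + N0)) - ent s (X (n + N0)) = (\<Sum>i<n. edrop q (q ^ i * t) (X (n + N0)))"
        unfolding s_def by (rule ent_telescope)
      also have "\<dots> \<le> (\<Sum>i<n. \<epsilon>)"
      proof (rule sum_mono)
        fix i assume i: "i \<in> {..<n}"
        have "n + N0 = (i + N0) + (n - i)" using i by simp
        then have "edrop q (q ^ i * t) (X (n + N0)) = edrop q (q ^ i * t) (X ((i + N0) + (n - i)))" by (simp only:)
        also have "\<dots> \<le> edrop q (q ^ i * t) (X (i + N0))" using t lam by (intro edrop_mono) simp
        also have "\<dots> \<le> edrop q t (X N0)" by (rule edrop_shift[OF t(1)])
        finally show "edrop q (q ^ i * t) (X (n + N0)) \<le> \<epsilon>" using t by simp
      qed
      finally show ?thesis by simp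
    qed
    have 2: "ent t (return_pmf 0) \<le> ent t (X (n + N0))"
      using gain_nonneg[of "return_pmf 0" "X (n + N0)" t] t by (simp add: gain_def)
    have 3: "ent s (X (n + N0)) \<le> ent s (X n) + R\<^sup>2 / (2 * t\<^sup>2)"
    proof -
      have "gain s (X n) (pscale (lam ^ n) (X N0)) \<le> measure_pmf.expectation (pscale (lam ^ n) (X N0)) (\<lambda>b. (cmod (b - 0))\<^sup>2) / (2 * s\<^sup>2)"
        using s by (intro gain_le_variance) auto
      also have "measure_pmf.expectation (pscale (lam ^ n) (X N0)) (\<lambda>b. (cmod (b - 0))\<^sup>2) \<le> measure_pmf.expectation (pscale (lam ^ n) (X N0)) (\<lambda>b. (q ^ n * R)\<^sup>2)"
        using lam R by (intro expectation_mono_pmf power_mono) (auto simp: pscale_def norm_mult norm_power)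
      finally have "gain s (X n) (pscale (lam ^ n) (X N0)) \<le> (q ^ n * R)\<^sup>2 / (2 * s\<^sup>2)" by (simp add: divide_right_mono)
      also have "\<dots> = R\<^sup>2 / (2 * t\<^sup>2)" using lam t by (simp add: s_def power_mult_distrib)
      finally show ?thesis by (simp add: gain_def X_add)
    qed
    define Z where "Z = map_pmf (sq_cell (q ^ n)) (X n)"
    have 4: "ent s (X n) \<le> shannon Z + (ent s (return_pmf 0) + 2 / t\<^sup>2)"
    proof -
      have Z: "fin_pmf Z" by (simp add: Z_def)
      have Y: "fin_pmf (cell (X n) (sq_cell (q ^ n)) w)" if "w \<in> set_pmf Z" for w using that by (auto simp: Z_def intro: fin_cell)
      have e: "ent s (cell (X n) (sq_cell (q ^ n)) w) \<le> ent s (return_pmf 0) + 2 / t\<^sup>2" if w: "w \<in> set_pmf Z" for w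
      proof -
        have w': "w \<in> sq_cell (q ^ n) ` set_pmf (X n)" using w by (simp add: Z_def)
        then obtain c where c: "c \<in> set_pmf (X n)" "w = sq_cell (q ^ n) c" by auto
        let ?Y = "cell (X n) (sq_cell (q ^ n)) w"
        have "gain s (return_pmf 0) ?Y \<le> measure_pmf.expectation ?Y (\<lambda>b. (cmod (b - c))\<^sup>2) / (2 * s\<^sup>2)"
          using s Y[OF w] by (intro gain_le_variance) auto
        also have "measure_pmf.expectation ?Y (\<lambda>b. (cmod (b - c))\<^sup>2) \<le> measure_pmf.expectation ?Y (\<lambda>b. (2 * q ^ n)\<^sup>2)"
          using lam by (intro expectation_mono_pmf Y[OF w] power_mono sq_cell_diam) (use set_cell[OF w'] c in auto)
        finally have "gain s (return_pmf 0) ?Y \<le> (2 * q ^ n)\<^sup>2 / (2 * s\<^sup>2)" by (simp add: divide_right_mono)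
        also have "\<dots> = 2 / t\<^sup>2" using lam t by (simp add: s_def power_mult_distrib)
        finally show ?thesis by (simp add: gain_def)
      qed
      have "ent s (X n) = ent s (bind_pmf Z (cell (X n) (sq_cell (q ^ n))))" by (simp add: Z_def bind_cell)
      also have "\<dots> \<le> shannon Z + measure_pmf.expectation Z (\<lambda>w. ent s (cell (X n) (sq_cell (q ^ n)) w))"
        by (rule ent_bind_le_shannon[OF Z Y s])
      also have "measure_pmf.expectation Z (\<lambda>w. ent s (cell (X n) (sq_cell (q ^ n)) w)) \<le> measure_pmf.expectation Z (\<lambda>w. ent s (return_pmf 0) + 2 / t\<^sup>2)"
        by (rule expectation_mono_pmf[OF Z e])
      finally show ?thesis by simp
    qed
    have 5: "ent s (return_pmf 0) = ent t (return_pmf 0) + 2 * (real n * ln q)"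
      using ent_return_scale[OF s] ent_return_scale[OF t(1)] t lam by (simp add: s_def ln_mult ln_realpow)
    show ?thesis using 1 2 3 4 5 by (simp add: Z_def C_def algebra_simps)
  qed
  then show ?thesis by blast
qed

text \<open>The auxiliary function \<open>g\<close> vanishes at 0, where its derivative is the mean
  of \<open>v\<close> minus \<open>T\<close>, hence negative.\<close>

lemma exp_moment_small:
  fixes v :: "'a \<Rightarrow> real"
  assumes A: "fin_pmf A" and v: "measure_pmf.expectation A v < T"
  shows "\<exists>s. 0 < s \<and> s \<le> 1 \<and> measure_pmf.expectation A (\<lambda>y. exp (s * v y)) \<le> exp (s * T)"
proof -
  define g where "g s = (\<Sum>y\<in>set_pmf A. pmf A y * exp (s * v y)) - 1 - s * T" for s
  have "(g has_real_derivative (\<Sum>y\<in>set_pmf A. pmf A y * v y) - T) (at 0)"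
    unfolding g_def by (auto intro!: derivative_eq_intros sum.cong)
  moreover have "(\<Sum>y\<in>set_pmf A. pmf A y * v y) - T < 0" using v A by (simp add: expectation_fin)
  ultimately obtain d where d: "d > 0" "\<And>h. h > 0 \<Longrightarrow> h < d \<Longrightarrow> g (0 + h) < g 0"
    using DERIV_neg_dec_right by blast
  define s where "s = min 1 (d / 2)"
  have s: "0 < s" "s \<le> 1" "s < d" using d(1) by (auto simp: s_def)
  have "g 0 = 0" using sum_pmf_eq_1[OF A order_refl] by (simp add: g_def)
  then have "(\<Sum>y\<in>set_pmf A. pmf A y * exp (s * v y)) \<le> 1 + s * T" using d(2)[OF s(1,3)] by (simp add: g_def)
  also have "\<dots> \<le> exp (s * T)" by (rule exp_ge_add_one_self)
  finally show ?thesis using s A by (intro exI[of _ s]) (simp add: expectation_fin)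
qed

text \<open>The factor in \<open>dens_moment_conv\<close> is the exponential moment of
  \<open>v\<close>, whose mean \<open>ln K - 2 * n * ln q - shannon Z\<close> is below
  \<open>n * \<epsilon>\<close> by the cell entropy bound. A small exponent \<open>s\<close>
  preserves this, and the factors of successive blocks of length \<open>n\<close> multiply.\<close>

theorem dens_moments:
  assumes FD: "\<forall>\<epsilon>>0. \<exists>t>0. \<exists>N. edrop q t (X N) < \<epsilon>" and \<epsilon>: "\<epsilon> > 0"
  shows "\<exists>n s. n \<ge> 1 \<and> 0 < s \<and> s \<le> 1 \<and>
    (\<forall>k. (LINT x|lborel. dens (q ^ (k * n)) (X (k * n)) x powr (1 + s)) \<le> exp (s * \<epsilon> * real (k * n)))"
proof -
  obtain R where R: "R \<ge> 0" "\<And>n x. x \<in> set_pmf (X n) \<Longrightarrow> cmod x \<le> R" using bounded_X by meson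
  define K where "K = (2 * (R + 1) + 3)\<^sup>2"
  have K: "K > 0" using R unfolding K_def by (intro zero_less_power add_nonneg_pos) auto
  obtain C where C: "\<And>n. shannon (map_pmf (sq_cell (q ^ n)) (X n)) \<ge> real n * (- 2 * ln q - \<epsilon> / 2) - C"
    using shannon_cells_ge[OF FD, of "\<epsilon> / 2"] \<epsilon> by auto
  \<comment> \<open>The block is so long that half of \<epsilon> absorbs the constants
    \<open>ln K\<close> and \<open>C\<close>, which recur in every block.\<close>
  obtain n0 where n0: "real n0 > 2 * (ln K + C) / \<epsilon>" using reals_Archimedean2 by blast
  define n where "n = Suc n0"
  have n: "n \<ge> 1" "ln K + C < real n * (\<epsilon> / 2)" using n0 \<epsilon> by (auto simp: n_def field_simps)
  define Z where "Z = map_pmf (sq_cell (q ^ n)) (X n)"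
  have fZ: "fin_pmf Z" by (simp add: Z_def)
  define v where "v y = ln (K * pmf Z (sq_cell (q ^ n) y) / (q ^ n)\<^sup>2)" for y
  have qn: "q ^ n > 0" using lam by simp
  have Z0: "pmf Z (sq_cell (q ^ n) y) > 0" if "y \<in> set_pmf (X n)" for y
    unfolding Z_def by (rule pmf_positive) (use that in auto)
  have "measure_pmf.expectation (X n) v = measure_pmf.expectation (X n) (\<lambda>y. (ln K - 2 * (real n * ln q)) + ln (pmf Z (sq_cell (q ^ n) y)))"
  proof (rule expectation_cong_pmf)
    fix y assume "y \<in> set_pmf (X n)"
    then show "v y = (ln K - 2 * (real n * ln q)) + ln (pmf Z (sq_cell (q ^ n) y))"
      using K qn Z0[of y] lam by (simp add: v_def ln_div ln_mult ln_realpow)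
  qed
  also have "\<dots> = (ln K - 2 * (real n * ln q)) + measure_pmf.expectation Z (\<lambda>w. ln (pmf Z w))"
    unfolding Z_def by (simp add: integrable_fin_pmf)
  also have "measure_pmf.expectation Z (\<lambda>w. ln (pmf Z w)) = - shannon Z"
    unfolding shannon_def using fZ by (simp add: expectation_fin)
  also have "(ln K - 2 * (real n * ln q)) + - shannon Z < real n * \<epsilon>"
    using C[of n] n(2) by (simp add: Z_def algebra_simps)
  finally obtain s where s: "0 < s" "s \<le> 1" "measure_pmf.expectation (X n) (\<lambda>y. exp (s * v y)) \<le> exp (s * (real n * \<epsilon>))"
    using exp_moment_small[OF fin_X] by blast
  have "(LINT x|lborel. dens (q ^ (k * n)) (X (k * n)) x powr (1 + s)) \<le> exp (s * \<epsilon> * real (k * n))" for k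
  proof (induction k)
    case 0
    have "dens 1 (return_pmf 0) x powr (1 + s) \<le> disc 1 x" for x
    proof -
      have "dens 1 (return_pmf 0) x = disc 1 x" by (simp add: dens_def)
      moreover have "1 / (pi * 1\<^sup>2) \<le> 1" using pi_ge_two by (simp add: divide_le_eq)
      then have "disc 1 x \<le> 1" using disc_le[of 1 x] by linarith
      moreover have "u powr (1 + s) \<le> u" if "0 \<le> u" "u \<le> 1" for u :: real
      proof (cases "u = 0")
        case False
        then have "u powr (1 + s) = u * u powr s" using that by (simp add: powr_add)
        also have "\<dots> \<le> u * 1" using that s by (intro mult_left_mono powr_le1) auto
        finally show ?thesis by simp
      qed simp
      ultimately show ?thesis by (simp add: disc_nonneg)
    qed
    then have "(LINT x|lborel. dens 1 (return_pmf 0) x powr (1 + s)) \<le> (LINT x|lborel. disc 1 x)"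
      using s by (intro integral_mono dens_powr_integrable integrable_disc) auto
    then show ?case by (simp add: X_0 integral_disc)
  next
    case (Suc k)
    have e: "q ^ (Suc k * n) = cmod (lam ^ n) * q ^ (k * n)" "X (Suc k * n) = X n \<oplus> pscale (lam ^ n) (X (k * n))"
      by (simp_all add: norm_power power_add X_add)
    have "(LINT x|lborel. dens (q ^ (Suc k * n)) (X (Suc k * n)) x powr (1 + s))
      \<le> measure_pmf.expectation (X n) (\<lambda>y. (K * pmf (map_pmf (sq_cell (cmod (lam ^ n))) (X n)) (sq_cell (cmod (lam ^ n)) y) / (cmod (lam ^ n))\<^sup>2) powr s)
       * (LINT x|lborel. dens (q ^ (k * n)) (X (k * n)) x powr (1 + s))"
      unfolding e by (rule dens_moment_conv[OF _ _ R(2)]) (use R lam s in \<open>auto simp: K_def power_le_one\<close>)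
    also have "measure_pmf.expectation (X n) (\<lambda>y. (K * pmf (map_pmf (sq_cell (cmod (lam ^ n))) (X n)) (sq_cell (cmod (lam ^ n)) y) / (cmod (lam ^ n))\<^sup>2) powr s)
       = measure_pmf.expectation (X n) (\<lambda>y. exp (s * v y))"
    proof (rule expectation_cong_pmf)
      fix y assume "y \<in> set_pmf (X n)"
      then have "K * pmf Z (sq_cell (q ^ n) y) / (q ^ n)\<^sup>2 > 0" using K qn Z0[of y] by simp
      then show "(K * pmf (map_pmf (sq_cell (cmod (lam ^ n))) (X n)) (sq_cell (cmod (lam ^ n)) y) / (cmod (lam ^ n))\<^sup>2) powr s = exp (s * v y)"
        unfolding norm_power Z_def[symmetric] v_def by (auto simp: powr_def)
    qed
    finally have "(LINT x|lborel. dens (q ^ (Suc k * n)) (X (Suc k * n)) x powr (1 + s))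
       \<le> measure_pmf.expectation (X n) (\<lambda>y. exp (s * v y)) * (LINT x|lborel. dens (q ^ (k * n)) (X (k * n)) x powr (1 + s))" .
    also have "\<dots> \<le> exp (s * (real n * \<epsilon>)) * exp (s * \<epsilon> * real (k * n))"
      using s Suc.IH by (intro mult_mono) (auto intro!: Bochner_Integration.integral_nonneg)
    also have "\<dots> = exp (s * \<epsilon> * real (Suc k * n))" by (simp add: mult_exp_exp algebra_simps)
    finally show ?case .
  qed
  then show ?thesis using n s by (intro exI[of _ n] exI[of _ s]) blast
qed

end

section \<open>Absolute continuity from Fourier decay and full dimension\<close>

lemma borel_measurable_cis[measurable (raw)]:
  assumes [measurable]: "f \<in> borel_measurable M"
  shows "(\<lambda>x. cis (f x)) \<in> borel_measurable M"
  unfolding cis_conv_exp by measurable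

lemma measurable_indicator_ball[measurable (raw)]:
  fixes f :: "'a \<Rightarrow> complex"
  assumes "f \<in> borel_measurable M"
  shows "(\<lambda>x. indicator (ball c r) (f x) :: ennreal) \<in> borel_measurable M"
  by (rule measurable_compose[OF assms]) (intro borel_measurable_indicator, simp)

lemma complex_finite_measureI:
  assumes "finite_measure M" "sets M = sets borel"
  shows "complex_finite_measure M"
proof -
  interpret finite_measure M by fact
  show ?thesis by unfold_locales (simp add: measurable_ident_sets[OF assms(2)])
qed

context complex_finite_measure
begin

lemma nn_integral_gsm:
  assumes r: "r > 0" and [measurable]: "F \<in> borel_measurable borel"
  shows "(\<integral>\<^sup>+x. F x * ennreal (gsm r N x) \<partial>lborel) = (\<integral>\<^sup>+y. \<integral>\<^sup>+x. F x * ennreal (gauss r (x - y)) \<partial>lborel \<partial>N)"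
proof -
  interpret P: pair_sigma_finite "lborel :: complex measure" N ..
  have "(\<integral>\<^sup>+x. F x * ennreal (gsm r N x) \<partial>lborel) = (\<integral>\<^sup>+x. \<integral>\<^sup>+y. F x * ennreal (gauss r (x - y)) \<partial>N \<partial>lborel)"
  proof (intro nn_integral_cong)
    fix x
    have "ennreal (gsm r N x) = (\<integral>\<^sup>+y. ennreal (gauss r (x - y)) \<partial>N)"
      unfolding gsm_def by (rule nn_integral_eq_integral[symmetric]) (auto intro: integrable_gauss_shift r simp: gauss_nonneg)
    then show "F x * ennreal (gsm r N x) = (\<integral>\<^sup>+y. F x * ennreal (gauss r (x - y)) \<partial>N)"
      by (simp add: nn_integral_cmult)
  qed
  also have "\<dots> = (\<integral>\<^sup>+y. \<integral>\<^sup>+x. F x * ennreal (gauss r (x - y)) \<partial>lborel \<partial>N)"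
    by (rule P.Fubini'[symmetric]) measurable
  finally show ?thesis .
qed

lemma nn_integral_gsm_total:
  assumes r: "r > 0"
  shows "(\<integral>\<^sup>+x. ennreal (gsm r N x) \<partial>lborel) = emeasure N (space N)"
proof -
  have "(\<integral>\<^sup>+x. ennreal (gauss r (x - y)) \<partial>lborel) = 1" for y
    using nn_integral_complex_translate[of "\<lambda>x. ennreal (gauss r x)" y] nn_integral_gauss[OF r] by simp
  then show ?thesis using nn_integral_gsm[OF r, of "\<lambda>_. 1"] by simp
qed

lemma integrable_gsm_N: "r > 0 \<Longrightarrow> integrable lborel (gsm r N)"
  by (rule integrableI_nonneg) (auto simp: gsm_nonneg nn_integral_gsm_total emeasure_eq_measure)

lemma integral_gsm_N: "r > 0 \<Longrightarrow> (LINT x|lborel. gsm r N x) = measure N (space N)"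
  by (rule integral_eq_nn_integral[THEN trans]) (auto simp: gsm_nonneg nn_integral_gsm_total emeasure_eq_measure)

lemma cf_norm_le: "cmod (cf N \<xi>) \<le> measure N (space N)"
proof -
  have "cmod (cf N \<xi>) \<le> (LINT x|N. cmod (cis (\<xi> \<bullet> x)))" unfolding cf_def by (rule integral_norm_bound)
  then show ?thesis by simp
qed

end

text \<open>Bilinear extension of \<open>gauss_parseval\<close>; real coefficients allow it to be
  applied to differences of measures.\<close>

lemma parseval_sum:
  fixes N :: "'i \<Rightarrow> complex measure" and c :: "'i \<Rightarrow> real"
  assumes I: "finite I" and N: "\<And>i. i \<in> I \<Longrightarrow> complex_finite_measure (N i)" and k: "k > 0"
  shows "integrable lborel (\<lambda>x. (\<Sum>i\<in>I. c i * gsm k (N i) x)\<^sup>2)"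
    and "integrable lborel (\<lambda>\<xi>. exp (- k\<^sup>2 * (cmod \<xi>)\<^sup>2) * (cmod (\<Sum>i\<in>I. c i * cf (N i) \<xi>))\<^sup>2)"
    and "(LINT x|lborel. (\<Sum>i\<in>I. c i * gsm k (N i) x)\<^sup>2)
      = (LINT \<xi>|lborel. exp (- k\<^sup>2 * (cmod \<xi>)\<^sup>2) * (cmod (\<Sum>i\<in>I. c i * cf (N i) \<xi>))\<^sup>2) / (4 * pi\<^sup>2)"
proof -
  have e1: "(\<Sum>i\<in>I. c i * gsm k (N i) x)\<^sup>2 = (\<Sum>i\<in>I. \<Sum>j\<in>I. (c i * c j) * (gsm k (N i) x * gsm k (N j) x))" for x
    by (simp add: power2_eq_square sum_product mult_ac)
  have e2: "exp (- k\<^sup>2 * (cmod \<xi>)\<^sup>2) * (cmod (\<Sum>i\<in>I. c i * cf (N i) \<xi>))\<^sup>2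
     = (\<Sum>i\<in>I. \<Sum>j\<in>I. (c i * c j) * (exp (- k\<^sup>2 * (cmod \<xi>)\<^sup>2) * Re (cf (N i) \<xi> * cnj (cf (N j) \<xi>))))" for \<xi>
  proof -
    have "(cmod (\<Sum>i\<in>I. c i * cf (N i) \<xi>))\<^sup>2 = Re ((\<Sum>i\<in>I. c i * cf (N i) \<xi>) * cnj (\<Sum>i\<in>I. c i * cf (N i) \<xi>))"
      by (simp only: complex_norm_square[symmetric] Re_complex_of_real)
    also have "\<dots> = (\<Sum>i\<in>I. \<Sum>j\<in>I. (c i * c j) * Re (cf (N i) \<xi> * cnj (cf (N j) \<xi>)))"
      by (simp add: sum_product Re_sum algebra_simps)
    finally show ?thesis by (simp add: sum_distrib_left mult_ac)
  qed
  show "integrable lborel (\<lambda>x. (\<Sum>i\<in>I. c i * gsm k (N i) x)\<^sup>2)"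
    unfolding e1 using gauss_parseval(1)[OF N N k] by (intro Bochner_Integration.integrable_sum integrable_mult_right) auto
  show "integrable lborel (\<lambda>\<xi>. exp (- k\<^sup>2 * (cmod \<xi>)\<^sup>2) * (cmod (\<Sum>i\<in>I. c i * cf (N i) \<xi>))\<^sup>2)"
    unfolding e2 using gauss_parseval(2)[OF N N k] by (intro Bochner_Integration.integrable_sum integrable_mult_right) auto
  have "(LINT x|lborel. (\<Sum>i\<in>I. \<Sum>j\<in>I. (c i * c j) * (gsm k (N i) x * gsm k (N j) x)))
     = (\<Sum>i\<in>I. \<Sum>j\<in>I. (c i * c j) * (LINT x|lborel. gsm k (N i) x * gsm k (N j) x))"
    using gauss_parseval(1)[OF N N k] by (simp add: Bochner_Integration.integral_sum)
  also have "\<dots> = (\<Sum>i\<in>I. \<Sum>j\<in>I. (c i * c j) * (LINT \<xi>|lborel. exp (- k\<^sup>2 * (cmod \<xi>)\<^sup>2) * Re (cf (N i) \<xi> * cnj (cf (N j) \<xi>)))) / (4 * pi\<^sup>2)"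
    using gauss_parseval(3)[OF N N k] by (simp add: sum_divide_distrib)
  also have "(\<Sum>i\<in>I. \<Sum>j\<in>I. (c i * c j) * (LINT \<xi>|lborel. exp (- k\<^sup>2 * (cmod \<xi>)\<^sup>2) * Re (cf (N i) \<xi> * cnj (cf (N j) \<xi>))))
     = (LINT \<xi>|lborel. (\<Sum>i\<in>I. \<Sum>j\<in>I. (c i * c j) * (exp (- k\<^sup>2 * (cmod \<xi>)\<^sup>2) * Re (cf (N i) \<xi> * cnj (cf (N j) \<xi>)))))"
  proof -
    have i: "integrable lborel (\<lambda>\<xi>. (c i * c j) * (exp (- k\<^sup>2 * (cmod \<xi>)\<^sup>2) * Re (cf (N i) \<xi> * cnj (cf (N j) \<xi>))))" if "i \<in> I" "j \<in> I" for i j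
      using gauss_parseval(2)[OF N[OF that(1)] N[OF that(2)] k] by (rule integrable_mult_right)
    show ?thesis
      by (subst Bochner_Integration.integral_sum, intro Bochner_Integration.integrable_sum i, assumption+,
          intro sum.cong refl, subst Bochner_Integration.integral_sum, intro i, assumption+, intro sum.cong refl integral_mult_right_zero[symmetric])
  qed
  finally show "(LINT x|lborel. (\<Sum>i\<in>I. c i * gsm k (N i) x)\<^sup>2)
      = (LINT \<xi>|lborel. exp (- k\<^sup>2 * (cmod \<xi>)\<^sup>2) * (cmod (\<Sum>i\<in>I. c i * cf (N i) \<xi>))\<^sup>2) / (4 * pi\<^sup>2)"
    unfolding e1 e2 .
qed

lemma sets_conv_measure[simp]: "sets (conv_measure M N) = sets borel"
  by (simp add: conv_measure_def)

lemma space_conv_measure[simp]: "space (conv_measure M N) = UNIV"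
  by (simp add: conv_measure_def)

context
  fixes M N :: "complex measure"
  assumes M: "complex_finite_measure M" and N: "complex_finite_measure N"
begin

interpretation M: complex_finite_measure M by (rule M)
interpretation N: complex_finite_measure N by (rule N)
interpretation P: finite_measure "M \<Otimes>\<^sub>M N"
  by (rule finite_pair_measure) unfold_locales

lemma conv_measure_finite: "complex_finite_measure (conv_measure M N)"
  by (rule complex_finite_measureI) (auto simp: conv_measure_def intro!: P.finite_measure_distr)

lemma nn_integral_conv_measure:
  assumes [measurable]: "F \<in> borel_measurable borel"
  shows "(\<integral>\<^sup>+z. F z \<partial>conv_measure M N) = (\<integral>\<^sup>+x. \<integral>\<^sup>+y. F (x + y) \<partial>N \<partial>M)"
  unfolding conv_measure_def
  by (subst nn_integral_distr) (auto simp: N.nn_integral_fst[symmetric] split_beta)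

lemma measure_conv_measure: "measure (conv_measure M N) UNIV = measure M (space M) * measure N (space N)"
proof -
  have "emeasure (conv_measure M N) UNIV = emeasure M (space M) * emeasure N (space N)"
    using nn_integral_conv_measure[of "\<lambda>_. 1"] by (simp add: mult.commute)
  then show ?thesis by (simp add: measure_def enn2real_mult)
qed

lemma cf_conv_measure: "cf (conv_measure M N) \<xi> = cf M \<xi> * cf N \<xi>"
proof -
  have i: "complex_integrable M (\<lambda>x. cis (\<xi> \<bullet> x))" "complex_integrable N (\<lambda>x. cis (\<xi> \<bullet> x))"
    by (rule M.integrable_bounded[where B=1] N.integrable_bounded[where B=1]; auto simp: cis_conv_exp)+
  have "cf (conv_measure M N) \<xi> = (CLINT p|M \<Otimes>\<^sub>M N. cis (\<xi> \<bullet> (case p of (x, y) \<Rightarrow> x + y)))"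
    unfolding cf_def conv_measure_def by (subst integral_distr) auto
  also have "\<dots> = (CLINT p|M \<Otimes>\<^sub>M N. cis (\<xi> \<bullet> fst p) * cis (\<xi> \<bullet> snd p))"
    by (simp add: split_beta inner_add_right cis_mult)
  also have "\<dots> = cf M \<xi> * cf N \<xi>"
    unfolding cf_def by (rule pair_integral_product(2)[OF _ _ i]) unfold_locales
  finally show ?thesis .
qed

end

lemma conv_measure_prob:
  assumes "prob_space M" "prob_space N" "complex_finite_measure M" "complex_finite_measure N"
  shows "prob_space (conv_measure M N)"
proof -
  interpret M: prob_space M by fact
  interpret N: prob_space N by fact
  interpret C: complex_finite_measure "conv_measure M N" by (rule conv_measure_finite) fact+
  have "measure (conv_measure M N) UNIV = 1"
    using measure_conv_measure[OF assms(3,4)] by (simp add: M.prob_space N.prob_space)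
  then show ?thesis by (intro prob_spaceI) (simp add: C.emeasure_eq_measure)
qed

section \<open>Uniform discs as mollifiers\<close>

definition disc_measure :: "real \<Rightarrow> complex measure" where
  "disc_measure r = density lborel (\<lambda>x. ennreal (disc r x))"

lemma density_complex_finite:
  fixes f :: "complex \<Rightarrow> real"
  assumes "integrable lborel f" "\<And>x. f x \<ge> 0"
  shows "complex_finite_measure (density lborel (\<lambda>x. ennreal (f x)))"
proof (rule complex_finite_measureI)
  have [measurable]: "f \<in> borel_measurable borel" using assms(1) by auto
  have "(\<integral>\<^sup>+x. ennreal (f x) \<partial>lborel) = ennreal (LINT x|lborel. f x)"
    using assms by (intro nn_integral_eq_integral) auto
  then show "finite_measure (density lborel (\<lambda>x. ennreal (f x)))"
    by (intro finite_measureI) (simp add: emeasure_density)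
qed simp

lemma measure_density_total:
  fixes f :: "complex \<Rightarrow> real"
  assumes "integrable lborel f" "\<And>x. f x \<ge> 0"
  shows "measure (density lborel (\<lambda>x. ennreal (f x))) UNIV = (LINT x|lborel. f x)"
proof -
  have [measurable]: "f \<in> borel_measurable borel" using assms(1) by auto
  have "(\<integral>\<^sup>+x. ennreal (f x) \<partial>lborel) = ennreal (LINT x|lborel. f x)"
    using assms by (intro nn_integral_eq_integral) auto
  then show ?thesis using assms by (simp add: measure_def emeasure_density)
qed

lemma cf_density:
  fixes f :: "complex \<Rightarrow> real"
  assumes "f \<in> borel_measurable borel" "\<And>x. f x \<ge> 0"
  shows "cf (density lborel (\<lambda>x. ennreal (f x))) \<xi> = (CLINT x|lborel. f x * cis (\<xi> \<bullet> x))"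
proof -
  show ?thesis using assms unfolding cf_def by (subst integral_density) (auto simp: scaleR_conv_of_real)
qed

lemma disc_measure_finite: "r > 0 \<Longrightarrow> complex_finite_measure (disc_measure r)"
  unfolding disc_measure_def by (intro density_complex_finite integrable_disc disc_nonneg)

lemma disc_measure_prob: "r > 0 \<Longrightarrow> prob_space (disc_measure r)"
  unfolding disc_measure_def
  by (rule prob_spaceI) (simp add: emeasure_density nn_integral_eq_integral integrable_disc disc_nonneg integral_disc)

lemma integrable_cis:
  fixes f :: "complex \<Rightarrow> real"
  assumes f: "integrable lborel f"
  shows "complex_integrable lborel (\<lambda>x. f x * cis (\<xi> \<bullet> x))"
proof (rule Bochner_Integration.integrable_bound[OF f])
  have [measurable]: "f \<in> borel_measurable borel" using f by auto
  show "(\<lambda>x. complex_of_real (f x) * cis (\<xi> \<bullet> x)) \<in> borel_measurable lborel"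
    by (intro borel_measurable_times borel_measurable_cis) simp_all
qed (simp add: norm_mult)

lemma cf_dens:
  assumes A: "fin_pmf A" and r: "r > 0"
  shows "(CLINT x|lborel. dens r A x * cis (\<xi> \<bullet> x)) = cf (measure_pmf A) \<xi> * cf (disc_measure r) \<xi>"
proof -
  have sh: "(CLINT x|lborel. disc r (x - y) * cis (\<xi> \<bullet> x)) = cis (\<xi> \<bullet> y) * cf (disc_measure r) \<xi>" for y
  proof -
    have "(CLINT x|lborel. disc r (x - y) * cis (\<xi> \<bullet> x)) = (CLINT x|lborel. (\<lambda>x. disc r x * cis (\<xi> \<bullet> (x + y))) (x - y))"
      by simp
    also have "\<dots> = (CLINT x|lborel. disc r x * cis (\<xi> \<bullet> (x + y)))"
      by (rule integral_complex_translate) (auto simp: cis_conv_exp)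
    also have "\<dots> = (CLINT x|lborel. cis (\<xi> \<bullet> y) * (disc r x * cis (\<xi> \<bullet> x)))"
      by (simp add: inner_add_right cis_mult[symmetric] mult_ac)
    finally show ?thesis unfolding disc_measure_def by (subst cf_density) (auto simp: disc_nonneg)
  qed
  have i: "complex_integrable lborel (\<lambda>x. disc r (x - y) * cis (\<xi> \<bullet> x))" for y
    by (rule integrable_cis[OF integrable_complex_translate[OF integrable_disc[OF r]]])
  have "(CLINT x|lborel. dens r A x * cis (\<xi> \<bullet> x)) = (CLINT x|lborel. (\<Sum>y\<in>set_pmf A. of_real (pmf A y) * (disc r (x - y) * cis (\<xi> \<bullet> x))))"
    using A by (simp add: dens_def expectation_fin sum_distrib_left mult_ac)
  also have "\<dots> = (\<Sum>y\<in>set_pmf A. of_real (pmf A y) * (cis (\<xi> \<bullet> y) * cf (disc_measure r) \<xi>))"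
    using i sh by (subst Bochner_Integration.integral_sum) auto
  finally show ?thesis using A by (simp add: cf_pmf sum_distrib_left mult_ac)
qed

lemma cf_disc_near_1:
  assumes r: "r > 0"
  shows "cmod (1 - cf (disc_measure r) \<xi>) \<le> r * cmod \<xi>" "cmod (1 - cf (disc_measure r) \<xi>) \<le> 2"
proof -
  interpret prob_space "disc_measure r" by (rule disc_measure_prob[OF r])
  interpret C: complex_finite_measure "disc_measure r" by (rule disc_measure_finite[OF r])
  have "cmod (cf (disc_measure r) \<xi>) \<le> 1" using C.cf_norm_le[of \<xi>] by (simp add: prob_space)
  then show "cmod (1 - cf (disc_measure r) \<xi>) \<le> 2" using norm_triangle_ineq4[of 1 "cf (disc_measure r) \<xi>"] by simp
  have i: "integrable lborel (disc r)" by (rule integrable_disc[OF r])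
  have i1: "complex_integrable lborel (\<lambda>x. complex_of_real (disc r x))" using i by simp
  have i2: "complex_integrable lborel (\<lambda>x. disc r x * cis (\<xi> \<bullet> x))" by (rule integrable_cis[OF i])
  have c1: "(CLINT x|lborel. complex_of_real (disc r x)) = 1" using integral_disc[OF r] by simp
  have "1 - cf (disc_measure r) \<xi> = (CLINT x|lborel. complex_of_real (disc r x)) - (CLINT x|lborel. disc r x * cis (\<xi> \<bullet> x))"
    unfolding c1 disc_measure_def by (subst cf_density) (auto simp: disc_nonneg)
  also have "\<dots> = (CLINT x|lborel. complex_of_real (disc r x) - disc r x * cis (\<xi> \<bullet> x))"
    by (rule Bochner_Integration.integral_diff[symmetric, OF i1 i2])
  finally have "cmod (1 - cf (disc_measure r) \<xi>) \<le> (LINT x|lborel. cmod (complex_of_real (disc r x) - disc r x * cis (\<xi> \<bullet> x)))"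
    by (simp only: integral_norm_bound)
  also have "\<dots> \<le> (LINT x|lborel. (r * cmod \<xi>) * disc r x)"
  proof (rule integral_mono)
    fix x
    have "cmod (complex_of_real (disc r x) - disc r x * cis (\<xi> \<bullet> x)) = disc r x * cmod (1 - cis (\<xi> \<bullet> x))"
    proof -
      have "complex_of_real (disc r x) - disc r x * cis (\<xi> \<bullet> x) = of_real (disc r x) * (1 - cis (\<xi> \<bullet> x))" by (simp add: algebra_simps)
      then show ?thesis by (simp only: norm_mult norm_of_real abs_of_nonneg[OF disc_nonneg])
    qed
    also have "\<dots> \<le> disc r x * (r * cmod \<xi>)"
    proof (cases "cmod x < r")
      case True
      have "cmod (1 - cis (\<xi> \<bullet> x)) \<le> \<bar>\<xi> \<bullet> x\<bar>"
        using iexp_approx1[of "\<xi> \<bullet> x" 0] by (simp add: cis_conv_exp norm_minus_commute)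
      also have "\<dots> \<le> cmod \<xi> * cmod x" by (rule Cauchy_Schwarz_ineq2)
      also have "\<dots> \<le> r * cmod \<xi>" using True by (subst mult.commute) (intro mult_right_mono, auto)
      finally show ?thesis by (intro mult_left_mono disc_nonneg)
    qed (simp add: disc_def)
    finally show "cmod (complex_of_real (disc r x) - disc r x * cis (\<xi> \<bullet> x)) \<le> (r * cmod \<xi>) * disc r x" by (simp add: mult_ac)
  qed (use i i1 i2 in auto)
  also have "\<dots> = r * cmod \<xi>" using integral_disc[OF r] by simp
  finally show "cmod (1 - cf (disc_measure r) \<xi>) \<le> r * cmod \<xi>" .
qed


lemma nn_integral_disc_measure:
  assumes [measurable]: "F \<in> borel_measurable borel"
  shows "(\<integral>\<^sup>+z. F z \<partial>disc_measure r) = (\<integral>\<^sup>+z. ennreal (disc r z) * F z \<partial>lborel)"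
  unfolding disc_measure_def by (subst nn_integral_density) auto

text \<open>Convolution with the disc bounds the density by \<open>1 / (pi * r ^ 2)\<close>, and
  Gaussian smoothing preserves the bound.\<close>

lemma gsm_conv_disc_le:
  assumes \<nu>: "prob_space \<nu>" "complex_finite_measure \<nu>" and r: "r > 0" "\<delta> > 0" and [measurable]: "B \<in> sets borel"
  shows "(\<integral>\<^sup>+x. indicator B x * ennreal (gsm \<delta> (conv_measure \<nu> (disc_measure r)) x) \<partial>lborel) \<le> ennreal (1 / (pi * r\<^sup>2)) * emeasure lborel B"
proof -
  interpret \<nu>: prob_space \<nu> by fact
  interpret \<nu>': complex_finite_measure \<nu> by fact
  interpret C: complex_finite_measure "conv_measure \<nu> (disc_measure r)"
    by (intro conv_measure_finite \<nu> disc_measure_finite r)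
  have inner: "(\<integral>\<^sup>+z. (\<integral>\<^sup>+x. indicator B x * ennreal (gauss \<delta> (x - (y + z))) \<partial>lborel) \<partial>disc_measure r)
     \<le> ennreal (1 / (pi * r\<^sup>2)) * emeasure lborel B" for y
  proof -
    have "(\<integral>\<^sup>+z. (\<integral>\<^sup>+x. indicator B x * ennreal (gauss \<delta> (x - (y + z))) \<partial>lborel) \<partial>disc_measure r)
       = (\<integral>\<^sup>+z. ennreal (disc r z) * (\<integral>\<^sup>+x. indicator B x * ennreal (gauss \<delta> (x - (y + z))) \<partial>lborel) \<partial>lborel)"
      by (rule nn_integral_disc_measure) measurable
    also have "\<dots> \<le> (\<integral>\<^sup>+z. ennreal (1 / (pi * r\<^sup>2)) * (\<integral>\<^sup>+x. indicator B x * ennreal (gauss \<delta> (x - (y + z))) \<partial>lborel) \<partial>lborel)"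
      by (intro nn_integral_mono mult_right_mono ennreal_leI disc_le r) auto
    also have "\<dots> = ennreal (1 / (pi * r\<^sup>2)) * (\<integral>\<^sup>+z. (\<integral>\<^sup>+x. indicator B x * ennreal (gauss \<delta> (x - (y + z))) \<partial>lborel) \<partial>lborel)"
      by (rule nn_integral_cmult) measurable
    also have "(\<integral>\<^sup>+z. (\<integral>\<^sup>+x. indicator B x * ennreal (gauss \<delta> (x - (y + z))) \<partial>lborel) \<partial>lborel)
       = (\<integral>\<^sup>+x. (\<integral>\<^sup>+z. indicator B x * ennreal (gauss \<delta> (x - (y + z))) \<partial>lborel) \<partial>lborel)"
      by (rule lborel_pair.Fubini') measurable
    also have "\<dots> = (\<integral>\<^sup>+x. indicator B x \<partial>lborel)"
    proof (rule nn_integral_cong)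
      fix x
      have "(\<integral>\<^sup>+z. ennreal (gauss \<delta> (x - (y + z))) \<partial>lborel) = (\<integral>\<^sup>+z. ennreal (gauss \<delta> (z - (x - y))) \<partial>lborel)"
        by (intro nn_integral_cong arg_cong[where f=ennreal], subst gauss_minus_commute) (simp add: algebra_simps)
      also have "\<dots> = 1"
        using nn_integral_complex_translate[of "\<lambda>x. ennreal (gauss \<delta> x)" "x - y"] nn_integral_gauss[OF r(2)] by simp
      finally show "(\<integral>\<^sup>+z. indicator B x * ennreal (gauss \<delta> (x - (y + z))) \<partial>lborel) = indicator B x"
        by (simp add: nn_integral_cmult)
    qed
    finally show ?thesis by simp
  qed
  have "(\<integral>\<^sup>+x. indicator B x * ennreal (gsm \<delta> (conv_measure \<nu> (disc_measure r)) x) \<partial>lborel)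
     = (\<integral>\<^sup>+y. (\<integral>\<^sup>+z. (\<integral>\<^sup>+x. indicator B x * ennreal (gauss \<delta> (x - (y + z))) \<partial>lborel) \<partial>disc_measure r) \<partial>\<nu>)"
    by (subst C.nn_integral_gsm[OF r(2)], measurable, subst nn_integral_conv_measure[OF \<nu>(2) disc_measure_finite[OF r(1)]]) measurable
  also have "\<dots> \<le> (\<integral>\<^sup>+y. ennreal (1 / (pi * r\<^sup>2)) * emeasure lborel B \<partial>\<nu>)"
    by (intro nn_integral_mono inner)
  finally show ?thesis by (simp add: \<nu>.emeasure_space_1)
qed

text \<open>Cauchy-Schwarz on a set of measure at most 1, in the pointwise form
  \<open>|D| \<le> D ^ 2 / (2 * K) + K / 2\<close>, which yields integrability at the same
  time.\<close>

lemma integrable_mult_indicator_square: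
  fixes D :: "complex \<Rightarrow> real"
  assumes [measurable]: "D \<in> borel_measurable borel" "B \<in> sets borel" and D2: "integrable lborel (\<lambda>x. (D x)\<^sup>2)"
    and K: "(LINT x|lborel. (D x)\<^sup>2) \<le> K\<^sup>2" "K > 0" and B: "emeasure lborel B \<le> 1"
  shows "integrable lborel (\<lambda>x. indicator B x * D x)" "\<bar>LINT x|lborel. indicator B x * D x\<bar> \<le> K"
proof -
  have iB: "integrable lborel (indicator B :: complex \<Rightarrow> real)"
    using B by (intro integrable_real_indicator) (auto intro: le_less_trans)
  have mB: "(LINT x|lborel. indicator B x) \<le> (1::real)"
  proof -
    have "measure lborel B \<le> 1" using B unfolding measure_def by (metis enn2real_1 enn2real_mono ennreal_one_less_top)
    then show ?thesis by simp
  qed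
  have pw: "\<bar>indicator B x * D x\<bar> \<le> (D x)\<^sup>2 / (2 * K) + K / 2 * indicator B x" for x
  proof -
    have "0 \<le> (\<bar>D x\<bar> - K)\<^sup>2" by simp
    then have "2 * K * \<bar>D x\<bar> \<le> (D x)\<^sup>2 + K\<^sup>2" by (simp add: power2_diff mult_ac)
    then have "\<bar>D x\<bar> \<le> (D x)\<^sup>2 / (2 * K) + K / 2" using K(2) by (simp add: field_simps power2_eq_square)
    then show ?thesis using K(2) by (auto simp: indicator_def)
  qed
  have iR: "integrable lborel (\<lambda>x. (D x)\<^sup>2 / (2 * K) + K / 2 * indicator B x)" using D2 iB by simp
  show i: "integrable lborel (\<lambda>x. indicator B x * D x)"
    by (rule Bochner_Integration.integrable_bound[OF iR]) (use pw in \<open>auto intro!: AE_I2 order_trans[OF pw] abs_ge_self\<close>)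
  have "\<bar>LINT x|lborel. indicator B x * D x\<bar> \<le> (LINT x|lborel. \<bar>indicator B x * D x\<bar>)" by (rule integral_abs_bound)
  also have "\<dots> \<le> (LINT x|lborel. (D x)\<^sup>2 / (2 * K) + K / 2 * indicator B x)"
    by (rule integral_mono[OF _ iR pw]) (use i in auto)
  also have "\<dots> = (LINT x|lborel. (D x)\<^sup>2) / (2 * K) + K / 2 * (LINT x|lborel. indicator B x)"
    using D2 iB by simp
  also have "\<dots> \<le> K\<^sup>2 / (2 * K) + K / 2 * 1"
    using K mB by (intro add_mono divide_right_mono mult_left_mono) auto
  also have "\<dots> = K" using K(2) by (simp add: power2_eq_square)
  finally show "\<bar>LINT x|lborel. indicator B x * D x\<bar> \<le> K" .
qed

lemma gsm_density_le:
  fixes f :: "complex \<Rightarrow> real"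
  assumes f: "integrable lborel f" "\<And>x. 0 \<le> f x" "\<And>x. f x \<le> T" and \<delta>: "\<delta> > 0"
  shows "gsm \<delta> (density lborel (\<lambda>x. ennreal (f x))) x \<le> T"
proof -
  have [measurable]: "f \<in> borel_measurable borel" using f(1) by auto
  have ig: "integrable lborel (\<lambda>y. gauss \<delta> (x - y))"
    using integrable_complex_translate[OF integrable_gauss[OF \<delta>], of x] by (simp add: gauss_minus_commute[of \<delta> x])
  have T0: "T \<ge> 0" using f(2)[of 0] f(3)[of 0] by linarith
  have "gsm \<delta> (density lborel (\<lambda>x. ennreal (f x))) x = (LINT y|lborel. f y * gauss \<delta> (x - y))"
    unfolding gsm_def using f(2) by (subst integral_density) auto
  also have "\<dots> \<le> (LINT y|lborel. T * gauss \<delta> (x - y))"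
  proof (rule integral_mono_AE')
    show "integrable lborel (\<lambda>y. T * gauss \<delta> (x - y))" using ig by simp
  qed (use f T0 gauss_nonneg in \<open>auto intro!: AE_I2 mult_right_mono mult_nonneg_nonneg\<close>)
  also have "\<dots> = T"
    using integral_complex_translate[of "gauss \<delta>" x] integral_gauss[OF \<delta>] by (simp add: gauss_minus_commute[of \<delta> x])
  finally show ?thesis .
qed

lemma sum_lessThan_4:
  fixes g :: "nat \<Rightarrow> 'a::comm_monoid_add"
  shows "(\<Sum>i<4. g i) = g 0 + g 1 + g 2 + g 3"
  by (simp add: numeral_eq_Suc add_ac)

text \<open>Convolving with one more disc hardly changes the smoothed measure: on the part of the density
  below the cut-off \<open>T\<close> Plancherel applies with the multiplier \<open>cf Q (1 - cf disc)\<close>, the rest has small mass.\<close>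

lemma smoothing_diff:
  assumes \<nu>: "prob_space \<nu>" "complex_finite_measure \<nu>" and Q: "prob_space Q" "complex_finite_measure Q"
    and A: "fin_pmf A" and split: "\<And>\<xi>. cf \<nu> \<xi> = cf (measure_pmf A) \<xi> * cf Q \<xi>"
    and r: "r > 0" "r' > 0" and \<delta>: "\<delta> > 0" and T: "T > 0" and M: "M > 0"
    and mult: "\<And>\<xi>. cmod (cf Q \<xi>) * cmod (1 - cf (disc_measure r') \<xi>) \<le> M"
    and tail: "(LINT x|lborel. indicator {x. dens r A x > T} x * dens r A x) \<le> b"
    and B: "B \<in> sets borel" "emeasure lborel B \<le> 1"
  shows "\<bar>(LINT x|lborel. indicator B x * gsm \<delta> (conv_measure \<nu> (disc_measure r)) x)
      - (LINT x|lborel. indicator B x * gsm \<delta> (conv_measure (conv_measure \<nu> (disc_measure r)) (disc_measure r')) x)\<bar> \<le> M * sqrt T + b"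
proof -
  have [measurable]: "B \<in> sets borel" by (rule B)
  define f where "f = dens r A"
  have f0: "f x \<ge> 0" for x by (simp add: f_def dens_nonneg)
  have [measurable]: "f \<in> borel_measurable borel" unfolding f_def by (rule measurable_dens[OF A])
  have fi: "integrable lborel f" 
    using A integrable_complex_translate[OF integrable_disc[OF r(1)]] unfolding f_def dens_def by (simp add: expectation_fin)
  have f1: "(LINT x|lborel. f x) = 1"
  proof -
    have "(LINT x|lborel. disc r (x - y)) = 1" for y
      using integral_complex_translate[of "disc r" y] integral_disc[OF r(1)] by simp
    then show ?thesis using A integrable_complex_translate[OF integrable_disc[OF r(1)]] sum_pmf_eq_1[OF A order_refl]
      unfolding f_def dens_def by (simp add: expectation_fin)
  qed
  define fg where "fg x = indicator {x. f x \<le> T} x * f x" for x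
  define fb where "fb x = indicator {x. f x > T} x * f x" for x
  have fgb: "f x = fg x + fb x" for x by (auto simp: fg_def fb_def indicator_def)
  have [measurable]: "fg \<in> borel_measurable borel" "fb \<in> borel_measurable borel" unfolding fg_def fb_def by measurable
  have fg0: "0 \<le> fg x" "fg x \<le> T" "fg x \<le> f x" for x using f0[of x] T by (auto simp: fg_def indicator_def)
  have fb0: "0 \<le> fb x" "fb x \<le> f x" for x using f0[of x] by (auto simp: fb_def indicator_def)
  have fgi: "integrable lborel fg" by (rule Bochner_Integration.integrable_bound[OF fi]) (use fg0 f0 in auto)
  have fbi: "integrable lborel fb" by (rule Bochner_Integration.integrable_bound[OF fi]) (use fb0 f0 in auto)
  define G where "G = density lborel (\<lambda>x. ennreal (fg x))"
  define H where "H = density lborel (\<lambda>x. ennreal (fb x))"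
  have fin: "complex_finite_measure G" "complex_finite_measure H"
    unfolding G_def H_def using fgi fbi fg0 fb0 by (auto intro!: density_complex_finite)
  interpret G: complex_finite_measure G by (rule fin)
  have Gm: "measure G (space G) \<le> 1"
    using measure_density_total[OF fgi fg0(1)] integral_mono[OF fgi fi fg0(3)] f1 by (simp add: G_def)
  have Hm: "measure H (space H) \<le> b"
    using measure_density_total[OF fbi fb0(1)] tail by (simp add: H_def fb_def f_def)
  let ?u = "disc_measure r" and ?u' = "disc_measure r'"
  note u = disc_measure_finite[OF r(1)] and u' = disc_measure_finite[OF r(2)]
  \<comment> \<open>With the signs \<open>c\<close> the transforms combine to
    \<open>cf G * cf Q * (1 - cf ?u')\<close>: the last two measures cancel the contribution of the
    unbounded part \<open>H\<close>, whose mass is at most \<open>b\<close>.\<close>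
  define N where "N i = (if i = (0::nat) then conv_measure \<nu> ?u else if i = 1 then conv_measure (conv_measure \<nu> ?u) ?u'
      else if i = 2 then conv_measure H Q else conv_measure (conv_measure H Q) ?u')" for i
  define c where "c i = (if i = (0::nat) \<or> i = 3 then 1 else - 1 :: real)" for i
  have fN: "complex_finite_measure (N i)" for i
    unfolding N_def by (auto intro!: conv_measure_finite \<nu> Q fin u u')
  define D where "D x = (\<Sum>i<4. c i * gsm \<delta> (N i) x)" for x
  have [measurable]: "gsm \<delta> (N i) \<in> borel_measurable borel" for i by (rule complex_finite_measure.measurable_gsm[OF fN])
  have [measurable]: "D \<in> borel_measurable borel" unfolding D_def by measurable
  have cfD: "(\<Sum>i<4. c i * cf (N i) \<xi>) = cf G \<xi> * (cf Q \<xi> * (1 - cf ?u' \<xi>))" for \<xi>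
  proof -
    have "cf (measure_pmf A) \<xi> * cf ?u \<xi> = (CLINT x|lborel. f x * cis (\<xi> \<bullet> x))"
      unfolding f_def by (rule cf_dens[OF A r(1), symmetric])
    also have "\<dots> = (CLINT x|lborel. fg x * cis (\<xi> \<bullet> x) + fb x * cis (\<xi> \<bullet> x))"
      by (simp add: fgb distrib_right)
    also have "\<dots> = cf G \<xi> + cf H \<xi>"
      unfolding G_def H_def using fg0 fb0
      by (subst (1 2) cf_density, measurable, simp, measurable, simp) (rule Bochner_Integration.integral_add; intro integrable_cis fgi fbi)
    finally have "cf (measure_pmf A) \<xi> * cf ?u \<xi> = cf G \<xi> + cf H \<xi>" .
    then have "cf \<nu> \<xi> * cf ?u \<xi> = (cf G \<xi> + cf H \<xi>) * cf Q \<xi>" by (simp add: split mult_ac)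
    then show ?thesis
      unfolding sum_lessThan_4 by (simp add: c_def N_def cf_conv_measure \<nu> Q fin u u' conv_measure_finite algebra_simps)
  qed
  have iD: "integrable lborel (\<lambda>x. (D x)\<^sup>2)" unfolding D_def by (rule parseval_sum(1)[OF _ fN \<delta>]) simp
  have "(LINT x|lborel. (D x)\<^sup>2) \<le> (M * sqrt T)\<^sup>2"
  proof -
    have 1: "(LINT x|lborel. (D x)\<^sup>2) = (LINT \<xi>|lborel. exp (- \<delta>\<^sup>2 * (cmod \<xi>)\<^sup>2) * (cmod (\<Sum>i<4. c i * cf (N i) \<xi>))\<^sup>2) / (4 * pi\<^sup>2)"
      unfolding D_def by (rule parseval_sum(3)[OF _ fN \<delta>]) simp
    have 2: "integrable lborel (\<lambda>\<xi>. exp (- \<delta>\<^sup>2 * (cmod \<xi>)\<^sup>2) * (cmod (\<Sum>i<4. c i * cf (N i) \<xi>))\<^sup>2)"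
      by (rule parseval_sum(2)[OF _ fN \<delta>]) simp
    note p1 = parseval_sum[of "{0::nat}" "\<lambda>_. G" \<delta> "\<lambda>_. 1", OF _ fin(1) \<delta>, simplified]
    have "(LINT \<xi>|lborel. exp (- \<delta>\<^sup>2 * (cmod \<xi>)\<^sup>2) * (cmod (\<Sum>i<4. c i * cf (N i) \<xi>))\<^sup>2)
       \<le> (LINT \<xi>|lborel. M\<^sup>2 * (exp (- (\<delta>\<^sup>2 * (cmod \<xi>)\<^sup>2)) * (cmod (cf G \<xi>))\<^sup>2))"
    proof (rule integral_mono[OF 2])
      show "integrable lborel (\<lambda>\<xi>. M\<^sup>2 * (exp (- (\<delta>\<^sup>2 * (cmod \<xi>)\<^sup>2)) * (cmod (cf G \<xi>))\<^sup>2))" using p1(2) by simp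
      fix \<xi>
      have "(cmod (cf Q \<xi>) * cmod (1 - cf ?u' \<xi>))\<^sup>2 \<le> M\<^sup>2" using mult by (intro power_mono) auto
      then have "(cmod (cf G \<xi>))\<^sup>2 * (cmod (cf Q \<xi>) * cmod (1 - cf ?u' \<xi>))\<^sup>2 \<le> (cmod (cf G \<xi>))\<^sup>2 * M\<^sup>2"
        by (rule mult_left_mono) simp
      then have "(cmod (\<Sum>i<4. c i * cf (N i) \<xi>))\<^sup>2 \<le> M\<^sup>2 * (cmod (cf G \<xi>))\<^sup>2"
        unfolding cfD by (simp add: norm_mult power_mult_distrib mult_ac)
      then show "exp (- \<delta>\<^sup>2 * (cmod \<xi>)\<^sup>2) * (cmod (\<Sum>i<4. c i * cf (N i) \<xi>))\<^sup>2 \<le> M\<^sup>2 * (exp (- (\<delta>\<^sup>2 * (cmod \<xi>)\<^sup>2)) * (cmod (cf G \<xi>))\<^sup>2)"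
        by (simp add: mult.left_commute)
    qed
    then have "(LINT x|lborel. (D x)\<^sup>2) \<le> M\<^sup>2 * (LINT x|lborel. (gsm \<delta> G x)\<^sup>2)"
      unfolding 1 p1(3) by (simp add: divide_right_mono)
    \<comment> \<open>The cut-off enters here: a density bounded by \<open>T\<close> has square
      integral at most \<open>T\<close> times its mass.\<close>
    also have "(LINT x|lborel. (gsm \<delta> G x)\<^sup>2) \<le> (LINT x|lborel. T * gsm \<delta> G x)"
    proof (rule integral_mono[OF p1(1)])
      fix x show "(gsm \<delta> G x)\<^sup>2 \<le> T * gsm \<delta> G x"
        using gsm_density_le[OF fgi fg0(1,2) \<delta>, of x] G.gsm_nonneg[of \<delta> x]
        unfolding power2_eq_square by (intro mult_right_mono) (auto simp: G_def)
    qed (use G.integrable_gsm_N[OF \<delta>] in simp)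
    also have "\<dots> \<le> T * 1" using G.integral_gsm_N[OF \<delta>] Gm T by simp
    finally show ?thesis using T M by (simp add: power_mult_distrib mult_left_mono)
  qed
  then have DB: "integrable lborel (\<lambda>x. indicator B x * D x)" "\<bar>LINT x|lborel. indicator B x * D x\<bar> \<le> M * sqrt T"
    using integrable_mult_indicator_square[of D B, OF _ _ iD _ _ B(2)] T M by auto
  have iN: "integrable lborel (\<lambda>x. indicator B x * gsm \<delta> (N i) x)" for i
    by (rule Bochner_Integration.integrable_bound[OF complex_finite_measure.integrable_gsm_N[OF fN \<delta>, of i]]) (auto simp: indicator_def)
  let ?I = "\<lambda>i. LINT x|lborel. indicator B x * gsm \<delta> (N i) x"
  have dec: "(LINT x|lborel. indicator B x * D x) = ?I 0 - ?I 1 - ?I 2 + ?I 3"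
  proof -
    have "indicator B x * D x = indicator B x * gsm \<delta> (N 0) x - indicator B x * gsm \<delta> (N 1) x - indicator B x * gsm \<delta> (N 2) x + indicator B x * gsm \<delta> (N 3) x" for x
      unfolding D_def sum_lessThan_4 by (simp add: c_def algebra_simps)
    then show ?thesis using iN by simp
  qed
  have small: "0 \<le> ?I i \<and> ?I i \<le> b" if i: "i = 2 \<or> i = 3" for i
  proof
    interpret Ni: complex_finite_measure "N i" by (rule fN)
    interpret Q: prob_space Q by (rule Q)
    interpret u': prob_space ?u' by (rule disc_measure_prob[OF r(2)])
    show "0 \<le> ?I i" by (intro Bochner_Integration.integral_nonneg) (auto simp: Ni.gsm_nonneg)
    have "?I i \<le> (LINT x|lborel. gsm \<delta> (N i) x)"
      using Ni.integrable_gsm_N[OF \<delta>] iN[of i] by (intro integral_mono) (auto simp: indicator_def Ni.gsm_nonneg)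
    also have "\<dots> = measure (N i) UNIV" using Ni.integral_gsm_N[OF \<delta>] i by (auto simp: N_def)
    also have "\<dots> = measure H (space H)"
      using i by (auto simp: N_def measure_conv_measure fin Q conv_measure_finite u' Q.prob_space u'.prob_space)
    finally show "?I i \<le> b" using Hm by simp
  qed
  have "\<bar>?I 0 - ?I 1\<bar> \<le> M * sqrt T + b" using DB(2) dec small[of 2] small[of 3] by auto
  then show ?thesis by (simp add: N_def)
qed


text \<open>\<open>B\<close> is exhausted by the points at distance at least
  \<open>2 / (m + 1)\<close> from its complement. A disc of radius below
  \<open>e = 1 / (m + 1)\<close> leaves a margin \<open>e\<close>, and the Gaussian mass within this
  margin tends to 1 as the width shrinks.\<close>

lemma open_le_smoothed:
  assumes \<nu>: "prob_space \<nu>" "complex_finite_measure \<nu>" "sets \<nu> = sets borel" and B: "open B"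
    and r: "r \<longlonglongrightarrow> 0" "\<And>k. r k > 0"
    and K: "K \<ge> 0" "\<And>k \<delta>. k \<ge> k0 \<Longrightarrow> \<delta> > 0 \<Longrightarrow>
        (\<integral>\<^sup>+x. indicator B x * ennreal (gsm \<delta> (conv_measure \<nu> (disc_measure (r k))) x) \<partial>lborel) \<le> ennreal K"
  shows "emeasure \<nu> B \<le> ennreal K"
proof -
  interpret \<nu>: prob_space \<nu> by fact
  have [measurable]: "B \<in> sets borel" using B by simp
  define F where "F m = {x. \<forall>y\<in>- B. dist x y \<ge> 2 / real (Suc m)}" for m
  have cF: "closed (F m)" for m
  proof -
    have "F m = (\<Inter>y\<in>- B. {x. dist x y \<ge> 2 / real (Suc m)})" by (auto simp: F_def)
    then show ?thesis by (auto intro!: closed_INT closed_Collect_le continuous_intros)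
  qed
  have [measurable]: "F m \<in> sets borel" for m using cF by simp
  have UF: "(\<Union>m. F m) = B"
  proof (intro equalityI subsetI)
    fix x assume "x \<in> (\<Union>m. F m)"
    then show "x \<in> B" by (force simp: F_def)
  next
    fix x assume "x \<in> B"
    then obtain e where e: "e > 0" "ball x e \<subseteq> B" using B openE by blast
    obtain m where "inverse (real (Suc m)) < e / 2" using reals_Archimedean[of "e / 2"] e by auto
    then have "2 / real (Suc m) < e" by (simp add: inverse_eq_divide)
    then have "x \<in> F m" using e(2) by (force simp: F_def)
    then show "x \<in> (\<Union>m. F m)" by blast
  qed
  have incF: "incseq F"
  proof (rule incseq_SucI, rule subsetI)
    fix m x assume "x \<in> F m"
    moreover have "2 / real (Suc (Suc m)) \<le> 2 / real (Suc m)" by (intro divide_left_mono) auto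
    ultimately show "x \<in> F (Suc m)" unfolding F_def by (blast intro: order_trans)
  qed
  have bound: "emeasure \<nu> (F m) \<le> ennreal K" for m
  proof -
    define e where "e = 1 / real (Suc m)"
    have e: "e > 0" by (simp add: e_def)
    obtain k where k: "k \<ge> k0" "r k < e"
    proof -
      have "\<forall>\<^sub>F k in sequentially. r k < e" by (rule order_tendstoD(2)[OF r(1) e])
      then obtain k1 where "\<And>k. k \<ge> k1 \<Longrightarrow> r k < e" unfolding eventually_sequentially by blast
      then show thesis using that[of "max k0 k1"] by simp
    qed
    interpret C: complex_finite_measure "conv_measure \<nu> (disc_measure (r k))"
      by (intro conv_measure_finite \<nu> disc_measure_finite r)
    interpret u: prob_space "disc_measure (r k)" by (rule disc_measure_prob[OF r(2)])
    define P where "P = density lborel (gauss 1)"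
    interpret P: prob_space P unfolding P_def by (rule gauss_prob_space) simp
    define g where "g j = emeasure P (ball 0 (e * real (Suc j)))" for j
    have sP: "sets P = sets borel" by (simp add: P_def)
    have "(\<lambda>j. emeasure P (ball 0 (e * real (Suc j)))) \<longlonglongrightarrow> emeasure P (\<Union>j. ball 0 (e * real (Suc j)))"
      using e by (intro Lim_emeasure_incseq) (auto simp: incseq_def sP intro!: subset_ball)
    moreover have "(\<Union>j. ball (0::complex) (e * real (Suc j))) = UNIV"
    proof -
      have "\<exists>j. cmod x < e * real (Suc j)" for x
      proof -
        obtain j where "cmod x / e < real j" using reals_Archimedean2 by blast
        then have "cmod x < e * real j" using e by (simp add: divide_less_eq mult.commute)
        also have "\<dots> \<le> e * real (Suc j)" using e by simp
        finally show ?thesis by blast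
      qed
      then show ?thesis by auto
    qed
    moreover have "emeasure P UNIV = 1" using P.emeasure_space_1 by (simp add: P_def)
    ultimately have glim: "g \<longlonglongrightarrow> 1" unfolding g_def by simp
    have inner: "g j \<le> (\<integral>\<^sup>+x. indicator B x * ennreal (gauss (1 / real (Suc j)) (x - w)) \<partial>lborel)" if w: "ball w e \<subseteq> B" for j w
    proof -
      define d where "d = 1 / real (Suc j)"
      have d: "d > 0" by (simp add: d_def)
      define c :: complex where c: "c = of_real (1 / d)"
      have c0: "c \<noteq> 0" using d by (simp add: c)
      have "g j = (\<integral>\<^sup>+x. ennreal (gauss 1 x) * indicator (ball 0 (e * real (Suc j))) x \<partial>lborel)"
        unfolding g_def P_def by (subst emeasure_density) auto
      also have "\<dots> = ennreal ((cmod (c))\<^sup>2) * (\<integral>\<^sup>+x. ennreal (gauss 1 (c * x)) * indicator (ball 0 (e * real (Suc j))) (c * x) \<partial>lborel)"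
        using c0 by (intro nn_integral_complex_mult borel_measurable_times_ennreal measurable_indicator_ball) (simp, measurable)
      also have "\<dots> = (\<integral>\<^sup>+x. ennreal ((cmod (c))\<^sup>2) * (ennreal (gauss 1 (c * x)) * indicator (ball 0 (e * real (Suc j))) (c * x)) \<partial>lborel)"
        by (rule nn_integral_cmult[symmetric]) (simp only: measurable_lborel2, intro borel_measurable_times_ennreal measurable_indicator_ball; measurable)
      also have "\<dots> = (\<integral>\<^sup>+x. ennreal (gauss d x) * indicator (ball 0 e) x \<partial>lborel)"
      proof (rule nn_integral_cong)
        fix x :: complex
        have 1: "gauss d x = gauss 1 (c * x) * (1 / d)\<^sup>2" unfolding c
          using gauss_mult[of 1 "of_real d" "of_real (1 / d) * x"] d by (simp add: field_simps)
        have 2: "(cmod c)\<^sup>2 = (1 / d)\<^sup>2" using d by (simp add: c norm_divide power_divide)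
        have 3: "ennreal (gauss d x) = ennreal (gauss 1 (c * x)) * ennreal ((cmod c)\<^sup>2)"
          unfolding 1 2 by (rule ennreal_mult) (simp_all add: gauss_nonneg)
        have 4: "indicator (ball 0 (e * real (Suc j))) (c * x) = (indicator (ball 0 e) x :: ennreal)" unfolding c
          using d by (auto simp: indicator_def d_def norm_mult mult.commute simp del: of_nat_Suc)
        show "ennreal ((cmod c)\<^sup>2) * (ennreal (gauss 1 (c * x)) * indicator (ball 0 (e * real (Suc j))) (c * x))
           = ennreal (gauss d x) * indicator (ball 0 e) x"
          unfolding 3 4 by (simp only: mult_ac)
      qed
      also have "\<dots> = (\<integral>\<^sup>+x. ennreal (gauss d (x - w)) * indicator (ball 0 e) (x - w) \<partial>lborel)"
        by (rule nn_integral_complex_translate[symmetric]) (intro borel_measurable_times_ennreal measurable_indicator_ball; measurable)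
      also have "\<dots> \<le> (\<integral>\<^sup>+x. indicator B x * ennreal (gauss d (x - w)) \<partial>lborel)"
        using w by (intro nn_integral_mono) (auto simp: indicator_def dist_norm norm_minus_commute subset_iff)
      finally show ?thesis by (simp add: d_def)
    qed
    have le: "emeasure \<nu> (F m) * g j \<le> ennreal K" for j
    proof -
      let ?d = "1 / real (Suc j)"
      have "emeasure \<nu> (F m) * g j = (\<integral>\<^sup>+y. indicator (F m) y * g j \<partial>\<nu>)"
      proof -
        have "F m \<in> sets \<nu>" unfolding \<nu>(3) using cF by simp
        then show ?thesis by (subst nn_integral_multc) (auto intro: borel_measurable_indicator)
      qed
      also have "\<dots> \<le> (\<integral>\<^sup>+y. (\<integral>\<^sup>+z. (\<integral>\<^sup>+x. indicator B x * ennreal (gauss ?d (x - (y + z))) \<partial>lborel) \<partial>disc_measure (r k)) \<partial>\<nu>)"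
      proof (intro nn_integral_mono)
        fix y
        show "indicator (F m) y * g j \<le> (\<integral>\<^sup>+z. (\<integral>\<^sup>+x. indicator B x * ennreal (gauss ?d (x - (y + z))) \<partial>lborel) \<partial>disc_measure (r k))"
        proof (cases "y \<in> F m")
          case True
          have "g j = (\<integral>\<^sup>+z. g j \<partial>disc_measure (r k))" by (simp add: u.emeasure_space_1)
          also have "\<dots> = (\<integral>\<^sup>+z. ennreal (disc (r k) z) * g j \<partial>lborel)" by (rule nn_integral_disc_measure) simp
          also have "\<dots> \<le> (\<integral>\<^sup>+z. ennreal (disc (r k) z) * (\<integral>\<^sup>+x. indicator B x * ennreal (gauss ?d (x - (y + z))) \<partial>lborel) \<partial>lborel)"
          proof (intro nn_integral_mono)
            fix z show "ennreal (disc (r k) z) * g j \<le> ennreal (disc (r k) z) * (\<integral>\<^sup>+x. indicator B x * ennreal (gauss ?d (x - (y + z))) \<partial>lborel)"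
            proof (cases "cmod z < r k")
              case z: True
              have "ball (y + z) e \<subseteq> B"
              proof (rule subsetI, rule ccontr)
                fix x assume x: "x \<in> ball (y + z) e" "x \<notin> B"
                then have "dist y x \<ge> 2 * e" using True by (auto simp: F_def e_def)
                moreover have "dist y x \<le> dist y (y + z) + dist (y + z) x" by (rule dist_triangle)
                moreover have "dist y (y + z) < e" using z k by (simp add: dist_norm)
                ultimately show False using x by simp
              qed
              then show ?thesis by (intro mult_left_mono inner) auto
            qed (simp add: disc_def)
          qed
          also have "\<dots> = (\<integral>\<^sup>+z. (\<integral>\<^sup>+x. indicator B x * ennreal (gauss ?d (x - (y + z))) \<partial>lborel) \<partial>disc_measure (r k))"
            by (rule nn_integral_disc_measure[symmetric]) measurable
          finally show ?thesis using True by simp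
        qed simp
      qed
      also have "\<dots> = (\<integral>\<^sup>+x. indicator B x * ennreal (gsm ?d (conv_measure \<nu> (disc_measure (r k))) x) \<partial>lborel)"
        by (subst C.nn_integral_gsm, simp, measurable, subst nn_integral_conv_measure[OF \<nu>(2) disc_measure_finite[OF r(2)]]) measurable
      also have "\<dots> \<le> ennreal K" using k by (intro K) auto
      finally show ?thesis .
    qed
    have "(\<lambda>j. emeasure \<nu> (F m) * g j) \<longlonglongrightarrow> emeasure \<nu> (F m) * 1"
      by (intro tendsto_mult_ennreal glim tendsto_const) (auto simp: \<nu>.emeasure_eq_measure)
    then show ?thesis using LIMSEQ_le_const2[of _ _ "ennreal K"] le by auto
  qed
  have "(\<lambda>m. emeasure \<nu> (F m)) \<longlonglongrightarrow> emeasure \<nu> (\<Union>m. F m)"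
    using incF cF \<nu>(3) by (intro Lim_emeasure_incseq) auto
  then show ?thesis unfolding UF using LIMSEQ_le_const2[of _ _ "ennreal K"] bound by auto
qed

text \<open>Equal transforms make the square integral of the difference vanish by Parseval. This
  serves to exchange the order in which two discs are convolved.\<close>

lemma smoothed_eqI:
  assumes "complex_finite_measure M" "complex_finite_measure N" and cf: "\<And>\<xi>. cf M \<xi> = cf N \<xi>" and \<delta>: "\<delta> > 0"
    and B: "B \<in> sets borel" "emeasure lborel B \<le> 1"
  shows "(LINT x|lborel. indicator B x * gsm \<delta> M x) = (LINT x|lborel. indicator B x * gsm \<delta> N x)"
proof -
  interpret M: complex_finite_measure M by fact
  interpret N: complex_finite_measure N by fact
  define F where "F i = (if i = (0::nat) then M else N)" for i
  define c where "c i = (if i = (0::nat) then 1 else - 1 :: real)" for i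
  define D where "D x = gsm \<delta> M x - gsm \<delta> N x" for x
  have F: "complex_finite_measure (F i)" for i using assms by (simp add: F_def)
  have D: "D x = (\<Sum>i<2. c i * gsm \<delta> (F i) x)" for x by (simp add: D_def c_def F_def numeral_2_eq_2)
  have C: "(\<Sum>i<2. c i * cf (F i) \<xi>) = 0" for \<xi> by (simp add: c_def F_def numeral_2_eq_2 cf)
  have D2: "integrable lborel (\<lambda>x. (D x)\<^sup>2)" "(LINT x|lborel. (D x)\<^sup>2) = 0"
    unfolding D using parseval_sum(1,3)[of "{..<2::nat}" F \<delta> c, OF _ F \<delta>] by (simp_all add: C)
  have [measurable]: "D \<in> borel_measurable borel" unfolding D_def by measurable
  have "\<bar>LINT x|lborel. indicator B x * D x\<bar> \<le> e" if "e > 0" for e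
    using integrable_mult_indicator_square(2)[of D B e, OF _ B(1) D2(1) _ that B(2)] D2(2) by simp
  then have "\<bar>LINT x|lborel. indicator B x * D x\<bar> \<le> 0" by (meson dense_ge)
  moreover have "integrable lborel (\<lambda>x. indicator B x * gsm \<delta> M x)"
    by (rule Bochner_Integration.integrable_bound[OF M.integrable_gsm_N[OF \<delta>]]) (use B in \<open>auto simp: indicator_def\<close>)
  moreover have "integrable lborel (\<lambda>x. indicator B x * gsm \<delta> N x)"
    by (rule Bochner_Integration.integrable_bound[OF N.integrable_gsm_N[OF \<delta>]]) (use B in \<open>auto simp: indicator_def\<close>)
  ultimately show ?thesis by (simp add: D_def right_diff_distrib)
qed

text \<open>For \<open>|\<xi>| \<ge> 1\<close> the second factor is at most
  \<open>r * |\<xi>|\<close> and at most 2, hence at most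
  \<open>2 * (r * |\<xi>|) powr \<sigma>\<close>, and the power of \<open>|\<xi>|\<close> cancels
  against the decay.\<close>

lemma disc_multiplier_le:
  assumes Q: "prob_space Q" "complex_finite_measure Q" and C: "C \<ge> 1" "0 < \<sigma>" "\<sigma> \<le> 1"
    and decay: "\<And>\<xi>. cmod \<xi> \<ge> 1 \<Longrightarrow> cmod (cf Q \<xi>) \<le> C * cmod \<xi> powr (- \<sigma>)"
    and r: "0 < r" "r \<le> 1"
  shows "cmod (cf Q \<xi>) * cmod (1 - cf (disc_measure r) \<xi>) \<le> 2 * C * r powr \<sigma>"
proof -
  interpret Q: prob_space Q by fact
  interpret Q': complex_finite_measure Q by fact
  have Q1: "cmod (cf Q \<xi>) \<le> 1" using Q'.cf_norm_le[of \<xi>] by (simp add: Q.prob_space)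
  note d = cf_disc_near_1[OF r(1), of \<xi>]
  have r1: "u \<le> u powr \<sigma>" if "0 \<le> u" "u \<le> 1" for u :: real
  proof (cases "u = 0")
    case False
    then have "u powr 1 \<le> u powr \<sigma>" using that C by (intro powr_mono') auto
    then show ?thesis using False that by simp
  qed simp
  show ?thesis
  proof (cases "cmod \<xi> \<ge> 1")
    case True
    have "cmod (1 - cf (disc_measure r) \<xi>) \<le> 2 * (r * cmod \<xi>) powr \<sigma>"
    proof (cases "r * cmod \<xi> \<le> 1")
      case small: True
      have "r * cmod \<xi> \<le> (r * cmod \<xi>) powr \<sigma>" using r small by (intro r1) auto
      then show ?thesis using d(1) powr_ge_zero[of "r * cmod \<xi>" \<sigma>] by linarith
    next
      case False
      then have "1 \<le> (r * cmod \<xi>) powr \<sigma>" using C by (intro ge_one_powr_ge_zero) auto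
      then show ?thesis using d(2) by linarith
    qed
    then have "cmod (cf Q \<xi>) * cmod (1 - cf (disc_measure r) \<xi>) \<le> (C * cmod \<xi> powr (- \<sigma>)) * (2 * (r * cmod \<xi>) powr \<sigma>)"
      using decay[OF True] C by (intro mult_mono) auto
    also have "\<dots> = 2 * C * r powr \<sigma> * (cmod \<xi> powr (- \<sigma>) * cmod \<xi> powr \<sigma>)"
      using r by (simp add: powr_mult mult_ac)
    also have "cmod \<xi> powr (- \<sigma>) * cmod \<xi> powr \<sigma> = 1" using True by (auto simp flip: powr_add)
    finally show ?thesis by simp
  next
    case False
    have "cmod (cf Q \<xi>) * cmod (1 - cf (disc_measure r) \<xi>) \<le> 1 * (r * cmod \<xi>)"
      using Q1 d(1) by (intro mult_mono) auto
    also have "\<dots> \<le> r * 1" using False r by (simp add: mult_left_le)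
    also have "\<dots> \<le> r powr \<sigma>" using r1[of r] r by simp
    also have "\<dots> \<le> 2 * C * r powr \<sigma>" using C mult_right_mono[of 1 "2 * C" "r powr \<sigma>"] by simp
    finally show ?thesis .
  qed
qed

text \<open>The mass of \<open>B\<close> after mollifying \<nu> by the disc of radius
  \<open>r k\<close> changes between consecutive \<open>k\<close> by at most a multiple of
  \<open>\<rho> ^ k\<close>, by \<open>smoothing_diff\<close>. At the starting level
  \<open>k0\<close> the bounded density of the disc applies; finally \<open>k0\<close> is adapted to
  the measure of \<open>B\<close>.\<close>

theorem (in selfsim_seq) power_bound:
  assumes FD: "\<forall>\<epsilon>>0. \<exists>t>0. \<exists>N. edrop q t (X N) < \<epsilon>"
    and \<nu>: "prob_space \<nu>" "complex_finite_measure \<nu>" "sets \<nu> = sets borel"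
    and Q: "\<And>n. prob_space (Q n)" "\<And>n. complex_finite_measure (Q n)"
    and split: "\<And>n \<xi>. cf \<nu> \<xi> = cf (measure_pmf (X n)) \<xi> * cf (Q n) \<xi>"
    and C: "C \<ge> 1" "0 < \<sigma>" "\<sigma> \<le> 1"
    and decay: "\<And>n \<xi>. cmod \<xi> \<ge> 1 \<Longrightarrow> cmod (cf (Q n) \<xi>) \<le> C * cmod \<xi> powr (- \<sigma>)"
  shows "\<exists>K \<gamma>. K > 0 \<and> \<gamma> > 0 \<and>
    (\<forall>B. open B \<longrightarrow> emeasure lborel B \<le> 1 \<longrightarrow> emeasure \<nu> B \<le> ennreal (K * measure lborel B powr \<gamma>))"
proof -
  define L where "L = - ln q"
  have L: "L > 0" using lam by (simp add: L_def)
  have qL: "q ^ m = exp (- (L * real m))" for m using lam by (simp add: L_def exp_of_nat2_mult)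
  \<comment> \<open>Up to a constant the multiplier is then
    \<open>exp (- 2 * \<epsilon> * k * n)\<close>, which outweighs the square root of the cut-off
    \<open>T k = exp (\<epsilon> * k * n)\<close>; moments taken with \<open>\<epsilon> / 2\<close>
    keep the mass above the cut-off below \<open>\<rho> ^ k\<close>.\<close>
  define \<epsilon> where "\<epsilon> = \<sigma> * L / 2"
  have \<epsilon>: "\<epsilon> > 0" using L C by (simp add: \<epsilon>_def)
  obtain n s where n: "n \<ge> 1" and s: "0 < s" "s \<le> 1"
    and mom: "\<And>k. (LINT x|lborel. dens (q ^ (k * n)) (X (k * n)) x powr (1 + s)) \<le> exp (s * (\<epsilon> / 2) * real (k * n))"
  proof -
    have "\<epsilon> / 2 > 0" using \<epsilon> by simp
    from dens_moments[OF FD this] that show thesis by blast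
  qed
  define r where "r k = q ^ (k * n)" for k
  have r: "0 < r k" "r k \<le> 1" for k using lam by (auto simp: r_def power_le_one)
  have rL: "r k = exp (- (L * real (k * n)))" for k by (simp add: r_def qL)
  define T where "T k = exp (\<epsilon> * real (k * n))" for k
  define \<rho> where "\<rho> = exp (- (s * \<epsilon> * real n / 2))"
  have \<rho>: "0 < \<rho>" "\<rho> < 1" using s \<epsilon> n by (auto simp: \<rho>_def)
  have \<rho>k: "\<rho> ^ k = exp (- (s * \<epsilon> * real (k * n) / 2))" for k
    unfolding \<rho>_def exp_of_nat_mult[symmetric] by (rule arg_cong[where f=exp]) simp
  define E where "E = 2 * C * (1 / q ^ n) powr \<sigma> + 1"
  have E: "E > 0" using C by (simp add: E_def add_nonneg_pos)
  \<comment> \<open>Dividing by \<open>q ^ n\<close> admits discs one level coarser too, because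
    \<open>r k = r (Suc k) / q ^ n\<close>.\<close>
  define M where "M k = 2 * C * (r k / q ^ n) powr \<sigma>" for k
  have M: "M k > 0" for k using C r[of k] lam by (simp add: M_def)
  have MT: "M k * sqrt (T k) + \<rho> ^ k \<le> E * \<rho> ^ k" for k
  proof -
    have "sqrt (T k) = exp (\<epsilon> * real (k * n) / 2)"
      unfolding T_def by (rule real_sqrt_unique) (auto simp flip: exp_of_nat2_mult exp_double)
    moreover have "(r k / q ^ n) powr \<sigma> = (1 / q ^ n) powr \<sigma> * exp (- (2 * \<epsilon> * real (k * n)))"
    proof -
      have "(r k / q ^ n) powr \<sigma> = (1 / q ^ n * r k) powr \<sigma>" by simp
      also have "\<dots> = (1 / q ^ n) powr \<sigma> * r k powr \<sigma>" by (rule powr_mult)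
      also have "r k powr \<sigma> = exp (- (2 * \<epsilon> * real (k * n)))" by (simp add: rL powr_def \<epsilon>_def)
      finally show ?thesis .
    qed
    ultimately have "M k * sqrt (T k) = 2 * C * (1 / q ^ n) powr \<sigma> * (exp (- (2 * \<epsilon> * real (k * n))) * exp (\<epsilon> * real (k * n) / 2))"
      by (simp add: M_def)
    also have "exp (- (2 * \<epsilon> * real (k * n))) * exp (\<epsilon> * real (k * n) / 2) \<le> \<rho> ^ k"
    proof -
      have "0 \<le> \<epsilon> * real (k * n)" using \<epsilon> by simp
      moreover have "s * (\<epsilon> * real (k * n)) \<le> 1 * (\<epsilon> * real (k * n))" using s calculation by (intro mult_right_mono) auto
      ultimately show ?thesis unfolding \<rho>k mult_exp_exp by simp
    qed
    finally have "M k * sqrt (T k) \<le> 2 * C * (1 / q ^ n) powr \<sigma> * \<rho> ^ k" using C by (simp add: mult_left_mono)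
    then show ?thesis by (simp add: E_def distrib_right)
  qed
  have tail: "(LINT x|lborel. indicator {x. dens (r k) (X (k * n)) x > T k} x * dens (r k) (X (k * n)) x) \<le> \<rho> ^ k" for k
  proof -
    let ?f = "dens (r k) (X (k * n))"
    have T0: "T k > 0" by (simp add: T_def)
    have i: "integrable lborel (\<lambda>x. ?f x powr (1 + s))" using s r by (intro dens_powr_integrable) auto
    have "(LINT x|lborel. indicator {x. ?f x > T k} x * ?f x) \<le> (LINT x|lborel. T k powr (- s) * ?f x powr (1 + s))"
    proof (rule integral_mono_AE')
      show "integrable lborel (\<lambda>x. T k powr (- s) * ?f x powr (1 + s))" using i by simp
      show "AE x in lborel. indicator {x. ?f x > T k} x * ?f x \<le> T k powr (- s) * ?f x powr (1 + s)"
      proof (rule AE_I2)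
        fix x show "indicator {x. ?f x > T k} x * ?f x \<le> T k powr (- s) * ?f x powr (1 + s)"
        proof (cases "?f x > T k")
          case True
          then have f: "?f x > 0" using T0 by linarith
          have "T k powr s \<le> ?f x powr s" using True T0 s by (intro powr_mono2) auto
          then have "T k powr (- s) * T k powr s \<le> T k powr (- s) * ?f x powr s" by (rule mult_left_mono) simp
          then have "1 \<le> T k powr (- s) * ?f x powr s" using T0 by (simp flip: powr_add)
          then have "?f x * 1 \<le> ?f x * (T k powr (- s) * ?f x powr s)" using f by (intro mult_left_mono) auto
          also have "\<dots> = T k powr (- s) * ?f x powr (1 + s)" using f by (simp add: powr_add)
          finally show ?thesis using True by simp
        qed simp
      qed
      show "AE x in lborel. 0 \<le> T k powr (- s) * ?f x powr (1 + s)" by simp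
    qed
    also have "\<dots> \<le> T k powr (- s) * exp (s * (\<epsilon> / 2) * real (k * n))"
      using mom[of k] by (simp add: r_def mult_left_mono)
    also have "\<dots> = \<rho> ^ k" by (simp add: T_def powr_def \<rho>k mult_exp_exp algebra_simps)
    finally show ?thesis .
  qed
  have mult: "cmod (cf (Q m) \<xi>) * cmod (1 - cf (disc_measure (r j)) \<xi>) \<le> M k" if "r j \<le> r k / q ^ n" for m \<xi> j k
  proof -
    have "cmod (cf (Q m) \<xi>) * cmod (1 - cf (disc_measure (r j)) \<xi>) \<le> 2 * C * r j powr \<sigma>"
      by (rule disc_multiplier_le[OF Q(1) Q(2) C _ r]) (rule decay)
    also have "\<dots> \<le> M k" unfolding M_def using that C r[of j] by (intro mult_left_mono powr_mono2) auto
    finally show ?thesis .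
  qed
  have rSuc: "r (Suc k) = r k * q ^ n" for k by (simp add: r_def power_add)
  have qn: "0 < q ^ n" "q ^ n \<le> 1" using lam by (auto simp: power_le_one)
  have step: "r (Suc k) \<le> r k / q ^ n" "r k \<le> r (Suc k) / q ^ n" for k
  proof -
    have "r k * q ^ n \<le> r k * 1" using r[of k] qn by (intro mult_left_mono) auto
    moreover have "r k \<le> r k / q ^ n" using r[of k] qn by (simp add: le_divide_eq mult_left_le)
    ultimately show "r (Suc k) \<le> r k / q ^ n" by (simp add: rSuc)
    show "r k \<le> r (Suc k) / q ^ n" using qn by (simp add: rSuc)
  qed
  have bound: "emeasure \<nu> B \<le> ennreal (measure lborel B / (r k0)\<^sup>2 + 2 * E / (1 - \<rho>) * \<rho> ^ k0)"
    if B: "open B" "emeasure lborel B \<le> 1" for B k0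
  proof -
    have [measurable]: "B \<in> sets borel" using B by simp
    have eB: "emeasure lborel B = ennreal (measure lborel B)"
      using B(2) by (intro emeasure_eq_ennreal_measure) (auto simp: top_unique)
    define a where "a k = conv_measure \<nu> (disc_measure (r k))" for k
    have fa: "complex_finite_measure (a k)" for k unfolding a_def by (intro conv_measure_finite \<nu> disc_measure_finite r)
    define I where "I \<delta> k = (LINT x|lborel. indicator B x * gsm \<delta> (a k) x)" for \<delta> k
    have conv: "(\<integral>\<^sup>+x. indicator B x * ennreal (gsm \<delta> (a k) x) \<partial>lborel) = ennreal (I \<delta> k)" if "\<delta> > 0" for \<delta> k
    proof -
      interpret a: complex_finite_measure "a k" by (rule fa)
      have "(\<integral>\<^sup>+x. indicator B x * ennreal (gsm \<delta> (a k) x) \<partial>lborel) = (\<integral>\<^sup>+x. ennreal (indicator B x * gsm \<delta> (a k) x) \<partial>lborel)"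
        by (intro nn_integral_cong) (auto simp: indicator_def)
      also have "\<dots> = ennreal (I \<delta> k)" unfolding I_def
        by (intro nn_integral_eq_integral Bochner_Integration.integrable_bound[OF a.integrable_gsm_N[OF that]])
           (auto simp: indicator_def a.gsm_nonneg)
      finally show ?thesis .
    qed
    have diff: "\<bar>I \<delta> (Suc k) - I \<delta> k\<bar> \<le> 2 * E * \<rho> ^ k" if \<delta>: "\<delta> > 0" for \<delta> k
    proof -
      let ?J = "\<lambda>i j. (LINT x|lborel. indicator B x * gsm \<delta> (conv_measure (a i) (disc_measure (r j))) x)"
      \<comment> \<open>Neighbouring levels are compared through the convolution with both discs,
        which is reached from either side by adding one disc.\<close>
      have "?J k (Suc k) = ?J (Suc k) k"
        by (rule smoothed_eqI)
           (auto simp: B \<delta> a_def cf_conv_measure \<nu> conv_measure_finite disc_measure_finite r mult_ac)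
      moreover have "\<bar>I \<delta> k - ?J k (Suc k)\<bar> \<le> M k * sqrt (T k) + \<rho> ^ k"
        unfolding I_def a_def
        by (rule smoothing_diff[OF \<nu>(1,2) Q fin_X split r(1) r(1) \<delta> _ M mult[OF step(1)] tail _ B(2)]) (auto simp: T_def)
      moreover have "\<bar>I \<delta> (Suc k) - ?J (Suc k) k\<bar> \<le> M (Suc k) * sqrt (T (Suc k)) + \<rho> ^ Suc k"
        unfolding I_def a_def
        by (rule smoothing_diff[OF \<nu>(1,2) Q fin_X split r(1) r(1) \<delta> _ M mult[OF step(2)] tail _ B(2)]) (auto simp: T_def)
      moreover have "E * \<rho> ^ Suc k \<le> E * \<rho> ^ k" using E \<rho> by (intro mult_left_mono power_decreasing) auto
      ultimately show ?thesis using MT[of k] MT[of "Suc k"] by linarith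
    qed
    have sum: "I \<delta> (k0 + m) \<le> I \<delta> k0 + 2 * E / (1 - \<rho>) * (\<rho> ^ k0 - \<rho> ^ (k0 + m))" if "\<delta> > 0" for \<delta> m
    proof (induction m)
      case (Suc m)
      have "2 * E / (1 - \<rho>) * (\<rho> ^ k0 - \<rho> ^ (k0 + Suc m))
         = 2 * E / (1 - \<rho>) * (\<rho> ^ k0 - \<rho> ^ (k0 + m)) + 2 * E / (1 - \<rho>) * ((1 - \<rho>) * \<rho> ^ (k0 + m))"
        unfolding distrib_left[symmetric] by (simp add: algebra_simps)
      also have "2 * E / (1 - \<rho>) * ((1 - \<rho>) * \<rho> ^ (k0 + m)) = 2 * E * \<rho> ^ (k0 + m)" using \<rho> by simp
      finally show ?case using Suc.IH diff[OF that, of "k0 + m"] by simp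
    qed simp
    have I0: "I \<delta> k0 \<le> measure lborel B / (r k0)\<^sup>2" if "\<delta> > 0" for \<delta>
    proof -
      have "ennreal (I \<delta> k0) \<le> ennreal (1 / (pi * (r k0)\<^sup>2)) * emeasure lborel B"
        unfolding conv[OF that, symmetric] a_def by (rule gsm_conv_disc_le[OF \<nu>(1,2) r(1) that]) simp
      also have "\<dots> = ennreal (1 / (pi * (r k0)\<^sup>2) * measure lborel B)"
        unfolding eB by (rule ennreal_mult[symmetric]) auto
      finally have "I \<delta> k0 \<le> 1 / (pi * (r k0)\<^sup>2) * measure lborel B" by (subst (asm) ennreal_le_iff) auto
      also have "\<dots> \<le> 1 / (1 * (r k0)\<^sup>2) * measure lborel B"
        using pi_ge_two r[of k0] by (intro mult_right_mono divide_left_mono) auto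
      finally show ?thesis by simp
    qed
    show ?thesis
    proof (rule open_le_smoothed[OF \<nu> B(1), of r _ k0])
      have "(\<lambda>k. (q ^ n) ^ k) \<longlonglongrightarrow> 0" using lam n by (intro LIMSEQ_realpow_zero) (auto simp: power_less_one_iff)
      then show "r \<longlonglongrightarrow> 0" by (simp add: r_def[abs_def] power_mult[symmetric] mult.commute)
      show "r k > 0" for k by (rule r)
      have "0 \<le> measure lborel B / (r k0)\<^sup>2" by simp
      moreover have "0 \<le> 2 * E / (1 - \<rho>) * \<rho> ^ k0" using E \<rho> by simp
      ultimately show "0 \<le> measure lborel B / (r k0)\<^sup>2 + 2 * E / (1 - \<rho>) * \<rho> ^ k0" by linarith
      fix k \<delta> assume k: "k0 \<le> k" and \<delta>: "0 < (\<delta>::real)"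
      have "I \<delta> k \<le> measure lborel B / (r k0)\<^sup>2 + 2 * E / (1 - \<rho>) * (\<rho> ^ k0 - \<rho> ^ k)"
        using sum[OF \<delta>, of "k - k0"] I0[OF \<delta>] k by simp
      also have "2 * E / (1 - \<rho>) * (\<rho> ^ k0 - \<rho> ^ k) \<le> 2 * E / (1 - \<rho>) * \<rho> ^ k0"
        using E \<rho> by (intro mult_left_mono) auto
      finally show "(\<integral>\<^sup>+x. indicator B x * ennreal (gsm \<delta> (conv_measure \<nu> (disc_measure (r k))) x) \<partial>lborel)
          \<le> ennreal (measure lborel B / (r k0)\<^sup>2 + 2 * E / (1 - \<rho>) * \<rho> ^ k0)"
        unfolding a_def[symmetric] conv[OF \<delta>] by (intro ennreal_leI) simp
    qed
  qed
  define \<gamma> where "\<gamma> = s * \<sigma> / 16"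
  have \<gamma>: "\<gamma> > 0" "\<gamma> \<le> 1 / 2"
  proof -
    have "s * \<sigma> \<le> 1" using s C mult_mono[of s 1 \<sigma> 1] by simp
    then show "\<gamma> \<le> 1 / 2" unfolding \<gamma>_def by linarith
    show "\<gamma> > 0" using s C by (simp add: \<gamma>_def)
  qed
  define K where "K = 1 + 2 * E / (1 - \<rho>) / \<rho>"
  have K: "K > 0" using E \<rho> by (simp add: K_def add_pos_nonneg)
  have "emeasure \<nu> B \<le> ennreal (K * measure lborel B powr \<gamma>)" if B: "open B" "emeasure lborel B \<le> 1" for B
  proof (cases "measure lborel B = 0")
    case True
    have "(\<lambda>k. 2 * E / (1 - \<rho>) * \<rho> ^ k) \<longlonglongrightarrow> 2 * E / (1 - \<rho>) * 0"
      using \<rho> by (intro tendsto_mult tendsto_const LIMSEQ_realpow_zero) auto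
    then have "(\<lambda>k. ennreal (2 * E / (1 - \<rho>) * \<rho> ^ k)) \<longlonglongrightarrow> ennreal 0" by (intro tendsto_ennrealI) simp
    moreover have "emeasure \<nu> B \<le> ennreal (2 * E / (1 - \<rho>) * \<rho> ^ k)" for k using bound[OF B, of k] True by simp
    ultimately have "emeasure \<nu> B \<le> ennreal 0" by (intro LIMSEQ_le_const) auto
    then show ?thesis by simp
  next
    case False
    define b where "b = measure lborel B"
    have b: "b > 0" using False by (simp add: b_def zero_less_measure_iff)
    have b1: "b \<le> 1" using B(2) unfolding b_def measure_def by (metis enn2real_1 enn2real_mono ennreal_one_less_top)
    \<comment> \<open>With \<open>k\<close> near \<open>x\<close>, the square of \<open>r k\<close>
      is about \<open>sqrt b\<close>, so the first term is at most \<open>b powr (1 / 2)\<close>.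
      The second becomes a multiple of \<open>b powr \<gamma>\<close>, since
      \<open>s * \<epsilon> * n * x / 2 = - \<gamma> * ln b\<close>.\<close>
    define x where "x = - ln b / (4 * L * real n)"
    have x: "x \<ge> 0" unfolding x_def using b b1 L by (intro divide_nonneg_nonneg mult_nonneg_nonneg) auto
    define k where "k = nat \<lfloor>x\<rfloor>"
    have k: "real k \<le> x" "x \<le> real k + 1" using x unfolding k_def by linarith+
    have n0: "real n > 0" using n by simp
    have xb: "4 * L * real n * x = - ln b" using L n0 by (simp add: x_def)
    have "(r k)\<^sup>2 = exp (- (2 * L * real n * real k))" by (simp add: rL power2_eq_square mult_exp_exp algebra_simps)
    then have "b / (r k)\<^sup>2 = exp (ln b + 2 * L * real n * real k)" by (simp only: exp_minus divide_inverse inverse_inverse_eq exp_add exp_ln[OF b])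
    also have "\<dots> \<le> exp (ln b / 2)"
    proof -
      have "2 * L * real n * real k \<le> 2 * L * real n * x" using L k n0 by (intro mult_left_mono) auto
      then show ?thesis using xb by simp
    qed
    also have "\<dots> = b powr (1 / 2)" using b by (simp add: powr_def)
    also have "\<dots> \<le> b powr \<gamma>" using b b1 \<gamma> by (intro powr_mono') auto
    finally have 1: "b / (r k)\<^sup>2 \<le> b powr \<gamma>" .
    have "\<rho> ^ k \<le> b powr \<gamma> / \<rho>"
    proof -
      have "\<rho> ^ Suc k = exp (- (s * \<epsilon> * real n / 2) * real (Suc k))" unfolding \<rho>k by (simp add: algebra_simps)
      also have "\<dots> \<le> exp (- (s * \<epsilon> * real n / 2) * x)"
        using k s \<epsilon> n0 by (simp only: exp_le_cancel_iff, intro mult_left_mono_neg) auto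
      also have "- (s * \<epsilon> * real n / 2) * x = - (s * \<sigma> / 16) * (4 * L * real n * x)" by (simp add: \<epsilon>_def)
      also have "\<dots> = \<gamma> * ln b" unfolding xb \<gamma>_def by simp
      also have "exp (\<gamma> * ln b) = b powr \<gamma>" using b by (simp add: powr_def)
      finally show ?thesis using \<rho> by (simp add: le_divide_eq mult.commute)
    qed
    then have 2: "2 * E / (1 - \<rho>) * \<rho> ^ k \<le> 2 * E / (1 - \<rho>) * (b powr \<gamma> / \<rho>)"
      using E \<rho> by (intro mult_left_mono) auto
    have "b / (r k)\<^sup>2 + 2 * E / (1 - \<rho>) * \<rho> ^ k \<le> K * b powr \<gamma>"
      using 1 2 unfolding K_def distrib_right by simp
    then show ?thesis using bound[OF B, of k] unfolding b_def by (meson ennreal_leI order_trans)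
  qed
  then show ?thesis using K \<gamma> by blast
qed


text \<open>Outer regularity passes from open sets to Borel sets. By Markov's inequality the level
  set \<open>A i\<close> has Lebesgue measure at most \<open>1 / 2 ^ (i + 1)\<close>, hence small
  mass under \<nu>, and summation over dyadic levels bounds a moment of order above 1.\<close>

theorem density_of_power_bound:
  fixes \<nu> :: "complex measure"
  assumes \<nu>: "prob_space \<nu>" "sets \<nu> = sets borel" and K: "K > 0" "\<gamma> > 0"
    and bound: "\<forall>B. open B \<longrightarrow> emeasure lborel B \<le> 1 \<longrightarrow> emeasure \<nu> B \<le> ennreal (K * measure lborel B powr \<gamma>)"
  shows "absolutely_continuous lborel \<nu> \<and> (\<exists>q>1. has_density_in_Lq q \<nu>)"
proof -
  interpret prob_space \<nu> by fact
  have borel: "emeasure \<nu> B \<le> ennreal (K * (2 * b) powr \<gamma>)"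
    if B: "B \<in> sets borel" "emeasure lborel B \<le> ennreal b" and b: "0 < b" "b \<le> 1 / 2" for B b
  proof -
    obtain U where U: "open U" "B \<subseteq> U" "emeasure lborel (U - B) < ennreal b"
      using outer_regular_lborel[OF B(1) b(1)] by blast
    have "emeasure lborel U \<le> emeasure lborel B + emeasure lborel (U - B)"
      using U B emeasure_subadditive[of B lborel "U - B"] by (simp add: Un_absorb1)
    also have "\<dots> \<le> ennreal b + ennreal b" using U(3) B(2) by (intro add_mono) auto
    also have "\<dots> = ennreal (2 * b)" using b by (simp flip: ennreal_plus)
    finally have Ub: "emeasure lborel U \<le> ennreal (2 * b)" .
    have "emeasure \<nu> B \<le> emeasure \<nu> U" using U(1,2) \<nu> by (intro emeasure_mono) auto
    also have "\<dots> \<le> ennreal (K * measure lborel U powr \<gamma>)"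
    proof -
      have "ennreal (2 * b) \<le> ennreal 1" using b by (intro ennreal_leI) simp
      then have "emeasure lborel U \<le> 1" using Ub by (metis ennreal_1 order_trans)
      with bound U(1) show ?thesis by blast
    qed
    also have "\<dots> \<le> ennreal (K * (2 * b) powr \<gamma>)"
    proof -
      have "measure lborel U \<le> 2 * b"
        using Ub b unfolding measure_def by (intro enn2real_leI) auto
      then show ?thesis using K by (intro ennreal_leI mult_left_mono powr_mono2) auto
    qed
    finally show ?thesis .
  qed
  have ac: "absolutely_continuous lborel \<nu>"
    unfolding absolutely_continuous_def
  proof
    fix B assume B: "B \<in> null_sets (lborel :: complex measure)"
    have "emeasure \<nu> B \<le> 0 + ennreal e" if e: "e > 0" for e
    proof -
      define b where "b = min (1 / 2) ((e / K) powr (1 / \<gamma>) / 2)"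
      have b: "0 < b" "b \<le> 1 / 2" using e K by (auto simp: b_def)
      have "2 * b \<le> (e / K) powr (1 / \<gamma>)" by (simp add: b_def)
      then have "(2 * b) powr \<gamma> \<le> ((e / K) powr (1 / \<gamma>)) powr \<gamma>" using b K by (intro powr_mono2) auto
      also have "\<dots> = e / K" using e K by (simp add: powr_powr)
      finally have "K * (2 * b) powr \<gamma> \<le> e" using K by (simp add: field_simps)
      moreover have "emeasure \<nu> B \<le> ennreal (K * (2 * b) powr \<gamma>)"
        using B b by (intro borel) (auto simp: null_sets_def)
      ultimately show ?thesis by (simp add: ennreal_leI order_trans)
    qed
    then have "emeasure \<nu> B = 0" by (metis ennreal_le_epsilon le_zero_eq)
    then show "B \<in> null_sets \<nu>" using B \<nu> by (auto simp: null_sets_def)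
  qed
  have "\<exists>f\<in>borel_measurable lborel. density lborel f = \<nu>"
    using ac \<nu> by (intro sigma_finite_measure.Radon_Nikodym sigma_finite_lborel) auto
  then obtain f where fl: "f \<in> borel_measurable lborel" and f\<nu>: "density lborel f = \<nu>" by blast
  have [measurable]: "f \<in> borel_measurable borel" using fl by simp
  have int1: "(\<integral>\<^sup>+x. f x \<partial>lborel) = 1"
  proof -
    have "emeasure (density lborel f) UNIV = (\<integral>\<^sup>+x. f x * indicator UNIV x \<partial>lborel)"
      using fl by (intro emeasure_density) auto
    then show ?thesis using emeasure_space_1 \<nu>(2) unfolding f\<nu> by (simp add: sets_eq_imp_space_eq)
  qed
  define g where "g x = enn2real (f x)" for x
  have [measurable]: "g \<in> borel_measurable borel" unfolding g_def by measurable
  have g0: "0 \<le> g x" for x by (simp add: g_def)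
  have fg: "AE x in lborel. f x = ennreal (g x)"
  proof -
    have "AE x in lborel. f x \<noteq> \<infinity>" using int1 fl by (intro nn_integral_PInf_AE) auto
    then show ?thesis by eventually_elim (simp add: g_def less_top)
  qed
  have g\<nu>: "\<nu> = density lborel (\<lambda>x. ennreal (g x))"
    unfolding f\<nu>[symmetric] using fg by (intro density_cong) (auto simp: fl)
  have g1: "(\<integral>\<^sup>+x. ennreal (g x) \<partial>lborel) = 1"
    unfolding int1[symmetric] using fg by (intro nn_integral_cong_AE) (auto elim: eventually_mono)
  \<comment> \<open>At level \<open>i\<close> the factor \<open>g powr s\<close> is at most
    \<open>2 powr (s * (i + 2))\<close> and the mass at most
    \<open>K * 2 powr (- 2 * s * i)\<close>; half of \<gamma> leaves a convergent geometric
    series.\<close>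
  define s where "s = \<gamma> / 2"
  have s: "s > 0" using K by (simp add: s_def)
  define A where "A i = {x. g x > 2 ^ Suc i}" for i :: nat
  have [measurable]: "A i \<in> sets borel" for i unfolding A_def by measurable
  define c where "c i = 2 powr (s * real (i + 2))" for i :: nat
  have \<nu>A: "(\<integral>\<^sup>+x. ennreal (g x) * indicator (A i) x \<partial>lborel) \<le> ennreal (K * (2 * (1 / 2 ^ Suc i)) powr \<gamma>)" for i
  proof -
    have "(\<integral>\<^sup>+x. ennreal (g x) * indicator (A i) x \<partial>lborel) = emeasure \<nu> (A i)"
      unfolding g\<nu> by (intro emeasure_density[symmetric]) auto
    also have "\<dots> \<le> ennreal (K * (2 * (1 / 2 ^ Suc i)) powr \<gamma>)"
    proof (rule borel)
      have "ennreal (2 ^ Suc i) * emeasure lborel (A i) = (\<integral>\<^sup>+x. ennreal (2 ^ Suc i) * indicator (A i) x \<partial>lborel)"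
        by (simp add: nn_integral_cmult_indicator)
      also have "\<dots> \<le> (\<integral>\<^sup>+x. ennreal (g x) \<partial>lborel)"
        by (intro nn_integral_mono) (auto simp: A_def indicator_def intro!: ennreal_leI)
      finally have "ennreal (2 ^ Suc i) * emeasure lborel (A i) \<le> 1" by (simp add: g1)
      then have "ennreal (1 / 2 ^ Suc i) * (ennreal (2 ^ Suc i) * emeasure lborel (A i)) \<le> ennreal (1 / 2 ^ Suc i) * 1"
        by (intro mult_left_mono) auto
      then show "emeasure lborel (A i) \<le> ennreal (1 / 2 ^ Suc i)"
        by (simp add: mult.assoc[symmetric] ennreal_mult[symmetric] del: power_Suc)
      have "(1::real) \<le> 2 ^ i" by simp
      then show "(1::real) / 2 ^ Suc i \<le> 1 / 2" by (simp add: field_simps)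
    qed auto
    finally show ?thesis .
  qed
  have pw: "ennreal (g x powr (1 + s)) \<le> ennreal (2 powr s) * ennreal (g x) + (\<Sum>i. ennreal (c i) * (ennreal (g x) * indicator (A i) x))" for x
  proof (cases "g x \<le> 2")
    case True
    have "g x powr (1 + s) = g x * g x powr s" using g0[of x] by (simp add: powr_mult_base)
    also have "\<dots> \<le> g x * 2 powr s" using True g0[of x] s by (intro mult_left_mono powr_mono2) auto
    finally have "ennreal (g x powr (1 + s)) \<le> ennreal (2 powr s) * ennreal (g x)"
      by (simp add: ennreal_mult[symmetric] g0 mult.commute ennreal_leI)
    then show ?thesis by (rule order_trans) simp
  next
    case False
    define m where "m = (LEAST m. g x \<le> 2 ^ m)"
    have "\<exists>m. g x \<le> 2 ^ m" using real_arch_pow[of 2 "g x"] by (auto intro: less_imp_le)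
    then have m: "g x \<le> 2 ^ m" unfolding m_def by (rule LeastI_ex)
    have m2: "m \<ge> 2"
    proof (rule ccontr)
      assume "\<not> m \<ge> 2"
      then have "(2::real) ^ m \<le> 2 ^ 1" by (intro power_increasing) auto
      then show False using m False by simp
    qed
    define i where "i = m - 2"
    have mi: "m = i + 2" using m2 by (simp add: i_def)
    have "\<not> g x \<le> 2 ^ (i + 1)" using not_less_Least[of "i + 1" "\<lambda>m. g x \<le> 2 ^ m"] mi unfolding m_def by simp
    then have xA: "x \<in> A i" by (simp add: A_def)
    have "g x powr (1 + s) = g x * g x powr s" using g0[of x] by (simp add: powr_mult_base)
    also have "\<dots> \<le> g x * (2 ^ m) powr s" using m g0[of x] s by (intro mult_left_mono powr_mono2) auto
    also have "(2 ^ m) powr s = c i"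
      unfolding c_def mi powr_realpow[of 2, OF zero_less_numeral, symmetric] powr_powr by (simp only: mult.commute)
    finally have "ennreal (g x powr (1 + s)) \<le> ennreal (c i) * (ennreal (g x) * indicator (A i) x)"
      using xA by (simp add: ennreal_mult[symmetric] g0 mult.commute ennreal_leI c_def)
    also have "\<dots> = (\<Sum>j\<in>{i}. ennreal (c j) * (ennreal (g x) * indicator (A j) x))" by simp
    also have "\<dots> \<le> (\<Sum>i. ennreal (c i) * (ennreal (g x) * indicator (A i) x))" by (rule sum_le_suminf) auto
    finally show ?thesis by (simp add: add_increasing)
  qed
  have "(\<integral>\<^sup>+x. ennreal (g x powr (1 + s)) \<partial>lborel)
      \<le> (\<integral>\<^sup>+x. ennreal (2 powr s) * ennreal (g x) + (\<Sum>i. ennreal (c i) * (ennreal (g x) * indicator (A i) x)) \<partial>lborel)"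
    by (intro nn_integral_mono pw)
  also have "\<dots> = (\<integral>\<^sup>+x. ennreal (2 powr s) * ennreal (g x) \<partial>lborel)
      + (\<integral>\<^sup>+x. (\<Sum>i. ennreal (c i) * (ennreal (g x) * indicator (A i) x)) \<partial>lborel)"
    by (rule nn_integral_add) (simp_all only: measurable_lborel2, measurable)
  also have "\<dots> = ennreal (2 powr s) + (\<Sum>i. ennreal (c i) * (\<integral>\<^sup>+x. ennreal (g x) * indicator (A i) x \<partial>lborel))"
    by (simp add: nn_integral_cmult nn_integral_suminf g1)
  also have "\<dots> \<le> ennreal (2 powr s) + (\<Sum>i. ennreal (K * 4 powr s * (2 powr (- s)) ^ i))"
  proof (intro add_left_mono suminf_le)
    fix i
    have "ennreal (c i) * (\<integral>\<^sup>+x. ennreal (g x) * indicator (A i) x \<partial>lborel)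
        \<le> ennreal (c i) * ennreal (K * (2 * (1 / 2 ^ Suc i)) powr \<gamma>)" by (intro mult_left_mono \<nu>A) simp
    also have "\<dots> = ennreal (c i * (K * (2 * (1 / 2 ^ Suc i)) powr \<gamma>))"
      using K by (intro ennreal_mult[symmetric]) (auto simp: c_def)
    also have "c i * (K * (2 * (1 / 2 ^ Suc i)) powr \<gamma>) = K * 4 powr s * (2 powr (- s)) ^ i"
    proof -
      have "(2 * (1 / 2 ^ Suc i) :: real) = 2 powr (- real i)"
      proof -
        have "(2::real) powr (- real i) = inverse (2 ^ i)" by (simp only: powr_minus powr_realpow[of 2, OF zero_less_numeral])
        then show ?thesis by (simp add: inverse_eq_divide)
      qed
      then have 1: "(2 * (1 / 2 ^ Suc i)) powr \<gamma> = 2 powr (- real i * (2 * s))"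
        unfolding s_def by (simp only: powr_powr) simp
      have 2: "4 powr s = 2 powr (2 * s)" unfolding powr_powr[symmetric] by simp
      have 3: "(2 powr (- s)) ^ i = 2 powr (- s * real i)"
        unfolding powr_powr[symmetric] by (intro powr_realpow[symmetric]) simp
      have "2 powr (s * real (i + 2)) * 2 powr (- real i * (2 * s)) = 2 powr (2 * s) * (2 powr (- s * real i) :: real)"
        unfolding powr_add[symmetric] by (rule arg_cong[where f="(powr) 2"]) (simp add: algebra_simps)
      then show ?thesis unfolding 1 2 3 c_def by (metis mult.assoc mult.commute)
    qed
    finally show "ennreal (c i) * (\<integral>\<^sup>+x. ennreal (g x) * indicator (A i) x \<partial>lborel) \<le> ennreal (K * 4 powr s * (2 powr (- s)) ^ i)" .
  qed auto
  also have "\<dots> = ennreal (2 powr s) + ennreal (\<Sum>i. K * 4 powr s * (2 powr (- s)) ^ i)"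
  proof -
    have "(2::real) powr (- s) < 1" using s by (simp add: powr_less_one)
    then have "summable (\<lambda>i. (2 powr (- s)) ^ i :: real)" by (intro summable_geometric) auto
    then show ?thesis using K by (subst suminf_ennreal2) (auto intro!: summable_mult)
  qed
  also have "\<dots> < \<infinity>" by simp
  finally have "integrable lborel (\<lambda>x. g x powr (1 + s))" by (intro integrableI_bounded) auto
  then have "has_density_in_Lq (1 + s) \<nu>" unfolding has_density_in_Lq_def using g\<nu> g0 by (intro exI[of _ g]) auto
  then show ?thesis using ac s by (intro conjI exI[of _ "1 + s"]) auto
qed

section \<open>Self-similar measures and attractors\<close>

context
  fixes lam :: complex and a :: "'i::finite \<Rightarrow> complex"
  assumes lam: "0 < cmod lam" "cmod lam < 1"
begin

definition coding :: "'i stream \<Rightarrow> complex" where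
  "coding s = (\<Sum>n. lam ^ n * a (s !! n))"

lemma digits_bounded: "\<exists>R\<ge>0. \<forall>i. cmod (a i) \<le> R"
proof -
  have "\<forall>i. cmod (a i) \<le> (\<Sum>i\<in>UNIV. cmod (a i))" by (auto intro!: member_le_sum)
  then show ?thesis by (meson norm_ge_zero order_trans)
qed

lemma coding_aux: "summable (\<lambda>n. lam ^ n * a (s !! n))" "\<exists>R. \<forall>s. cmod (coding s) \<le> R"
proof -
  obtain R where R: "R \<ge> 0" "\<And>i. cmod (a i) \<le> R" using digits_bounded by blast
  have s: "summable (\<lambda>n. cmod lam ^ n * R)" using lam by (intro summable_mult2 summable_geometric) auto
  have b: "cmod (lam ^ n * a (s !! n)) \<le> cmod lam ^ n * R" for n and s :: "'i stream"
    by (simp add: norm_mult norm_power R mult_left_mono)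
  show "summable (\<lambda>n. lam ^ n * a (s !! n))" by (rule summable_comparison_test'[OF s b])
  have "cmod (coding s) \<le> (\<Sum>n. cmod lam ^ n * R)" for s
    unfolding coding_def by (rule norm_suminf_le[OF b s])
  then show "\<exists>R. \<forall>s. cmod (coding s) \<le> R" by blast
qed

lemma coding_Stream: "coding (i ## s) = lam * coding s + a i"
proof -
  have "coding (i ## s) = (\<Sum>n. lam ^ Suc n * a ((i ## s) !! Suc n)) + a i"
    unfolding coding_def using suminf_split_head[OF coding_aux(1)[of "i ## s"]] by simp
  also have "(\<Sum>n. lam ^ Suc n * a ((i ## s) !! Suc n)) = lam * coding s"
    unfolding coding_def by (subst suminf_mult[symmetric]) (auto simp: coding_aux mult.assoc)
  finally show ?thesis .
qed

lemma measurable_coding[measurable]: "coding \<in> borel_measurable (stream_space (count_space UNIV))"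
proof (rule borel_measurable_LIMSEQ_metric)
  show "(\<lambda>s. \<Sum>n<k. lam ^ n * a (s !! n)) \<in> borel_measurable (stream_space (count_space UNIV))" for k
    by measurable
  show "(\<lambda>k. \<Sum>n<k. lam ^ n * a (s !! n)) \<longlonglongrightarrow> coding s" for s
    unfolding coding_def by (rule summable_LIMSEQ[OF coding_aux(1)])
qed

text \<open>The image of the Bernoulli measure under the coding map: an explicit model that settles
  existence, so that \<open>THE\<close> is resolved by uniqueness alone.\<close>

definition coding_measure :: "'i pmf \<Rightarrow> complex measure" where
  "coding_measure P = distr (stream_space (measure_pmf P)) borel coding"

lemma coding_measure_self_similar: "is_self_similar_measure lam a (pmf P) (coding_measure P)"
  unfolding is_self_similar_measure_def
proof (intro conjI ballI)
  interpret S: prob_space "stream_space (measure_pmf P)" by (rule prob_space.prob_space_stream_space[OF measure_pmf.prob_space_axioms])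
  show "prob_space (coding_measure P)" unfolding coding_measure_def by (rule S.prob_space_distr) measurable
  show "sets (coding_measure P) = sets borel" by (simp add: coding_measure_def)
  fix B :: "complex set" assume B[measurable]: "B \<in> sets borel"
  have [measurable]: "sim lam c \<in> borel_measurable borel" for c unfolding sim_def by measurable
  have I: "emeasure (coding_measure P) C = (\<integral>\<^sup>+s. indicator C (coding s) \<partial>stream_space (measure_pmf P))"
    if [measurable]: "C \<in> sets borel" for C
  proof -
    have "emeasure (coding_measure P) C = (\<integral>\<^sup>+x. indicator C x \<partial>coding_measure P)"
      by (simp add: coding_measure_def)
    also have "\<dots> = (\<integral>\<^sup>+s. indicator C (coding s) \<partial>stream_space (measure_pmf P))"
      unfolding coding_measure_def by (rule nn_integral_distr) (simp_all add: that)
    finally show ?thesis .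
  qed
  have "emeasure (coding_measure P) B = (\<integral>\<^sup>+i. (\<integral>\<^sup>+s. indicator B (coding (i ## s)) \<partial>stream_space (measure_pmf P)) \<partial>measure_pmf P)"
    unfolding I[OF B] by (rule prob_space.nn_integral_stream_space[OF measure_pmf.prob_space_axioms]) measurable
  also have "\<dots> = (\<integral>\<^sup>+i. emeasure (distr (coding_measure P) borel (sim lam (a i))) B \<partial>measure_pmf P)"
  proof (intro nn_integral_cong)
    fix i
    have "(\<integral>\<^sup>+s. indicator B (coding (i ## s)) \<partial>stream_space (measure_pmf P))
        = (\<integral>\<^sup>+s. indicator (sim lam (a i) -` B) (coding s) \<partial>stream_space (measure_pmf P))"
      by (simp add: coding_Stream sim_def indicator_def)
    also have "\<dots> = emeasure (coding_measure P) (sim lam (a i) -` B)"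
      by (intro I[symmetric] measurable_sets_borel[of _ borel]) measurable
    also have "\<dots> = emeasure (distr (coding_measure P) borel (sim lam (a i))) B"
      by (subst emeasure_distr) (auto simp: coding_measure_def)
    finally show "(\<integral>\<^sup>+s. indicator B (coding (i ## s)) \<partial>stream_space (measure_pmf P))
        = emeasure (distr (coding_measure P) borel (sim lam (a i))) B" .
  qed
  also have "\<dots> = (\<Sum>i\<in>set_pmf P. emeasure (distr (coding_measure P) borel (sim lam (a i))) B * ennreal (pmf P i))"
    by (rule nn_integral_measure_pmf_finite) simp_all
  also have "\<dots> = (\<Sum>i\<in>UNIV. ennreal (pmf P i) * emeasure (distr (coding_measure P) borel (sim lam (a i))) B)"
    by (intro sum.mono_neutral_cong_left) (auto simp: set_pmf_iff mult.commute)
  finally show "emeasure (coding_measure P) B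
      = (\<Sum>i\<in>UNIV. ennreal (pmf P i) * emeasure (distr (coding_measure P) borel (sim lam (a i))) B)" .
qed

lemma self_similar_integral:
  fixes f :: "complex \<Rightarrow> 'b::{banach, second_countable_topology}"
  assumes \<nu>: "is_self_similar_measure lam a (pmf P) \<nu>" and f[measurable]: "f \<in> borel_measurable borel"
    and B: "\<And>x. norm (f x) \<le> B"
  shows "(LINT x|\<nu>. f x) = (\<Sum>i\<in>UNIV. pmf P i *\<^sub>R (LINT x|\<nu>. f (lam * x + a i)))"
proof -
  have sets[measurable_cong]: "sets \<nu> = sets borel" and "prob_space \<nu>"
    using \<nu> by (auto simp: is_self_similar_measure_def)
  interpret \<nu>: prob_space \<nu> by fact
  interpret PP: pair_prob_space "measure_pmf P" \<nu> ..
  have sp: "space \<nu> = UNIV" using sets_eq_imp_space_eq[OF sets] by simp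
  define \<phi> where "\<phi> = (\<lambda>(i, x). lam * x + a i)"
  have [measurable]: "\<phi> \<in> borel_measurable (measure_pmf P \<Otimes>\<^sub>M \<nu>)"
    unfolding \<phi>_def split_beta by measurable
  have "\<nu> = distr (measure_pmf P \<Otimes>\<^sub>M \<nu>) borel \<phi>"
  proof (rule measure_eqI)
    fix B assume "B \<in> sets \<nu>"
    then have B[measurable]: "B \<in> sets borel" by (simp add: sets)
    have m: "sim lam c \<in> borel_measurable \<nu>" for c
      unfolding measurable_cong_sets[OF sets refl] sim_def by measurable
    have "emeasure (distr (measure_pmf P \<Otimes>\<^sub>M \<nu>) borel \<phi>) B
        = emeasure (measure_pmf P \<Otimes>\<^sub>M \<nu>) (\<phi> -` B \<inter> space (measure_pmf P \<Otimes>\<^sub>M \<nu>))"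
      by (rule emeasure_distr) measurable
    also have "\<dots> = (\<integral>\<^sup>+i. emeasure \<nu> (Pair i -` (\<phi> -` B \<inter> space (measure_pmf P \<Otimes>\<^sub>M \<nu>))) \<partial>measure_pmf P)"
      by (rule \<nu>.emeasure_pair_measure_alt) measurable
    also have "\<dots> = (\<integral>\<^sup>+i. emeasure (distr \<nu> borel (sim lam (a i))) B \<partial>measure_pmf P)"
      by (intro nn_integral_cong, subst emeasure_distr)
        (auto simp: m \<phi>_def sim_def space_pair_measure sp intro!: arg_cong[where f="emeasure \<nu>"])
    also have "\<dots> = (\<Sum>i\<in>set_pmf P. emeasure (distr \<nu> borel (sim lam (a i))) B * ennreal (pmf P i))"
      by (rule nn_integral_measure_pmf_finite) simp_all
    also have "\<dots> = (\<Sum>i\<in>UNIV. ennreal (pmf P i) * emeasure (distr \<nu> borel (sim lam (a i))) B)"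
      by (intro sum.mono_neutral_cong_left) (auto simp: set_pmf_iff mult.commute)
    also have "\<dots> = emeasure \<nu> B" using \<nu> B by (simp add: is_self_similar_measure_def)
    finally show "emeasure \<nu> B = emeasure (distr (measure_pmf P \<Otimes>\<^sub>M \<nu>) borel \<phi>) B" by simp
  qed (simp add: sets)
  then have "(LINT x|\<nu>. f x) = (LINT x|distr (measure_pmf P \<Otimes>\<^sub>M \<nu>) borel \<phi>. f x)" by simp
  also have "\<dots> = (LINT z|(measure_pmf P \<Otimes>\<^sub>M \<nu>). f (\<phi> z))" by (rule integral_distr) measurable
  also have "\<dots> = (LINT i|measure_pmf P. LINT x|\<nu>. f (\<phi> (i, x)))"
    by (rule PP.integral_fst'[symmetric], rule PP.integrable_const_bound[where B=B]) (auto simp: B)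
  also have "\<dots> = (\<Sum>i\<in>set_pmf P. pmf P i *\<^sub>R (LINT x|\<nu>. f (lam * x + a i)))"
    by (subst expectation_fin) (auto simp: \<phi>_def)
  also have "\<dots> = (\<Sum>i\<in>UNIV. pmf P i *\<^sub>R (LINT x|\<nu>. f (lam * x + a i)))"
    by (intro sum.mono_neutral_left) (auto simp: set_pmf_iff)
  finally show ?thesis .
qed

text \<open>Averaging \<open>f\<close> over the maps preserves both integrals and multiplies the
  Lipschitz constant by \<open>|lam|\<close>; a nearly constant function has nearly equal integrals.
  Arbitrary invariant probabilities come without moment bounds, hence the truncation in \<kappa> and
  dominated convergence.\<close>

lemma self_similar_lipschitz_integral_eq:
  fixes f :: "complex \<Rightarrow> real"
  assumes M: "is_self_similar_measure lam a (pmf P) M" and N: "is_self_similar_measure lam a (pmf P) N"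
    and f: "\<And>x y. \<bar>f x - f y\<bar> \<le> c * cmod (x - y)" "\<And>x. \<bar>f x\<bar> \<le> 1" and c: "c \<ge> 0"
  shows "(LINT x|M. f x) = (LINT x|N. f x)"
proof -
  define \<kappa> where "\<kappa> K \<epsilon> = (LINT x|K. min 2 (\<epsilon> * cmod x))" for K \<epsilon>
  have main: "\<bar>(LINT x|K. f x) - f 0\<bar> \<le> \<kappa> K \<epsilon>" "\<kappa> K \<epsilon> \<ge> 0"
    if K: "is_self_similar_measure lam a (pmf P) K" and f: "\<And>x y. \<bar>f x - f y\<bar> \<le> \<epsilon> * cmod (x - y)" "\<And>x. \<bar>f x\<bar> \<le> 1"
      and \<epsilon>: "\<epsilon> \<ge> 0" and [measurable]: "f \<in> borel_measurable borel" for K f \<epsilon>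
  proof -
    have sets: "sets K = sets borel" and "prob_space K"
      using K by (auto simp: is_self_similar_measure_def)
    interpret K: prob_space K by fact
    note mK = measurable_cong_sets[OF sets refl]
    have i: "integrable K (\<lambda>x. min 2 (\<epsilon> * cmod x))" using \<epsilon> by (intro K.integrable_const_bound[where B=2] AE_I2) (simp, simp only: mK, measurable)
    have j: "integrable K f" using f by (intro K.integrable_const_bound[where B=1] AE_I2) (simp, simp only: mK, measurable)
    have "\<bar>f x - f 0\<bar> \<le> min 2 (\<epsilon> * cmod x)" for x using f(1)[of x 0] f(2)[of x] f(2)[of 0] by simp
    then have "(LINT x|K. \<bar>f x - f 0\<bar>) \<le> \<kappa> K \<epsilon>" unfolding \<kappa>_def
      using i j by (intro integral_mono) auto
    moreover have "\<bar>LINT x|K. f x - f 0\<bar> \<le> (LINT x|K. \<bar>f x - f 0\<bar>)" by (rule integral_abs_bound)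
    moreover have "(LINT x|K. f x - f 0) = (LINT x|K. f x) - f 0" using j by (simp add: K.prob_space)
    ultimately show "\<bar>(LINT x|K. f x) - f 0\<bar> \<le> \<kappa> K \<epsilon>" by simp
    show "\<kappa> K \<epsilon> \<ge> 0" unfolding \<kappa>_def using \<epsilon> by (intro integral_nonneg_AE) auto
  qed
  have lip_meas: "f \<in> borel_measurable borel" if "\<And>x y. \<bar>f x - f y\<bar> \<le> \<epsilon> * cmod (x - y)" "\<epsilon> \<ge> 0" for f :: "complex \<Rightarrow> real" and \<epsilon>
  proof (rule borel_measurable_continuous_onI)
    have "\<epsilon>-lipschitz_on UNIV f" using that by (intro lipschitz_onI) (auto simp: dist_norm)
    then show "continuous_on UNIV f" by (rule lipschitz_on_continuous_on)
  qed
  have claim: "\<bar>(LINT x|M. f x) - (LINT x|N. f x)\<bar> \<le> \<kappa> M (c * cmod lam ^ n) + \<kappa> N (c * cmod lam ^ n)"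
    if "\<And>x y. \<bar>f x - f y\<bar> \<le> c * cmod (x - y)" "\<And>x. \<bar>f x\<bar> \<le> 1" "c \<ge> 0" for n c and f :: "complex \<Rightarrow> real"
    using that
  proof (induction n arbitrary: f c)
    case 0
    then show ?case using main(1)[OF M 0 lip_meas[OF 0(1,3)]] main(1)[OF N 0 lip_meas[OF 0(1,3)]] by simp
  next
    case (Suc n)
    define g where "g x = (\<Sum>i\<in>UNIV. pmf P i * f (lam * x + a i))" for x
    have p1: "(\<Sum>i\<in>UNIV. pmf P i) = 1" using sum_pmf_eq_1[of UNIV P] by simp
    have [measurable]: "f \<in> borel_measurable borel" by (rule lip_meas[OF Suc.prems(1,3)])
    have gi: "(LINT x|K. f x) = (LINT x|K. g x)" if K: "is_self_similar_measure lam a (pmf P) K" for K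
    proof -
      have sets: "sets K = sets borel" and "prob_space K"
        using K by (auto simp: is_self_similar_measure_def)
      interpret K: prob_space K by fact
      note mK = measurable_cong_sets[OF sets refl]
      have "integrable K (\<lambda>x. f (lam * x + a i))" for i
        using Suc.prems(2) by (intro K.integrable_const_bound[where B=1] AE_I2) (simp, simp only: mK, measurable)
      then show ?thesis
        using self_similar_integral[OF K, of f 1] Suc.prems unfolding g_def by simp
    qed
    have "\<bar>(LINT x|M. g x) - (LINT x|N. g x)\<bar> \<le> \<kappa> M ((c * cmod lam) * cmod lam ^ n) + \<kappa> N ((c * cmod lam) * cmod lam ^ n)"
    proof (rule Suc.IH)
      fix x y
      have "g x - g y = (\<Sum>i\<in>UNIV. pmf P i * (f (lam * x + a i) - f (lam * y + a i)))"
        by (simp add: g_def sum_subtractf right_diff_distrib)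
      also have "\<bar>\<dots>\<bar> \<le> (\<Sum>i\<in>UNIV. \<bar>pmf P i * (f (lam * x + a i) - f (lam * y + a i))\<bar>)" by (rule sum_abs)
      also have "\<dots> \<le> (\<Sum>i\<in>UNIV. pmf P i * (c * (cmod lam * cmod (x - y))))"
      proof (rule sum_mono)
        fix i
        have "\<bar>f (lam * x + a i) - f (lam * y + a i)\<bar> \<le> c * cmod ((lam * x + a i) - (lam * y + a i))" by (rule Suc.prems)
        also have "(lam * x + a i) - (lam * y + a i) = lam * (x - y)" by (simp add: algebra_simps)
        finally show "\<bar>pmf P i * (f (lam * x + a i) - f (lam * y + a i))\<bar> \<le> pmf P i * (c * (cmod lam * cmod (x - y)))"
          by (simp add: abs_mult mult_left_mono norm_mult)
      qed
      also have "\<dots> = c * cmod lam * cmod (x - y)" by (simp add: sum_distrib_right[symmetric] p1)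
      finally show "\<bar>g x - g y\<bar> \<le> c * cmod lam * cmod (x - y)" .
    next
      fix x
      have "\<bar>g x\<bar> \<le> (\<Sum>i\<in>UNIV. \<bar>pmf P i * f (lam * x + a i)\<bar>)" unfolding g_def by (rule sum_abs)
      also have "\<dots> \<le> (\<Sum>i\<in>UNIV. pmf P i)" using Suc.prems(2) by (intro sum_mono) (simp add: abs_mult mult_left_le)
      finally show "\<bar>g x\<bar> \<le> 1" by (simp add: p1)
    qed (use Suc.prems in auto)
    then show ?case by (simp add: gi[OF M] gi[OF N] mult.assoc)
  qed
  have lim: "(\<lambda>n. \<kappa> K (c * cmod lam ^ n)) \<longlonglongrightarrow> 0" if K: "is_self_similar_measure lam a (pmf P) K" for K
  proof -
    have sets: "sets K = sets borel" and "prob_space K"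
      using K by (auto simp: is_self_similar_measure_def)
    interpret K: prob_space K by fact
    note mK = measurable_cong_sets[OF sets refl]
    have "(\<lambda>n. LINT x|K. min 2 (c * cmod lam ^ n * cmod x)) \<longlonglongrightarrow> (LINT x|K. 0)"
    proof (rule integral_dominated_convergence[where w="\<lambda>_. 2"])
      show "AE x in K. (\<lambda>n. min 2 (c * cmod lam ^ n * cmod x)) \<longlonglongrightarrow> 0"
      proof (rule AE_I2)
        fix x
        have "(\<lambda>n. min 2 (c * cmod lam ^ n * cmod x)) \<longlonglongrightarrow> min 2 (c * 0 * cmod x)"
          using lam by (intro tendsto_intros LIMSEQ_realpow_zero) auto
        then show "(\<lambda>n. min 2 (c * cmod lam ^ n * cmod x)) \<longlonglongrightarrow> 0" by simp
      qed
      show "AE x in K. norm (min 2 (c * cmod lam ^ n * cmod x)) \<le> 2" for n using c by (intro AE_I2) auto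
      show "(\<lambda>x. min 2 (c * cmod lam ^ n * cmod x)) \<in> borel_measurable K" for n unfolding mK by measurable
    qed auto
    then show ?thesis by (simp add: \<kappa>_def)
  qed
  have "(\<lambda>n. \<kappa> M (c * cmod lam ^ n) + \<kappa> N (c * cmod lam ^ n)) \<longlonglongrightarrow> 0 + 0"
    by (intro tendsto_add lim M N)
  then have "\<bar>(LINT x|M. f x) - (LINT x|N. f x)\<bar> \<le> 0 + 0"
    by (rule LIMSEQ_le_const) (use claim[OF f c] in auto)
  then show ?thesis by simp
qed

text \<open>Indicators of closed sets are decreasing limits of bounded Lipschitz functions, and
  closed sets generate the Borel sets.\<close>

lemma self_similar_unique:
  assumes M: "is_self_similar_measure lam a (pmf P) M" and N: "is_self_similar_measure lam a (pmf P) N"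
  shows "M = N"
proof (rule measure_eqI_generator_eq[of "{F. closed F}" UNIV _ _ "\<lambda>_. UNIV"])
  have KK: "sets K = sets borel \<and> prob_space K" if "is_self_similar_measure lam a (pmf P) K" for K
    using that by (auto simp: is_self_similar_measure_def)
  show "Int_stable {F::complex set. closed F}" by (auto simp: Int_stable_def)
  show "sets M = sigma_sets UNIV {F. closed F}" "sets N = sigma_sets UNIV {F. closed F}"
    using KK[OF M] KK[OF N] by (simp_all add: borel_eq_closed)
  interpret M: prob_space M using KK[OF M] by simp
  show "emeasure M UNIV \<noteq> \<infinity>" by simp
  fix F :: "complex set" assume "F \<in> {F. closed F}"
  then have F: "closed F" by simp
  show "emeasure M F = emeasure N F"
  proof (cases "F = {}")
    case False
    define f where "f k x = max 0 (1 - real k * infdist x F)" for k x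
    have lim: "(\<lambda>k. LINT x|K. f k x) \<longlonglongrightarrow> measure K F" if K: "is_self_similar_measure lam a (pmf P) K" for K
    proof -
      have sets: "sets K = sets borel" and "prob_space K" using KK[OF K] by auto
      interpret K: prob_space K by fact
      note mK = measurable_cong_sets[OF sets refl]
      have Fm[measurable]: "F \<in> sets borel" using F by simp
      have "(\<lambda>k. LINT x|K. f k x) \<longlonglongrightarrow> (LINT x|K. indicator F x)"
      proof (rule integral_dominated_convergence[where w="\<lambda>_. 1"])
        have [measurable]: "f k \<in> borel_measurable borel" for k unfolding f_def[abs_def]
          by (intro borel_measurable_continuous_onI continuous_intros)
        show "f k \<in> borel_measurable K" for k unfolding mK by measurable
        show "(\<lambda>x. indicator F x :: real) \<in> borel_measurable K" unfolding mK by measurable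
        show "AE x in K. (\<lambda>k. f k x) \<longlonglongrightarrow> indicator F x"
        proof (rule AE_I2)
          fix x
          show "(\<lambda>k. f k x) \<longlonglongrightarrow> indicator F x"
          proof (cases "x \<in> F")
            case False
            then have d: "infdist x F > 0" using F \<open>F \<noteq> {}\<close> by (simp add: infdist_pos_not_in_closed)
            obtain n where "1 / infdist x F < real n" using reals_Archimedean2 by blast
            then have n: "1 < real n * infdist x F" using d by (simp add: divide_less_eq)
            have "f k x = 0" if "k \<ge> n" for k
            proof -
              have "real n * infdist x F \<le> real k * infdist x F" using that d by (intro mult_right_mono) auto
              then show ?thesis using n by (simp add: f_def)
            qed
            then have "\<forall>\<^sub>F k in sequentially. f k x = 0" by (auto simp: eventually_sequentially)
            then show ?thesis using False by (simp add: tendsto_eventually)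
          qed (simp add: f_def)
        qed
        show "AE x in K. norm (f k x) \<le> 1" for k by (intro AE_I2) (auto simp: f_def infdist_nonneg)
      qed auto
      then show ?thesis by (simp add: sets_eq_imp_space_eq[OF sets])
    qed
    have "(LINT x|M. f k x) = (LINT x|N. f k x)" for k
    proof (rule self_similar_lipschitz_integral_eq[OF M N, of _ "real k"])
      fix x y
      have "\<bar>infdist x F - infdist y F\<bar> \<le> cmod (x - y)"
        using infdist_triangle_abs[of x F y] by (simp add: dist_norm)
      then have "real k * \<bar>infdist x F - infdist y F\<bar> \<le> real k * cmod (x - y)" by (rule mult_left_mono) simp
      moreover have "\<bar>f k x - f k y\<bar> \<le> \<bar>real k * infdist x F - real k * infdist y F\<bar>" by (simp add: f_def)
      moreover have "\<bar>real k * infdist x F - real k * infdist y F\<bar> = real k * \<bar>infdist x F - infdist y F\<bar>"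
        by (simp add: right_diff_distrib[symmetric] abs_mult)
      ultimately show "\<bar>f k x - f k y\<bar> \<le> real k * cmod (x - y)" by linarith
    qed (auto simp: f_def infdist_nonneg)
    then have eq: "measure M F = measure N F" using lim[OF M] lim[OF N] LIMSEQ_unique by simp
    interpret N: prob_space N using KK[OF N] by simp
    show ?thesis by (simp add: eq M.emeasure_eq_measure N.emeasure_eq_measure)
  qed simp
qed auto

lemma self_similar_measure_eq: "self_similar_measure lam a (pmf P) = coding_measure P"
  unfolding self_similar_measure_def
  by (rule the_equality) (use coding_measure_self_similar self_similar_unique in blast)+

lemma coding_measure_finite: "complex_finite_measure (coding_measure P)" "prob_space (coding_measure P)" "sets (coding_measure P) = sets borel"
proof -
  show p: "prob_space (coding_measure P)" and s: "sets (coding_measure P) = sets borel"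
    using coding_measure_self_similar[of P] by (auto simp: is_self_similar_measure_def)
  interpret prob_space "coding_measure P" by fact
  show "complex_finite_measure (coding_measure P)" by (rule complex_finite_measureI[OF _ s]) unfold_locales
qed

lemma cf_coding_measure:
  "cf (coding_measure P) \<xi> = cf (measure_pmf (map_pmf a P)) \<xi> * cf (coding_measure P) (cnj lam * \<xi>)"
proof -
  have "cf (coding_measure P) \<xi> = (\<Sum>i\<in>UNIV. pmf P i *\<^sub>R (CLINT x|coding_measure P. cis (\<xi> \<bullet> (lam * x + a i))))"
    unfolding cf_def by (rule self_similar_integral[OF coding_measure_self_similar, where B=1]) auto
  also have "\<dots> = (\<Sum>i\<in>UNIV. pmf P i *\<^sub>R (cis (\<xi> \<bullet> a i) * cf (coding_measure P) (cnj lam * \<xi>)))"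
  proof (intro sum.cong refl arg_cong[where f="(*\<^sub>R) _"])
    fix i
    have "(CLINT x|coding_measure P. cis (\<xi> \<bullet> (lam * x + a i))) = (CLINT x|coding_measure P. cis (\<xi> \<bullet> a i) * cis ((cnj lam * \<xi>) \<bullet> x))"
      by (intro Bochner_Integration.integral_cong) (simp_all add: inner_add_right cis_mult inner_complex_mult add.commute)
    then show "(CLINT x|coding_measure P. cis (\<xi> \<bullet> (lam * x + a i))) = cis (\<xi> \<bullet> a i) * cf (coding_measure P) (cnj lam * \<xi>)"
      by (simp add: cf_def)
  qed
  also have "\<dots> = (\<Sum>i\<in>UNIV. pmf P i *\<^sub>R cis (\<xi> \<bullet> a i)) * cf (coding_measure P) (cnj lam * \<xi>)"
    by (simp add: sum_distrib_right)
  also have "(\<Sum>i\<in>UNIV. pmf P i *\<^sub>R cis (\<xi> \<bullet> a i)) = cf (measure_pmf (map_pmf a P)) \<xi>"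
    unfolding cf_def by (simp add: integral_measure_pmf[of UNIV])
  finally show ?thesis .
qed

text \<open>The coded points form an invariant set; its closure stays invariant because the finite
  union of compact images is closed.\<close>

lemma attractor_aux: "\<exists>K. K \<noteq> {} \<and> compact K \<and> K = (\<Union>i. sim lam (a i) ` K) \<and> range coding \<subseteq> K"
proof -
  define S where "S = range coding"
  have inv: "S = (\<Union>i. sim lam (a i) ` S)"
  proof (intro equalityI subsetI)
    fix x assume "x \<in> S"
    then obtain s where "x = coding s" by (auto simp: S_def)
    then have "x = sim lam (a (shd s)) (coding (stl s))" using coding_Stream[of "shd s" "stl s"] by (simp add: sim_def)
    then show "x \<in> (\<Union>i. sim lam (a i) ` S)" by (auto simp: S_def)
  next
    fix x assume "x \<in> (\<Union>i. sim lam (a i) ` S)"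
    then obtain i s where "x = sim lam (a i) (coding s)" by (auto simp: S_def)
    then have "x = coding (i ## s)" by (simp add: coding_Stream sim_def)
    then show "x \<in> S" by (simp add: S_def)
  qed
  have cont: "continuous_on A (sim lam c)" for A c unfolding sim_def[abs_def] by (intro continuous_intros)
  have bS: "bounded S" using coding_aux(2) by (auto simp: S_def bounded_iff)
  have comp: "compact (closure S)" using bS by (simp add: compact_closure)
  have "closure S = (\<Union>i. sim lam (a i) ` closure S)"
  proof
    have "compact (\<Union>i. sim lam (a i) ` closure S)" using comp by (intro compact_UN compact_continuous_image cont) auto
    moreover have "S \<subseteq> (\<Union>i. sim lam (a i) ` closure S)" using inv closure_subset[of S] by blast
    ultimately show "closure S \<subseteq> (\<Union>i. sim lam (a i) ` closure S)" by (intro closure_minimal compact_imp_closed)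
    have "sim lam (a i) ` closure S \<subseteq> closure S" for i
    proof (rule image_closure_subset[OF cont])
      show "sim lam (a i) ` S \<subseteq> closure S" using inv closure_subset[of S] by blast
    qed simp
    then show "(\<Union>i. sim lam (a i) ` closure S) \<subseteq> closure S" by blast
  qed
  moreover have "closure S \<noteq> {}" by (simp add: S_def)
  ultimately show ?thesis using comp closure_subset[of S] unfolding S_def by blast
qed

text \<open>Pulling a point of \<open>K\<close> back through \<open>n\<close> maps and pushing a
  point of \<open>L\<close> forward along the same maps brings the two within
  \<open>|lam| ^ n * R\<close>. Used in both directions, this gives uniqueness.\<close>

lemma attractor_subset:
  assumes K: "compact K" "K = (\<Union>i. sim lam (a i) ` K)" and L: "L \<noteq> {}" "compact L" "L = (\<Union>i. sim lam (a i) ` L)"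
  shows "K \<subseteq> L"
proof
  obtain y where y: "y \<in> L" using L(1) by blast
  obtain R where R: "\<And>x. x \<in> K \<Longrightarrow> cmod (x - y) \<le> R"
  proof -
    obtain B where "\<And>x. x \<in> K \<Longrightarrow> cmod x \<le> B" using compact_imp_bounded[OF K(1)] by (auto simp: bounded_iff)
    then have "cmod (x - y) \<le> B + cmod y" if "x \<in> K" for x
      using norm_triangle_ineq4[of x y] that by (meson add_right_mono order_trans)
    then show thesis using that by blast
  qed
  have near: "\<forall>x\<in>K. \<exists>z\<in>L. cmod (x - z) \<le> cmod lam ^ n * R" for n
  proof (induction n)
    case 0 then show ?case using R y by auto
  next
    case (Suc n)
    show ?case
    proof
      fix x assume "x \<in> K"
      then obtain i x' where x': "x' \<in> K" "x = sim lam (a i) x'" using K(2) by blast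
      then obtain z' where z': "z' \<in> L" "cmod (x' - z') \<le> cmod lam ^ n * R" using Suc by blast
      have "sim lam (a i) z' \<in> L" using z'(1) L(3) by blast
      moreover have "cmod (x - sim lam (a i) z') = cmod lam * cmod (x' - z')"
        by (simp add: x' sim_def norm_mult flip: right_diff_distrib)
      then have "cmod (x - sim lam (a i) z') \<le> cmod lam ^ Suc n * R"
        using mult_left_mono[OF z'(2), of "cmod lam"] by (simp add: mult.assoc)
      ultimately show "\<exists>z\<in>L. cmod (x - z) \<le> cmod lam ^ Suc n * R" by blast
    qed
  qed
  fix x assume x: "x \<in> K"
  have "(\<lambda>n. cmod lam ^ n * R) \<longlonglongrightarrow> 0 * R" using lam by (intro tendsto_intros LIMSEQ_realpow_zero) auto
  moreover have "infdist x L \<le> cmod lam ^ n * R" for n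
    using near[of n] x by (metis infdist_le order_trans dist_norm)
  ultimately have "infdist x L \<le> 0" by (intro LIMSEQ_le_const[of _ 0]) auto
  then have "infdist x L = 0" using infdist_nonneg[of x L] by linarith
  then show "x \<in> L" using L by (simp add: in_closed_iff_infdist_zero compact_imp_closed)
qed

lemma attractor: "compact (attractor lam a)" "range coding \<subseteq> attractor lam a"
proof -
  obtain K where K: "K \<noteq> {}" "compact K" "K = (\<Union>i. sim lam (a i) ` K)" "range coding \<subseteq> K"
    using attractor_aux by blast
  have "attractor lam a = K"
    unfolding attractor_def
  proof (rule the_equality)
    show "K \<noteq> {} \<and> compact K \<and> K = (\<Union>i. sim lam (a i) ` K)" using K by blast
    fix L assume "L \<noteq> {} \<and> compact L \<and> L = (\<Union>i. sim lam (a i) ` L)"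
    then show "L = K" using K attractor_subset by (metis subset_antisym)
  qed
  with K show "compact (attractor lam a)" "range coding \<subseteq> attractor lam a" by auto
qed

lemma emeasure_coding_measure_attractor: "AE x in coding_measure P. x \<in> attractor lam a"
proof -
  have "closed (attractor lam a)" by (rule compact_imp_closed[OF attractor(1)])
  then have "{x. x \<in> attractor lam a} \<in> sets borel" by simp
  then show ?thesis unfolding coding_measure_def
    by (subst AE_distr_iff) (use attractor(2) in auto)
qed

text \<open>The measure is carried by the attractor, so the convolution is carried by the sum set,
  which is compact and therefore measurable; an absolutely continuous probability gives null sets no
  mass.\<close>

lemma conv_attractor_positive:
  assumes ac: "absolutely_continuous lborel (conv_measure (coding_measure P) (scale_measure_by u (coding_measure P)))"
  shows "emeasure lborel {x + u * y | x y. x \<in> attractor lam a \<and> y \<in> attractor lam a} > 0"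
proof (rule ccontr)
  let ?\<nu> = "coding_measure P" and ?A = "attractor lam a"
  let ?S = "{x + u * y | x y. x \<in> ?A \<and> y \<in> ?A}"
  interpret \<nu>: complex_finite_measure ?\<nu> by (rule coding_measure_finite)
  interpret p\<nu>: prob_space ?\<nu> by (rule coding_measure_finite)
  have [measurable_cong]: "sets ?\<nu> = sets borel" by (rule coding_measure_finite)
  have S: "?S = (\<lambda>(x, y). x + u * y) ` (?A \<times> ?A)" by auto
  have "compact ?S" unfolding S split_beta
    by (intro compact_continuous_image compact_Times attractor continuous_intros)
  then have Sm[measurable]: "?S \<in> sets borel" by (simp add: compact_imp_closed)
  define T where "T = scale_measure_by u ?\<nu>"
  have pT: "prob_space T" unfolding T_def scale_measure_by_def by (rule p\<nu>.prob_space_distr) measurable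
  interpret T: prob_space T by (rule pT)
  have cT: "complex_finite_measure T"
    by (rule complex_finite_measureI) (simp_all add: T.finite_measure_axioms, simp add: T_def scale_measure_by_def)
  assume "\<not> emeasure lborel ?S > 0"
  then have "?S \<in> null_sets lborel" by (auto simp: null_sets_def)
  then have "?S \<in> null_sets (conv_measure ?\<nu> T)" using ac by (auto simp: absolutely_continuous_def T_def)
  then have "0 = (\<integral>\<^sup>+z. indicator ?S z \<partial>conv_measure ?\<nu> T)" by (simp add: null_sets_def)
  also have "\<dots> = (\<integral>\<^sup>+x. \<integral>\<^sup>+y. indicator ?S (x + y) \<partial>T \<partial>?\<nu>)"
    by (rule nn_integral_conv_measure[OF \<nu>.complex_finite_measure_axioms cT]) measurable
  also have "\<dots> = (\<integral>\<^sup>+x. \<integral>\<^sup>+y. indicator ?S (x + u * y) \<partial>?\<nu> \<partial>?\<nu>)"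
    unfolding T_def scale_measure_by_def by (intro nn_integral_cong nn_integral_distr) measurable
  also have "\<dots> = (\<integral>\<^sup>+x. 1 \<partial>?\<nu>)"
  proof (rule nn_integral_cong_AE)
    show "AE x in ?\<nu>. (\<integral>\<^sup>+y. indicator ?S (x + u * y) \<partial>?\<nu>) = 1"
      using emeasure_coding_measure_attractor[of P]
    proof eventually_elim
      case (elim x)
      have "(\<integral>\<^sup>+y. indicator ?S (x + u * y) \<partial>?\<nu>) = (\<integral>\<^sup>+y. 1 \<partial>?\<nu>)"
      proof (rule nn_integral_cong_AE)
        show "AE y in ?\<nu>. indicator ?S (x + u * y) = (1 :: ennreal)"
          using emeasure_coding_measure_attractor[of P]
          by eventually_elim (use elim in \<open>auto simp: indicator_def\<close>)
      qed
      then show ?case by (simp add: p\<nu>.emeasure_space_1)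
    qed
  qed
  finally show False by (simp add: p\<nu>.emeasure_space_1)
qed

end

section \<open>Sets of vanishing Hausdorff dimension\<close>

text \<open>Vanishing of the \<open>s\<close>-dimensional measure in terms of explicit covers, the
  form in which the covering arguments below deliver it.\<close>

definition hausdorff_null :: "real \<Rightarrow> complex set \<Rightarrow> bool" where
  "hausdorff_null s X \<longleftrightarrow> (\<forall>\<delta>>0. \<forall>\<epsilon>>0. \<exists>U :: nat \<Rightarrow> complex set.
     X \<subseteq> (\<Union>n. U n) \<and> (\<forall>n. bounded (U n) \<and> diameter (U n) \<le> \<delta>) \<and> (\<Sum>n. diam_pow s (U n)) \<le> ennreal \<epsilon>)"

lemma hausdorff_null_subset: "hausdorff_null s Y \<Longrightarrow> X \<subseteq> Y \<Longrightarrow> hausdorff_null s X"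
  unfolding hausdorff_null_def by (meson order_trans)

lemma hausdorff_dim_eq_0:
  assumes "\<And>s. s > 0 \<Longrightarrow> hausdorff_null s X"
  shows "hausdorff_dim X = 0"
proof -
  have m0: "hausdorff_measure s X = 0" if s: "s > 0" for s
  proof -
    have le: "hausdorff_premeasure s \<delta> X \<le> 0 + ennreal \<epsilon>" if pos: "\<delta> > 0" "\<epsilon> > 0" for \<delta> \<epsilon>
    proof -
      obtain U :: "nat \<Rightarrow> complex set" where U: "X \<subseteq> (\<Union>n. U n) \<and> (\<forall>n. bounded (U n) \<and> diameter (U n) \<le> \<delta>)
        \<and> (\<Sum>n. diam_pow s (U n)) \<le> ennreal \<epsilon>"
        using assms[OF s, unfolded hausdorff_null_def, rule_format, OF pos] by (rule exE)
      then have "(\<Sum>n. diam_pow s (U n)) \<le> ennreal \<epsilon>" by simp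
      moreover have "hausdorff_premeasure s \<delta> X \<le> (\<Sum>n. diam_pow s (U n))"
        unfolding hausdorff_premeasure_def by (intro Inf_lower CollectI exI[of _ U]) (use U in simp)
      ultimately show ?thesis by (metis add_0 order_trans)
    qed
    have "hausdorff_premeasure s \<delta> X \<le> 0" if "\<delta> > 0" for \<delta> by (rule ennreal_le_epsilon) (rule le[OF that])
    then have "hausdorff_measure s X \<le> 0" unfolding hausdorff_measure_def by (intro SUP_least) auto
    then show ?thesis by simp
  qed
  have le: "hausdorff_dim X \<le> 0 + ennreal s" if "s > 0" for s
    unfolding hausdorff_dim_def using m0[OF that] that by (simp, intro Inf_lower) auto
  have "hausdorff_dim X \<le> 0" by (rule ennreal_le_epsilon) (rule le)
  then show ?thesis by simp
qed

lemma diam_pow_empty[simp]: "diam_pow s {} = 0"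
  by (simp add: diam_pow_def)

lemma hausdorff_null_UN:
  assumes X: "\<And>i::nat. hausdorff_null s (X i)"
  shows "hausdorff_null s (\<Union>i. X i)"
  unfolding hausdorff_null_def
proof (intro allI impI)
  fix \<delta> \<epsilon> :: real assume \<delta>: "\<delta> > 0" and \<epsilon>: "\<epsilon> > 0"
  have "\<forall>i. \<exists>U :: nat \<Rightarrow> complex set. X i \<subseteq> (\<Union>n. U n) \<and> (\<forall>n. bounded (U n) \<and> diameter (U n) \<le> \<delta>)
      \<and> (\<Sum>n. diam_pow s (U n)) \<le> ennreal (\<epsilon> * (1 / 2) ^ Suc i)"
  proof
    fix i
    have "\<epsilon> * (1 / 2) ^ Suc i > 0" using \<epsilon> by simp
    from X[of i, unfolded hausdorff_null_def, rule_format, OF \<delta> this] show "\<exists>U :: nat \<Rightarrow> complex set. X i \<subseteq> (\<Union>n. U n) \<and> (\<forall>n. bounded (U n) \<and> diameter (U n) \<le> \<delta>)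
      \<and> (\<Sum>n. diam_pow s (U n)) \<le> ennreal (\<epsilon> * (1 / 2) ^ Suc i)" .
  qed
  then have "\<exists>U. \<forall>i. X i \<subseteq> (\<Union>n. U i n) \<and> (\<forall>n. bounded (U i n) \<and> diameter (U i n) \<le> \<delta>)
      \<and> (\<Sum>n. diam_pow s (U i n)) \<le> ennreal (\<epsilon> * (1 / 2) ^ Suc i)" by (rule choice)
  then obtain U :: "nat \<Rightarrow> nat \<Rightarrow> complex set" where UU: "\<forall>i. X i \<subseteq> (\<Union>n. U i n) \<and> (\<forall>n. bounded (U i n) \<and> diameter (U i n) \<le> \<delta>)
      \<and> (\<Sum>n. diam_pow s (U i n)) \<le> ennreal (\<epsilon> * (1 / 2) ^ Suc i)"
    by (rule exE)
  have U: "X i \<subseteq> (\<Union>n. U i n)" "bounded (U i n) \<and> diameter (U i n) \<le> \<delta>"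
    "(\<Sum>n. diam_pow s (U i n)) \<le> ennreal (\<epsilon> * (1 / 2) ^ Suc i)" for i n
    using UU[rule_format, of i] by simp_all
  define V where "V k = (case prod_decode k of (i, n) \<Rightarrow> U i n)" for k
  have VU: "V (prod_encode (i, n)) = U i n" for i n by (simp add: V_def)
  have "(\<Sum>k. diam_pow s (V k)) = (\<Sum>k. (case prod_decode k of (i, n) \<Rightarrow> diam_pow s (U i n)))"
    by (simp add: V_def split_beta)
  also have "\<dots> = (\<Sum>i. \<Sum>n. diam_pow s (U i n))" by (rule suminf_ennreal_2dimen) simp
  also have "\<dots> \<le> (\<Sum>i. ennreal (\<epsilon> * (1 / 2) ^ Suc i))" by (intro suminf_le U) auto
  also have "\<dots> = ennreal \<epsilon>"
  proof (subst suminf_ennreal2)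
    show "summable (\<lambda>i. \<epsilon> * (1 / 2) ^ Suc i)" by (intro summable_mult) (simp add: summable_geometric)
    show "ennreal (\<Sum>i. \<epsilon> * (1 / 2) ^ Suc i) = ennreal \<epsilon>"
      using sums_unique[OF sums_mult[OF power_half_series, of \<epsilon>]] by simp
  qed (use \<epsilon> in auto)
  finally have "(\<Sum>k. diam_pow s (V k)) \<le> ennreal \<epsilon>" .
  moreover have "(\<Union>i. X i) \<subseteq> (\<Union>k. V k)" using U(1) VU by fastforce
  moreover have "\<forall>k. bounded (V k) \<and> diameter (V k) \<le> \<delta>" unfolding V_def split_beta using U(2) by auto
  ultimately show "\<exists>U :: nat \<Rightarrow> complex set. (\<Union>i. X i) \<subseteq> (\<Union>n. U n) \<and> (\<forall>n. bounded (U n) \<and> diameter (U n) \<le> \<delta>)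
      \<and> (\<Sum>n. diam_pow s (U n)) \<le> ennreal \<epsilon>" by blast
qed

lemma hausdorff_null_Un:
  assumes "hausdorff_null s X" "hausdorff_null s Y"
  shows "hausdorff_null s (X \<union> Y)"
proof -
  have "hausdorff_null s (\<Union>i::nat. if i = 0 then X else Y)" using assms by (intro hausdorff_null_UN) auto
  then show ?thesis by (rule hausdorff_null_subset) (auto intro: exI[of _ "1::nat"])
qed

text \<open>Every point lies in sets of arbitrarily high level, so the levels from \<open>N\<close>
  on cover \<open>X\<close>; their \<open>s\<close>-sums form the tail of a geometric series with
  ratio \<open>M * r powr s\<close>.\<close>

lemma hausdorff_null_limsup:
  fixes F :: "nat \<Rightarrow> complex set set"
  assumes cover: "\<And>x N. x \<in> X \<Longrightarrow> \<exists>n\<ge>N. x \<in> \<Union>(F n)"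
    and F: "\<And>n. finite (F n)" "\<And>n. real (card (F n)) \<le> A * M ^ n"
    and small: "\<And>n U x y. U \<in> F n \<Longrightarrow> x \<in> U \<Longrightarrow> y \<in> U \<Longrightarrow> cmod (x - y) \<le> D * r ^ n"
    and r: "0 < r" "r < 1" and M: "M \<ge> 0" "A \<ge> 0" "D \<ge> 0" and Mr: "M * r powr s < 1" and s: "s > 0"
  shows "hausdorff_null s X"
  unfolding hausdorff_null_def
proof (intro allI impI)
  fix \<delta> \<epsilon> :: real assume \<delta>: "\<delta> > 0" and \<epsilon>: "\<epsilon> > 0"
  define \<kappa> where "\<kappa> = M * r powr s"
  have \<kappa>: "0 \<le> \<kappa>" "\<kappa> < 1" using M Mr by (auto simp: \<kappa>_def)
  define B where "B = A * D powr s"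
  have B: "B \<ge> 0" using M by (simp add: B_def)
  have "\<forall>\<^sub>F N in sequentially. B * \<kappa> ^ N / (1 - \<kappa>) < \<epsilon>"
  proof (rule order_tendstoD(2))
    have "(\<lambda>N. B * \<kappa> ^ N / (1 - \<kappa>)) \<longlonglongrightarrow> B * 0 / (1 - \<kappa>)"
      using \<kappa> by (intro tendsto_intros LIMSEQ_realpow_zero) auto
    then show "(\<lambda>N. B * \<kappa> ^ N / (1 - \<kappa>)) \<longlonglongrightarrow> 0" by simp
  qed (rule \<epsilon>)
  moreover have "\<forall>\<^sub>F N in sequentially. D * r ^ N < \<delta>"
  proof (rule order_tendstoD(2))
    have "(\<lambda>N. D * r ^ N) \<longlonglongrightarrow> D * 0" using r by (intro tendsto_intros LIMSEQ_realpow_zero) auto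
    then show "(\<lambda>N. D * r ^ N) \<longlonglongrightarrow> 0" by simp
  qed (rule \<delta>)
  ultimately have "\<forall>\<^sub>F N in sequentially. B * \<kappa> ^ N / (1 - \<kappa>) < \<epsilon> \<and> D * r ^ N < \<delta>" by (rule eventually_conj)
  then obtain N where N: "B * \<kappa> ^ N / (1 - \<kappa>) < \<epsilon>" "D * r ^ N < \<delta>" by (auto simp: eventually_sequentially)
  have "\<forall>n. \<exists>e. bij_betw e {0..<card (F n)} (F n)" using ex_bij_betw_nat_finite F(1) by blast
  then obtain e where e: "\<And>n. bij_betw (e n) {0..<card (F n)} (F n)" by metis
  define U where "U n j = (if j < card (F (n + N)) then e (n + N) j else {})" for n j
  have UF: "U n j = {} \<or> U n j \<in> F (n + N)" for n j using e[of "n + N"] by (auto simp: U_def bij_betw_def)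
  have Us: "cmod (x - y) \<le> D * r ^ (n + N)" if "x \<in> U n j" "y \<in> U n j" for x y n j
    using that UF[of n j] small by blast
  have Ud: "bounded (U n j) \<and> diameter (U n j) \<le> D * r ^ (n + N)" for n j
  proof
    show "bounded (U n j)" unfolding bounded_two_points
      by (intro exI[of _ "D * r ^ (n + N)"] ballI) (simp add: dist_norm Us)
    show "diameter (U n j) \<le> D * r ^ (n + N)" using Us M r by (intro diameter_le) auto
  qed
  have dn: "(\<Sum>j. diam_pow s (U n j)) \<le> ennreal (B * \<kappa> ^ N * \<kappa> ^ n)" for n
  proof -
    have "(\<Sum>j. diam_pow s (U n j)) = (\<Sum>j<card (F (n + N)). diam_pow s (U n j))"
      by (rule suminf_finite) (auto simp: U_def)
    also have "\<dots> \<le> (\<Sum>j<card (F (n + N)). ennreal ((D * r ^ (n + N)) powr s))"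
    proof (rule sum_mono)
      fix j
      have "diameter (U n j) powr s \<le> (D * r ^ (n + N)) powr s"
        using Ud[of n j] s by (intro powr_mono2) (auto simp: diameter_ge_0)
      then show "diam_pow s (U n j) \<le> ennreal ((D * r ^ (n + N)) powr s)"
        using s by (simp add: diam_pow_def ennreal_leI)
    qed
    also have "\<dots> = ennreal (real (card (F (n + N))) * (D * r ^ (n + N)) powr s)"
      by (simp add: ennreal_mult' ennreal_of_nat_eq_real_of_nat)
    also have "\<dots> \<le> ennreal ((A * M ^ (n + N)) * (D * r ^ (n + N)) powr s)"
      by (intro ennreal_leI mult_right_mono F) auto
    also have "(A * M ^ (n + N)) * (D * r ^ (n + N)) powr s = B * \<kappa> ^ N * \<kappa> ^ n"
    proof -
      have "(r ^ (n + N)) powr s = (r powr s) ^ (n + N)"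
        using r by (simp add: powr_realpow[symmetric] powr_powr mult.commute)
      then show ?thesis
        by (simp add: powr_mult B_def \<kappa>_def power_mult_distrib power_add)
    qed
    finally show ?thesis .
  qed
  define V where "V k = (case prod_decode k of (i, n) \<Rightarrow> U i n)" for k
  have VU: "V (prod_encode (i, n)) = U i n" for i n by (simp add: V_def)
  have "(\<Sum>k. diam_pow s (V k)) = (\<Sum>k. (case prod_decode k of (i, n) \<Rightarrow> diam_pow s (U i n)))"
    by (simp add: V_def split_beta)
  also have "\<dots> = (\<Sum>i. \<Sum>n. diam_pow s (U i n))" by (rule suminf_ennreal_2dimen) simp
  also have "\<dots> \<le> (\<Sum>n. ennreal (B * \<kappa> ^ N * \<kappa> ^ n))" by (intro suminf_le dn) auto
  also have "\<dots> = ennreal (B * \<kappa> ^ N / (1 - \<kappa>))"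
  proof (subst suminf_ennreal2)
    show "summable (\<lambda>i. B * \<kappa> ^ N * \<kappa> ^ i)" using \<kappa> by (intro summable_mult summable_geometric) auto
    show "ennreal (\<Sum>i. B * \<kappa> ^ N * \<kappa> ^ i) = ennreal (B * \<kappa> ^ N / (1 - \<kappa>))"
      using \<kappa> by (subst suminf_mult) (auto simp: suminf_geometric summable_geometric)
  qed (use B \<kappa> in auto)
  also have "\<dots> \<le> ennreal \<epsilon>" using N by (intro ennreal_leI) simp
  finally have "(\<Sum>k. diam_pow s (V k)) \<le> ennreal \<epsilon>" .
  moreover have "X \<subseteq> (\<Union>k. V k)"
  proof
    fix x assume "x \<in> X"
    then obtain n W where n: "n \<ge> N" "W \<in> F n" "x \<in> W" using cover[of x N] by blast
    have "W \<in> e n ` {0..<card (F n)}" using n(2) e[of n] by (simp add: bij_betw_def)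
    then obtain j where "j < card (F n)" "e n j = W" by auto
    then have "W = U (n - N) j" using n by (simp add: U_def)
    then show "x \<in> (\<Union>k. V k)" using n(3) VU by (metis UN_I UNIV_I)
  qed
  moreover have "\<forall>k. bounded (V k) \<and> diameter (V k) \<le> \<delta>"
  proof
    fix k
    obtain i n where k: "prod_decode k = (i, n)" by fastforce
    have "D * r ^ (i + N) \<le> D * r ^ N" using r M by (intro mult_left_mono power_decreasing) auto
    then show "bounded (V k) \<and> diameter (V k) \<le> \<delta>" using Ud[of i n] N(2) by (simp add: V_def k)
  qed
  ultimately show "\<exists>U :: nat \<Rightarrow> complex set. X \<subseteq> (\<Union>n. U n) \<and> (\<forall>n. bounded (U n) \<and> diameter (U n) \<le> \<delta>)
      \<and> (\<Sum>n. diam_pow s (U n)) \<le> ennreal \<epsilon>" by blast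
qed

section \<open>Exact overlaps\<close>

text \<open>Horner form of the sum of \<open>lam ^ t * f (w ! t)\<close> over the positions
  \<open>t\<close> of the word.\<close>

fun wsum :: "complex \<Rightarrow> ('d \<Rightarrow> complex) \<Rightarrow> 'd list \<Rightarrow> complex" where
  "wsum lam f [] = 0"
| "wsum lam f (x # w) = f x + lam * wsum lam f w"

lemma wsum_append: "wsum lam f (v @ w) = wsum lam f v + lam ^ length v * wsum lam f w"
  by (induction v) (auto simp: algebra_simps)

text \<open>The maps of distinct words of equal length send \<open>V\<close> to disjoint sets. If
  two values were closer than claimed, moving \<open>v\<close> by their difference divided by
  \<open>lam ^ n\<close> would stay in the ball around \<open>v\<close> inside \<open>V\<close>, and
  the two maps would share an image point.\<close>

lemma osc_separated:
  assumes osc: "open_set_condition lam a" and lam: "lam \<noteq> 0"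
  shows "\<exists>c>0. \<forall>w w'. length w = length w' \<longrightarrow> w \<noteq> w' \<longrightarrow> c * cmod lam ^ length w \<le> cmod (wsum lam a w - wsum lam a w')"
proof -
  obtain V where V: "V \<noteq> {}" "open V" "disjoint_family (\<lambda>i. sim lam (a i) ` V)" "\<And>i. sim lam (a i) ` V \<subseteq> V"
    using osc unfolding open_set_condition_def by blast
  obtain v c where v: "v \<in> V" and c: "c > 0" "ball v c \<subseteq> V" using V(1,2) by (meson openE equals0I)
  define T where "T w z = wsum lam a w + lam ^ length w * z" for w z
  have T_Cons: "T (x # w) z = sim lam (a x) (T w z)" for x w z by (simp add: T_def sim_def algebra_simps)
  have T_in: "z \<in> V \<Longrightarrow> T w z \<in> V" for w z
  proof (induction w)
    case (Cons x w) then show ?case using V(4)[of x] by (auto simp: T_Cons)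
  qed (simp add: T_def)
  have inj: "sim lam b z = sim lam b z' \<Longrightarrow> z = z'" for b z z' using lam by (simp add: sim_def)
  have disj: "w = w'" if "length w = length w'" "z \<in> V" "z' \<in> V" "T w z = T w' z'" for w w' z z'
    using that
  proof (induction w w' rule: list_induct2)
    case (Cons x w x' w')
    have "sim lam (a x) (T w z) \<in> sim lam (a x) ` V" "sim lam (a x') (T w' z') \<in> sim lam (a x') ` V"
      using T_in Cons.prems by auto
    then have xx: "x = x'" using V(3) Cons.prems unfolding T_Cons disjoint_family_on_def by (metis IntI UNIV_I emptyE)
    then have "T w z = T w' z'" using Cons.prems by (auto simp: T_Cons intro: inj)
    then show ?case using Cons xx by simp
  qed simp
  have "c * cmod lam ^ length w \<le> cmod (wsum lam a w - wsum lam a w')" if l: "length w = length w'" "w \<noteq> w'" for w w'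
  proof (rule ccontr)
    assume n: "\<not> ?thesis"
    define z where "z = v + (wsum lam a w - wsum lam a w') / lam ^ length w"
    have "cmod (z - v) = cmod (wsum lam a w - wsum lam a w') / cmod lam ^ length w"
      by (simp add: z_def norm_divide norm_power)
    also have "\<dots> < c" using n lam by (simp add: divide_less_eq)
    finally have "z \<in> V" using c by (auto simp: dist_norm norm_minus_commute)
    moreover have "T w' z = T w v" using lam l by (simp add: T_def z_def field_simps)
    ultimately show False using disj[of w' w z v] l v by simp
  qed
  then show ?thesis using c by blast
qed

text \<open>Super-exponential near coincidences: off this set some exponent \<open>C\<close>
  separates all sufficiently long words over pairs of digits.\<close>

definition overlap_set :: "complex \<Rightarrow> ('i \<Rightarrow> complex) \<Rightarrow> complex set" where
  "overlap_set lam a = {u. \<forall>C N0 :: nat. \<exists>N\<ge>N0. \<exists>w w'. length w = N \<and> length w' = N \<and> w \<noteq> w' \<and>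
     cmod (wsum lam (\<lambda>(i, j). a i + u * a j) w - wsum lam (\<lambda>(i, j). a i + u * a j) w') < cmod lam ^ (C * N)}"

lemma wsum_pair: "wsum lam (\<lambda>(i, j). a i + u * a j) w = wsum lam a (map fst w) + u * wsum lam a (map snd w)"
  by (induction w) (auto simp: algebra_simps)

text \<open>A near coincidence is an affine condition on \<open>u\<close> whose leading coefficient
  is a difference of two word values. The open set condition bounds this coefficient from below, so
  \<open>u\<close> lies in a small disc; a large exponent \<open>C\<close> beats the number of
  quadruples of words.\<close>

lemma overlap_set_null:
  fixes a :: "'i::finite \<Rightarrow> complex"
  assumes osc: "open_set_condition lam a" and lam: "0 < cmod lam" "cmod lam < 1" and s: "s > 0"
  shows "hausdorff_null s (overlap_set lam a)"
proof -
  have "lam \<noteq> 0" using lam by auto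
  then obtain c where c: "c > 0"
    and sep: "\<And>w w'. length w = length w' \<Longrightarrow> w \<noteq> w' \<Longrightarrow> c * cmod lam ^ length w \<le> cmod (wsum lam a w - wsum lam a w')"
    using osc_separated[OF osc] by blast
  have ls: "0 < cmod lam powr s" "cmod lam powr s < 1" using lam s by (auto simp: powr01_less_one)
  define m where "m = real CARD('i)"
  obtain k where k: "m ^ 4 * (cmod lam powr s) ^ k < 1"
  proof -
    have "(\<lambda>k. m ^ 4 * (cmod lam powr s) ^ k) \<longlonglongrightarrow> m ^ 4 * 0"
      using ls by (intro tendsto_intros LIMSEQ_realpow_zero) auto
    then have "\<forall>\<^sub>F k in sequentially. m ^ 4 * (cmod lam powr s) ^ k < 1" by (rule order_tendstoD(2)) simp
    then show thesis using that by (auto simp: eventually_sequentially)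
  qed
  \<comment> \<open>One factor \<open>|lam| ^ n\<close> is spent on the lower bound for the
    coefficient of \<open>u\<close>; the remaining exponent \<open>k + 1\<close> makes
    \<open>r powr s\<close> beat the count \<open>m ^ 4\<close>.\<close>
  define C where "C = Suc (Suc k)"
  define r where "r = cmod lam ^ Suc k"
  have r: "0 < r" using lam by (simp add: r_def)
  have r1: "r < 1" unfolding r_def using lam by (intro power_Suc_less_one) auto
  have Cr: "cmod lam ^ (C * n) = r ^ n * cmod lam ^ n" for n
    unfolding C_def r_def power_mult[symmetric] power_add[symmetric] by (rule arg_cong[where f="(^) _"]) simp
  define Wn where "Wn n = {w :: 'i list. length w = n}" for n
  have Wn: "finite (Wn n)" "real (card (Wn n)) = m ^ n" for n
    using finite_lists_length_eq[of "UNIV :: 'i set" n] card_lists_length_eq[of "UNIV :: 'i set" n]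
    by (auto simp: Wn_def m_def)
  define S where "S n = (\<lambda>(i, j, l, l'). if l = l' then {} else
      {u. cmod (wsum lam a i - wsum lam a j + u * (wsum lam a l - wsum lam a l')) < cmod lam ^ (C * n)})" for n
  define F where "F n = S n ` (Wn n \<times> Wn n \<times> Wn n \<times> Wn n)" for n
  obtain N1 where N1: "\<And>n. n \<ge> N1 \<Longrightarrow> r ^ n < c"
  proof -
    have "(\<lambda>n. r ^ n) \<longlonglongrightarrow> 0" using r r1 by (intro LIMSEQ_realpow_zero) auto
    then have "\<forall>\<^sub>F n in sequentially. r ^ n < c" by (rule order_tendstoD(2)) (rule c)
    then show thesis using that by (auto simp: eventually_sequentially)
  qed
  show ?thesis
  proof (rule hausdorff_null_limsup[where F=F and A=1 and M="m ^ 4" and D="2 / c" and r=r])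
    fix u N assume "u \<in> overlap_set lam a"
    then have "\<exists>n\<ge>max N N1. \<exists>w w'. length w = n \<and> length w' = n \<and> w \<noteq> w' \<and>
      cmod (wsum lam (\<lambda>(i, j). a i + u * a j) w - wsum lam (\<lambda>(i, j). a i + u * a j) w') < cmod lam ^ (C * n)"
      unfolding overlap_set_def mem_Collect_eq by (elim allE)
    then obtain n w w' where n: "n \<ge> max N N1" and w: "length w = n" "length w' = n" "w \<noteq> w'"
      and ov: "cmod (wsum lam (\<lambda>(i, j). a i + u * a j) w - wsum lam (\<lambda>(i, j). a i + u * a j) w') < cmod lam ^ (C * n)"
      by (elim exE conjE)
    let ?i = "map fst w" and ?j = "map fst w'" and ?l = "map snd w" and ?l' = "map snd w'"
    have eq: "wsum lam (\<lambda>(i, j). a i + u * a j) w - wsum lam (\<lambda>(i, j). a i + u * a j) w'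
        = wsum lam a ?i - wsum lam a ?j + u * (wsum lam a ?l - wsum lam a ?l')"
      by (simp add: wsum_pair algebra_simps)
    \<comment> \<open>If the second components agreed, \<open>u\<close> would drop out and the first
      components would differ, which for large \<open>n\<close> contradicts the open set
      condition.\<close>
    have "?l \<noteq> ?l'"
    proof
      assume l: "?l = ?l'"
      then have "?i \<noteq> ?j" using w(3) by (metis zip_map_fst_snd)
      then have "c * cmod lam ^ n \<le> cmod (wsum lam a ?i - wsum lam a ?j)" using sep[of ?i ?j] w by simp
      also have "\<dots> < cmod lam ^ (C * n)" using ov unfolding eq l by simp
      finally have "c < r ^ n" using lam unfolding Cr by simp
      then show False using N1[of n] n by simp
    qed
    then have "u \<in> S n (?i, ?j, ?l, ?l')" using ov unfolding eq by (simp add: S_def)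
    moreover have "(?i, ?j, ?l, ?l') \<in> Wn n \<times> Wn n \<times> Wn n \<times> Wn n" using w by (simp add: Wn_def)
    ultimately show "\<exists>n\<ge>N. u \<in> \<Union>(F n)" using n unfolding F_def by (intro exI[of _ n]) auto
  next
    fix n
    show "finite (F n)" by (simp add: F_def Wn)
    have "card (F n) \<le> card (Wn n \<times> Wn n \<times> Wn n \<times> Wn n)" unfolding F_def by (intro card_image_le) (simp add: Wn)
    then have "real (card (F n)) \<le> real (card (Wn n \<times> Wn n \<times> Wn n \<times> Wn n))" by (rule of_nat_mono)
    also have "\<dots> = (m ^ n) ^ 4" by (simp add: card_cartesian_product Wn power4_eq_xxxx)
    also have "\<dots> = (m ^ 4) ^ n" by (simp flip: power_mult add: mult.commute)
    finally show "real (card (F n)) \<le> 1 * (m ^ 4) ^ n" by simp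
  next
    fix n U x y assume U: "U \<in> F n" "x \<in> U" "y \<in> U"
    then obtain i j l l' where w: "i \<in> Wn n" "j \<in> Wn n" "l \<in> Wn n" "l' \<in> Wn n" and Ueq: "U = S n (i, j, l, l')"
      unfolding F_def by auto
    let ?d = "wsum lam a l - wsum lam a l'" and ?e = "wsum lam a i - wsum lam a j"
    have ll: "l \<noteq> l'" using U by (auto simp: Ueq S_def)
    have xy: "cmod (?e + x * ?d) < cmod lam ^ (C * n)" "cmod (?e + y * ?d) < cmod lam ^ (C * n)"
      using U ll by (simp_all add: Ueq S_def)
    have "cmod (x - y) * (c * cmod lam ^ n) \<le> cmod (x - y) * cmod ?d"
      using sep[of l l'] ll w by (intro mult_left_mono) (auto simp: Wn_def)
    also have "\<dots> = cmod ((?e + x * ?d) - (?e + y * ?d))"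
      unfolding norm_mult[symmetric] by (rule arg_cong[where f=cmod]) (simp add: algebra_simps)
    also have "\<dots> \<le> 2 * cmod lam ^ (C * n)" using norm_triangle_ineq4[of "?e + x * ?d" "?e + y * ?d"] xy by linarith
    also have "\<dots> = 2 * r ^ n * cmod lam ^ n" by (simp add: Cr)
    finally have "(cmod (x - y) * c) * cmod lam ^ n \<le> (2 * r ^ n) * cmod lam ^ n" by (simp add: mult_ac)
    then have "cmod (x - y) * c \<le> 2 * r ^ n" by (rule mult_right_le_imp_le) (use lam in simp)
    then show "cmod (x - y) \<le> 2 / c * r ^ n" using c by (simp add: field_simps)
  next
    have "r powr s = (cmod lam powr s) ^ Suc k"
      unfolding r_def using lam by (simp add: powr_realpow[symmetric] powr_powr mult.commute del: power_Suc)
    also have "\<dots> \<le> (cmod lam powr s) ^ k" using ls by (intro power_decreasing) auto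
    finally have "m ^ 4 * r powr s \<le> m ^ 4 * (cmod lam powr s) ^ k" by (intro mult_left_mono) auto
    then show "m ^ 4 * r powr s < 1" using k by linarith
  qed (use r r1 c s in \<open>auto simp: m_def\<close>)
qed

section \<open>Erdos--Kahane sets\<close>

text \<open>Exponential Chebyshev bound: giving each non-zero entry the weight \<open>x\<close>
  turns the sum over all lists into a product over positions.\<close>

lemma card_sparse_lists:
  fixes x t :: real and n :: nat
  assumes Q: "Q \<ge> (0::int)" and x: "0 < x" "x \<le> 1"
  defines "L \<equiv> {l. set l \<subseteq> {-Q..Q} \<and> length l = n \<and> real (length (filter (\<lambda>k. k \<noteq> 0) l)) \<le> t}"
  shows "finite L" "real (card L) * x powr t \<le> (1 + 2 * real_of_int Q * x) ^ n"
proof -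
  define T where "T n = {l. set l \<subseteq> {-Q..Q} \<and> length l = n}" for n
  have fT: "finite (T n)" for n unfolding T_def by (rule finite_lists_length_eq) simp
  have LT: "L \<subseteq> T n" by (auto simp: L_def T_def)
  then show fL: "finite L" using fT finite_subset by blast
  define wt where "wt l = x ^ length (filter (\<lambda>k. k \<noteq> 0) l)" for l :: "int list"
  have digit: "(\<Sum>k\<in>{-Q..Q}. if k \<noteq> 0 then x else 1) = 1 + 2 * real_of_int Q * x"
  proof -
    have "(\<Sum>k\<in>{-Q..Q}. if k \<noteq> 0 then x else 1) = (\<Sum>k\<in>{-Q..Q}. x) + (\<Sum>k\<in>{-Q..Q}. if k = 0 then 1 - x else 0)"
      unfolding sum.distrib[symmetric] by (intro sum.cong) auto
    also have "(\<Sum>k\<in>{-Q..Q}. if k = 0 then 1 - x else 0) = 1 - x" using Q by simp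
    finally show ?thesis using Q by (simp add: algebra_simps)
  qed
  have sumT: "(\<Sum>l\<in>T n. wt l) = (1 + 2 * real_of_int Q * x) ^ n" for n
  proof (induction n)
    case 0
    have "T 0 = {[]}" by (auto simp: T_def)
    then show ?case by (simp add: wt_def)
  next
    case (Suc n)
    have T: "T (Suc n) = (\<lambda>(k, l). k # l) ` ({-Q..Q} \<times> T n)"
      by (auto simp: T_def image_iff length_Suc_conv)
    have "(\<Sum>l\<in>T (Suc n). wt l) = (\<Sum>(k, l)\<in>{-Q..Q} \<times> T n. (if k \<noteq> 0 then x else 1) * wt l)"
      unfolding T by (subst sum.reindex) (auto simp: inj_on_def wt_def split_beta intro!: sum.cong)
    also have "\<dots> = (\<Sum>k\<in>{-Q..Q}. if k \<noteq> 0 then x else 1) * (\<Sum>l\<in>T n. wt l)"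
      by (simp add: sum.cartesian_product[symmetric] sum_product)
    finally show ?case by (simp add: digit Suc.IH)
  qed
  have "real (card L) * x powr t = (\<Sum>l\<in>L. x powr t)" by simp
  also have "\<dots> \<le> (\<Sum>l\<in>L. wt l)"
  proof (rule sum_mono)
    fix l assume "l \<in> L"
    then have "x powr t \<le> x powr real (length (filter (\<lambda>k. k \<noteq> 0) l))" using x by (intro powr_mono') (auto simp: L_def)
    then show "x powr t \<le> wt l" using x by (simp add: wt_def powr_realpow)
  qed
  also have "\<dots> \<le> (\<Sum>l\<in>T n. wt l)" using LT fT x by (intro sum_mono2) (auto simp: wt_def)
  finally show "real (card L) * x powr t \<le> (1 + 2 * real_of_int Q * x) ^ n" by (simp add: sumT)
qed

definition int_dist :: "real \<Rightarrow> real" where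
  "int_dist x = \<bar>x - of_int (round x)\<bar>"

text \<open>The denominator contains the total weight of the recurrence
  \<open>\<theta> ^ 2 = 2 * Re \<theta> * \<theta> - |\<theta>| ^ 2\<close>. If three consecutive
  terms are this close to integers, rounding the recurrence predicts the third integer with an error
  of at most 1/4, hence exactly.\<close>

definition ek_radius :: "complex \<Rightarrow> real" where
  "ek_radius \<theta> = 1 / (4 * (1 + \<bar>2 * Re \<theta>\<bar> + (cmod \<theta>)\<^sup>2))"

definition ek_bad :: "complex \<Rightarrow> complex \<Rightarrow> complex \<Rightarrow> nat \<Rightarrow> bool" where
  "ek_bad \<theta> u z j \<longleftrightarrow> ek_radius \<theta> \<le> int_dist (Re (\<theta> ^ j * z)) \<or> ek_radius \<theta> \<le> int_dist (Re (\<theta> ^ j * (u * z)))"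

text \<open>For other \<open>u\<close> in the disc one \<delta> bounds the density of bad positions
  from below, uniformly in \<open>z\<close> and in all large \<open>n\<close>. The annulus is a
  fundamental domain for multiplication by \<theta>, so every large frequency can be normalised into
  it.\<close>

definition ek_set :: "complex \<Rightarrow> real \<Rightarrow> complex set" where
  "ek_set \<theta> R = {u. cmod u \<le> R \<and> (\<forall>\<delta>>0. \<forall>N0. \<exists>n\<ge>N0. \<exists>z. 1 \<le> cmod z \<and> cmod z \<le> cmod \<theta> \<and>
     real (card {j. j < n + 2 \<and> ek_bad \<theta> u z j}) < \<delta> * real n)}"

lemma int_dist_le: "int_dist x \<le> 1 / 2"
  unfolding int_dist_def using of_int_round_abs_le[of x] by (simp add: abs_minus_commute)

context
  fixes \<theta> :: complex
  assumes \<theta>: "Im \<theta> \<noteq> 0" "cmod \<theta> > 1"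
begin

definition ek_hat :: "complex \<Rightarrow> nat \<Rightarrow> int" where
  "ek_hat z m = round (Re (\<theta> ^ m * z))"

text \<open>The error made when the recurrence of \<theta> predicts a nearest integer from the two
  preceding ones.\<close>

definition ek_kap :: "complex \<Rightarrow> nat \<Rightarrow> int" where
  "ek_kap z m = ek_hat z (m + 2) - round (2 * Re \<theta> * ek_hat z (m + 1) - (cmod \<theta>)\<^sup>2 * ek_hat z m)"

definition ek_code :: "nat \<Rightarrow> complex \<Rightarrow> int \<times> int \<times> int list" where
  "ek_code n z = (ek_hat z 0, ek_hat z 1, map (ek_kap z) [0..<n])"

abbreviation "ekS \<equiv> 1 + \<bar>2 * Re \<theta>\<bar> + (cmod \<theta>)\<^sup>2"

lemma ek_recurrence: "Re (\<theta> ^ (m + 2) * z) = 2 * Re \<theta> * Re (\<theta> ^ (m + 1) * z) - (cmod \<theta>)\<^sup>2 * Re (\<theta> ^ m * z)"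
proof -
  have "\<theta>\<^sup>2 = of_real (2 * Re \<theta>) * \<theta> - of_real ((cmod \<theta>)\<^sup>2)"
    unfolding cmod_power2 by (simp add: complex_eq_iff power2_eq_square algebra_simps)
  then have sq: "\<theta>\<^sup>2 * w = of_real (2 * Re \<theta>) * (\<theta> * w) - of_real ((cmod \<theta>)\<^sup>2) * w" for w
    by (simp add: left_diff_distrib mult.assoc)
  have "\<theta> ^ (m + 2) * z = \<theta>\<^sup>2 * (\<theta> ^ m * z)" by (simp add: power_add power2_eq_square)
  also have "\<dots> = of_real (2 * Re \<theta>) * (\<theta> ^ (m + 1) * z) - of_real ((cmod \<theta>)\<^sup>2) * (\<theta> ^ m * z)"
    unfolding sq by (simp add: mult_ac)
  finally show ?thesis
    by (simp only: minus_complex.simps Re_complex_of_real times_complex.simps Im_complex_of_real mult_zero_left diff_zero)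
qed

lemma ek_deviation:
  assumes e: "int_dist (Re (\<theta> ^ m * z)) \<le> e" "int_dist (Re (\<theta> ^ (m + 1) * z)) \<le> e" "int_dist (Re (\<theta> ^ (m + 2) * z)) \<le> e"
  shows "\<bar>(2 * Re \<theta> * ek_hat z (m + 1) - (cmod \<theta>)\<^sup>2 * ek_hat z m) - ek_hat z (m + 2)\<bar> \<le> ekS * e"
proof -
  define d where "d j = Re (\<theta> ^ j * z) - of_int (ek_hat z j)" for j
  have d: "\<bar>d m\<bar> \<le> e" "\<bar>d (m + 1)\<bar> \<le> e" "\<bar>d (m + 2)\<bar> \<le> e" using e by (auto simp: d_def ek_hat_def int_dist_def)
  have h: "of_int (ek_hat z j) = Re (\<theta> ^ j * z) - d j" for j by (simp add: d_def)
  have "(2 * Re \<theta> * ek_hat z (m + 1) - (cmod \<theta>)\<^sup>2 * ek_hat z m) - ek_hat z (m + 2)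
      = d (m + 2) - (2 * Re \<theta>) * d (m + 1) + (cmod \<theta>)\<^sup>2 * d m"
    unfolding h ek_recurrence by (simp add: algebra_simps)
  also have "\<bar>\<dots>\<bar> \<le> \<bar>d (m + 2)\<bar> + \<bar>2 * Re \<theta>\<bar> * \<bar>d (m + 1)\<bar> + (cmod \<theta>)\<^sup>2 * \<bar>d m\<bar>"
    using abs_triangle_ineq[of "d (m + 2) - (2 * Re \<theta>) * d (m + 1)" "(cmod \<theta>)\<^sup>2 * d m"]
      abs_triangle_ineq4[of "d (m + 2)" "(2 * Re \<theta>) * d (m + 1)"] by (simp only: abs_mult abs_power2 power2_abs abs_norm_cancel)
  also have "\<dots> \<le> e + \<bar>2 * Re \<theta>\<bar> * e + (cmod \<theta>)\<^sup>2 * e"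
    using d by (intro add_mono mult_left_mono) auto
  finally show ?thesis by (simp add: algebra_simps)
qed

lemma ek_kap_bound: "ek_kap z m \<in> {- \<lceil>ekS\<rceil>..\<lceil>ekS\<rceil>}"
proof -
  let ?v = "2 * Re \<theta> * ek_hat z (m + 1) - (cmod \<theta>)\<^sup>2 * ek_hat z m"
  have le: "\<bar>k\<bar> \<le> S" if "\<bar>v - h\<bar> \<le> S * (1 / 2)" "\<bar>r - v\<bar> \<le> 1 / 2" "k = h - r" "S \<ge> 1" for v h r k S :: real
    using that by linarith
  have "\<bar>?v - ek_hat z (m + 2)\<bar> \<le> ekS * (1 / 2)" by (intro ek_deviation int_dist_le)
  then have "\<bar>real_of_int (ek_kap z m)\<bar> \<le> ekS"
    by (rule le[OF _ of_int_round_abs_le]) (simp_all add: ek_kap_def)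
  then show ?thesis by (simp add: abs_le_iff) linarith
qed

lemma ek_kap_zero:
  assumes "int_dist (Re (\<theta> ^ m * z)) < ek_radius \<theta>" "int_dist (Re (\<theta> ^ (m + 1) * z)) < ek_radius \<theta>"
    "int_dist (Re (\<theta> ^ (m + 2) * z)) < ek_radius \<theta>"
  shows "ek_kap z m = 0"
proof -
  let ?v = "2 * Re \<theta> * ek_hat z (m + 1) - (cmod \<theta>)\<^sup>2 * ek_hat z m"
  have "\<bar>?v - ek_hat z (m + 2)\<bar> \<le> ekS * ek_radius \<theta>" using assms by (intro ek_deviation) auto
  also have "ekS * ek_radius \<theta> = 1 / 4"
  proof -
    have "ekS > 0" using \<theta> by (simp add: add_pos_nonneg)
    then show ?thesis by (simp add: ek_radius_def)
  qed
  finally have "round ?v = ek_hat z (m + 2)" by (intro round_unique') simp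
  then show ?thesis by (simp add: ek_kap_def)
qed

text \<open>The code reproduces the nearest integers at \<open>n\<close> and \<open>n + 1\<close>,
  so \<open>Re d\<close> and \<open>Re (\<theta> * d)\<close> are at most 1 in absolute value for
  \<open>d = \<theta> ^ n * (z - z')\<close>; for non-real \<theta> these two real parts control
  \<open>d\<close>.\<close>

lemma ek_code_near:
  assumes "ek_code n z = ek_code n z'"
  shows "cmod (z - z') \<le> (1 + (1 + \<bar>Re \<theta>\<bar>) / \<bar>Im \<theta>\<bar>) * (1 / cmod \<theta>) ^ n"
proof -
  have h: "ek_hat z m = ek_hat z' m \<and> ek_hat z (m + 1) = ek_hat z' (m + 1)" if "m \<le> n" for m
    using that
  proof (induction m)
    case 0 then show ?case using assms by (simp add: ek_code_def)
  next
    case (Suc m)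
    then have "ek_kap z m = ek_kap z' m" using assms by (auto simp: ek_code_def)
    with Suc show ?case by (simp add: ek_kap_def)
  qed
  define d where "d = \<theta> ^ n * (z - z')"
  have close: "\<bar>Re (\<theta> ^ m * z) - Re (\<theta> ^ m * z')\<bar> \<le> 1" if "ek_hat z m = ek_hat z' m" for m
    using that int_dist_le[of "Re (\<theta> ^ m * z)"] int_dist_le[of "Re (\<theta> ^ m * z')"]
    unfolding ek_hat_def int_dist_def by linarith
  have 1: "\<bar>Re d\<bar> \<le> 1" using close[of n] h[of n] by (simp add: d_def right_diff_distrib)
  have "\<theta> * d = \<theta> ^ (n + 1) * z - \<theta> ^ (n + 1) * z'" by (simp add: d_def algebra_simps)
  then have 2: "\<bar>Re (\<theta> * d)\<bar> \<le> 1" using close[of "n + 1"] h[of n] by simp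
  have "Im \<theta> * Im d = Re \<theta> * Re d - Re (\<theta> * d)" by simp
  then have "\<bar>Im \<theta>\<bar> * \<bar>Im d\<bar> = \<bar>Re \<theta> * Re d - Re (\<theta> * d)\<bar>" unfolding abs_mult[symmetric] by (rule arg_cong)
  also have "\<dots> \<le> \<bar>Re \<theta> * Re d\<bar> + \<bar>Re (\<theta> * d)\<bar>" by (rule abs_triangle_ineq4)
  also have "\<dots> \<le> \<bar>Re \<theta>\<bar> * \<bar>Re d\<bar> + 1" using 2 unfolding abs_mult by (rule add_left_mono)
  also have "\<dots> \<le> 1 + \<bar>Re \<theta>\<bar>" using 1 by (simp add: mult_left_le)
  finally have "\<bar>Im d\<bar> \<le> (1 + \<bar>Re \<theta>\<bar>) / \<bar>Im \<theta>\<bar>" using \<theta> by (simp add: le_divide_eq mult.commute)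
  then have "cmod d \<le> 1 + (1 + \<bar>Re \<theta>\<bar>) / \<bar>Im \<theta>\<bar>" using 1 cmod_le[of d] by linarith
  moreover have "cmod (z - z') = cmod d * (1 / cmod \<theta>) ^ n"
    using \<theta> by (auto simp: d_def norm_mult norm_power power_one_over)
  ultimately show ?thesis by (simp add: mult_right_mono)
qed

text \<open>A non-zero correction at \<open>m\<close> forces a bad position among \<open>m\<close>,
  \<open>m + 1\<close> and \<open>m + 2\<close>, so each bad position is charged at most three
  times.\<close>

lemma ek_kap_sparse:
  assumes bad: "\<And>j. ek_radius \<theta> \<le> int_dist (Re (\<theta> ^ j * z)) \<Longrightarrow> B j"
  shows "length (filter (\<lambda>k. k \<noteq> 0) (map (ek_kap z) [0..<n])) \<le> 3 * card {j. j < n + 2 \<and> B j}"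
proof -
  let ?B = "{j. j < n + 2 \<and> B j}"
  have "length (filter (\<lambda>k. k \<noteq> 0) (map (ek_kap z) [0..<n])) = card {m. m < n \<and> ek_kap z m \<noteq> 0}"
    by (auto simp: length_filter_conv_card intro!: arg_cong[where f=card])
  also have "\<dots> \<le> card ({m. m \<in> ?B} \<union> {m. m + 1 \<in> ?B} \<union> {m. m + 2 \<in> ?B})"
  proof (rule card_mono)
    show "finite ({m. m \<in> ?B} \<union> {m. m + 1 \<in> ?B} \<union> {m. m + 2 \<in> ?B})"
      by (rule finite_subset[of _ "{..<n + 2}"]) auto
    show "{m. m < n \<and> ek_kap z m \<noteq> 0} \<subseteq> {m. m \<in> ?B} \<union> {m. m + 1 \<in> ?B} \<union> {m. m + 2 \<in> ?B}"
    proof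
      fix m assume m: "m \<in> {m. m < n \<and> ek_kap z m \<noteq> 0}"
      have good: "int_dist (Re (\<theta> ^ j * z)) < ek_radius \<theta>" if "\<not> B j" for j
        using bad[of j] that by (cases "ek_radius \<theta> \<le> int_dist (Re (\<theta> ^ j * z))") auto
      have "B m \<or> B (m + 1) \<or> B (m + 2)"
      proof (rule ccontr)
        assume "\<not> ?thesis"
        then have "ek_kap z m = 0" by (intro ek_kap_zero good) simp_all
        then show False using m by simp
      qed
      then show "m \<in> {m. m \<in> ?B} \<union> {m. m + 1 \<in> ?B} \<union> {m. m + 2 \<in> ?B}" using m by auto
    qed
  qed
  also have "\<dots> \<le> card {m. m \<in> ?B} + card {m. m + 1 \<in> ?B} + card {m. m + 2 \<in> ?B}"
    using card_Un_le[of "{m. m \<in> ?B} \<union> {m. m + 1 \<in> ?B}" "{m. m + 2 \<in> ?B}"]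
      card_Un_le[of "{m. m \<in> ?B}" "{m. m + 1 \<in> ?B}"] by linarith
  also have "\<dots> \<le> card ?B + card ?B + card ?B"
  proof -
    have le: "card {m. m + i \<in> ?B} \<le> card ?B" for i
    proof (rule card_inj_on_le[of "\<lambda>m. m + i"])
      show "finite ?B" by (rule finite_subset[of _ "{..<n + 2}"]) auto
    qed auto
    show ?thesis using le[of 0] le[of 1] le[of 2] unfolding add_0_right by (intro add_mono)
  qed
  finally show ?thesis by simp
qed

text \<open>\<open>u\<close> is the quotient of \<open>u * z\<close> by \<open>z\<close>, so the two
  codes locate it up to a multiple of \<open>|\<theta>| ^ (- n)\<close>. Few bad positions make both
  codes sparse, and sparse codes grow in number at an arbitrarily small exponential rate.\<close>

lemma ek_set_null:
  assumes s: "s > 0" and R: "R \<ge> 0"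
  shows "hausdorff_null s (ek_set \<theta> R)"
proof -
  define r where "r = 1 / cmod \<theta>"
  have "0 < cmod \<theta>" using \<theta> by linarith
  then have r: "0 < r" "r < 1" using \<theta> by (simp_all add: r_def)
  define \<tau> where "\<tau> = r powr s"
  have \<tau>: "0 < \<tau>" "\<tau> < 1" using r s by (auto simp: \<tau>_def powr01_less_one)
  define Q where "Q = \<lceil>ekS\<rceil>"
  have "ekS \<ge> 0" by simp
  then have "real_of_int Q \<ge> 0" unfolding Q_def using le_of_int_ceiling[of ekS] by linarith
  then have Q: "Q \<ge> 0" by simp
  \<comment> \<open>The square accounts for the two codes. First \<open>x\<close> is taken so small
    that the growth rate times \<tau> stays below 1; then \<delta> so small that the factor
    \<open>x powr (- 3 * \<delta>)\<close> does not destroy this.\<close>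
  obtain x where x: "0 < x" "x \<le> 1" "(1 + 2 * real_of_int Q * x)\<^sup>2 * \<tau> < 1"
  proof -
    have "((\<lambda>x. (1 + 2 * real_of_int Q * x)\<^sup>2 * \<tau>) \<longlongrightarrow> (1 + 2 * real_of_int Q * 0)\<^sup>2 * \<tau>) (at_right 0)"
      by (intro tendsto_intros)
    then have "\<forall>\<^sub>F x in at_right 0. (1 + 2 * real_of_int Q * x)\<^sup>2 * \<tau> < 1" by (rule order_tendstoD(2)) (use \<tau> in simp)
    moreover have "\<forall>\<^sub>F x in at_right (0::real). x \<in> {0<..<1}" by (rule eventually_at_right_real) simp
    ultimately have "\<forall>\<^sub>F x in at_right 0. (1 + 2 * real_of_int Q * x)\<^sup>2 * \<tau> < 1 \<and> x \<in> {0<..<1}" by (rule eventually_conj)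
    then obtain x where "(1 + 2 * real_of_int Q * x)\<^sup>2 * \<tau> < 1 \<and> x \<in> {0<..<1}"
      using eventually_happens'[OF trivial_limit_at_right_real] by blast
    then show thesis by (intro that[of x]) auto
  qed
  define M1 where "M1 \<delta> = (1 + 2 * real_of_int Q * x) / x powr (3 * \<delta>)" for \<delta>
  obtain \<delta> where \<delta>: "\<delta> > 0" "(M1 \<delta>)\<^sup>2 * \<tau> < 1"
  proof -
    have "((\<lambda>\<delta>. (M1 \<delta>)\<^sup>2 * \<tau>) \<longlongrightarrow> ((1 + 2 * real_of_int Q * x) / x powr (3 * 0))\<^sup>2 * \<tau>) (at_right 0)"
      unfolding M1_def using x by (intro tendsto_intros) auto
    then have "\<forall>\<^sub>F \<delta> in at_right 0. (M1 \<delta>)\<^sup>2 * \<tau> < 1" by (rule order_tendstoD(2)) (use x in simp)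
    moreover have "\<forall>\<^sub>F \<delta> in at_right (0::real). \<delta> \<in> {0<..<1}" by (rule eventually_at_right_real) simp
    ultimately have "\<forall>\<^sub>F \<delta> in at_right 0. (M1 \<delta>)\<^sup>2 * \<tau> < 1 \<and> \<delta> \<in> {0<..<1}" by (rule eventually_conj)
    then obtain \<delta> where "(M1 \<delta>)\<^sup>2 * \<tau> < 1 \<and> \<delta> \<in> {0<..<1}"
      using eventually_happens'[OF trivial_limit_at_right_real] by blast
    then show thesis by (intro that[of \<delta>]) auto
  qed
  have M1: "M1 \<delta> \<ge> 0" using x Q by (simp add: M1_def)
  define L where "L n = {l. set l \<subseteq> {-Q..Q} \<and> length l = n \<and> real (length (filter (\<lambda>k. k \<noteq> 0) l)) \<le> 3 * \<delta> * real n}" for n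
  have L: "finite (L n)" "real (card (L n)) \<le> M1 \<delta> ^ n" for n
  proof -
    note * = card_sparse_lists[OF Q x(1,2), of n "3 * \<delta> * real n"]
    show "finite (L n)" using *(1) by (simp add: L_def)
    have "x powr (3 * \<delta> * real n) = (x powr (3 * \<delta>)) ^ n" using x by (simp add: powr_realpow[symmetric] powr_powr)
    then have "real (card (L n)) * (x powr (3 * \<delta>)) ^ n \<le> (1 + 2 * real_of_int Q * x) ^ n" using *(2) by (simp add: L_def)
    then show "real (card (L n)) \<le> M1 \<delta> ^ n" using x by (simp add: M1_def power_divide le_divide_eq)
  qed
  define K where "K = \<lceil>(1 + R) * (cmod \<theta>)\<^sup>2 + 1\<rceil>"
  define I where "I = {-K..K}"
  define CS where "CS n = I \<times> I \<times> L n" for n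
  have CS: "finite (CS n)" "real (card (CS n)) \<le> (real (card I))\<^sup>2 * M1 \<delta> ^ n" for n
  proof -
    show "finite (CS n)" by (simp add: CS_def I_def L)
    have "real (card (CS n)) = (real (card I))\<^sup>2 * real (card (L n))"
      by (simp add: CS_def card_cartesian_product power2_eq_square)
    also have "\<dots> \<le> (real (card I))\<^sup>2 * M1 \<delta> ^ n" by (intro mult_left_mono L) auto
    finally show "real (card (CS n)) \<le> (real (card I))\<^sup>2 * M1 \<delta> ^ n" .
  qed
  define S where "S n = (\<lambda>(c, c'). {u. cmod u \<le> R \<and> (\<exists>z. 1 \<le> cmod z \<and> ek_code n z = c \<and> ek_code n (u * z) = c')})" for n
  define F where "F n = S n ` (CS n \<times> CS n)" for n
  have hatI: "ek_hat z m \<in> I" if "cmod z \<le> (1 + R) * cmod \<theta>" "m \<le> 1" for z m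
  proof -
    have "\<bar>Re (\<theta> ^ m * z)\<bar> \<le> cmod \<theta> ^ m * cmod z" using abs_Re_le_cmod[of "\<theta> ^ m * z"] by (simp add: norm_mult norm_power)
    also have "\<dots> \<le> cmod \<theta> ^ 1 * ((1 + R) * cmod \<theta>)" using that \<theta> by (intro mult_mono power_increasing) auto
    also have "\<dots> = (1 + R) * (cmod \<theta>)\<^sup>2" by (simp add: power2_eq_square)
    finally have "\<bar>real_of_int (ek_hat z m)\<bar> \<le> (1 + R) * (cmod \<theta>)\<^sup>2 + 1"
      using of_int_round_abs_le[of "Re (\<theta> ^ m * z)"] unfolding ek_hat_def by linarith
    then show ?thesis unfolding I_def K_def by (simp add: abs_le_iff) linarith
  qed
  have inCS: "ek_code n z \<in> CS n" if z: "cmod z \<le> (1 + R) * cmod \<theta>"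
    and bad: "\<And>j. ek_radius \<theta> \<le> int_dist (Re (\<theta> ^ j * z)) \<Longrightarrow> B j" and B: "real (card {j. j < n + 2 \<and> B j}) < \<delta> * real n"
  for n z B
  proof -
    have "real (length (filter (\<lambda>k. k \<noteq> 0) (map (ek_kap z) [0..<n]))) \<le> real (3 * card {j. j < n + 2 \<and> B j})"
      by (intro of_nat_mono ek_kap_sparse bad)
    also have "\<dots> \<le> 3 * \<delta> * real n" using B by simp
    finally have "map (ek_kap z) [0..<n] \<in> L n" using ek_kap_bound by (auto simp: L_def Q_def)
    then show ?thesis using hatI[OF z] by (simp add: CS_def ek_code_def)
  qed
  show ?thesis
  proof (rule hausdorff_null_limsup[where F=F and A="(real (card I)) ^ 4" and M="(M1 \<delta>)\<^sup>2"
        and D="(1 + R) * (1 + (1 + \<bar>Re \<theta>\<bar>) / \<bar>Im \<theta>\<bar>)" and r=r])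
    fix u N assume "u \<in> ek_set \<theta> R"
    then have u: "cmod u \<le> R" and "\<exists>n\<ge>N. \<exists>z. 1 \<le> cmod z \<and> cmod z \<le> cmod \<theta> \<and>
       real (card {j. j < n + 2 \<and> ek_bad \<theta> u z j}) < \<delta> * real n" using \<delta>(1) by (auto simp: ek_set_def)
    then obtain n z where n: "n \<ge> N" and z: "1 \<le> cmod z" "cmod z \<le> cmod \<theta>"
      and bad: "real (card {j. j < n + 2 \<and> ek_bad \<theta> u z j}) < \<delta> * real n" by (elim exE conjE)
    have "cmod z \<le> (1 + R) * cmod \<theta>" using z R mult_right_mono[of 1 "1 + R" "cmod \<theta>"] by simp
    then have 1: "ek_code n z \<in> CS n" by (rule inCS[OF _ _ bad]) (simp add: ek_bad_def)
    have "cmod (u * z) \<le> R * cmod \<theta>" unfolding norm_mult using u z R by (intro mult_mono) auto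
    also have "\<dots> \<le> (1 + R) * cmod \<theta>" by (intro mult_right_mono) auto
    finally have 2: "ek_code n (u * z) \<in> CS n" by (rule inCS[OF _ _ bad]) (simp add: ek_bad_def)
    have "u \<in> S n (ek_code n z, ek_code n (u * z))" using u z by (auto simp: S_def)
    then show "\<exists>n\<ge>N. u \<in> \<Union>(F n)" using n 1 2 unfolding F_def by (intro exI[of _ n]) auto
  next
    fix n
    show "finite (F n)" by (simp add: F_def CS)
    have "card (F n) \<le> card (CS n \<times> CS n)" unfolding F_def by (intro card_image_le) (simp add: CS)
    then have "real (card (F n)) \<le> real (card (CS n)) * real (card (CS n))"
      by (simp add: card_cartesian_product flip: of_nat_mult)
    also have "\<dots> \<le> ((real (card I))\<^sup>2 * M1 \<delta> ^ n) * ((real (card I))\<^sup>2 * M1 \<delta> ^ n)"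
      using M1 by (intro mult_mono CS) auto
    also have "\<dots> = (real (card I)) ^ 4 * ((M1 \<delta>)\<^sup>2) ^ n"
      by (simp add: power2_eq_square power4_eq_xxxx power_mult_distrib mult_ac)
    finally show "real (card (F n)) \<le> (real (card I)) ^ 4 * ((M1 \<delta>)\<^sup>2) ^ n" .
  next
    fix n U u u' assume U: "U \<in> F n" "u \<in> U" "u' \<in> U"
    then obtain c c' where "U = S n (c, c')" unfolding F_def by auto
    then obtain z z' where u: "cmod u \<le> R" "1 \<le> cmod z" "1 \<le> cmod z'"
      and c: "ek_code n z = ek_code n z'" "ek_code n (u * z) = ek_code n (u' * z')"
      using U(2,3) unfolding S_def by auto
    let ?G = "(1 + (1 + \<bar>Re \<theta>\<bar>) / \<bar>Im \<theta>\<bar>) * r ^ n"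
    have g: "cmod (z - z') \<le> ?G" "cmod (u * z - u' * z') \<le> ?G"
      using ek_code_near[OF c(1)] ek_code_near[OF c(2)] by (simp_all add: r_def)
    have "cmod (u - u') * 1 \<le> cmod (u - u') * cmod z'" using u by (intro mult_left_mono) auto
    also have "\<dots> = cmod ((u * z - u' * z') - u * (z - z'))"
      unfolding norm_mult[symmetric] by (rule arg_cong[where f=cmod]) (simp add: algebra_simps)
    also have "\<dots> \<le> cmod (u * z - u' * z') + cmod u * cmod (z - z')"
      using norm_triangle_ineq4[of "u * z - u' * z'" "u * (z - z')"] by (simp add: norm_mult)
    also have "\<dots> \<le> ?G + R * ?G" using g u R by (intro add_mono mult_mono) auto
    finally show "cmod (u - u') \<le> (1 + R) * (1 + (1 + \<bar>Re \<theta>\<bar>) / \<bar>Im \<theta>\<bar>) * r ^ n"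
      by (simp only: mult.assoc distrib_right[of 1 R "_ * _"] mult_1_left mult_1_right)
  next
    show "(M1 \<delta>)\<^sup>2 * r powr s < 1" using \<delta>(2) by (simp add: \<tau>_def)
  qed (use r s R in auto)
qed

end

section \<open>Power decay of the transform off the Erdos-Kahane set\<close>

lemma cos_int_dist: "cos (2 * pi * x) = cos (2 * pi * int_dist x)"
proof -
  have "cos (2 * pi * x) = cos (2 * pi * x - 2 * pi * of_int (round x))"
    by (simp add: cos_diff cos_int_2pin sin_int_2pin)
  also have "\<dots> = cos (2 * pi * (x - of_int (round x)))" by (simp add: right_diff_distrib)
  also have "\<dots> = cos \<bar>2 * pi * (x - of_int (round x))\<bar>" by (rule cos_abs_real[symmetric])
  also have "\<bar>2 * pi * (x - of_int (round x))\<bar> = 2 * pi * int_dist x" by (simp add: int_dist_def abs_mult)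
  finally show ?thesis .
qed

text \<open>A bad position means a phase away from the integers and costs the product a factor
  \<open>exp (- c1 / 2)\<close>; the half is there because \<open>h\<close> is bounded through its
  square. About \<open>ln |\<xi>| / ln B\<close> positions are available, so a positive density of
  bad ones yields a power of \<open>|\<xi>|\<close>.\<close>

lemma ek_decay:
  fixes h :: "complex \<Rightarrow> real"
  assumes \<theta>: "0 < cmod \<theta>" "cmod \<theta> < 1"
    and \<delta>: "\<delta> > 0"
    and nek: "\<And>n z. n \<ge> N0 \<Longrightarrow> 1 \<le> cmod z \<Longrightarrow> cmod z \<le> cmod (1 / \<theta>) \<Longrightarrow>
      \<delta> * real n \<le> real (card {j. j < n + 2 \<and> ek_bad (1 / \<theta>) u z j})"
    and h: "\<And>\<eta>. 0 \<le> h \<eta>" "\<And>\<eta>. (h \<eta>)\<^sup>2 \<le> 1 - c * (1 - cos (\<eta> \<bullet> b))" and c: "c > 0" and b: "b \<noteq> 0"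
  shows "\<exists>C\<ge>1. \<exists>\<sigma>. 0 < \<sigma> \<and> \<sigma> \<le> 1 \<and> (\<forall>\<xi>. 1 \<le> cmod \<xi> \<longrightarrow>
    (\<exists>M. (\<Prod>m<M. h (cnj \<theta> ^ m * \<xi>) * h (cnj u * (cnj \<theta> ^ m * \<xi>))) \<le> C * cmod \<xi> powr (- \<sigma>)))"
proof -
  define B where "B = cmod (1 / \<theta>)"
  have B: "B > 1" using \<theta> by (simp add: B_def norm_divide)
  have th0: "\<theta> \<noteq> 0" using \<theta> by auto
  define \<rho> where "\<rho> = ek_radius (1 / \<theta>)"
  have \<rho>: "0 < \<rho>" "\<rho> \<le> 1 / 4"
  proof -
    define D where "D = 1 + \<bar>2 * Re (1 / \<theta>)\<bar> + (cmod (1 / \<theta>))\<^sup>2"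
    have "1 \<le> D" by (simp add: D_def)
    then show "0 < \<rho>" "\<rho> \<le> 1 / 4" unfolding \<rho>_def ek_radius_def D_def[symmetric] by (simp_all add: divide_le_eq)
  qed
  define c1 where "c1 = c * (1 - cos (2 * pi * \<rho>))"
  have "cos (2 * pi * \<rho>) < cos 0" using \<rho> by (intro cos_monotone_0_pi) auto
  then have c1: "c1 > 0" using c by (simp add: c1_def)
  have h1: "h \<eta> \<le> 1" for \<eta>
  proof -
    have "0 \<le> c * (1 - cos (\<eta> \<bullet> b))" using c by (intro mult_nonneg_nonneg) auto
    then have "(h \<eta>)\<^sup>2 \<le> 1\<^sup>2" using h(2)[of \<eta>] by simp
    then show ?thesis by (rule power2_le_imp_le) simp
  qed
  have hbad: "(h \<eta>)\<^sup>2 \<le> exp (- c1)" if "\<eta> \<bullet> b = 2 * pi * x" "\<rho> \<le> int_dist x" for \<eta> x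
  proof -
    have "cos (2 * pi * int_dist x) \<le> cos (2 * pi * \<rho>)" using \<rho> that int_dist_le[of x]
      by (intro cos_monotone_0_pi_le) auto
    then have "c1 \<le> c * (1 - cos (\<eta> \<bullet> b))" unfolding c1_def that(1) cos_int_dist[of x] using c by simp
    then have "(h \<eta>)\<^sup>2 \<le> 1 + - c1" using h(2)[of \<eta>] by simp
    also have "\<dots> \<le> exp (- c1)" by (rule exp_ge_add_one_self)
    finally show ?thesis .
  qed
  define \<sigma> where "\<sigma> = min 1 (c1 * \<delta> / (2 * ln B))"
  have lnB: "ln B > 0" using B by simp
  have \<sigma>: "0 < \<sigma>" "\<sigma> \<le> 1" "\<sigma> \<le> c1 * \<delta> / (2 * ln B)" using c1 \<delta> lnB by (auto simp: \<sigma>_def)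
  then have \<sigma>B: "\<sigma> * ln B \<le> c1 * \<delta> / 2" using lnB by (simp add: field_simps)
  define W where "W = max 1 (2 * pi / cmod b * B ^ 2)"
  define R0 where "R0 = 2 * pi / cmod b * B ^ (N0 + 1)"
  define C where "C = max W R0"
  have W: "W \<ge> 1" by (simp add: W_def)
  have C: "C \<ge> 1" "C \<ge> W" "C \<ge> R0" using W by (auto simp: C_def)
  have "\<exists>M. (\<Prod>m<M. h (cnj \<theta> ^ m * \<xi>) * h (cnj u * (cnj \<theta> ^ m * \<xi>))) \<le> C * cmod \<xi> powr (- \<sigma>)"
    if \<xi>: "1 \<le> cmod \<xi>" for \<xi>
  proof -
    \<comment> \<open>This makes the phases real parts: \<open>(cnj \<theta> ^ m * \<xi>) \<bullet>
      b = 2 * pi * Re (\<theta> ^ m * z0)\<close>. The later rescaling of \<open>z0\<close> into the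
      annulus of \<open>ek_set\<close> reverses the order of positions: \<open>m\<close> corresponds
      to \<open>j = n + 1 - m\<close>.\<close>
    define z0 where "z0 = cnj \<xi> * b / of_real (2 * pi)"
    have z0: "cmod \<xi> = 2 * pi / cmod b * cmod z0" using b by (simp add: z0_def norm_mult norm_divide)
    have xip: "cmod \<xi> powr \<sigma> > 0" using \<xi> by auto
    show ?thesis
    proof (cases "cmod z0 < B ^ (N0 + 1)")
      case True
      have "cmod \<xi> \<le> R0" unfolding z0 R0_def using True by (intro mult_left_mono) auto
      moreover have "cmod \<xi> powr \<sigma> \<le> cmod \<xi> powr 1" using \<xi> \<sigma> by (intro powr_mono) auto
      ultimately have "cmod \<xi> powr \<sigma> \<le> C" using C \<xi> by simp
      then have "1 \<le> C * cmod \<xi> powr (- \<sigma>)" using xip by (simp add: powr_minus field_simps)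
      then show ?thesis by (intro exI[of _ 0]) simp
    next
      case False
      define p where "p = (LEAST p. cmod z0 < B ^ p)"
      have ex: "\<exists>p. cmod z0 < B ^ p" using real_arch_pow[OF B] by blast
      have p: "cmod z0 < B ^ p" unfolding p_def using ex by (rule LeastI_ex)
      have "N0 + 1 < p"
      proof (rule ccontr)
        assume "\<not> ?thesis"
        then have "B ^ p \<le> B ^ (N0 + 1)" using B by (intro power_increasing) auto
        then show False using p False by linarith
      qed
      then have "p = (p - 2) + 2" "p - 2 \<ge> N0" by auto
      then obtain n where n: "p = n + 2" "n \<ge> N0" by blast
      have lo: "B ^ (n + 1) \<le> cmod z0" using not_less_Least[of "n + 1" "\<lambda>p. cmod z0 < B ^ p"] n(1) unfolding p_def by simp
      define z where "z = z0 * \<theta> ^ (n + 1)"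
      have zB: "cmod z = cmod z0 / B ^ (n + 1)"
        by (simp only: z_def B_def norm_mult norm_power norm_divide norm_one power_one_over) simp
      have Bn: "B ^ (n + 1) > 0" using B by simp
      have z: "1 \<le> cmod z" "cmod z \<le> cmod (1 / \<theta>)"
      proof -
        show "1 \<le> cmod z" unfolding zB using lo Bn by (simp only: le_divide_eq_1_pos)
        have "cmod z0 \<le> B * B ^ (n + 1)" using p n(1) by simp
        then show "cmod z \<le> cmod (1 / \<theta>)" unfolding zB B_def[symmetric] using Bn by (simp only: divide_le_eq if_True)
      qed
      define f where "f m = h (cnj \<theta> ^ m * \<xi>) * h (cnj u * (cnj \<theta> ^ m * \<xi>))" for m
      let ?bad = "ek_bad (1 / \<theta>) u z"
      have f0: "f m \<ge> 0" for m using h(1) by (simp add: f_def)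
      have fb: "(f (n + 2 - Suc j))\<^sup>2 \<le> (if ?bad j then exp (- c1) else 1)" if j: "j < n + 2" for j
      proof -
        define m where "m = n + 2 - Suc j"
        have iR: "x \<bullet> y = Re (cnj x * y)" for x y :: complex by (simp add: inner_complex_def)
        have rR: "Re (of_real r * w) = r * Re w" for r w by simp
        have mj: "n + 1 = m + j" using j by (simp add: m_def)
        have zm: "cnj \<xi> * b * \<theta> ^ m = of_real (2 * pi) * ((1 / \<theta>) ^ j * z)"
        proof -
          have gen: "cnj \<xi> * b * (T * A) = of_real (2 * pi) * (A * (z0 * T))" for A T by (simp add: z0_def)
          have "\<theta> ^ (n + 1) * (1 / \<theta>) ^ j = \<theta> ^ m" unfolding mj power_add using th0 by (simp add: power_one_over)
          then show ?thesis using gen[of "\<theta> ^ (n + 1)" "(1 / \<theta>) ^ j"] by (simp only: z_def)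
        qed
        have "(cnj \<theta> ^ m * \<xi>) \<bullet> b = Re (cnj \<xi> * b * \<theta> ^ m)" unfolding iR by (simp add: mult_ac del: times_complex.simps)
        also have "\<dots> = 2 * pi * Re ((1 / \<theta>) ^ j * z)" unfolding zm by (rule rR)
        finally have x: "(cnj \<theta> ^ m * \<xi>) \<bullet> b = 2 * pi * Re ((1 / \<theta>) ^ j * z)" .
        have "(cnj u * (cnj \<theta> ^ m * \<xi>)) \<bullet> b = Re (u * (cnj \<xi> * b * \<theta> ^ m))" unfolding iR by (simp add: mult_ac del: times_complex.simps)
        also have "u * (cnj \<xi> * b * \<theta> ^ m) = of_real (2 * pi) * ((1 / \<theta>) ^ j * (u * z))" unfolding zm by (simp add: mult_ac)
        also have "Re \<dots> = 2 * pi * Re ((1 / \<theta>) ^ j * (u * z))" by (rule rR)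
        finally have y: "(cnj u * (cnj \<theta> ^ m * \<xi>)) \<bullet> b = 2 * pi * Re ((1 / \<theta>) ^ j * (u * z))" .
        have le1: "(h \<eta>)\<^sup>2 \<le> 1" for \<eta> using h1[of \<eta>] h(1)[of \<eta>] by (simp add: power_le_one)
        have "(f m)\<^sup>2 = (h (cnj \<theta> ^ m * \<xi>))\<^sup>2 * (h (cnj u * (cnj \<theta> ^ m * \<xi>)))\<^sup>2" by (simp add: f_def power_mult_distrib)
        also have "\<dots> \<le> (if ?bad j then exp (- c1) else 1)"
        proof (cases "?bad j")
          case True
          then consider "\<rho> \<le> int_dist (Re ((1 / \<theta>) ^ j * z))" | "\<rho> \<le> int_dist (Re ((1 / \<theta>) ^ j * (u * z)))"
            unfolding ek_bad_def \<rho>_def by blast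
          then show ?thesis
          proof cases
            case 1
            have "(h (cnj \<theta> ^ m * \<xi>))\<^sup>2 * (h (cnj u * (cnj \<theta> ^ m * \<xi>)))\<^sup>2 \<le> exp (- c1) * 1"
              by (intro mult_mono hbad[OF x 1] le1) auto
            then show ?thesis using True by simp
          next
            case 2
            have "(h (cnj \<theta> ^ m * \<xi>))\<^sup>2 * (h (cnj u * (cnj \<theta> ^ m * \<xi>)))\<^sup>2 \<le> 1 * exp (- c1)"
              by (intro mult_mono hbad[OF y 2] le1) auto
            then show ?thesis using True by simp
          qed
        next
          case False
          have "(h (cnj \<theta> ^ m * \<xi>))\<^sup>2 * (h (cnj u * (cnj \<theta> ^ m * \<xi>)))\<^sup>2 \<le> 1 * 1"
            by (intro mult_mono le1) auto
          then show ?thesis using False by simp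
        qed
        finally show ?thesis by (simp add: m_def)
      qed
      define K where "K = card {j. j < n + 2 \<and> ?bad j}"
      have "(\<Prod>m<n + 2. f m)\<^sup>2 = (\<Prod>j<n + 2. (f (n + 2 - Suc j))\<^sup>2)"
        unfolding prod_power_distrib[symmetric] by (subst prod.nat_diff_reindex) simp
      also have "\<dots> \<le> (\<Prod>j<n + 2. if ?bad j then exp (- c1) else 1)" using fb by (intro prod_mono) auto
      also have "\<dots> = (\<Prod>j\<in>{j \<in> {..<n + 2}. ?bad j}. exp (- c1))" by (rule prod.inter_filter[symmetric]) simp
      also have "\<dots> = exp (- c1) ^ K" by (simp add: K_def)
      also have "\<dots> = (exp (- c1 * real K / 2))\<^sup>2"
        unfolding exp_of_nat_mult[symmetric] by simp
      finally have "(\<Prod>m<n + 2. f m) \<le> exp (- c1 * real K / 2)" by (rule power2_le_imp_le) simp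
      also have "\<dots> \<le> exp (- (\<sigma> * ln B * real n))"
      proof -
        have "c1 * (\<delta> * real n) \<le> c1 * real K" using nek[OF n(2) z] c1 by (intro mult_left_mono) (auto simp: K_def)
        moreover have "\<sigma> * ln B * real n \<le> c1 * \<delta> / 2 * real n" using \<sigma>B by (intro mult_right_mono) auto
        ultimately show ?thesis by simp
      qed
      also have "\<dots> \<le> W * cmod \<xi> powr (- \<sigma>)"
      proof -
        have "cmod \<xi> \<le> 2 * pi / cmod b * B ^ (n + 2)" unfolding z0 using p n by (intro mult_left_mono) auto
        also have "\<dots> = (2 * pi / cmod b * B ^ 2) * B ^ n" by (simp add: power_add power2_eq_square)
        also have "\<dots> \<le> W * B ^ n" using B by (intro mult_right_mono) (auto simp: W_def)
        finally have "cmod \<xi> powr \<sigma> \<le> (W * B ^ n) powr \<sigma>" using \<sigma> by (intro powr_mono2) auto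
        also have "\<dots> = W powr \<sigma> * (B ^ n) powr \<sigma>" by (rule powr_mult)
        also have "(B ^ n) powr \<sigma> = exp (\<sigma> * ln B * real n)" using B by (simp add: powr_def ln_realpow mult_ac)
        also have "W powr \<sigma> * exp (\<sigma> * ln B * real n) \<le> W * exp (\<sigma> * ln B * real n)"
        proof -
          have "W powr \<sigma> \<le> W powr 1" using W \<sigma> by (intro powr_mono) auto
          then show ?thesis using W by (intro mult_right_mono) auto
        qed
        finally have *: "cmod \<xi> powr \<sigma> \<le> W * exp (\<sigma> * ln B * real n)" .
        have "exp (- (\<sigma> * ln B * real n)) * cmod \<xi> powr \<sigma> \<le> exp (- (\<sigma> * ln B * real n)) * (W * exp (\<sigma> * ln B * real n))"
          by (rule mult_left_mono[OF *]) simp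
        also have "\<dots> = W" by (simp add: exp_minus)
        finally show ?thesis using xip by (simp add: powr_minus field_simps)
      qed
      also have "\<dots> \<le> C * cmod \<xi> powr (- \<sigma>)" using C by (intro mult_right_mono) auto
      finally show ?thesis unfolding f_def by blast
    qed
  qed
  then show ?thesis using C(1) \<sigma>(1,2) by blast
qed

section \<open>Random digit sums\<close>

lemma shannon_map_inj: "inj_on f (set_pmf A) \<Longrightarrow> shannon (map_pmf f A) = shannon A"
  unfolding shannon_def by (simp add: sum.reindex pmf_map_inj)

lemma shannon_pair:
  assumes "fin_pmf A" "fin_pmf B"
  shows "shannon (pair_pmf A B) = shannon A + shannon B"
proof -
  have "(\<Sum>z\<in>set_pmf (pair_pmf A B). pmf (pair_pmf A B) z * ln (pmf (pair_pmf A B) z))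
      = (\<Sum>x\<in>set_pmf A. \<Sum>y\<in>set_pmf B. (pmf A x * ln (pmf A x)) * pmf B y + pmf A x * (pmf B y * ln (pmf B y)))"
    unfolding set_pair_pmf sum.cartesian_product
  proof (intro sum.cong refl)
    fix z assume "z \<in> set_pmf A \<times> set_pmf B"
    then obtain x y where z: "z = (x, y)" "x \<in> set_pmf A" "y \<in> set_pmf B" by auto
    then have "ln (pmf A x * pmf B y) = ln (pmf A x) + ln (pmf B y)" using pmf_positive[of x A] pmf_positive[of y B] by (simp add: ln_mult_pos)
    then show "pmf (pair_pmf A B) z * ln (pmf (pair_pmf A B) z)
      = (case z of (x, y) \<Rightarrow> (pmf A x * ln (pmf A x)) * pmf B y + pmf A x * (pmf B y * ln (pmf B y)))"
      by (simp add: z pmf_pair algebra_simps)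
  qed
  also have "\<dots> = (\<Sum>x\<in>set_pmf A. pmf A x * ln (pmf A x)) * (\<Sum>y\<in>set_pmf B. pmf B y)
      + (\<Sum>x\<in>set_pmf A. pmf A x) * (\<Sum>y\<in>set_pmf B. pmf B y * ln (pmf B y))"
    by (simp add: sum.distrib sum_product)
  finally show ?thesis using assms by (simp add: shannon_def sum_pmf_eq_1)
qed

lemma shannon_return[simp]: "shannon (return_pmf x) = 0"
  by (simp add: shannon_def)

primrec dsum :: "complex \<Rightarrow> (nat \<Rightarrow> complex pmf) \<Rightarrow> nat \<Rightarrow> complex pmf" where
  "dsum lam B 0 = return_pmf 0"
| "dsum lam B (Suc N) = dsum lam B N \<oplus> pscale (lam ^ N) (B N)"

lemma fin_dsum: "(\<And>t. fin_pmf (B t)) \<Longrightarrow> fin_pmf (dsum lam B N)"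
  by (induction N) auto

lemma dsum_add:
  assumes "\<And>t. B (N + t) = B t"
  shows "dsum lam B (N + M) = dsum lam B N \<oplus> pscale (lam ^ N) (dsum lam B M)"
proof (induction M)
  case (Suc M)
  then show ?case by (simp add: assms pscale_pconv pscale_pscale power_add pconv_assoc)
qed simp

lemma cf_dsum:
  assumes "\<And>t. fin_pmf (B t)"
  shows "cf (measure_pmf (dsum lam B N)) \<xi> = (\<Prod>t<N. cf (measure_pmf (B t)) (cnj lam ^ t * \<xi>))"
  by (induction N) (simp_all add: cf_pconv cf_pscale fin_dsum assms)

lemma set_dsum: "set_pmf (dsum lam (\<lambda>t. map_pmf f (G t)) N) \<subseteq> {wsum lam f w | w. length w = N}"
proof (induction N)
  case (Suc N)
  show ?case
  proof
    fix x assume "x \<in> set_pmf (dsum lam (\<lambda>t. map_pmf f (G t)) (Suc N))"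
    then obtain y d where "y \<in> set_pmf (dsum lam (\<lambda>t. map_pmf f (G t)) N)" "x = y + lam ^ N * f d"
      by (auto simp: set_pconv pscale_def)
    moreover then obtain w where "length w = N" "y = wsum lam f w" using Suc by blast
    ultimately have "length (w @ [d]) = Suc N \<and> x = wsum lam f (w @ [d])" by (simp add: wsum_append)
    then show "x \<in> {wsum lam f w | w. length w = Suc N}" by blast
  qed
qed simp

text \<open>When no two words of equal length have the same value, a sum determines its digits, so
  each digit contributes its full entropy.\<close>

lemma shannon_dsum:
  assumes G: "\<And>t. fin_pmf (G t)"
    and inj: "\<And>w w'. length w = length w' \<Longrightarrow> wsum lam f w = wsum lam f w' \<Longrightarrow> w = w'"
  shows "shannon (dsum lam (\<lambda>t. map_pmf f (G t)) N) = (\<Sum>t<N. shannon (G t))"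
proof (induction N)
  case (Suc N)
  let ?V = "dsum lam (\<lambda>t. map_pmf f (G t)) N"
  have "?V \<oplus> pscale (lam ^ N) (map_pmf f (G N)) = map_pmf (\<lambda>(x, d). x + lam ^ N * f d) (pair_pmf ?V (G N))"
    unfolding pconv_alt pair_pmf_def pscale_def
    by (simp add: map_bind_pmf map_pmf_def bind_assoc_pmf bind_return_pmf)
  moreover have "inj_on (\<lambda>(x, d). x + lam ^ N * f d) (set_pmf (pair_pmf ?V (G N)))"
  proof (rule inj_onI, clarsimp)
    fix x d x' d' assume x: "x \<in> set_pmf ?V" "x' \<in> set_pmf ?V" and eq: "x + lam ^ N * f d = x' + lam ^ N * f d'"
    obtain w w' where w: "length w = N" "x = wsum lam f w" "length w' = N" "x' = wsum lam f w'"
      using x set_dsum[of lam f G N] by blast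
    have "wsum lam f (w @ [d]) = wsum lam f (w' @ [d'])" using eq w by (simp add: wsum_append)
    then have "w @ [d] = w' @ [d']" using w by (intro inj) auto
    then show "x = x' \<and> d = d'" using w by simp
  qed
  moreover have "fin_pmf ?V" by (rule fin_dsum) (simp add: G)
  ultimately show ?case using G Suc by (simp add: shannon_map_inj shannon_pair)
qed simp

text \<open>Periodic digit laws become self-similar when read in blocks of one period.\<close>

lemma selfsim_seq_dsum:
  assumes lam: "0 < cmod lam" "cmod lam < 1" "Im (lam ^ k) \<noteq> 0" and B: "\<And>t. fin_pmf (B t)" "\<And>t. B (k + t) = B t"
  shows "selfsim_seq (lam ^ k) (\<lambda>n. dsum lam B (k * n))"
proof
  have k: "k > 0" using lam(3) by (cases k) auto
  show "0 < cmod (lam ^ k)" "cmod (lam ^ k) < 1" using lam k by (auto simp: norm_power power_less_one_iff)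
  have per: "B (k * n + t) = B t" for n t
    by (induction n) (auto simp: B(2) add.assoc)
  show "dsum lam B (k * (n + m)) = dsum lam B (k * n) \<oplus> pscale ((lam ^ k) ^ n) (dsum lam B (k * m))" for n m
    unfolding distrib_left power_mult[symmetric] by (rule dsum_add) (rule per)
qed (use lam B in \<open>auto intro: fin_dsum\<close>)

lemma prod_blocks:
  fixes k n :: nat
  assumes "k > 0"
  shows "(\<Prod>t<k * n. if k dvd t then f t else 1) = (\<Prod>j<n. f (k * j) :: real)"
proof -
  have "(\<Prod>t<k * n. if k dvd t then f t else 1) = (\<Prod>t\<in>{t \<in> {..<k * n}. k dvd t}. f t)"
    by (rule prod.inter_filter[symmetric]) simp
  also have "{t \<in> {..<k * n}. k dvd t} = (*) k ` {..<n}" using assms by (auto elim: dvdE)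
  also have "prod f ((*) k ` {..<n}) = (\<Prod>j<n. f (k * j))" using assms by (subst prod.reindex) (auto simp: inj_on_def)
  finally show ?thesis .
qed

lemma sum_blocks:
  fixes k n :: nat
  assumes "k > 0"
  shows "(\<Sum>t<k * n. if k dvd t then 0 else c) = real n * (real k - 1) * (c :: real)"
proof -
  have "(\<Sum>t<k * n. if k dvd t then 0 else c) = (\<Sum>t<k * n. c) - (\<Sum>t<k * n. if k dvd t then c else 0)"
    unfolding sum_subtractf[symmetric] by (intro sum.cong) auto
  also have "(\<Sum>t<k * n. if k dvd t then c else 0) = (\<Sum>t\<in>{t \<in> {..<k * n}. k dvd t}. c)"
    by (rule sum.inter_filter[symmetric]) simp
  also have "{t \<in> {..<k * n}. k dvd t} = (*) k ` {..<n}" using assms by (auto elim: dvdE)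
  also have "(\<Sum>t\<in>(*) k ` {..<n}. c) = real n * c" using assms by (subst sum.reindex) (auto simp: inj_on_def)
  finally show ?thesis by (simp add: algebra_simps)
qed

section \<open>Convolutions of self-similar measures\<close>

lemma scale_measure_by_finite:
  assumes "prob_space M" "sets M = sets borel"
  shows "prob_space (scale_measure_by u M)" "complex_finite_measure (scale_measure_by u M)"
    "cf (scale_measure_by u M) \<xi> = cf M (cnj u * \<xi>)"
proof -
  interpret M: prob_space M by fact
  have m[measurable]: "(\<lambda>z. u * z) \<in> borel_measurable M" unfolding measurable_cong_sets[OF assms(2) refl] by measurable
  show p: "prob_space (scale_measure_by u M)" unfolding scale_measure_by_def by (rule M.prob_space_distr[OF m])
  interpret S: prob_space "scale_measure_by u M" by fact
  show "complex_finite_measure (scale_measure_by u M)"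
    by (rule complex_finite_measureI) (simp_all add: S.finite_measure_axioms, simp add: scale_measure_by_def)
  show "cf (scale_measure_by u M) \<xi> = cf M (cnj u * \<xi>)"
    unfolding cf_def scale_measure_by_def by (subst integral_distr[OF m]) (auto simp: inner_complex_mult)
qed

lemma expectation_le_atom:
  fixes f :: "'i::finite \<Rightarrow> real"
  assumes "\<And>x. f x \<le> 1" "f i \<le> 1 - t"
  shows "measure_pmf.expectation P f \<le> 1 - pmf P i * t"
proof -
  have "pmf P i * t \<le> pmf P i * (1 - f i)" using assms(2) by (intro mult_left_mono) auto
  also have "\<dots> \<le> (\<Sum>x\<in>UNIV. pmf P x * (1 - f x))"
    using assms(1) by (intro member_le_sum[where f="\<lambda>x. pmf P x * (1 - f x)"]) auto
  also have "\<dots> = (\<Sum>x\<in>UNIV. pmf P x) - (\<Sum>x\<in>UNIV. pmf P x * f x)"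
    by (simp add: right_diff_distrib sum_subtractf)
  also have "(\<Sum>x\<in>UNIV. pmf P x) = 1" by (rule sum_pmf_eq_1) auto
  also have "(\<Sum>x\<in>UNIV. pmf P x * f x) = measure_pmf.expectation P f" by (simp add: integral_measure_pmf[of UNIV])
  finally show ?thesis by simp
qed

text \<open>The entropy hypothesis on \<open>k\<close> says that the \<open>k - 1\<close> unreserved
  positions of a block, each carrying a pair of digits, still have entropy above
  \<open>- 2 * ln |lam ^ k|\<close>, as \<open>full_dimension\<close> demands.\<close>

theorem conv_self_similar_regular:
  fixes a :: "'i::finite \<Rightarrow> complex"
  assumes osc: "open_set_condition lam a" and lam: "0 < cmod lam" "cmod lam < 1" and P: "set_pmf P = UNIV"
    and k: "Im (lam ^ k) \<noteq> 0" "real k * (- ln (cmod lam)) < (real k - 1) * shannon P"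
    and u: "u \<notin> overlap_set lam a" "u \<notin> ek_set (1 / lam ^ k) R" "cmod u \<le> R"
  defines "\<nu> \<equiv> conv_measure (coding_measure lam a P) (scale_measure_by u (coding_measure lam a P))"
  shows "absolutely_continuous lborel \<nu> \<and> (\<exists>q>1. has_density_in_Lq q \<nu>)"
proof -
  have lam0: "lam \<noteq> 0" using lam by auto
  have k0: "k > 0" using k(1) by (cases k) auto
  define h where "h = shannon P"
  define \<theta> where "\<theta> = lam ^ k"
  have \<theta>: "0 < cmod \<theta>" "cmod \<theta> < 1" using lam k0 by (auto simp: \<theta>_def norm_power power_less_one_iff)
  define f where "f = (\<lambda>(i, j). a i + u * a j)"
  let ?\<mu> = "coding_measure lam a P"
  have \<mu>: "complex_finite_measure ?\<mu>" "prob_space ?\<mu>" "sets ?\<mu> = sets borel"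
    by (rule coding_measure_finite[OF lam])+
  note S\<mu> = scale_measure_by_finite[OF \<mu>(2,3), of u]
  have \<nu>: "prob_space \<nu>" "complex_finite_measure \<nu>" "sets \<nu> = sets borel"
    unfolding \<nu>_def by (auto intro!: conv_measure_prob conv_measure_finite \<mu> S\<mu>)

  \<comment> \<open>Words over pairs of digits are separated, because \<open>u\<close> is not in the overlap set.\<close>
  obtain C N0 :: nat where far: "\<And>N w w'. N \<ge> N0 \<Longrightarrow> length w = N \<Longrightarrow> length w' = N \<Longrightarrow> w \<noteq> w' \<Longrightarrow>
      cmod lam ^ (C * N) \<le> cmod (wsum lam f w - wsum lam f w')"
  proof -
    have "\<not> (\<forall>C N0. \<exists>N\<ge>N0. \<exists>w w'. length w = N \<and> length w' = N \<and> w \<noteq> w' \<and>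
        cmod (wsum lam f w - wsum lam f w') < cmod lam ^ (C * N))"
      using u(1) by (simp add: overlap_set_def f_def)
    then have "\<exists>C N0. \<not> (\<exists>N\<ge>N0. \<exists>w w'. length w = N \<and> length w' = N \<and> w \<noteq> w' \<and>
        cmod (wsum lam f w - wsum lam f w') < cmod lam ^ (C * N))" by (simp only: not_all)
    then obtain C N0 where no: "\<not> (\<exists>N\<ge>N0. \<exists>w w'. length w = N \<and> length w' = N \<and> w \<noteq> w' \<and>
        cmod (wsum lam f w - wsum lam f w') < cmod lam ^ (C * N))" by (elim exE)
    show thesis
    proof (rule that[of N0 C], rule leI, rule notI)
      fix N and w w' :: "('i \<times> 'i) list"
      assume as: "N0 \<le> N" "length w = N" "length w' = N" "w \<noteq> w'" "cmod (wsum lam f w - wsum lam f w') < cmod lam ^ (C * N)"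
      show False by (rule notE[OF no], intro exI[of _ N] exI[of _ w] exI[of _ w'] conjI as)
    qed
  qed
  \<comment> \<open>Separation is known only from length \<open>N0\<close> on; a common suffix
    \<open>v\<close> lifts shorter words to that length.\<close>
  have inj: "w = w'" if "length w = length w'" "wsum lam f w = wsum lam f w'" for w w'
  proof (rule ccontr)
    assume "w \<noteq> w'"
    define v where "v = replicate N0 (undefined :: 'i \<times> 'i)"
    have "wsum lam f (w @ v) = wsum lam f (w' @ v)" using that by (simp add: wsum_append)
    moreover have "cmod lam ^ (C * length (w @ v)) \<le> cmod (wsum lam f (w @ v) - wsum lam f (w' @ v))"
      using \<open>w \<noteq> w'\<close> that(1) by (intro far) (auto simp: v_def)
    ultimately have "cmod lam ^ (C * length (w @ v)) \<le> 0" by simp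
    then show False using zero_less_power[OF lam(1), of "C * length (w @ v)"] by linarith
  qed

  \<comment> \<open>Two distinct translations supply the phase \<open>a i0 - a i1\<close> for the
    decay. With a single index the entropy would vanish, against the hypothesis on
    \<open>k\<close>.\<close>
  obtain i0 i1 :: 'i where i01: "a i0 \<noteq> a i1"
  proof -
    have "\<exists>i j :: 'i. i \<noteq> j"
    proof (rule ccontr)
      assume "\<nexists>i j :: 'i. i \<noteq> j"
      then have UV: "UNIV = {undefined :: 'i}" by auto
      have "sum (pmf P) UNIV = 1" by (rule sum_pmf_eq_1) auto
      then have "pmf P undefined = 1" unfolding UV by simp
      moreover have "set_pmf P = {undefined}" using P UV by (rule trans)
      ultimately have "shannon P = 0" by (simp add: shannon_def)
      then have "0 < real k * ln (cmod lam)" using k(2) by simp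
      then have "0 < ln (cmod lam)" by (simp add: zero_less_mult_iff)
      then show False using lam by simp
    qed
    then obtain i j :: 'i where "i \<noteq> j" by blast
    obtain c where "c > 0" "\<And>w w'. length w = length w' \<Longrightarrow> w \<noteq> w' \<Longrightarrow> c * cmod lam ^ length w \<le> cmod (wsum lam a w - wsum lam a w')"
      using osc_separated[OF osc lam0] by blast
    from this(2)[of "[i]" "[j]"] have "c * cmod lam \<le> cmod (a i - a j)" using \<open>i \<noteq> j\<close> by simp
    moreover have "0 < c * cmod lam" using \<open>c > 0\<close> lam by simp
    ultimately have "0 < cmod (a i - a j)" by linarith
    then show thesis by (intro that[of i j]) auto
  qed

  define PP where "PP = pair_pmf P P"
  \<comment> \<open>Reserved positions carry a constant pair and not the digit 0, so that the atoms
    of \<eta> are values of words over pairs and inherit their separation. At these positions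
    \<open>Z\<close> contributes \<open>D\<close> shifted by \<open>- d0\<close>, which restores the
    full digit law.\<close>
  define G where "G t = (if k dvd t then return_pmf (i0, i0) else PP)" for t
  define D where "D = map_pmf f PP"
  define \<eta> where "\<eta> = dsum lam (\<lambda>t. map_pmf f (G t))"
  define d0 where "d0 = f (i0, i0)"
  define Z where "Z t = (if k dvd t then map_pmf (\<lambda>x. x - d0) D else return_pmf 0)" for t
  define \<zeta> where "\<zeta> = dsum lam Z"
  have finG: "fin_pmf (G t)" "fin_pmf (map_pmf f (G t))" "fin_pmf (Z t)" for t by (auto simp: Z_def D_def)
  have cfGZ: "cf (measure_pmf (map_pmf f (G t))) \<xi> * cf (measure_pmf (Z t)) \<xi> = cf (measure_pmf D) \<xi>" for t \<xi>
  proof (cases "k dvd t")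
    case True
    have "cf (measure_pmf (Z t)) \<xi> = (CLINT x|measure_pmf D. cis (- (\<xi> \<bullet> d0)) * cis (\<xi> \<bullet> x))"
      using True by (simp add: cf_def Z_def inner_diff_right cis_mult add.commute)
    also have "\<dots> = cis (- (\<xi> \<bullet> d0)) * cf (measure_pmf D) \<xi>" by (simp add: cf_def)
    finally show ?thesis using True by (simp add: G_def cf_def d0_def cis_mult flip: mult.assoc)
  next
    case False
    have "cf (return_pmf 0) \<xi> = 1" by simp
    then show ?thesis using False by (simp add: G_def Z_def D_def)
  qed

  have cfD: "cf (measure_pmf D) \<xi> = cf (measure_pmf (map_pmf a P)) \<xi> * cf (measure_pmf (map_pmf a P)) (cnj u * \<xi>)" for \<xi>
  proof -
    have "D = map_pmf a P \<oplus> pscale u (map_pmf a P)"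
      unfolding D_def PP_def f_def pconv_alt pscale_def pair_pmf_def
      by (simp add: map_bind_pmf map_pmf_def bind_assoc_pmf bind_return_pmf)
    then show ?thesis by (simp add: cf_pconv cf_pscale)
  qed
  have cf\<nu>1: "cf \<nu> \<xi> = cf (measure_pmf D) \<xi> * cf \<nu> (cnj lam * \<xi>)" for \<xi>
  proof -
    have "cf \<nu> \<xi> = cf ?\<mu> \<xi> * cf ?\<mu> (cnj u * \<xi>)" for \<xi>
      unfolding \<nu>_def cf_conv_measure[OF \<mu>(1) S\<mu>(2)] by (simp add: S\<mu>(3))
    moreover note cf_coding_measure[OF lam, of a P \<xi>] cf_coding_measure[OF lam, of a P "cnj u * \<xi>"]
    ultimately show ?thesis unfolding cfD by (simp add: mult_ac)
  qed
  have cf\<nu>: "cf \<nu> \<xi> = (\<Prod>t<N. cf (measure_pmf D) (cnj lam ^ t * \<xi>)) * cf \<nu> (cnj lam ^ N * \<xi>)" for N \<xi>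
  proof (induction N)
    case (Suc N)
    then show ?case using cf\<nu>1[of "cnj lam ^ N * \<xi>"] by (simp add: mult_ac)
  qed simp
  interpret \<nu>: prob_space \<nu> by (rule \<nu>)
  interpret \<nu>': complex_finite_measure \<nu> by (rule \<nu>)
  have cf\<nu>_le: "cmod (cf \<nu> \<xi>) \<le> 1" for \<xi> using \<nu>'.cf_norm_le[of \<xi>] by (simp add: \<nu>.prob_space)
  have cf\<eta>\<zeta>: "cf (measure_pmf (\<eta> N)) \<xi> * cf (measure_pmf (\<zeta> N)) \<xi> = (\<Prod>t<N. cf (measure_pmf D) (cnj lam ^ t * \<xi>))" for N \<xi>
    unfolding \<eta>_def \<zeta>_def cf_dsum[OF finG(2)] cf_dsum[OF finG(3)] prod.distrib[symmetric] cfGZ ..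

  \<comment> \<open>The reserved digits of the first \<open>n\<close> blocks together with the whole
    tail, a copy of \<nu> shrunk by \<open>lam ^ (k * n)\<close>.\<close>
  define Q where "Q n = conv_measure (measure_pmf (\<zeta> (k * n))) (scale_measure_by (lam ^ (k * n)) \<nu>)" for n
  note S\<nu> = scale_measure_by_finite[OF \<nu>(1,3)]
  have Q: "prob_space (Q n)" "complex_finite_measure (Q n)" for n
    unfolding Q_def by (auto intro!: conv_measure_prob conv_measure_finite measure_pmf_complex_finite S\<nu> measure_pmf.prob_space_axioms)
  have cfQ: "cf (Q n) \<xi> = cf (measure_pmf (\<zeta> (k * n))) \<xi> * cf \<nu> (cnj lam ^ (k * n) * \<xi>)" for n \<xi>
    unfolding Q_def cf_conv_measure[OF measure_pmf_complex_finite S\<nu>(2)] by (simp add: S\<nu>(3))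
  have split: "cf \<nu> \<xi> = cf (measure_pmf (\<eta> (k * n))) \<xi> * cf (Q n) \<xi>" for n \<xi>
    unfolding cfQ mult.assoc[symmetric] cf\<eta>\<zeta> by (rule cf\<nu>)

  \<comment> \<open>Fourier decay of the remaining factors, because \<open>u\<close> is not in the Erdos--Kahane set.\<close>
  define g where "g \<xi> = cmod (cf (measure_pmf (map_pmf a P)) \<xi>)" for \<xi>
  define p where "p = pmf P i0 * pmf P i1"
  have p: "p > 0" using P by (simp add: p_def pmf_positive)
  have g: "0 \<le> g \<xi>" "(g \<xi>)\<^sup>2 \<le> 1 - p * (1 - cos (\<xi> \<bullet> (a i0 - a i1)))" for \<xi>
  proof -
    show "0 \<le> g \<xi>" by (simp add: g_def)
    have "(g \<xi>)\<^sup>2 = measure_pmf.expectation P (\<lambda>x. measure_pmf.expectation P (\<lambda>y. cos (\<xi> \<bullet> (a x - a y))))"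
      unfolding g_def by (subst cf_norm_square) auto
    also have "\<dots> \<le> 1 - pmf P i0 * (pmf P i1 * (1 - cos (\<xi> \<bullet> (a i0 - a i1))))"
    proof (rule expectation_le_atom)
      show "measure_pmf.expectation P (\<lambda>y. cos (\<xi> \<bullet> (a x - a y))) \<le> 1" for x
        using expectation_le_atom[of "\<lambda>y. cos (\<xi> \<bullet> (a x - a y))" undefined 0 P] by simp
      show "measure_pmf.expectation P (\<lambda>y. cos (\<xi> \<bullet> (a i0 - a y))) \<le> 1 - pmf P i1 * (1 - cos (\<xi> \<bullet> (a i0 - a i1)))"
        by (rule expectation_le_atom) auto
    qed
    finally show "(g \<xi>)\<^sup>2 \<le> 1 - p * (1 - cos (\<xi> \<bullet> (a i0 - a i1)))" by (simp add: p_def)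
  qed
  obtain \<delta> M0 where \<delta>: "\<delta> > 0" and nek: "\<And>n z. n \<ge> M0 \<Longrightarrow> 1 \<le> cmod z \<Longrightarrow> cmod z \<le> cmod (1 / \<theta>) \<Longrightarrow>
      \<delta> * real n \<le> real (card {j. j < n + 2 \<and> ek_bad (1 / \<theta>) u z j})"
  proof -
    have "\<not> (\<forall>\<delta>>0. \<forall>N0. \<exists>n\<ge>N0. \<exists>z. 1 \<le> cmod z \<and> cmod z \<le> cmod (1 / \<theta>) \<and>
        real (card {j. j < n + 2 \<and> ek_bad (1 / \<theta>) u z j}) < \<delta> * real n)"
      using u(2,3) unfolding ek_set_def \<theta>_def by blast
    then have "\<exists>\<delta>. \<delta> > 0 \<and> (\<exists>N0. \<not> (\<exists>n\<ge>N0. \<exists>z. 1 \<le> cmod z \<and> cmod z \<le> cmod (1 / \<theta>) \<and>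
        real (card {j. j < n + 2 \<and> ek_bad (1 / \<theta>) u z j}) < \<delta> * real n))" by (simp only: not_all not_imp)
    then obtain \<delta> N0 where pos: "\<delta> > 0" and no: "\<not> (\<exists>n\<ge>N0. \<exists>z. 1 \<le> cmod z \<and> cmod z \<le> cmod (1 / \<theta>) \<and>
        real (card {j. j < n + 2 \<and> ek_bad (1 / \<theta>) u z j}) < \<delta> * real n)" by (elim exE conjE)
    show thesis
    proof (rule that[of \<delta> N0, OF pos], rule leI, rule notI)
      fix n z assume as: "N0 \<le> n" "1 \<le> cmod z" "cmod z \<le> cmod (1 / \<theta>)"
        "real (card {j. j < n + 2 \<and> ek_bad (1 / \<theta>) u z j}) < \<delta> * real n"
      show False by (rule notE[OF no], intro exI[of _ n] exI[of _ z] conjI as)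
    qed
  qed
  obtain B \<sigma> where B: "B \<ge> 1" and \<sigma>: "0 < \<sigma>" "\<sigma> \<le> 1" and dec: "\<And>\<xi>. 1 \<le> cmod \<xi> \<Longrightarrow>
      \<exists>M. (\<Prod>m<M. g (cnj \<theta> ^ m * \<xi>) * g (cnj u * (cnj \<theta> ^ m * \<xi>))) \<le> B * cmod \<xi> powr (- \<sigma>)"
  proof -
    have "\<exists>C\<ge>1. \<exists>\<sigma>. 0 < \<sigma> \<and> \<sigma> \<le> 1 \<and> (\<forall>\<xi>. 1 \<le> cmod \<xi> \<longrightarrow>
      (\<exists>M. (\<Prod>m<M. g (cnj \<theta> ^ m * \<xi>) * g (cnj u * (cnj \<theta> ^ m * \<xi>))) \<le> C * cmod \<xi> powr (- \<sigma>)))"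
    proof (rule ek_decay[OF \<theta> \<delta>, where ?N0.0=M0 and c=p and b="a i0 - a i1"])
      show "\<delta> * real n \<le> real (card {j. j < n + 2 \<and> ek_bad (1 / \<theta>) u z j})"
        if "M0 \<le> n" "1 \<le> cmod z" "cmod z \<le> cmod (1 / \<theta>)" for n z by (rule nek[OF that])
    qed (use g p i01 in auto)
    then obtain C \<sigma> where "C \<ge> 1" "0 < \<sigma>" "\<sigma> \<le> 1" and C: "\<forall>\<xi>. 1 \<le> cmod \<xi> \<longrightarrow>
      (\<exists>M. (\<Prod>m<M. g (cnj \<theta> ^ m * \<xi>) * g (cnj u * (cnj \<theta> ^ m * \<xi>))) \<le> C * cmod \<xi> powr (- \<sigma>))"
      by (elim exE conjE)
    from this(1-3) show thesis by (rule that) (rule C[rule_format])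
  qed
  have decay: "cmod (cf (Q n) \<xi>) \<le> B * cmod \<xi> powr (- \<sigma>)" if \<xi>: "1 \<le> cmod \<xi>" for n \<xi>
  proof -
    obtain M where M: "(\<Prod>m<M. g (cnj \<theta> ^ m * \<xi>) * g (cnj u * (cnj \<theta> ^ m * \<xi>))) \<le> B * cmod \<xi> powr (- \<sigma>)"
      using dec[OF \<xi>] by blast
    define e where "e t = cmod (cf (measure_pmf D) (cnj lam ^ t * \<xi>))" for t
    define z where "z t = (if k dvd t then e t else 1)" for t
    have e: "0 \<le> e t" "e t \<le> z t" "0 \<le> z t" "z t \<le> 1" for t
      by (auto simp: e_def z_def cf_pmf_norm_le)
    have z_Z: "cmod (cf (measure_pmf (Z t)) (cnj lam ^ t * \<xi>)) = z t" for t
    proof (cases "k dvd t")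
      case True
      have "cmod (cf (measure_pmf (map_pmf f (G t))) (cnj lam ^ t * \<xi>)) = 1" using True by (simp add: G_def cf_def)
      then show ?thesis using True by (simp add: z_def e_def cfGZ[symmetric, of _ t] norm_mult)
    qed (simp add: z_def Z_def)
    have "cmod (cf (measure_pmf (\<zeta> (k * n))) \<xi>) = (\<Prod>t<k * n. z t)"
      unfolding \<zeta>_def cf_dsum[OF finG(3)] prod_norm[symmetric] z_Z ..
    moreover have "cmod (cf \<nu> (cnj lam ^ (k * n) * \<xi>)) \<le> (\<Prod>t<k * M. z (k * n + t))"
    proof -
      have "cmod (cf \<nu> (cnj lam ^ (k * n) * \<xi>)) \<le> (\<Prod>t<k * M. e (k * n + t)) * 1"
        unfolding cf\<nu>[of "cnj lam ^ (k * n) * \<xi>" "k * M"] norm_mult prod_norm[symmetric]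
        by (intro mult_mono cf\<nu>_le) (auto simp: e_def power_add mult_ac intro!: prod_mono prod_nonneg)
      also have "\<dots> \<le> (\<Prod>t<k * M. z (k * n + t))" using e by (simp add: prod_mono)
      finally show ?thesis .
    qed
    ultimately have "cmod (cf (Q n) \<xi>) \<le> (\<Prod>t<k * n. z t) * (\<Prod>t<k * M. z (k * n + t))"
      unfolding cfQ norm_mult using e by (simp add: mult_left_mono prod_nonneg)
    \<comment> \<open>Uniformity in \<open>n\<close>: the tail has been expanded by
      \<open>k * M\<close> further positions, so the factors at the first \<open>k * M\<close>
      positions are present whatever \<open>n\<close> is; all others are at most 1.\<close>
    also have "\<dots> = (\<Prod>t<k * M. z t) * (\<Prod>t<k * n. z (k * M + t))"
    proof -
      have "(\<Prod>t<A. z t) * (\<Prod>t<A'. z (A + t)) = (\<Prod>t<A + A'. z t)" for A A'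
        by (induction A') (simp_all flip: mult.assoc)
      then show ?thesis by (metis add.commute)
    qed
    also have "\<dots> \<le> (\<Prod>t<k * M. z t) * 1" using e by (intro mult_left_mono prod_le_1 prod_nonneg) auto
    also have "\<dots> = (\<Prod>t<k * M. z t)" by simp
    also have "(\<Prod>t<k * M. z t) = (\<Prod>j<M. e (k * j))" unfolding z_def by (rule prod_blocks[OF k0])
    also have "\<dots> = (\<Prod>m<M. g (cnj \<theta> ^ m * \<xi>) * g (cnj u * (cnj \<theta> ^ m * \<xi>)))"
      by (simp add: e_def cfD norm_mult g_def \<theta>_def power_mult)
    finally show ?thesis using M by simp
  qed

  interpret X: selfsim_seq \<theta> "\<lambda>n. \<eta> (k * n)"
    unfolding \<eta>_def \<theta>_def using lam k(1) by (intro selfsim_seq_dsum) (auto simp: G_def finG)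
  have shannon_\<eta>: "shannon (\<eta> (k * n)) = real n * ((real k - 1) * (2 * h))" for n
  proof -
    have "shannon (\<eta> (k * n)) = (\<Sum>t<k * n. shannon (G t))" unfolding \<eta>_def by (intro shannon_dsum finG inj)
    also have "\<dots> = (\<Sum>t<k * n. if k dvd t then 0 else 2 * h)"
      by (intro sum.cong) (auto simp: G_def PP_def shannon_pair h_def)
    finally show ?thesis using sum_blocks[OF k0, where n=n and c="2 * h"] by (simp add: mult.assoc)
  qed
  have FD: "\<forall>\<epsilon>>0. \<exists>t>0. \<exists>N. edrop (cmod \<theta>) t (\<eta> (k * N)) < \<epsilon>"
  proof (intro allI impI X.full_dimension)
    show "- 2 * ln (cmod \<theta>) < (real k - 1) * (2 * h)" using k(2) lam by (simp add: \<theta>_def norm_power ln_realpow h_def mult.commute)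
    show "real n * ((real k - 1) * (2 * h)) \<le> shannon (\<eta> (k * n))" for n by (simp add: shannon_\<eta>)
    fix n x y assume n: "N0 \<le> n" and xy: "x \<in> set_pmf (\<eta> (k * n))" "y \<in> set_pmf (\<eta> (k * n))" "x \<noteq> y"
    obtain w w' where w: "length w = k * n" "x = wsum lam f w" "length w' = k * n" "y = wsum lam f w'"
      using xy set_dsum[of lam f G "k * n"] unfolding \<eta>_def by blast
    have "1 * n \<le> k * n" using k0 by (intro mult_right_mono) auto
    then have N: "N0 \<le> k * n" using n by linarith
    have "w \<noteq> w'" using xy(3) w by auto
    then have "cmod lam ^ (C * (k * n)) \<le> cmod (x - y)" unfolding w(2,4) by (rule far[OF N w(1,3)])
    then show "cmod \<theta> ^ (C * n) \<le> cmod (x - y)" by (simp add: \<theta>_def norm_power mult_ac flip: power_mult)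
  qed
  obtain K \<gamma> where "K > 0" "\<gamma> > 0"
    "\<forall>B. open B \<longrightarrow> emeasure lborel B \<le> 1 \<longrightarrow> emeasure \<nu> B \<le> ennreal (K * measure lborel B powr \<gamma>)"
    using X.power_bound[OF FD \<nu> Q split B \<sigma> decay] by blast
  then show ?thesis by (intro density_of_power_bound[OF \<nu>(1,3)])
qed

text \<open>The period \<open>k\<close> depends on the entropy of \<open>p\<close>; admitting all
  periods with \<open>lam ^ k\<close> non-real makes the set independent of \<open>p\<close>. The
  radii \<open>R\<close> exhaust the plane, and the union is countable.\<close>

definition exceptional_set :: "complex \<Rightarrow> ('i \<Rightarrow> complex) \<Rightarrow> complex set" where
  "exceptional_set lam a = overlap_set lam a \<union>
     (\<Union>k. \<Union>R::nat. if Im (lam ^ k) \<noteq> 0 then ek_set (1 / lam ^ k) (real R) else {})"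

lemma exceptional_set_null:
  fixes a :: "'i::finite \<Rightarrow> complex"
  assumes osc: "open_set_condition lam a" and lam: "0 < cmod lam" "cmod lam < 1"
  shows "hausdorff_dim (exceptional_set lam a) = 0"
proof (rule hausdorff_dim_eq_0)
  fix s :: real assume s: "s > 0"
  have "hausdorff_null s (if Im (lam ^ k) \<noteq> 0 then ek_set (1 / lam ^ k) (real R) else {})" for k R :: nat
  proof (cases "Im (lam ^ k) = 0")
    case False
    have "k > 0" using False by (cases k) auto
    then have "cmod (lam ^ k) < 1" "lam \<noteq> 0" using lam by (auto simp: norm_power power_less_one_iff)
    then have "cmod (1 / lam ^ k) > 1" by (simp add: norm_divide)
    moreover have "Im (1 / lam ^ k) \<noteq> 0"
      using False \<open>lam \<noteq> 0\<close> by (simp add: Im_divide complex_eq_iff sum_power2_eq_zero_iff)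
    ultimately show ?thesis using ek_set_null[of "1 / lam ^ k" s "real R"] False s by simp
  next
    case True
    have "hausdorff_null s {}" using overlap_set_null[OF osc lam s] by (rule hausdorff_null_subset) simp
    then show ?thesis using True by simp
  qed
  then show "hausdorff_null s (exceptional_set lam a)"
    unfolding exceptional_set_def by (intro hausdorff_null_Un hausdorff_null_UN overlap_set_null osc lam s)
qed

text \<open>For large \<open>k\<close> reserving every \<open>k\<close>-th position costs little
  enough entropy. Of two consecutive powers of a non-real number at least one is non-real, so a
  large admissible \<open>k\<close> exists.\<close>

lemma conv_regular_off_exceptional:
  fixes a :: "'i::finite \<Rightarrow> complex"
  assumes osc: "open_set_condition lam a" and lam: "0 < cmod lam" "cmod lam < 1" "Im lam \<noteq> 0"
    and P: "set_pmf P = UNIV" "- ln (cmod lam) < shannon P" and u: "u \<notin> exceptional_set lam a"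
  defines "\<nu> \<equiv> conv_measure (coding_measure lam a P) (scale_measure_by u (coding_measure lam a P))"
  shows "absolutely_continuous lborel \<nu> \<and> (\<exists>q>1. has_density_in_Lq q \<nu>)"
proof -
  define L where "L = - ln (cmod lam)"
  obtain K0 where K0: "shannon P / (shannon P - L) < real K0" using reals_Archimedean2 by blast
  have big: "real k * L < (real k - 1) * shannon P" if "k \<ge> K0" for k
  proof -
    have "shannon P < real K0 * (shannon P - L)" using K0 P(2) by (simp add: L_def divide_less_eq)
    also have "\<dots> \<le> real k * (shannon P - L)" using that P(2) by (intro mult_right_mono) (auto simp: L_def)
    finally show ?thesis by (simp add: algebra_simps)
  qed
  obtain k where k: "k \<ge> K0" "Im (lam ^ k) \<noteq> 0"
  proof (cases "Im (lam ^ K0) = 0")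
    case True
    then have "lam ^ K0 = of_real (Re (lam ^ K0))" by (simp add: complex_eq_iff)
    moreover have "lam ^ K0 \<noteq> 0" using lam by auto
    ultimately have "Re (lam ^ K0) \<noteq> 0" by (metis of_real_0)
    then have "Im (lam ^ Suc K0) \<noteq> 0" using True lam(3) by simp
    then show thesis by (intro that[of "Suc K0"]) auto
  qed (use that in blast)
  obtain R :: nat where R: "cmod u \<le> real R" using real_arch_simple by blast
  have "u \<notin> overlap_set lam a" "u \<notin> ek_set (1 / lam ^ k) (real R)"
  proof -
    show "u \<notin> overlap_set lam a" using u by (simp add: exceptional_set_def)
    have "u \<notin> (if Im (lam ^ k) \<noteq> 0 then ek_set (1 / lam ^ k) (real R) else {})" using u unfolding exceptional_set_def by blast
    then show "u \<notin> ek_set (1 / lam ^ k) (real R)" using k by simp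
  qed
  then show ?thesis unfolding \<nu>_def
    by (intro conv_self_similar_regular[OF osc lam(1,2) P(1) k(2) _ _ _ R]) (use big[OF k(1)] in \<open>simp_all add: L_def\<close>)
qed

theorem theorem3:
  fixes lam :: complex and a :: "'i::finite \<Rightarrow> complex"
  assumes "lam \<in> ball 0 1 - \<real>"
    and "open_set_condition lam a"
  shows "\<exists>E :: complex set. hausdorff_dim E = 0 \<and>
    (\<forall>p \<in> prob_simplex. similarity_dim lam p > 1 \<longrightarrow>
       (\<forall>u \<in> - E.
          absolutely_continuous lborel
            (conv_measure (self_similar_measure lam a p)
               (scale_measure_by u (self_similar_measure lam a p))) \<and>
          (\<exists>q > 1. has_density_in_Lq q
            (conv_measure (self_similar_measure lam a p)
               (scale_measure_by u (self_similar_measure lam a p)))))) \<and>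
    (cmod lam > 1 / real CARD('i) \<longrightarrow>
       (\<forall>u \<in> - E. emeasure lborel
          {x + u * y | x y. x \<in> attractor lam a \<and> y \<in> attractor lam a} > 0))"
proof -
  have lam: "0 < cmod lam" "cmod lam < 1" "Im lam \<noteq> 0"
    using assms(1) by (auto simp: complex_is_Real_iff)
  have L: "- ln (cmod lam) > 0" using lam by simp
  let ?E = "exceptional_set lam a"
  have regular: "absolutely_continuous lborel (conv_measure (self_similar_measure lam a p) (scale_measure_by u (self_similar_measure lam a p))) \<and>
      (\<exists>q>1. has_density_in_Lq q (conv_measure (self_similar_measure lam a p) (scale_measure_by u (self_similar_measure lam a p))))
      \<and> (\<exists>P. self_similar_measure lam a p = coding_measure lam a P)"
    if p: "p \<in> prob_simplex" "similarity_dim lam p > 1" and u: "u \<in> - ?E" for p u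
  proof -
    have p0: "0 < p i" and p1: "(\<Sum>i\<in>UNIV. p i) = 1" for i using p(1) by (auto simp: prob_simplex_def)
    define P where "P = embed_pmf p"
    have pP: "pmf P i = p i" for i
      unfolding P_def
    proof (rule pmf_embed_pmf)
      show "0 \<le> p i" for i using p0[of i] by simp
      have "(\<integral>\<^sup>+ i. ennreal (p i) \<partial>count_space UNIV) = (\<Sum>i\<in>UNIV. ennreal (p i))" by (rule nn_integral_count_space_finite) simp
      also have "\<dots> = ennreal (\<Sum>i\<in>UNIV. p i)" using p0 by (intro sum_ennreal) (simp add: less_imp_le)
      finally show "(\<integral>\<^sup>+ i. ennreal (p i) \<partial>count_space UNIV) = 1" by (simp add: p1)
    qed
    then have p_eq: "p = pmf P" by auto
    have P: "set_pmf P = UNIV" using p0 pP by (auto simp: set_pmf_iff less_imp_neq[symmetric])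
    have "shannon_entropy p = shannon P" by (simp add: shannon_entropy_def shannon_def P p_eq)
    then have "- ln (cmod lam) < shannon P"
      using p(2) L unfolding similarity_dim_def by (simp only: less_divide_eq_1_pos)
    moreover have "self_similar_measure lam a p = coding_measure lam a P"
      unfolding p_eq by (rule self_similar_measure_eq[OF lam(1,2)])
    ultimately show ?thesis
      using conv_regular_off_exceptional[OF assms(2) lam P] u by auto
  qed
  have "emeasure lborel {x + u * y | x y. x \<in> attractor lam a \<and> y \<in> attractor lam a} > 0"
    if m: "cmod lam > 1 / real CARD('i)" and u: "u \<in> - ?E" for u
  proof -
    \<comment> \<open>The uniform vector has entropy \<open>ln CARD('i)\<close>, so the hypothesis
      on \<open>|lam|\<close> says exactly that its similarity dimension exceeds 1.\<close>
    define p where "p = (\<lambda>i :: 'i. 1 / real CARD('i))"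
    have p: "p \<in> prob_simplex" by (simp add: prob_simplex_def p_def)
    have "ln (1 / real CARD('i)) < ln (cmod lam)" using m lam by (subst ln_less_cancel_iff) auto
    then have "- ln (cmod lam) < ln (real CARD('i))" by (simp add: ln_div)
    also have "ln (real CARD('i)) = shannon_entropy p" by (simp add: shannon_entropy_def p_def ln_div)
    finally have "similarity_dim lam p > 1"
      using L unfolding similarity_dim_def by (simp only: less_divide_eq_1_pos)
    from regular[OF p this u] obtain P where "self_similar_measure lam a p = coding_measure lam a P"
      "absolutely_continuous lborel (conv_measure (self_similar_measure lam a p) (scale_measure_by u (self_similar_measure lam a p)))"
      by blast
    then show ?thesis using conv_attractor_positive[OF lam(1,2), of a P u] by simp
  qed
  with regular exceptional_set_null[OF assms(2) lam(1,2)] show ?thesis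
    by (intro exI[of _ ?E]) blast
qed

end
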